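(* Let $p$ be a prime and let $\sigma:\bar{\mathbb F}_p^\times\to\mathbb Q/\mathbb Z$ be an injective group homomorphism. The representation $\pi_\sigma$ of $\mathcal H_{\mathbb Z}$ on $\mathbb W_0(\bar{\mathbb F}_p)$ given by $\pi_\sigma(x)\xi=\tilde\sigma^{-1}(r(x))\xi$, $\pi_\sigma(\mu_n^* )=F_n$, $\pi_\sigma(\tilde\mu_n)=V_n$ extends by continuity to a representation of the integral BC-algebra $\mathcal H_{\mathbb Z}$ on $\mathbb W(\bar{\mathbb F}_p)$. For $n\in I(p)$ and $x\in\mathbb Z[\mathbb Q/\mathbb Z]$, the operators $\pi_\sigma(\mu_n)$, $\pi_\sigma(x)$ and $\pi_\sigma(\mu_n^* )$ are $\mathcal O$-linear operators on $\mathbb W(\bar{\mathbb F}_p)$, and $$\pi_\sigma(\mu_n)\epsilon_m=\epsilon_{nm},\qquad \pi_\sigma(e(a/b))\epsilon_m=\rho(\zeta_{a/b}^m)\,\epsilon_m\qquad\forall a\in\mathbb Z,\ \forall b,m\in I(p),$$ $$\pi_\sigma(\mu_n^* )\epsilon_k=\begin{cases}0&\text{if }k\notin n\mathbb N\\ \epsilon_{k/n}&\text{if }k\in n\mathbb N\end{cases}\qquad (k\in I(p)).$$ One has $\pi_\sigma(x)=\pi_\sigma(r(x))$ for all $x\in\mathbb Z[\mathbb Q/\mathbb Z]$, and $$\pi_\sigma(\mu_p)=\mathrm{Fr}^{-1},\qquad \pi_\sigma(\mu_p^* )=\mathrm{Fr},$$ where $\mathrm{Fr}$ is the Frobenius automorphism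 acting componentwise as a skew-linear operator.
   Context: $\mathbb N$ is the set of positive integers; $I(p)\subset\mathbb N$ is the set of positive integers prime to $p$. \textbf{The ring $\mathbb W_0$.} For a commutative unital ring $A$, $\mathbb W_0(A)=K_0(\underline{\mathrm{End}}_A)/K_0(A)$, where $\underline{\mathrm{End}}_A$ is the category of pairs $(E,f)$ ($E$ finite projective $A$-module, $f\in\mathrm{End}_A(E)$), with ring structure from $\oplus,\otimes$, and $K_0(A)$ is the ideal generated by the pairs $(E,0)$. $F_n(E,f)=(E,f^n)$; $V_n(E,f)=(E^{\oplus n},\Phi)$ with $(\Phi\xi)_1=f\xi_n$, $(\Phi\xi)_j=\xi_{j-1}$ for $2\le j\le n$. \textbf{The big Witt ring.} $\mathbb W(A)$ is the ring of big Witt vectors, with underlying set $A^{\mathbb N}$, ghost components $gh_n(x)=\sum_{d|n}d\,x_d^{n/d}$, Frobenius ring endomorphisms $F_n$ ($gh_m F_n=gh_{mn}$) and Verschiebung additive maps $V_n$. $\mathbb W(A)$ is identified with $\Lambda(A)=1+tA[[t]]$ by $x\mapsto\prod_n(1-x_nt^n)^{-1}$, and $\mathbb W_0(A)$ is embedded in $\mathbb W(A)$ as a subring via $(E,f)\mapsto\det(1-tf)^{-1}$, compatibly with $F_n$ and $V_n$. $\mathbb W(\bar{\mathbb F}_p)=\bar{\mathbb F}_p^{\mathbb N}$ has the product topology (discrete factors), for which $\mathbb W_0(\bar{\mathbb F}_p)$ is dense. \textbf{$p$-adic description.} Let $\mathcal O=\mathbb W_{p^\infty}(\bar{\mathbb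 F}_p)$ be the ring of $p$-typical Witt vectors of $\bar{\mathbb F}_p$; it is the ring of integers of the completion $\widehat{\mathbb Q_p^{\rm ur}}\subset\mathbb C_p$ of the maximal unramified extension of $\mathbb Q_p$. There is a ring isomorphism $\Theta:\mathbb W(\bar{\mathbb F}_p)\to\mathcal O^{I(p)}$ whose component $\Theta(x)_n\in\mathcal O$ ($n\in I(p)$) is the $p$-typical Witt vector with components $(\Theta(x)_n)_{p^k}=F_n(x)_{p^k}$, $k\ge0$. Through $\Theta$, $\mathbb W(\bar{\mathbb F}_p)$ is an $\mathcal O$-module and $\epsilon_m$ ($m\in I(p)$) denotes the element whose only non-zero component is $\epsilon_m(m)=1$. $\mathrm{Fr}\in\mathrm{Aut}(\mathcal O)$ is the automorphism induced by $x\mapsto x^p$ on $\bar{\mathbb F}_p$. \textbf{BC-algebra.} $\mathbb Z[\mathbb Q/\mathbb Z]$ has generators $e(\gamma)$. Let $\sigma_n(e(\gamma))=e(n\gamma)$, $\tilde\rho_n(e(\gamma))=\sum_{n\gamma'=\gamma}e(\gamma')$. $\mathcal H_{\mathbb Z}$ is the ring generated by $\mathbb Z[\mathbb Q/\mathbb Z]$ and $\tilde\mu_n,\mu_n^*$ ($n\in\mathbb N$) with relations $\tilde\mu_n x\mu_n^*=\tilde\rho_n(x)$, $\mu_n^*x=\sigma_n(x)\mu_n^*$, $x\tilde\mu_n=\tilde\mu_n\sigma_n(x)$, $\tilde\mu_{nm}=\tilde\mu_n\tilde\mu_m$, $\mu_{nm}^*=\mu_n^*\mu_m^*$, $\mu_n^*\tilde\mu_n=n$,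 and $\tilde\mu_n\mu_m^*=\mu_m^*\tilde\mu_n$ if $\gcd(n,m)=1$. One writes $\mu_n=\frac1n\tilde\mu_n$. \textbf{Data from $\sigma$.} $(\mathbb Q/\mathbb Z)^{(p)}$ is the subgroup of fractions with denominator prime to $p$ (the image of $\sigma$). $\tilde\sigma:\mathbb W_0(\bar{\mathbb F}_p)\to\mathbb Z[(\mathbb Q/\mathbb Z)^{(p)}]$ is the ring isomorphism sending $(E,f)$ to $\sum_\alpha e(\sigma(\alpha))$ over the non-zero eigenvalues $\alpha$ of $f$ with multiplicity. $r:\mathbb Z[\mathbb Q/\mathbb Z]\to\mathbb Z[(\mathbb Q/\mathbb Z)^{(p)}]$ is induced by the projection $\mathbb Q/\mathbb Z=(\mathbb Q/\mathbb Z)^{(p)}\times\mathbb Q_p/\mathbb Z_p\to(\mathbb Q/\mathbb Z)^{(p)}$. $\mathbb Q^{{\rm cyc},p}$ is the field generated over $\mathbb Q$ by the abstract roots of unity $\zeta_\gamma$, $\gamma\in(\mathbb Q/\mathbb Z)^{(p)}$ (with $\zeta_\gamma\zeta_{\gamma'}=\zeta_{\gamma+\gamma'}$ and $\zeta_\gamma$ of order the denominator of $\gamma$), and $\rho:\mathbb Q^{{\rm cyc},p}\to\mathbb C_p$ is the embedding determined by $\sigma$: $\rho(\zeta_\gamma)=\tau(\sigma^{-1}(\gamma))$, with $\tau:\bar{\mathbb F}_p^\times\to\mathcal O^\times$ the Teichmüller lift. *)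

theory Defs
  imports
    "Jordan_Normal_Form.Char_Poly"
    "Jordan_Normal_Form.Determinant"
    "HOL-Algebra.QuotRing"
    "HOL-Algebra.Generated_Fields"
    "HOL-Algebra.Algebraic_Closure_Type"
    "HOL-Computational_Algebra.Formal_Power_Series"
    "HOL-Library.Poly_Mapping"
    "HOL-Analysis.Infinite_Products"
    "HOL-Analysis.Function_Topology"
begin

section \<open>The group \<open>\<rat>/\<int>\<close> and its integral group ring\<close>

quotient_type qz = rat / "\<lambda>x y. x - y \<in> \<int>"
proof (rule equivpI)
  show "reflp (\<lambda>x y::rat. x - y \<in> \<int>)" by (simp add: reflp_def)
  show "symp (\<lambda>x y::rat. x - y \<in> \<int>)"
    unfolding symp_def by (metis Ints_minus minus_diff_eq)
  show "transp (\<lambda>x y::rat. x - y \<in> \<int>)"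
    unfolding transp_def by (metis Ints_add diff_add_cancel add_diff_eq)
qed

instantiation qz :: ab_group_add
begin
lift_definition zero_qz :: qz is 0 .
lift_definition plus_qz :: "qz \<Rightarrow> qz \<Rightarrow> qz" is "(+)"
  by (metis Ints_add add_diff_add)
lift_definition uminus_qz :: "qz \<Rightarrow> qz" is uminus
  by (metis Ints_minus minus_diff_eq minus_diff_commute diff_minus_eq_add add.commute uminus_add_conv_diff)
lift_definition minus_qz :: "qz \<Rightarrow> qz \<Rightarrow> qz" is "(-)"
  by (metis Ints_diff diff_diff_eq2 diff_add_eq add_diff_add diff_diff_add add.commute)
instance by (standard; transfer; simp)
end

lift_definition qz_of_rat :: "rat \<Rightarrow> qz" is "\<lambda>q. q" .

lift_definition qz_scale :: "nat \<Rightarrow> qz \<Rightarrow> qz" is "\<lambda>n q. of_nat n * q"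
  by (metis Ints_mult Ints_of_nat right_diff_distrib)

definition qz_frac :: "int \<Rightarrow> nat \<Rightarrow> qz" where
  "qz_frac a b = qz_of_rat (of_int a / of_nat b)"

text \<open>The group ring \<open>\<int>[\<rat>/\<int>]\<close> is the type \<^typ>\<open>qz \<Rightarrow>\<^sub>0 int\<close> with its convolution
  product; the basis element \<open>e(\<gamma>)\<close> is \<^term>\<open>frag_of \<gamma>\<close>.\<close>

type_synonym qz_ring = "qz \<Rightarrow>\<^sub>0 int"

definition bc_sigma :: "nat \<Rightarrow> qz_ring \<Rightarrow> qz_ring" where
  "bc_sigma n = frag_extend (\<lambda>\<gamma>. frag_of (qz_scale n \<gamma>))"

definition bc_rho :: "nat \<Rightarrow> qz_ring \<Rightarrow> qz_ring" where
  "bc_rho n = frag_extend (\<lambda>\<gamma>. \<Sum>\<gamma>' | qz_scale n \<gamma>' = \<gamma>. frag_of \<gamma>')"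

definition I_prime_to :: "nat \<Rightarrow> nat set" where
  "I_prime_to p = {n. n > 0 \<and> coprime n p}"

definition qz_prime_to :: "nat \<Rightarrow> qz set" where
  "qz_prime_to p = {qz_frac a b | a b. b \<in> I_prime_to p}"

definition qz_p_part :: "nat \<Rightarrow> qz set" where
  "qz_p_part p = {qz_frac a (p ^ k) | a k. True}"

definition qz_proj :: "nat \<Rightarrow> qz \<Rightarrow> qz" where
  "qz_proj p \<gamma> = (THE \<gamma>'. \<gamma>' \<in> qz_prime_to p \<and> \<gamma> - \<gamma>' \<in> qz_p_part p)"

definition bc_r :: "nat \<Rightarrow> qz_ring \<Rightarrow> qz_ring" where
  "bc_r p = frag_extend (\<lambda>\<gamma>. frag_of (qz_proj p \<gamma>))"


section \<open>Monoid rings and endomorphism rings\<close>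

definition monoid_ring :: "('m, 'z) monoid_scheme \<Rightarrow> ('m \<Rightarrow>\<^sub>0 int) ring" where
  "monoid_ring G =
    \<lparr>carrier = {c. Poly_Mapping.keys c \<subseteq> carrier G},
     mult = (\<lambda>x y. frag_extend (\<lambda>a. frag_extend (\<lambda>b. frag_of (a \<otimes>\<^bsub>G\<^esub> b)) y) x),
     one = frag_of \<one>\<^bsub>G\<^esub>,
     zero = 0,
     add = (+)\<rparr>"

text \<open>The ring of additive endomorphisms of the additive group of \<open>M\<close>.  Its elements are
  extensional, so that equality of endomorphisms is equality on \<^term>\<open>carrier M\<close>.\<close>

definition End_ring :: "('a, 'z) ring_scheme \<Rightarrow> ('a \<Rightarrow> 'a) ring" where
  "End_ring M =
    \<lparr>carrier = {f \<in> extensional (carrier M). f \<in> carrier M \<rightarrow> carrier M \<and>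
                (\<forall>x\<in>carrier M. \<forall>y\<in>carrier M. f (x \<oplus>\<^bsub>M\<^esub> y) = f x \<oplus>\<^bsub>M\<^esub> f y)},
     mult = compose (carrier M),
     one = (\<lambda>x\<in>carrier M. x),
     zero = (\<lambda>x\<in>carrier M. \<zero>\<^bsub>M\<^esub>),
     add = (\<lambda>f g. \<lambda>x\<in>carrier M. f x \<oplus>\<^bsub>M\<^esub> g x)\<rparr>"

definition representation ::
  "('h, 'y) ring_scheme \<Rightarrow> ('a, 'z) ring_scheme \<Rightarrow> ('h \<Rightarrow> 'a \<Rightarrow> 'a) \<Rightarrow> bool" where
  "representation H M \<pi> \<longleftrightarrow> \<pi> \<in> ring_hom H (End_ring M) \<and> \<pi> \<in> extensional (carrier H)"


section \<open>The integral BC-algebra\<close>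

datatype bc_gen = Elt qz_ring | Mu_tilde nat | Mu_star nat

fun bc_gen_ok :: "bc_gen \<Rightarrow> bool" where
  "bc_gen_ok (Elt x) = True"
| "bc_gen_ok (Mu_tilde n) = (n > 0)"
| "bc_gen_ok (Mu_star n) = (n > 0)"

definition bc_free :: "(bc_gen list \<Rightarrow>\<^sub>0 int) ring" where
  "bc_free = monoid_ring \<lparr>carrier = lists {g. bc_gen_ok g}, mult = (@), one = []\<rparr>"

text \<open>The first three sets make \<^const>\<open>Elt\<close> a unital ring homomorphism from
  \<open>\<int>[\<rat>/\<int>]\<close>; a relation \<open>u = v\<close> is encoded as \<open>u - v\<close>, and a product of generators is
  a word.\<close>

definition bc_relations :: "(bc_gen list \<Rightarrow>\<^sub>0 int) set" where
  "bc_relations =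
     {frag_of [Elt (x + y)] - (frag_of [Elt x] + frag_of [Elt y]) | x y. True} \<union>
     {frag_of [Elt (x * y)] - frag_of [Elt x, Elt y] | x y. True} \<union>
     {frag_of [Elt 1] - frag_of []} \<union>
     {frag_of [Mu_tilde n, Elt x, Mu_star n] - frag_of [Elt (bc_rho n x)] | n x. n > 0} \<union>
     {frag_of [Mu_star n, Elt x] - frag_of [Elt (bc_sigma n x), Mu_star n] | n x. n > 0} \<union>
     {frag_of [Elt x, Mu_tilde n] - frag_of [Mu_tilde n, Elt (bc_sigma n x)] | n x. n > 0} \<union>
     {frag_of [Mu_tilde (n * m)] - frag_of [Mu_tilde n, Mu_tilde m] | n m. n > 0 \<and> m > 0} \<union>
     {frag_of [Mu_star (n * m)] - frag_of [Mu_star n, Mu_star m] | n m. n > 0 \<and> m > 0} \<union>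
     {frag_of [Mu_star n, Mu_tilde n] - frag_cmul (int n) (frag_of []) | n. n > 0} \<union>
     {frag_of [Mu_tilde n, Mu_star m] - frag_of [Mu_star m, Mu_tilde n] | n m.
        n > 0 \<and> m > 0 \<and> coprime n m}"

definition bc_ideal :: "(bc_gen list \<Rightarrow>\<^sub>0 int) set" where
  "bc_ideal = genideal bc_free bc_relations"

definition bc_algebra :: "(bc_gen list \<Rightarrow>\<^sub>0 int) set ring" where
  "bc_algebra = bc_free Quot bc_ideal"

definition bc_class :: "bc_gen \<Rightarrow> (bc_gen list \<Rightarrow>\<^sub>0 int) set" where
  "bc_class g = bc_ideal +>\<^bsub>bc_free\<^esub> frag_of [g]"


section \<open>The ring \<open>\<bbbW>\<^sub>0\<close> of a field\<close>

text \<open>Over a field every finite projective module is isomorphic to some \<open>k\<^sup>d\<close>, so the square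
  matrices form a skeleton of the category of pairs \<open>(E, f)\<close>.\<close>

definition kronecker :: "'k::semiring_1 mat \<Rightarrow> 'k mat \<Rightarrow> 'k mat" where
  "kronecker A B = Matrix.mat (dim_row A * dim_row B) (dim_col A * dim_col B)
     (\<lambda>(i, j). A $$ (i div dim_row B, j div dim_col B) * B $$ (i mod dim_row B, j mod dim_col B))"

definition endo_exact :: "'k::field mat \<Rightarrow> 'k mat \<Rightarrow> 'k mat \<Rightarrow> bool" where
  "endo_exact A B C \<longleftrightarrow> square_mat A \<and> square_mat B \<and> square_mat C \<and>
     (\<exists>G\<in>carrier_mat (dim_row B) (dim_row A). \<exists>H\<in>carrier_mat (dim_row C) (dim_row B).
        G * A = B * G \<and> H * B = C * H \<and>
        inj_on (\<lambda>u. G *\<^sub>v u) (carrier_vec (dim_row A)) \<and>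
        (\<lambda>v. H *\<^sub>v v) ` carrier_vec (dim_row B) = carrier_vec (dim_row C) \<and>
        (\<lambda>u. G *\<^sub>v u) ` carrier_vec (dim_row A)
          = {v \<in> carrier_vec (dim_row B). H *\<^sub>v v = 0\<^sub>v (dim_row C)})"

definition end_free :: "('k::field mat \<Rightarrow>\<^sub>0 int) ring" where
  "end_free = monoid_ring \<lparr>carrier = {A. square_mat A}, mult = kronecker, one = 1\<^sub>m 1\<rparr>"

text \<open>\<open>K\<^sub>0\<close> of endomorphisms modulo the pairs \<open>(E, 0)\<close>, as a single quotient of the free
  abelian group on the pairs.  The subgroup generated by the short exact sequences is already an
  ideal, since tensor products over a field are exact.\<close>

definition W0_ideal :: "('k::field mat \<Rightarrow>\<^sub>0 int) set" where
  "W0_ideal = genideal end_free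
     ({frag_of B - (frag_of A + frag_of C) | A B C. endo_exact A B C} \<union>
      {frag_of (0\<^sub>m d d) | d. True})"

definition W0 :: "('k::field mat \<Rightarrow>\<^sub>0 int) set ring" where
  "W0 = end_free Quot W0_ideal"

text \<open>The map induced on the quotient by a map on the free abelian group.\<close>

definition W0_induced :: "(('k::field mat \<Rightarrow>\<^sub>0 int) \<Rightarrow> 'b) \<Rightarrow> ('k mat \<Rightarrow>\<^sub>0 int) set \<Rightarrow> 'b" where
  "W0_induced g = (\<lambda>\<xi>\<in>carrier W0. the_elem (g ` \<xi>))"

definition W0_F :: "nat \<Rightarrow> ('k::field mat \<Rightarrow>\<^sub>0 int) set \<Rightarrow> ('k mat \<Rightarrow>\<^sub>0 int) set" where
  "W0_F n = W0_induced (\<lambda>c. W0_ideal +>\<^bsub>end_free\<^esub> frag_extend (\<lambda>A. frag_of (A ^\<^sub>m n)) c)"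

text \<open>The block matrix of \<open>\<Phi>\<close> on \<open>E\<^sup>\<oplus>\<^sup>n\<close>: with \<open>d = dim E\<close>, row \<open>i\<close> lies in block
  \<open>i div d\<close> (counted from 0).\<close>

definition verschiebung_mat :: "nat \<Rightarrow> 'k::field mat \<Rightarrow> 'k mat" where
  "verschiebung_mat n A = (let d = dim_row A in Matrix.mat (n * d) (n * d) (\<lambda>(i, j).
     if i < d then (if (n - 1) * d \<le> j then A $$ (i, j - (n - 1) * d) else 0)
     else (if j = i - d then 1 else 0)))"

definition W0_V :: "nat \<Rightarrow> ('k::field mat \<Rightarrow>\<^sub>0 int) set \<Rightarrow> ('k mat \<Rightarrow>\<^sub>0 int) set" where
  "W0_V n = W0_induced
     (\<lambda>c. W0_ideal +>\<^bsub>end_free\<^esub> frag_extend (\<lambda>A. frag_of (verschiebung_mat n A)) c)"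

definition sigma_tilde :: "('k::field \<Rightarrow> qz) \<Rightarrow> ('k mat \<Rightarrow>\<^sub>0 int) set \<Rightarrow> qz_ring" where
  "sigma_tilde \<sigma> = W0_induced (frag_extend (\<lambda>A.
     \<Sum>\<alpha> | \<alpha> \<noteq> 0 \<and> eigenvalue A \<alpha>.
       frag_cmul (int (Polynomial.order \<alpha> (char_poly A))) (frag_of (\<sigma> \<alpha>))))"


section \<open>Witt vectors\<close>

text \<open>Polynomials with integer coefficients in the variables \<open>X\<^sub>i\<close> (\<^term>\<open>Inl i\<close>) and
  \<open>Y\<^sub>i\<close> (\<^term>\<open>Inr i\<close>).\<close>

type_synonym witt_poly = "((nat + nat) \<Rightarrow>\<^sub>0 nat) \<Rightarrow>\<^sub>0 int"

definition poly_var :: "nat + nat \<Rightarrow> witt_poly" where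
  "poly_var v = Poly_Mapping.single (Poly_Mapping.single v 1) 1"

definition poly_eval :: "(nat + nat \<Rightarrow> 'a::comm_ring_1) \<Rightarrow> witt_poly \<Rightarrow> 'a" where
  "poly_eval f P = (\<Sum>m\<in>Poly_Mapping.keys P. of_int (Poly_Mapping.lookup P m) *
     (\<Prod>v\<in>Poly_Mapping.keys m. f v ^ Poly_Mapping.lookup m v))"

definition ghost :: "nat \<Rightarrow> (nat \<Rightarrow> 'a::comm_ring_1) \<Rightarrow> 'a" where
  "ghost n x = (\<Sum>d | d dvd n. of_nat d * x d ^ (n div d))"

text \<open>The universal polynomials with prescribed ghost components.  As \<open>\<int>[X,Y]\<close> has no
  \<open>\<int>\<close>-torsion they are unique; the irrelevant value at index 0 is normalised.\<close>

definition witt_solve :: "(nat \<Rightarrow> witt_poly) \<Rightarrow> nat \<Rightarrow> witt_poly" where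
  "witt_solve g = (THE S. S 0 = 0 \<and> (\<forall>n>0. ghost n S = g n))"

definition witt_add_poly :: "nat \<Rightarrow> witt_poly" where
  "witt_add_poly = witt_solve (\<lambda>n. ghost n (poly_var \<circ> Inl) + ghost n (poly_var \<circ> Inr))"

definition witt_mult_poly :: "nat \<Rightarrow> witt_poly" where
  "witt_mult_poly = witt_solve (\<lambda>n. ghost n (poly_var \<circ> Inl) * ghost n (poly_var \<circ> Inr))"

definition witt_frob_poly :: "nat \<Rightarrow> nat \<Rightarrow> witt_poly" where
  "witt_frob_poly n = witt_solve (\<lambda>m. ghost (m * n) (poly_var \<circ> Inl))"

text \<open>Witt vectors indexed by a set \<open>S\<close> of positive integers that is closed under divisors:
  the component of index \<open>n\<close> of a sum or a product involves only the components indexed by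
  divisors of \<open>n\<close>.\<close>

definition teichmueller :: "nat set \<Rightarrow> 'a::comm_ring_1 \<Rightarrow> nat \<Rightarrow> 'a" where
  "teichmueller S a = (\<lambda>n\<in>S. if n = 1 then a else 0)"

definition witt_ring :: "nat set \<Rightarrow> (nat \<Rightarrow> 'a::comm_ring_1) ring" where
  "witt_ring S =
    \<lparr>carrier = S \<rightarrow>\<^sub>E UNIV,
     mult = (\<lambda>x y. \<lambda>n\<in>S. poly_eval (case_sum x y) (witt_mult_poly n)),
     one = teichmueller S 1,
     zero = teichmueller S 0,
     add = (\<lambda>x y. \<lambda>n\<in>S. poly_eval (case_sum x y) (witt_add_poly n))\<rparr>"

abbreviation big_witt :: "(nat \<Rightarrow> 'a::comm_ring_1) ring" where
  "big_witt \<equiv> witt_ring {0<..}"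

definition p_powers :: "nat \<Rightarrow> nat set" where
  "p_powers p = {p ^ k | k. True}"

text \<open>The \<open>p\<close>-typical component number \<open>k\<close> has index \<open>p\<^sup>k\<close>.\<close>

abbreviation p_witt :: "nat \<Rightarrow> (nat \<Rightarrow> 'a::comm_ring_1) ring" where
  "p_witt p \<equiv> witt_ring (p_powers p)"

definition witt_F :: "nat \<Rightarrow> (nat \<Rightarrow> 'a::comm_ring_1) \<Rightarrow> nat \<Rightarrow> 'a" where
  "witt_F n x = (\<lambda>m\<in>{0<..}. poly_eval (case_sum x x) (witt_frob_poly n m))"

definition witt_topology :: "(nat \<Rightarrow> 'a) topology" where
  "witt_topology = product_topology (\<lambda>_. discrete_topology UNIV) {0<..}"

definition witt_series :: "(nat \<Rightarrow> 'k::field) \<Rightarrow> 'k fps" where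
  "witt_series x = prodinf (\<lambda>n. inverse (1 - fps_const (x (Suc n)) * fps_X ^ Suc n))"

definition det_series :: "'k::field mat \<Rightarrow> 'k fps" where
  "det_series A = Determinant.det (1\<^sub>m (dim_row A) - fps_X \<cdot>\<^sub>m map_mat fps_const A)"

text \<open>The embedding of \<open>\<bbbW>\<^sub>0\<close> into the big Witt ring through \<open>(E, f) \<mapsto> det (1 - t f)\<^sup>-\<^sup>1\<close>;
  addition of Witt vectors corresponds to multiplication of series.\<close>

definition W0_embed :: "('k::field mat \<Rightarrow>\<^sub>0 int) set \<Rightarrow> nat \<Rightarrow> 'k" where
  "W0_embed = W0_induced (\<lambda>c. inv_into (carrier big_witt) witt_series
     (\<Prod>A\<in>Poly_Mapping.keys c. det_series A powi (- Poly_Mapping.lookup c A)))"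


section \<open>The \<open>p\<close>-adic description\<close>

definition Theta :: "nat \<Rightarrow> (nat \<Rightarrow> 'k::comm_ring_1) \<Rightarrow> nat \<Rightarrow> nat \<Rightarrow> 'k" where
  "Theta p x = (\<lambda>n\<in>I_prime_to p. \<lambda>i\<in>p_powers p. witt_F n x i)"

definition Theta_inv :: "nat \<Rightarrow> (nat \<Rightarrow> nat \<Rightarrow> 'k::comm_ring_1) \<Rightarrow> nat \<Rightarrow> 'k" where
  "Theta_inv p = inv_into (carrier big_witt) (Theta p)"

definition O_scale :: "nat \<Rightarrow> (nat \<Rightarrow> 'k::comm_ring_1) \<Rightarrow> (nat \<Rightarrow> 'k) \<Rightarrow> nat \<Rightarrow> 'k" where
  "O_scale p c x = Theta_inv p (\<lambda>n\<in>I_prime_to p. c \<otimes>\<^bsub>p_witt p\<^esub> Theta p x n)"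

definition witt_eps :: "nat \<Rightarrow> nat \<Rightarrow> nat \<Rightarrow> 'k::comm_ring_1" where
  "witt_eps p m = Theta_inv p
     (\<lambda>n\<in>I_prime_to p. if n = m then \<one>\<^bsub>p_witt p\<^esub> else \<zero>\<^bsub>p_witt p\<^esub>)"

text \<open>The automorphism of \<^term>\<open>p_witt p\<close> induced by \<open>x \<mapsto> x\<^sup>p\<close>, and its action on every
  component of \<^const>\<open>Theta\<close>.\<close>

definition Fr :: "nat \<Rightarrow> (nat \<Rightarrow> 'k::comm_ring_1) \<Rightarrow> nat \<Rightarrow> 'k" where
  "Fr p c = (\<lambda>i\<in>p_powers p. c i ^ p)"

definition Fr_op :: "nat \<Rightarrow> (nat \<Rightarrow> 'k::comm_ring_1) \<Rightarrow> nat \<Rightarrow> 'k" where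
  "Fr_op p = (\<lambda>x\<in>carrier big_witt. Theta_inv p (\<lambda>n\<in>I_prime_to p. Fr p (Theta p x n)))"

definition Fr_inv_op :: "nat \<Rightarrow> (nat \<Rightarrow> 'k::comm_ring_1) \<Rightarrow> nat \<Rightarrow> 'k" where
  "Fr_inv_op p = (\<lambda>x\<in>carrier big_witt. inv_into (carrier big_witt) (Fr_op p) x)"

definition O_linear :: "nat \<Rightarrow> ((nat \<Rightarrow> 'k::comm_ring_1) \<Rightarrow> nat \<Rightarrow> 'k) \<Rightarrow> bool" where
  "O_linear p T \<longleftrightarrow> T \<in> carrier (End_ring big_witt) \<and>
     (\<forall>c\<in>carrier (p_witt p). \<forall>x\<in>carrier big_witt. T (O_scale p c x) = O_scale p c (T x))"


section \<open>The cyclotomic field and its embedding\<close>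

lift_definition zeta :: "qz \<Rightarrow> complex" is "\<lambda>q. cis (2 * pi * of_rat q)"
proof -
  fix q q' :: rat
  assume "q - q' \<in> \<int>"
  then obtain k where "q - q' = of_int k" by (elim Ints_cases)
  hence "q = q' + of_int k" by (simp add: algebra_simps)
  hence "2 * pi * of_rat q = 2 * pi * of_rat q' + 2 * pi * of_int k"
    by (simp add: of_rat_add distrib_left)
  thus "cis (2 * pi * of_rat q) = cis (2 * pi * of_rat q')"
    by (simp add: cis_mult [symmetric])
qed

definition Q_cyc :: "nat \<Rightarrow> complex ring" where
  "Q_cyc p = (ring_of_type_algebra :: complex ring)
     \<lparr>carrier := generate_field ring_of_type_algebra (zeta ` qz_prime_to p)\<rparr>"

definition sigma_inv :: "('k::field \<Rightarrow> qz) \<Rightarrow> qz \<Rightarrow> 'k" where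
  "sigma_inv \<sigma> = inv_into (UNIV - {0}) \<sigma>"

text \<open>\<open>C\<close> is a field into which the ring \<^term>\<open>p_witt p\<close> is embedded by \<open>\<iota>\<close>, for instance
  \<open>\<complex>\<^sub>p\<close>.\<close>

definition cyc_embedding :: "nat \<Rightarrow> ('k::field \<Rightarrow> qz) \<Rightarrow> 'c ring \<Rightarrow> ((nat \<Rightarrow> 'k) \<Rightarrow> 'c) \<Rightarrow>
    (complex \<Rightarrow> 'c) \<Rightarrow> bool" where
  "cyc_embedding p \<sigma> C \<iota> \<rho> \<longleftrightarrow>
     Ring.field C \<and> \<iota> \<in> ring_hom (p_witt p) C \<and> inj_on \<iota> (carrier (p_witt p)) \<and>
     \<rho> \<in> ring_hom (Q_cyc p) C \<and>
     (\<forall>\<gamma>\<in>qz_prime_to p. \<rho> (zeta \<gamma>) = \<iota> (teichmueller (p_powers p) (sigma_inv \<sigma> \<gamma>)))"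


section \<open>The representation and its extension\<close>

definition W0_representation :: "nat \<Rightarrow> ('k::field \<Rightarrow> qz) \<Rightarrow>
    ((bc_gen list \<Rightarrow>\<^sub>0 int) set \<Rightarrow> ('k mat \<Rightarrow>\<^sub>0 int) set \<Rightarrow> ('k mat \<Rightarrow>\<^sub>0 int) set) \<Rightarrow> bool" where
  "W0_representation p \<sigma> \<pi> \<longleftrightarrow> representation bc_algebra W0 \<pi> \<and>
     (\<forall>x. \<pi> (bc_class (Elt x)) =
        (\<lambda>\<xi>\<in>carrier W0. inv_into (carrier W0) (sigma_tilde \<sigma>) (bc_r p x) \<otimes>\<^bsub>W0\<^esub> \<xi>)) \<and>
     (\<forall>n>0. \<pi> (bc_class (Mu_star n)) = W0_F n) \<and>
     (\<forall>n>0. \<pi> (bc_class (Mu_tilde n)) = W0_V n)"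

definition continuous_extension ::
  "((bc_gen list \<Rightarrow>\<^sub>0 int) set \<Rightarrow> ('k::field mat \<Rightarrow>\<^sub>0 int) set \<Rightarrow> ('k mat \<Rightarrow>\<^sub>0 int) set) \<Rightarrow>
   ((bc_gen list \<Rightarrow>\<^sub>0 int) set \<Rightarrow> (nat \<Rightarrow> 'k) \<Rightarrow> nat \<Rightarrow> 'k) \<Rightarrow> bool" where
  "continuous_extension \<pi>0 \<pi> \<longleftrightarrow> representation bc_algebra big_witt \<pi> \<and>
     (\<forall>h\<in>carrier bc_algebra. continuous_map witt_topology witt_topology (\<pi> h) \<and>
        (\<forall>\<xi>\<in>carrier W0. \<pi> h (W0_embed \<xi>) = W0_embed (\<pi>0 h \<xi>)))"

text \<open>\<open>\<mu>\<^sub>n\<close> is \<open>\<mu>\<^sub>n\<close>-tilde divided by \<open>n\<close>, which is not an element of the integral algebra;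
  its operator is the additive operator whose \<open>n\<close>-fold multiple is that of \<open>\<mu>\<^sub>n\<close>-tilde.\<close>

definition is_mu_op :: "((bc_gen list \<Rightarrow>\<^sub>0 int) set \<Rightarrow> (nat \<Rightarrow> 'k::field) \<Rightarrow> nat \<Rightarrow> 'k) \<Rightarrow> nat \<Rightarrow>
    ((nat \<Rightarrow> 'k) \<Rightarrow> nat \<Rightarrow> 'k) \<Rightarrow> bool" where
  "is_mu_op \<pi> n T \<longleftrightarrow> T \<in> carrier (End_ring big_witt) \<and>
     [n] \<cdot>\<^bsub>End_ring big_witt\<^esub> T = \<pi> (bc_class (Mu_tilde n))"

definition mu_op :: "((bc_gen list \<Rightarrow>\<^sub>0 int) set \<Rightarrow> (nat \<Rightarrow> 'k::field) \<Rightarrow> nat \<Rightarrow> 'k) \<Rightarrow> nat \<Rightarrow>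
    (nat \<Rightarrow> 'k) \<Rightarrow> nat \<Rightarrow> 'k" where
  "mu_op \<pi> n = (THE T. is_mu_op \<pi> n T)"

end

theory Submission
  imports Defs
begin

text \<open>
  Everything is computed through the group ring \<open>\<int>[\<rat>/\<int>]\<close>, on which the integral BC-algebra acts
  tautologically: \<open>x\<close> by multiplication, \<open>\<mu>\<^sub>n\<close>-tilde by \<open>bc_rho n\<close> and the dual generator by
  \<open>bc_sigma n\<close>.  The defining relations are identities between these operators.

  By devissage over the algebraically closed field \<open>k\<close>, the class of a matrix in \<open>\<bbbW>\<^sub>0(k)\<close> is a sum of
  one-dimensional classes, so the ideal generated by the exact sequences and the zero matrices is the
  kernel of the map sending a matrix to its non-zero eigenvalues (\<open>W0_ideal_eq\<close>).  Reading \<open>\<rat>/\<int>\<close>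
  as eigenvalues through \<open>\<sigma>\<close> gives a surjective ring homomorphism \<open>W0_of\<close> from \<open>\<int>[\<rat>/\<int>]\<close> onto \<open>\<bbbW>\<^sub>0(k)\<close>
  that factors through \<open>r\<close> and induces the inverse of \<open>\<sigma>\<close>-tilde.  It turns \<open>bc_sigma n\<close> into \<open>F\<^sub>n\<close>,
      and it
  turns \<open>bc_rho n\<close> into \<open>V\<^sub>n\<close> because \<open>V\<^sub>n (\<alpha>)\<close> is the companion matrix of \<open>X\<^sup>n - \<alpha>\<close>, whose roots are
  parametrised with multiplicity by a fibre of multiplication by \<open>n\<close> on \<open>\<rat>/\<int>\<close>
  (\<open>root_polynomial\<close>).  As the action passes to the quotient by the kernel of \<open>r\<close>, it yields the
  representation on \<open>\<bbbW>\<^sub>0(k)\<close>.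

  The composite \<open>embed\<close> of \<open>W0_of\<close> with the embedding into the big Witt vectors sends \<open>e(\<gamma>)\<close> to a
  Teichmueller representative.  Its image is dense, since the partial products of
  \<open>\<Prod> (1 - x\<^sub>n t\<^sup>n)\<close> are determinants of sums of companion matrices.  The operator of each generator has
  therefore exactly one continuous extension, namely multiplication by \<open>embed x\<close>,
      \<open>F\<^sub>n\<close> or \<open>V\<^sub>n\<close>; continuous
  additive operators are closed under products and differences, and uniqueness makes the extension
  multiplicative.

  In the coordinates \<open>\<Theta>\<close>, which are bijective because they are triangular with coefficients prime
  to \<open>p\<close>, the operator \<open>F\<^sub>n\<close> for \<open>n\<close> prime to \<open>p\<close> is the shift \<open>y\<^sub>m \<mapsto> y\<^bsub>mn\<^esub>\<close> and \<open>V\<^sub>n\<close> is \<open>n\<close> times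
  the transposed shift.  The big Witt vectors have no \<open>n\<close>-torsion, a power series with constant
  term \<open>1\<close> having only one \<open>n\<close>-th root with constant term \<open>1\<close>; so \<open>\<mu>\<^sub>n\<close> is the transposed shift
  itself.  At \<open>p\<close> itself, \<open>F\<^sub>p\<close> raises all components to the \<open>p\<close>-th power and \<open>V\<^sub>p F\<^sub>p = p\<close>: both
  identities are checked on Teichmueller representatives.  Hence \<open>F\<^sub>p = Fr\<close> is bijective and
  \<open>\<mu>\<^sub>p\<close> is its inverse.

  The arithmetic of Witt vectors underneath is built on Dwork's criterion for the ghost components
  of the universal polynomials (\<open>ghost_witt_rec\<close>), and its laws are transferred from ghost
  components over polynomial rings with integer coefficients (\<open>witt_transfer\<close>).
\<close>

section \<open>Polynomials with integer coefficients\<close>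

text \<open>Arbitrary variables are allowed, so that every commutative ring is the image under \<open>zeval\<close> of the
  polynomials in its own elements.\<close>

type_synonym 'v zpoly = "('v \<Rightarrow>\<^sub>0 nat) \<Rightarrow>\<^sub>0 int"

definition zvar :: "'v \<Rightarrow> 'v zpoly" where
  "zvar v = Poly_Mapping.single (Poly_Mapping.single v 1) 1"

definition meval :: "('v \<Rightarrow> 'a::comm_ring_1) \<Rightarrow> ('v \<Rightarrow>\<^sub>0 nat) \<Rightarrow> 'a" where
  "meval f m = (\<Prod>v\<in>Poly_Mapping.keys m. f v ^ Poly_Mapping.lookup m v)"

definition zeval :: "('v \<Rightarrow> 'a::comm_ring_1) \<Rightarrow> 'v zpoly \<Rightarrow> 'a" where
  "zeval f P = (\<Sum>m\<in>Poly_Mapping.keys P. of_int (Poly_Mapping.lookup P m) * meval f m)"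

lemma poly_eval_eq_zeval: "poly_eval f P = zeval f P"
  by (simp add: poly_eval_def zeval_def meval_def)

lemma poly_var_eq_zvar: "poly_var = zvar"
  by (simp add: poly_var_def zvar_def fun_eq_iff)

lemma meval_superset:
  assumes "finite V" "Poly_Mapping.keys m \<subseteq> V"
  shows "meval f m = (\<Prod>v\<in>V. f v ^ Poly_Mapping.lookup m v)"
  unfolding meval_def
  by (rule prod.mono_neutral_left) (use assms in \<open>auto simp: in_keys_iff\<close>)

lemma meval_add: "meval f (m + m') = meval f m * meval f m'"
proof -
  let ?V = "Poly_Mapping.keys m \<union> Poly_Mapping.keys m'"
  have "meval f (m + m') = (\<Prod>v\<in>?V. f v ^ Poly_Mapping.lookup (m + m') v)"
    by (rule meval_superset) (auto simp: Poly_Mapping.keys_add)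
  also have "\<dots> = (\<Prod>v\<in>?V. f v ^ Poly_Mapping.lookup m v) * (\<Prod>v\<in>?V. f v ^ Poly_Mapping.lookup m' v)"
    by (simp add: lookup_add power_add prod.distrib)
  also have "\<dots> = meval f m * meval f m'"
    by (subst (1 2) meval_superset[of ?V]) auto
  finally show ?thesis .
qed

lemma meval_0 [simp]: "meval f 0 = 1"
  by (simp add: meval_def)

lemma zeval_superset:
  assumes "finite V" "Poly_Mapping.keys P \<subseteq> V"
  shows "zeval f P = (\<Sum>m\<in>V. of_int (Poly_Mapping.lookup P m) * meval f m)"
  unfolding zeval_def
  by (rule sum.mono_neutral_left) (use assms in \<open>auto simp: in_keys_iff\<close>)

lemma zeval_0 [simp]: "zeval f 0 = 0"
  by (simp add: zeval_def)

lemma zeval_add: "zeval f (P + Q) = zeval f P + zeval f Q"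
proof -
  let ?V = "Poly_Mapping.keys P \<union> Poly_Mapping.keys Q"
  have "zeval f (P + Q) = (\<Sum>m\<in>?V. of_int (Poly_Mapping.lookup (P + Q) m) * meval f m)"
    by (rule zeval_superset) (auto dest: subsetD[OF Poly_Mapping.keys_add])
  also have "\<dots> = (\<Sum>m\<in>?V. of_int (Poly_Mapping.lookup P m) * meval f m) +
                   (\<Sum>m\<in>?V. of_int (Poly_Mapping.lookup Q m) * meval f m)"
    by (simp add: lookup_add distrib_right sum.distrib)
  also have "\<dots> = zeval f P + zeval f Q"
    by (subst (1 2) zeval_superset[of ?V]) auto
  finally show ?thesis .
qed

lemma zeval_diff: "zeval f (P - Q) = zeval f P - zeval f Q"
  using zeval_add[of f "P - Q" Q] by simp

lemma zeval_single: "zeval f (Poly_Mapping.single m c) = of_int c * meval f m"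
  by (subst zeval_superset[of "{m}"]) auto

lemma zpoly_induct [case_names zero monom diff]:
  assumes "P 0" "\<And>m. P (Poly_Mapping.single m 1)" "\<And>a b. P a \<Longrightarrow> P b \<Longrightarrow> P (a - b)"
  shows "P (c :: 'v zpoly)"
  by (rule frag_induction[of c UNIV]) (use assms in auto)

lemma zeval_mult: "zeval f (P * Q) = zeval f P * zeval f Q"
proof (induction P rule: zpoly_induct)
  case (monom m)
  show ?case
    by (induction Q rule: zpoly_induct)
       (simp_all add: mult_single zeval_single meval_add zeval_diff right_diff_distrib)
qed (simp_all add: zeval_diff left_diff_distrib)

lemma zeval_zvar [simp]: "zeval f (zvar v) = f v"
  unfolding zvar_def zeval_single meval_def by simp

lemma zeval_1 [simp]: "zeval f 1 = 1"
  by (metis meval_0 mult_1 of_int_1 single_one zeval_single)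

lemma comm_ring_hom_zeval: "comm_ring_hom (zeval f)"
  by unfold_locales (simp_all add: zeval_add zeval_mult)

lemma zeval_power: "zeval f (P ^ n) = zeval f P ^ n"
  by (induction n) (simp_all add: zeval_mult)

lemma zeval_of_nat: "zeval f (of_nat n) = of_nat n"
  by (induction n) (simp_all add: zeval_add)

lemma zeval_hom:
  assumes "comm_ring_hom h"
  shows "h (zeval f P) = zeval (\<lambda>v. h (f v)) P"
proof -
  interpret comm_ring_hom h by fact
  show ?thesis
    by (simp add: zeval_def meval_def hom_distribs)
qed

text \<open>The only arithmetic input about the coefficient ring in the construction of the universal
  Witt polynomials: an identity may be divided by a positive integer.\<close>

definition torsion_free :: "'a::comm_ring_1 itself \<Rightarrow> bool" where
  "torsion_free _ \<longleftrightarrow> (\<forall>n>0. \<forall>x::'a. of_nat n * x = 0 \<longrightarrow> x = 0)"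

lemma torsion_freeD:
  fixes x y :: "'a::comm_ring_1"
  assumes "torsion_free TYPE('a)" "n > 0" "of_nat n * x = of_nat n * y"
  shows "x = y"
  using assms unfolding torsion_free_def by (metis eq_iff_diff_eq_0 right_diff_distrib)

lemma lookup_of_nat_mult: "Poly_Mapping.lookup (of_nat n * P :: 'v zpoly) m
    = int n * Poly_Mapping.lookup P m"
  by (induction n) (simp_all add: distrib_right lookup_add)

lemma torsion_free_zpoly: "torsion_free TYPE('v zpoly)"
  unfolding torsion_free_def
  by (auto intro!: poly_mapping_eqI) (metis lookup_of_nat_mult lookup_zero mult_eq_0_iff neq0_conv
      of_nat_0_eq_iff)

section \<open>Congruences modulo an integer in a commutative ring\<close>

definition ncong :: "'a::comm_ring_1 \<Rightarrow> 'a \<Rightarrow> nat \<Rightarrow> bool" where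
  "ncong x y n \<longleftrightarrow> of_nat n dvd (x - y)"

lemma ncong_refl [simp]: "ncong x x n"
  by (simp add: ncong_def)

lemma ncong_sym: "ncong x y n \<Longrightarrow> ncong y x n"
  unfolding ncong_def by (metis dvd_minus_iff minus_diff_eq)

lemma ncong_trans: "ncong x y n \<Longrightarrow> ncong y z n \<Longrightarrow> ncong x z n"
  unfolding ncong_def using dvd_add[of "of_nat n" "x - y" "y - z"] by simp

lemma ncong_add: "ncong x y n \<Longrightarrow> ncong x' y' n \<Longrightarrow> ncong (x + x') (y + y') n"
  unfolding ncong_def using dvd_add[of "of_nat n" "x - y" "x' - y'"] by (simp add: algebra_simps)

lemma ncong_diff: "ncong x y n \<Longrightarrow> ncong x' y' n \<Longrightarrow> ncong (x - x') (y - y') n"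
  unfolding ncong_def using dvd_diff[of "of_nat n" "x - y" "x' - y'"] by (simp add: algebra_simps)

lemma ncong_mult:
  assumes "ncong x y n" "ncong x' y' n" shows "ncong (x * x') (y * y') n"
proof -
  have "x * x' - y * y' = (x - y) * x' + y * (x' - y')" by (simp add: algebra_simps)
  with assms show ?thesis unfolding ncong_def by (metis dvd_add dvd_mult dvd_mult2)
qed

lemma ncong_sum: "(\<And>i. i \<in> I \<Longrightarrow> ncong (f i) (g i) n) \<Longrightarrow> ncong (sum f I) (sum g I) n"
  by (induction I rule: infinite_finite_induct) (auto intro: ncong_add)

lemma ncong_power: "ncong x y n \<Longrightarrow> ncong (x ^ k) (y ^ k) n"
  by (induction k) (auto intro: ncong_mult)

lemma of_nat_dvd_of_nat:
  assumes "m dvd n" shows "(of_nat m :: 'a::comm_semiring_1) dvd of_nat n"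
  using assms by (auto elim!: dvdE)

lemma ncong_dvd: "ncong x y n \<Longrightarrow> m dvd n \<Longrightarrow> ncong x y m"
  unfolding ncong_def by (meson dvd_trans of_nat_dvd_of_nat)

lemma ncong_scale: "ncong x y n \<Longrightarrow> ncong (of_nat m * x) (of_nat m * y) (m * n)"
  unfolding ncong_def using mult_dvd_mono[of "of_nat m" "of_nat m" "of_nat n" "x - y"]
  by (simp add: right_diff_distrib)

lemma ncong_zero_mult: "n dvd m \<Longrightarrow> ncong (of_nat m * x) 0 n"
  unfolding ncong_def by (simp add: dvd_mult2 of_nat_dvd_of_nat)

lemma ncong_freshmans_dream:
  fixes x y :: "'a::comm_ring_1"
  assumes "Factorial_Ring.prime q"
  shows "ncong ((x + y) ^ q) (x ^ q + y ^ q) q"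
proof -
  have q0: "q > 0" using assms by (simp add: prime_gt_0_nat)
  have "(x + y) ^ q = (\<Sum>k\<le>q. of_nat (q choose k) * x ^ k * y ^ (q - k))"
    by (rule binomial_ring)
  also have "{..q} = insert 0 (insert q {0<..<q})" using q0 by auto
  also have "(\<Sum>k\<in>insert 0 (insert q {0<..<q}). of_nat (q choose k) * x ^ k * y ^ (q - k))
     = (x ^ q + y ^ q) + (\<Sum>k\<in>{0<..<q}. of_nat (q choose k) * x ^ k * y ^ (q - k))"
    using q0 by simp
  finally have eq: "(x + y) ^ q = (x ^ q + y ^ q) + (\<Sum>k\<in>{0<..<q}. of_nat (q choose k) * x ^ k * y ^
      (q - k))" .
  have "of_nat q dvd (\<Sum>k\<in>{0<..<q}. of_nat (q choose k) * x ^ k * y ^ (q - k))"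
  proof (rule dvd_sum)
    fix k assume "k \<in> {0<..<q}"
    hence "q dvd (q choose k)" using assms by (intro dvd_choose_prime) auto
    thus "(of_nat q :: 'a) dvd of_nat (q choose k) * x ^ k * y ^ (q - k)"
      by (intro dvd_mult2) (rule of_nat_dvd_of_nat)
  qed
  thus ?thesis unfolding ncong_def eq by simp
qed

text \<open>Raising a congruence to the power \<open>q\<close> gains a factor \<open>q\<close> in the modulus.  This is what
  makes the ghost components of a Witt vector congruent along multiplication of the index by
  \<open>q\<close>.\<close>

lemma ncong_prime_power_step:
  fixes x y :: "'a::comm_ring_1"
  assumes q: "Factorial_Ring.prime q" and "q dvd n" "ncong x y n"
  shows "ncong (x ^ q) (y ^ q) (q * n)"
proof -
  obtain z where z: "x = y + of_nat n * z"
    using assms(3) unfolding ncong_def dvd_def by (metis add.commute diff_add_cancel)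
  have q0: "q > 1" using q by (rule prime_gt_1_nat)
  have "x ^ q = (\<Sum>k\<le>q. of_nat (q choose k) * (of_nat n * z) ^ k * y ^ (q - k))"
    unfolding z by (subst add.commute) (rule binomial_ring)
  also have "{..q} = insert 0 {0<..q}" by auto
  also have "(\<Sum>k\<in>insert 0 {0<..q}. of_nat (q choose k) * (of_nat n * z) ^ k * y ^ (q - k))
     = y ^ q + (\<Sum>k\<in>{0<..q}. of_nat (q choose k) * (of_nat n * z) ^ k * y ^ (q - k))"
    by simp
  finally have eq: "x ^ q - y ^ q = (\<Sum>k\<in>{0<..q}. of_nat (q choose k) * (of_nat n * z) ^ k * y ^ (q - k))"
    by simp
  have "of_nat (q * n) dvd (x ^ q - y ^ q)" unfolding eq
  proof (rule dvd_sum)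
    fix k assume k: "k \<in> {0<..q}"
    have "q * n dvd (q choose k) * n ^ k"
    proof (cases "k = q")
      case True
      have "q * n dvd n * n" using \<open>q dvd n\<close> by simp
      also have "n * n dvd n ^ q" using q0 by (metis le_imp_power_dvd power2_eq_square Suc_leI Suc_1)
      finally show ?thesis using True by simp
    next
      case False
      hence "q dvd (q choose k)" using k q by (intro dvd_choose_prime) auto
      moreover have "n dvd n ^ k" using k by (simp add: dvd_power)
      ultimately show ?thesis by (rule mult_dvd_mono)
    qed
    hence "(of_nat (q * n) :: 'a) dvd of_nat ((q choose k) * n ^ k)" by (rule of_nat_dvd_of_nat)
    moreover have "of_nat (q choose k) * (of_nat n * z) ^ k * y ^ (q - k)
       = of_nat ((q choose k) * n ^ k) * (z ^ k * y ^ (q - k))"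
      by (simp add: power_mult_distrib mult_ac)
    ultimately show "of_nat (q * n) dvd of_nat (q choose k) * (of_nat n * z) ^ k * y ^ (q - k)"
      by (metis dvd_mult2)
  qed
  thus ?thesis unfolding ncong_def .
qed

lemma ncong_prime_power:
  fixes x y :: "'a::comm_ring_1"
  assumes q: "Factorial_Ring.prime q" and "ncong x y q"
  shows "ncong (x ^ (q ^ a)) (y ^ (q ^ a)) (q ^ Suc a)"
proof (induction a)
  case (Suc a)
  have "ncong ((x ^ (q ^ a)) ^ q) ((y ^ (q ^ a)) ^ q) (q * q ^ Suc a)"
    by (rule ncong_prime_power_step[OF q _ Suc]) simp
  thus ?case by (simp add: power_mult [symmetric] mult.commute)
qed (use assms in simp)

text \<open>Bezout coefficients combine the two divisibilities; the ring itself need not have unique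
  factorization.\<close>

lemma of_nat_dvd_coprime:
  fixes x :: "'a::comm_ring_1"
  assumes "coprime a b" "of_nat a dvd x" "of_nat b dvd x"
  shows "of_nat (a * b) dvd x"
proof -
  obtain s t where st: "s * int a + t * int b = 1"
    using bezout_int[of "int a" "int b"] assms(1) by auto
  have "x = (of_int s * of_nat a + of_int t * of_nat b) * x"
    using arg_cong[OF st, of "of_int :: int \<Rightarrow> 'a"] by simp
  also have "\<dots> = of_int s * (of_nat a * x) + of_int t * (of_nat b * x)" by (simp add: algebra_simps)
  finally have eq: "x = of_int s * (of_nat a * x) + of_int t * (of_nat b * x)" .
  have "of_nat (a * b) dvd of_nat a * x" using assms(3) by (simp add: mult_dvd_mono)
  moreover have "of_nat (a * b) dvd of_nat b * x" using assms(2) by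
      (simp add: mult_dvd_mono mult.commute)
  ultimately have "of_nat (a * b) dvd of_int s * (of_nat a * x) + of_int t * (of_nat b * x)"
    by (meson dvd_add dvd_mult)
  thus ?thesis by (subst eq)
qed

lemma split_prime_power:
  fixes n :: nat
  assumes "Factorial_Ring.prime q" "n > 0"
  obtains a m where "n = q ^ a * m" "\<not> q dvd m"
proof (rule that)
  show "n = q ^ multiplicity q n * (n div q ^ multiplicity q n)"
    by (simp add: multiplicity_dvd)
  show "\<not> q dvd n div q ^ multiplicity q n"
    using assms by (intro multiplicity_decompose) (auto simp: prime_nat_iff)
qed

lemma of_nat_dvd_if_prime_powers:
  fixes x :: "'a::comm_ring_1"
  assumes "n > 0" "\<And>q a. Factorial_Ring.prime q \<Longrightarrow> q ^ Suc a dvd n \<Longrightarrow> of_nat (q ^ Suc a) dvd x"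
  shows "of_nat n dvd x"
  using assms
proof (induction n rule: less_induct)
  case (less n)
  show ?case
  proof (cases "n = 1")
    case False
    then obtain q where q: "Factorial_Ring.prime q" "q dvd n" by (metis prime_factor_nat)
    obtain a m where am: "n = q ^ a * m" "\<not> q dvd m"
      by (rule split_prime_power[OF q(1) less.prems(1)])
    have "a > 0" using am q by (cases a) auto
    then obtain b where b: "a = Suc b" by (cases a) auto
    have "m > 0" using less.prems(1) am(1) by (auto intro: Nat.gr0I)
    moreover have "q ^ a > 1" using q(1) \<open>a > 0\<close> by (simp only: one_less_power prime_gt_1_nat)
    ultimately have m: "m > 0" "m < n" using am(1) by simp_all
    have "of_nat m dvd x"
    proof (rule less.IH[OF m(2) m(1)])
      fix q' c assume "Factorial_Ring.prime q'" "q' ^ Suc c dvd m"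
      thus "of_nat (q' ^ Suc c) dvd x" by (intro less.prems(2)) (simp_all only: am(1) dvd_mult)
    qed
    moreover have "of_nat (q ^ a) dvd x" using less.prems(2)[OF q(1), of b] am(1) b by auto
    moreover have "coprime (q ^ a) m" using am(2) q(1) by (simp add: prime_imp_coprime)
    ultimately show ?thesis unfolding am(1) by (intro of_nat_dvd_coprime)
  qed auto
qed

section \<open>Ghost components and the universal Witt polynomials\<close>

lemma single_var_power:
  "(Poly_Mapping.single (Poly_Mapping.single v 1) 1 :: 'v zpoly) ^ n
      = Poly_Mapping.single (Poly_Mapping.single v n) 1"
  by (induction n) (simp_all add: mult_single flip: single_add)

lemma prod_single_monom:
  "(\<Prod>v\<in>V. Poly_Mapping.single (g v) 1 :: 'v zpoly) = Poly_Mapping.single (\<Sum>v\<in>V. g v) 1"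
  by (induction V rule: infinite_finite_induct) (simp_all add: mult_single)

lemma meval_zvar: "meval zvar m = Poly_Mapping.single m 1"
proof -
  have "(\<Sum>v\<in>Poly_Mapping.keys m. Poly_Mapping.single v (Poly_Mapping.lookup m v)) = m"
    by (rule poly_mapping_eqI)
       (auto simp: lookup_sum lookup_single when_def in_keys_iff if_distrib cong: if_cong)
  thus ?thesis unfolding meval_def zvar_def by (simp only: single_var_power prod_single_monom)
qed

text \<open>The ring endomorphism \<open>X\<^sub>v \<mapsto> X\<^sub>v\<^sup>q\<close> lifts the \<open>q\<close>-th power map from characteristic \<open>q\<close>.\<close>

definition frob_lift :: "nat \<Rightarrow> 'v zpoly \<Rightarrow> 'v zpoly" where
  "frob_lift q = zeval (\<lambda>v. zvar v ^ q)"

lemma comm_ring_hom_frob_lift: "comm_ring_hom (frob_lift q)"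
  unfolding frob_lift_def by (rule comm_ring_hom_zeval)

lemma frob_lift_ncong:
  assumes q: "Factorial_Ring.prime q"
  shows "ncong (frob_lift q P) (P ^ q) q"
proof (induction P rule: zpoly_induct)
  case zero
  show ?case using q by (simp add: frob_lift_def prime_gt_0_nat zero_power)
next
  case (monom m)
  have "frob_lift q (Poly_Mapping.single m 1) = (meval zvar m) ^ q"
    unfolding frob_lift_def zeval_single meval_def
    by (simp add: prod_power_distrib power_mult [symmetric] mult.commute)
  thus ?case by (simp add: meval_zvar)
next
  case (diff a b)
  have "ncong (((a - b) + b) ^ q) ((a - b) ^ q + b ^ q) q" by (rule ncong_freshmans_dream[OF q])
  hence "ncong (a ^ q - b ^ q) ((a - b) ^ q) q"
    unfolding ncong_def by (simp add: algebra_simps)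
  moreover have "ncong (frob_lift q (a - b)) (a ^ q - b ^ q) q"
    unfolding frob_lift_def zeval_diff using diff unfolding frob_lift_def by (intro ncong_diff)
  ultimately show ?case by (rule ncong_trans[rotated])
qed

lemma ghost_hom:
  assumes "comm_ring_hom h"
  shows "h (ghost n x) = ghost n (\<lambda>d. h (x d))"
proof -
  interpret comm_ring_hom h by fact
  show ?thesis by (simp add: ghost_def hom_distribs)
qed

lemma ghost_cong:
  assumes "\<And>d. d dvd n \<Longrightarrow> x d = y d"
  shows "ghost n x = ghost n y"
  unfolding ghost_def by (rule sum.cong) (use assms in auto)

lemma ghost_split:
  assumes "n > 0"
  shows "ghost n x = of_nat n * x n + (\<Sum>d | d dvd n \<and> d < n. of_nat d * x d ^ (n div d))"
proof -
  have "{d. d dvd n} = insert n {d. d dvd n \<and> d < n}"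
    using assms by (auto dest: dvd_imp_le)
  thus ?thesis using assms by (simp add: ghost_def)
qed

definition divisor_closed :: "nat set \<Rightarrow> bool" where
  "divisor_closed S \<longleftrightarrow> (\<forall>n\<in>S. n > 0 \<and> (\<forall>d. d dvd n \<longrightarrow> d \<in> S))"

lemma divisor_closed_positive: "divisor_closed {0<..}"
  by (auto simp: divisor_closed_def intro: Nat.gr0I)

lemma divisor_closed_divisors: "n > 0 \<Longrightarrow> divisor_closed {d. d dvd n}"
  by (auto simp: divisor_closed_def intro: Nat.gr0I dvd_trans)

text \<open>The component of index \<open>n\<close> enters the ghost component of index \<open>n\<close> linearly with coefficient \<open>n\<close>,
  so the components are recovered one after the other.\<close>

lemma ghost_inj:
  fixes x y :: "nat \<Rightarrow> 'a::comm_ring_1"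
  assumes tf: "torsion_free TYPE('a)" and S: "divisor_closed S"
    and eq: "\<And>n. n \<in> S \<Longrightarrow> ghost n x = ghost n y"
  shows "n \<in> S \<Longrightarrow> x n = y n"
proof (induction n rule: less_induct)
  case (less n)
  have n: "n > 0" "\<And>d. d dvd n \<Longrightarrow> d \<in> S" using S less.prems by (auto simp: divisor_closed_def)
  have "(\<Sum>d | d dvd n \<and> d < n. of_nat d * x d ^ (n div d)) = (\<Sum>d | d dvd n \<and>
      d < n. of_nat d * y d ^ (n div d))"
    by (rule sum.cong) (use less.IH n in auto)
  with eq[OF less.prems] have "of_nat n * x n = of_nat n * y n"
    unfolding ghost_split[OF n(1)] by simp
  thus ?case by (rule torsion_freeD[OF tf n(1)])
qed

lemma prime_power_dvd_cofactor:
  fixes q :: nat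
  assumes q: "Factorial_Ring.prime q" and n: "q ^ a dvd d * e" "\<not> q dvd e"
  shows "q ^ a dvd d"
proof -
  have "coprime (q ^ a) e" using q n(2) by (simp add: prime_imp_coprime)
  thus ?thesis using n(1) by (simp add: coprime_dvd_mult_left_iff)
qed

text \<open>The easy half of Dwork's criterion.  Divisors of \<open>n\<close> that do not divide \<open>n / q\<close> carry the
  full power of \<open>q\<close>; for the others the lift of Frobenius may be replaced by the \<open>q\<close>-th power,
  with the gain of \<open>q\<close>-divisibility from \<open>ncong_prime_power\<close>.\<close>

lemma ghost_ncong:
  fixes S :: "nat \<Rightarrow> 'v zpoly"
  assumes q: "Factorial_Ring.prime q" and n: "n > 0" "q ^ Suc a dvd n"
  shows "ncong (ghost n S) (frob_lift q (ghost (n div q) S)) (q ^ Suc a)"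
proof -
  interpret fr: comm_ring_hom "frob_lift q :: 'v zpoly \<Rightarrow> 'v zpoly" by (rule comm_ring_hom_frob_lift)
  have q0: "q > 0" using q by (rule prime_gt_0_nat)
  have "q dvd n" using n(2) by (auto dest: dvd_mult_left)
  then obtain n' where n': "n = q * n'" by auto
  have n'0: "n' > 0" using n' n by auto
  have ndiv: "n div q = n'" using n' q0 by simp
  let ?A = "{d. d dvd n'}" and ?B = "{d. d dvd n \<and> \<not> d dvd n'}"
  have fin: "finite ?A" "finite ?B" using n n'0 by auto
  have "{d. d dvd n} = ?A \<union> ?B" using n' by auto
  hence "ghost n S = (\<Sum>d\<in>?A. of_nat d * S d ^ (n div d)) + (\<Sum>d\<in>?B. of_nat d * S d ^ (n div d))"
    unfolding ghost_def using fin by (subst sum.union_disjoint [symmetric]) auto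
  moreover have "ncong (\<Sum>d\<in>?B. of_nat d * S d ^ (n div d)) (\<Sum>d\<in>?B. 0) (q ^ Suc a)"
  proof (rule ncong_sum)
    fix d assume d: "d \<in> ?B"
    then obtain e where e: "n = d * e" by auto
    have "\<not> q dvd e"
    proof
      assume "q dvd e"
      then obtain e' where "e = q * e'" by auto
      hence "q * n' = q * (d * e')" using e n' by (simp add: mult_ac)
      hence "n' = d * e'" using q0 by simp
      thus False using d by auto
    qed
    with e n(2) q have "q ^ Suc a dvd d" by (metis prime_power_dvd_cofactor)
    thus "ncong (of_nat d * S d ^ (n div d)) 0 (q ^ Suc a)" by (rule ncong_zero_mult)
  qed
  moreover have "ncong (\<Sum>d\<in>?A. of_nat d * S d ^ (n div d)) (\<Sum>d\<in>?A. of_nat d * frob_lift q (S d) ^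
      (n' div d)) (q ^ Suc a)"
  proof (rule ncong_sum)
    fix d assume "d \<in> ?A"
    then obtain e where e: "n' = d * e" by auto
    have d0: "d > 0" "e > 0" using e n'0 by auto
    have nd: "n div d = q * e" "n' div d = e" using e n' d0 by simp_all
    obtain b u where bu: "e = q ^ b * u" "\<not> q dvd u"
      by (rule split_prime_power[OF q d0(2)])
    have "ncong ((S d ^ q) ^ (q ^ b)) (frob_lift q (S d) ^ (q ^ b)) (q ^ Suc b)"
      by (rule ncong_prime_power[OF q ncong_sym[OF frob_lift_ncong[OF q]]])
    hence "ncong (((S d ^ q) ^ (q ^ b)) ^ u) ((frob_lift q (S d) ^ (q ^ b)) ^ u) (q ^ Suc b)"
      by (rule ncong_power)
    hence "ncong (S d ^ (q * e)) (frob_lift q (S d) ^ e) (q ^ Suc b)"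
      by (simp only: bu(1) power_mult)
    hence "ncong (of_nat d * S d ^ (q * e)) (of_nat d * frob_lift q (S d) ^ e) (d * q ^ Suc b)"
      by (rule ncong_scale)
    moreover have "q ^ Suc a dvd d * q ^ Suc b"
    proof -
      have "n = d * q ^ Suc b * u" using n' e bu(1) by (simp add: mult_ac)
      thus ?thesis using n(2) bu(2) q by (metis prime_power_dvd_cofactor)
    qed
    ultimately show "ncong (of_nat d * S d ^ (n div d)) (of_nat d * frob_lift q (S d) ^ (n' div d))
        (q ^ Suc a)"
      unfolding nd by (rule ncong_dvd)
  qed
  ultimately have "ncong (ghost n S) ((\<Sum>d\<in>?A. of_nat d * frob_lift q (S d) ^ (n' div d)) + (\<Sum>d\<in>?B.
      0)) (q ^ Suc a)"
    by (simp only: ncong_add)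
  thus ?thesis unfolding ndiv by (simp add: ghost_def fr.hom_sum fr.hom_mult fr.hom_power fr.hom_of_nat)
qed

text \<open>Dwork's congruences.  They are stable under sums, products, negation and dilation of the
  index, which is how the sequences that define addition, multiplication
      and Frobenius are seen to satisfy them.\<close>

definition ghostlike :: "(nat \<Rightarrow> 'v zpoly) \<Rightarrow> bool" where
  "ghostlike g \<longleftrightarrow> (\<forall>q a n. Factorial_Ring.prime q \<longrightarrow> n > 0 \<longrightarrow> q ^ Suc a dvd n \<longrightarrow>
     ncong (g n) (frob_lift q (g (n div q))) (q ^ Suc a))"

lemma ghostlike_ghost: "ghostlike (\<lambda>n. ghost n S)"
  unfolding ghostlike_def using ghost_ncong by blast

lemma ghostlike_add: "ghostlike f \<Longrightarrow> ghostlike g \<Longrightarrow> ghostlike (\<lambda>n. f n + g n)"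
  unfolding ghostlike_def frob_lift_def zeval_add by (blast intro: ncong_add)

lemma ghostlike_mult: "ghostlike f \<Longrightarrow> ghostlike g \<Longrightarrow> ghostlike (\<lambda>n. f n * g n)"
  unfolding ghostlike_def frob_lift_def zeval_mult by (blast intro: ncong_mult)

lemma ghostlike_minus:
  assumes "ghostlike g" shows "ghostlike (\<lambda>n. - g n)"
proof -
  have "ncong 0 0 m" for m by simp
  hence "ncong (0 - g n) (frob_lift q (0 - g (n div q))) (q ^ Suc a)"
    if "Factorial_Ring.prime q" "n > 0" "q ^ Suc a dvd n" for q n a
    using assms that unfolding ghostlike_def frob_lift_def zeval_diff zeval_0
        by (blast intro: ncong_diff)
  thus ?thesis unfolding ghostlike_def by simp
qed

lemma ghostlike_dilate:
  assumes "ghostlike g" "k > 0" shows "ghostlike (\<lambda>n. g (n * k))"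
  unfolding ghostlike_def
proof (intro allI impI)
  fix q a n :: nat assume h: "Factorial_Ring.prime q" "n > 0" "q ^ Suc a dvd n"
  have "q dvd n" using h(3) by (auto dest: dvd_mult_left)
  hence "(n * k) div q = (n div q) * k" by (simp add: div_mult_swap mult.commute)
  moreover have "q ^ Suc a dvd n * k" using h(3) by (rule dvd_mult2)
  ultimately show "ncong (g (n * k)) (frob_lift q (g (n div q * k))) (q ^ Suc a)"
    using assms h unfolding ghostlike_def by (metis nat_0_less_mult_iff)
qed

text \<open>Solves the ghost equations one index at a time; Dwork's congruences guarantee that the division by
  \<open>n\<close> in the choice is possible.\<close>

function witt_rec :: "(nat \<Rightarrow> 'v zpoly) \<Rightarrow> nat \<Rightarrow> 'v zpoly" where
  "witt_rec g n = (if n = 0 then 0 else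
     (SOME s. of_nat n * s = g n - (\<Sum>d | d dvd n \<and> d < n. of_nat d * witt_rec g d ^ (n div d))))"
  by auto
termination by (relation "measure snd") auto

declare witt_rec.simps [simp del]

text \<open>Dwork's criterion: a sequence of polynomials is the sequence of ghost components of a Witt
  vector as soon as it satisfies the congruences that every such sequence satisfies.\<close>

lemma ghost_witt_rec:
  assumes g: "ghostlike g"
  shows "n > 0 \<Longrightarrow> ghost n (witt_rec g) = g n"
proof (induction n rule: less_induct)
  case (less n)
  let ?R = "\<Sum>d | d dvd n \<and> d < n. of_nat d * witt_rec g d ^ (n div d)"
  have "of_nat n dvd g n - ?R"
  proof (rule of_nat_dvd_if_prime_powers[OF less.prems])
    fix q a assume q: "Factorial_Ring.prime q" and qa: "q ^ Suc a dvd n"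
    have "q > 1" using q by (rule prime_gt_1_nat)
    moreover have "q dvd n" using qa by (auto dest: dvd_mult_left)
    ultimately have "n div q < n" "n div q > 0" using less.prems by (auto elim!: dvdE)
    hence IH: "ghost (n div q) (witt_rec g) = g (n div q)" by (rule less.IH)
    have 1: "ncong (ghost n (witt_rec g)) (frob_lift q (g (n div q))) (q ^ Suc a)"
      using ghost_ncong[OF q less.prems qa, of "witt_rec g"] by (simp only: IH)
    have 2: "ncong (g n) (frob_lift q (g (n div q))) (q ^ Suc a)"
      using g q less.prems qa unfolding ghostlike_def by blast
    have 3: "ncong (of_nat n * witt_rec g n) 0 (q ^ Suc a)" by (rule ncong_zero_mult[OF qa])
    have "ncong (g n) (ghost n (witt_rec g) - of_nat n * witt_rec g n) (q ^ Suc a)"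
      using ncong_diff[OF ncong_trans[OF 2 ncong_sym[OF 1]] ncong_sym[OF 3]] by simp
    thus "of_nat (q ^ Suc a) dvd g n - ?R"
      unfolding ncong_def ghost_split[OF less.prems] by simp
  qed
  hence "\<exists>s. of_nat n * s = g n - ?R" by (auto elim!: dvdE)
  hence "of_nat n * (SOME s. of_nat n * s = g n - ?R) = g n - ?R" by (rule someI_ex)
  moreover have "witt_rec g n = (SOME s. of_nat n * s = g n - ?R)"
    using less.prems by (subst witt_rec.simps) simp
  ultimately have "of_nat n * witt_rec g n = g n - ?R" by simp
  thus ?case unfolding ghost_split[OF less.prems] by simp
qed

lemma ghost_witt_solve:
  assumes g: "ghostlike g" and n: "n > 0"
  shows "ghost n (witt_solve g) = g n"
proof -
  have "witt_solve g 0 = 0 \<and> (\<forall>n>0. ghost n (witt_solve g) = g n)"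
    unfolding witt_solve_def
  proof (rule theI'[where P = "\<lambda>S. S 0 = 0 \<and> (\<forall>n>0. ghost n S = g n)"])
    show "\<exists>!S. S 0 = 0 \<and> (\<forall>n>0. ghost n S = g n)"
    proof (rule ex_ex1I)
      show "\<exists>S. S 0 = 0 \<and> (\<forall>n>0. ghost n S = g n)"
        by (rule exI[of _ "witt_rec g"]) (use ghost_witt_rec[OF g] in \<open>simp add: witt_rec.simps\<close>)
    next
      fix S S' assume S: "S 0 = 0 \<and> (\<forall>n>0. ghost n S = g n)" and S': "S' 0 = 0 \<and> (\<forall>n>0. ghost n S'
          = g n)"
      have "S n = S' n" for n
      proof (cases "n = 0")
        case False
        show ?thesis
          by (rule ghost_inj[OF torsion_free_zpoly divisor_closed_positive]) (use S S' False in auto)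
      qed (use S S' in simp)
      thus "S = S'" by blast
    qed
  qed
  thus ?thesis using n by blast
qed

section \<open>Witt vector arithmetic over an arbitrary ring\<close>

text \<open>From here on a Witt vector is any sequence, read at positive indices; extensionality on an index
  set enters only with the rings.\<close>

definition wadd :: "(nat \<Rightarrow> 'a::comm_ring_1) \<Rightarrow> (nat \<Rightarrow> 'a) \<Rightarrow> nat \<Rightarrow> 'a" where
  "wadd x y n = poly_eval (case_sum x y) (witt_add_poly n)"

definition wmult :: "(nat \<Rightarrow> 'a::comm_ring_1) \<Rightarrow> (nat \<Rightarrow> 'a) \<Rightarrow> nat \<Rightarrow> 'a" where
  "wmult x y n = poly_eval (case_sum x y) (witt_mult_poly n)"

definition wneg :: "(nat \<Rightarrow> 'a::comm_ring_1) \<Rightarrow> nat \<Rightarrow> 'a" where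
  "wneg x n = poly_eval (case_sum x x) (witt_solve (\<lambda>n. - ghost n (poly_var \<circ> Inl)) n)"

definition wfrob :: "nat \<Rightarrow> (nat \<Rightarrow> 'a::comm_ring_1) \<Rightarrow> nat \<Rightarrow> 'a" where
  "wfrob k x n = poly_eval (case_sum x x) (witt_frob_poly k n)"

definition wver :: "nat \<Rightarrow> (nat \<Rightarrow> 'a::comm_ring_1) \<Rightarrow> nat \<Rightarrow> 'a" where
  "wver k x n = (if k dvd n then x (n div k) else 0)"

definition wteich :: "'a::comm_ring_1 \<Rightarrow> nat \<Rightarrow> 'a" where
  "wteich a n = (if n = 1 then a else 0)"

lemma ghost_poly_eval_solve:
  assumes "ghostlike g" "n > 0"
  shows "ghost n (\<lambda>m. poly_eval f (witt_solve g m)) = zeval f (g n)"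
  using ghost_witt_solve[OF assms] ghost_hom[OF comm_ring_hom_zeval, of f n "witt_solve g"]
  by (simp add: poly_eval_eq_zeval)

lemma zeval_ghost_var:
  "zeval (case_sum x y) (ghost n (poly_var \<circ> Inl)) = ghost n x"
  "zeval (case_sum x y) (ghost n (poly_var \<circ> Inr)) = ghost n y"
  by (simp_all add: ghost_hom[OF comm_ring_hom_zeval] poly_var_eq_zvar)

lemma ghost_wadd: "n > 0 \<Longrightarrow> ghost n (wadd x y) = ghost n x + ghost n y"
  unfolding wadd_def[abs_def] witt_add_poly_def
  by (subst ghost_poly_eval_solve) (simp_all add: ghostlike_ghost ghostlike_add zeval_add
      zeval_ghost_var)

lemma ghost_wmult: "n > 0 \<Longrightarrow> ghost n (wmult x y) = ghost n x * ghost n y"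
  unfolding wmult_def[abs_def] witt_mult_poly_def
  by (subst ghost_poly_eval_solve) (simp_all add: ghostlike_ghost ghostlike_mult zeval_mult
      zeval_ghost_var)

lemma ghost_wneg: "n > 0 \<Longrightarrow> ghost n (wneg x) = - ghost n x"
  unfolding wneg_def[abs_def]
  by (subst ghost_poly_eval_solve)
     (simp_all add: ghostlike_ghost ghostlike_minus zeval_ghost_var zeval_diff[of _ 0, simplified])

lemma ghost_wfrob: "n > 0 \<Longrightarrow> k > 0 \<Longrightarrow> ghost n (wfrob k x) = ghost (n * k) x"
  unfolding wfrob_def[abs_def] witt_frob_poly_def
  by (subst ghost_poly_eval_solve) (simp_all add: ghostlike_dilate[OF ghostlike_ghost] zeval_ghost_var)

lemma ghost_zero: "n > 0 \<Longrightarrow> ghost n (\<lambda>_. 0) = 0"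
  unfolding ghost_def by (rule sum.neutral) (auto elim!: dvdE simp: zero_power)

lemma ghost_wteich: "n > 0 \<Longrightarrow> ghost n (wteich a) = a ^ n"
proof -
  assume "n > 0"
  have "ghost n (wteich a) = (\<Sum>d\<in>{1}. of_nat d * wteich a d ^ (n div d))"
    unfolding ghost_def
    by (rule sum.mono_neutral_right)
       (use \<open>n > 0\<close> in \<open>auto simp: wteich_def zero_power div_greater_zero_iff dvd_imp_le intro!:
           zero_power\<close>)
  thus ?thesis by (simp add: wteich_def)
qed

lemma ghost_wver:
  assumes "n > 0" "k > 0"
  shows "ghost n (wver k x) = (if k dvd n then of_nat k * ghost (n div k) x else 0)"
proof -
  have pos: "n div d > 0" if "d dvd n" for d using that assms(1) by (auto elim!: dvdE)
  have "ghost n (wver k x) = (\<Sum>d | d dvd n \<and> k dvd d. of_nat d * x (d div k) ^ (n div d))"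
    unfolding ghost_def
    by (rule sum.mono_neutral_cong_right) (use assms pos in \<open>auto simp: wver_def zero_power\<close>)
  also have "\<dots> = (if k dvd n then of_nat k * ghost (n div k) x else 0)"
  proof (cases "k dvd n")
    case True
    then obtain m where m: "n = k * m" by auto
    have "(\<Sum>d | d dvd n \<and> k dvd d. of_nat d * x (d div k) ^ (n div d))
        = (\<Sum>e | e dvd m. of_nat (k * e) * x e ^ (m div e))"
      by (rule sum.reindex_bij_witness[of _ "\<lambda>e. k * e" "\<lambda>d. d div k"])
         (use assms m in \<open>auto elim!: dvdE\<close>)
    thus ?thesis using m assms by (simp add: ghost_def sum_distrib_left mult_ac)
  next
    case False
    hence "{d. d dvd n \<and> k dvd d} = {}" by (auto dest: dvd_trans)
    thus ?thesis using False by (simp only: if_False sum.empty)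
  qed
  finally show ?thesis .
qed

section \<open>Identities between Witt vectors\<close>

lemma map_poly_eval:
  assumes "comm_ring_hom h"
  shows "h (poly_eval f P) = poly_eval (\<lambda>v. h (f v)) P"
  unfolding poly_eval_eq_zeval by (rule zeval_hom[OF assms])

lemma case_sum_hom: "h (case_sum x y v) = case_sum (\<lambda>n. h (x n)) (\<lambda>n. h (y n)) v"
  by (cases v) auto

lemma
  assumes "comm_ring_hom h"
  shows map_wadd: "h (wadd x y n) = wadd (\<lambda>n. h (x n)) (\<lambda>n. h (y n)) n"
    and map_wmult: "h (wmult x y n) = wmult (\<lambda>n. h (x n)) (\<lambda>n. h (y n)) n"
    and map_wneg: "h (wneg x n) = wneg (\<lambda>n. h (x n)) n"
    and map_wfrob: "h (wfrob k x n) = wfrob k (\<lambda>n. h (x n)) n"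
  unfolding wadd_def wmult_def wneg_def wfrob_def
  by (simp_all add: map_poly_eval[OF assms] case_sum_hom[of h])

lemma map_wver:
  assumes "comm_ring_hom h" shows "h (wver k x n) = wver k (\<lambda>n. h (x n)) n"
proof -
  interpret comm_ring_hom h by fact
  show ?thesis by (simp add: wver_def)
qed

lemma wfun_cong:
  assumes n: "n > 0" and x: "\<And>d. d dvd n \<Longrightarrow> x d = x' d" and y: "\<And>d. d dvd n \<Longrightarrow> y d = y' d"
  shows wadd_cong: "wadd x y n = wadd x' y' n"
    and wmult_cong: "wmult x y n = wmult x' y' n"
proof -
  let ?h = "zeval (\<lambda>a. a) :: 'a zpoly \<Rightarrow> 'a"
  have h: "comm_ring_hom ?h" by (rule comm_ring_hom_zeval)
  have g: "ghost d (\<lambda>n. zvar (x n)) = ghost d (\<lambda>n. zvar (x' n))"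
    "ghost d (\<lambda>n. zvar (y n)) = ghost d (\<lambda>n. zvar (y' n))" if "d dvd n" for d
    by (rule ghost_cong; use that x y in \<open>auto intro: dvd_trans\<close>)+
  have d0: "d > 0" if "d dvd n" for d using that n by (auto intro: Nat.gr0I)
  note inj = ghost_inj[OF torsion_free_zpoly divisor_closed_divisors[OF n]]
  have "wadd (\<lambda>n. zvar (x n)) (\<lambda>n. zvar (y n)) n = wadd (\<lambda>n. zvar (x' n)) (\<lambda>n. zvar (y' n)) n"
    by (rule inj) (use g d0 in \<open>auto simp: ghost_wadd\<close>)
  from arg_cong[OF this, of ?h] show "wadd x y n = wadd x' y' n" by (simp add: map_wadd[OF h])
  have "wmult (\<lambda>n. zvar (x n)) (\<lambda>n. zvar (y n)) n = wmult (\<lambda>n. zvar (x' n)) (\<lambda>n. zvar (y' n)) n"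
    by (rule inj) (use g d0 in \<open>auto simp: ghost_wmult\<close>)
  from arg_cong[OF this, of ?h] show "wmult x y n = wmult x' y' n" by (simp add: map_wmult[OF h])
qed

text \<open>Every commutative ring is a quotient of a torsion-free one, namely of the polynomial ring on its
  elements.  An identity between Witt vectors therefore only has to be checked on the ghost
  components of universal polynomials, here \<open>L\<close> and \<open>R\<close>.\<close>

lemma witt_transfer:
  assumes S: "divisor_closed S" and "\<And>n. n \<in> S \<Longrightarrow> ghost n L = ghost n R" "n \<in> S"
  shows "zeval (\<lambda>a. a) (L n) = zeval (\<lambda>a. a) (R n)"
  by (rule arg_cong[OF ghost_inj[OF torsion_free_zpoly S]]) (use assms in auto)

lemmas witt_transfer_pos = witt_transfer[OF divisor_closed_positive, simplified greaterThan_iff]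

lemmas map_witt_zeval =
  map_wadd[OF comm_ring_hom_zeval] map_wmult[OF comm_ring_hom_zeval] map_wneg[OF comm_ring_hom_zeval]
  map_wfrob[OF comm_ring_hom_zeval] map_wver[OF comm_ring_hom_zeval]

lemma map_wteich_zeval: "zeval f (wteich a n) = wteich (zeval f a) n"
  by (simp add: wteich_def)

lemmas ghost_witt = ghost_wadd ghost_wmult ghost_wneg ghost_wfrob ghost_wteich ghost_zero ghost_wver

abbreviation (input) wvar :: "(nat \<Rightarrow> 'a) \<Rightarrow> nat \<Rightarrow> 'a zpoly" where
  "wvar x \<equiv> \<lambda>n. zvar (x n)"

context
  fixes x y z :: "nat \<Rightarrow> 'a::comm_ring_1" and n :: nat
  assumes n: "n > 0"
begin

lemma wadd_comm: "wadd x y n = wadd y x n"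
  using witt_transfer_pos[of "wadd (wvar x) (wvar y)" "wadd (wvar y) (wvar x)" n] n by
      (simp add: map_witt_zeval ghost_witt add.commute)

lemma wadd_assoc: "wadd (wadd x y) z n = wadd x (wadd y z) n"
  using witt_transfer_pos[of "wadd (wadd (wvar x) (wvar y)) (wvar z)"
      "wadd (wvar x) (wadd (wvar y) (wvar z))" n] n
  by (simp add: map_witt_zeval ghost_witt add.assoc)

lemma wadd_zero: "wadd (\<lambda>_. 0) x n = x n"
  using witt_transfer_pos[of "wadd (\<lambda>_. 0) (wvar x)" "wvar x" n] n by
      (simp add: map_witt_zeval ghost_witt)

lemma wadd_neg: "wadd (wneg x) x n = 0"
  using witt_transfer_pos[of "wadd (wneg (wvar x)) (wvar x)" "\<lambda>_. 0" n] n by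
      (simp add: map_witt_zeval ghost_witt)

lemma wmult_comm: "wmult x y n = wmult y x n"
  using witt_transfer_pos[of "wmult (wvar x) (wvar y)" "wmult (wvar y) (wvar x)" n] n by
      (simp add: map_witt_zeval ghost_witt mult.commute)

lemma wmult_assoc: "wmult (wmult x y) z n = wmult x (wmult y z) n"
  using witt_transfer_pos[of "wmult (wmult (wvar x) (wvar y)) (wvar z)"
      "wmult (wvar x) (wmult (wvar y) (wvar z))" n] n
  by (simp add: map_witt_zeval ghost_witt mult.assoc)

lemma wmult_one: "wmult (wteich 1) x n = x n"
  using witt_transfer_pos[of "wmult (wteich 1) (wvar x)" "wvar x" n] n
  by (simp add: map_witt_zeval ghost_witt map_wteich_zeval)

lemma wmult_distrib: "wmult (wadd x y) z n = wadd (wmult x z) (wmult y z) n"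
  using witt_transfer_pos[of "wmult (wadd (wvar x) (wvar y)) (wvar z)"
      "wadd (wmult (wvar x) (wvar z)) (wmult (wvar y) (wvar z))" n] n
  by (simp add: map_witt_zeval ghost_witt distrib_right)

lemma wfrob_wadd: "k > 0 \<Longrightarrow> wfrob k (wadd x y) n = wadd (wfrob k x) (wfrob k y) n"
  using witt_transfer_pos[of "wfrob k (wadd (wvar x) (wvar y))"
      "wadd (wfrob k (wvar x)) (wfrob k (wvar y))" n] n
  by (simp add: map_witt_zeval ghost_witt)

lemma wfrob_wmult: "k > 0 \<Longrightarrow> wfrob k (wmult x y) n = wmult (wfrob k x) (wfrob k y) n"
  using witt_transfer_pos[of "wfrob k (wmult (wvar x) (wvar y))"
      "wmult (wfrob k (wvar x)) (wfrob k (wvar y))" n] n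
  by (simp add: map_witt_zeval ghost_witt)

lemma wfrob_wfrob: "k > 0 \<Longrightarrow> l > 0 \<Longrightarrow> wfrob k (wfrob l x) n = wfrob (k * l) x n"
  using witt_transfer_pos[of "wfrob k (wfrob l (wvar x))" "wfrob (k * l) (wvar x)" n] n
  by (simp add: map_witt_zeval ghost_witt mult.assoc)

lemma wfrob_wteich: "k > 0 \<Longrightarrow> wfrob k (wteich a) n = wteich (a ^ k) n"
  using witt_transfer_pos[of "wfrob k (wteich (zvar a))" "wteich (zvar a ^ k)" n] n
  by (simp add: map_witt_zeval ghost_witt map_wteich_zeval power_mult [symmetric] mult.commute
      zeval_power)

lemma wmult_wteich: "wmult (wteich a) (wteich b) n = wteich (a * b) n"
  using witt_transfer_pos[of "wmult (wteich (zvar a)) (wteich (zvar b))" "wteich (zvar a * zvar b)" n] n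
  by (simp add: map_witt_zeval ghost_witt map_wteich_zeval power_mult_distrib zeval_mult)

lemma wver_wadd: "k > 0 \<Longrightarrow> wver k (wadd x y) n = wadd (wver k x) (wver k y) n"
  using witt_transfer_pos[of "wver k (wadd (wvar x) (wvar y))"
      "wadd (wver k (wvar x)) (wver k (wvar y))" n] n
  by (simp add: map_witt_zeval ghost_witt distrib_left div_greater_zero_iff dvd_imp_le)

end

fun wmultiple :: "nat \<Rightarrow> (nat \<Rightarrow> 'a::comm_ring_1) \<Rightarrow> nat \<Rightarrow> 'a" where
  "wmultiple 0 x = (\<lambda>_. 0)"
| "wmultiple (Suc k) x = wadd (wmultiple k x) x"

lemma ghost_wmultiple: "n > 0 \<Longrightarrow> ghost n (wmultiple k x) = of_nat k * ghost n x"
  by (induction k) (simp_all add: ghost_witt distrib_right)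

lemma map_wmultiple:
  assumes "comm_ring_hom h"
  shows "h (wmultiple k x n) = wmultiple k (\<lambda>n. h (x n)) n"
proof -
  interpret comm_ring_hom h by fact
  show ?thesis
    by (induction k arbitrary: n) (simp_all add: map_wadd[OF assms])
qed

lemma divisor_closed_p_powers:
  assumes "Factorial_Ring.prime p" shows "divisor_closed (p_powers p)"
  using assms unfolding divisor_closed_def p_powers_def
  by (auto simp: prime_gt_0_nat dvd_power_iff_le divides_primepow_nat)

text \<open>Composing \<open>V\<^sub>k\<close> with \<open>F\<^sub>m\<close> for \<open>k\<close> prime to \<open>p\<close> and restricting to \<open>p\<close>-powers keeps only the
  Frobenius of the quotient \<open>m / k\<close>, because \<open>k\<close> divides \<open>m p\<^sup>j\<close> exactly when it divides \<open>m\<close>.\<close>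

lemma wfrob_wver_p_powers:
  assumes p: "Factorial_Ring.prime p" and m: "m > 0" and k: "k > 0" "coprime k p"
    and n: "n \<in> p_powers p"
  shows "wfrob m (wver k x) n = (if k dvd m then wmultiple k (wfrob (m div k) x) n else 0)"
proof -
  let ?h = "zeval (\<lambda>a. a) :: 'a zpoly \<Rightarrow> 'a"
  let ?X = "\<lambda>n. zvar (x n)"
  let ?R = "if k dvd m then wmultiple k (wfrob (m div k) ?X) else (\<lambda>_. 0)"
  have "?h (wfrob m (wver k ?X) n) = ?h (?R n)"
  proof (rule witt_transfer[OF divisor_closed_p_powers[OF p] _ n])
    fix i assume i: "i \<in> p_powers p"
    hence i0: "i > 0" using divisor_closed_p_powers[OF p] by (auto simp: divisor_closed_def)
    have cop: "coprime k i" using i k(2) by (auto simp: p_powers_def)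
    hence dv: "k dvd i * m \<longleftrightarrow> k dvd m" by (simp add: coprime_dvd_mult_right_iff)
    have "i * m div k = i * (m div k)" "m div k > 0" if "k dvd m"
      using that m by (auto simp: div_mult_swap elim!: dvdE)
    thus "ghost i (wfrob m (wver k ?X)) = ghost i ?R"
      using i0 m k dv by (simp add: ghost_witt ghost_wmultiple)
  qed
  thus ?thesis
    by (auto simp: map_witt_zeval map_wmultiple[OF comm_ring_hom_zeval])
qed

text \<open>The top component of \<open>F\<^sub>k x\<close> at \<open>n\<close> is \<open>k x\<^bsub>kn\<^esub>\<close> up to terms in lower components; this
  triangular shape inverts \<open>\<Theta>\<close>.\<close>

lemma wfrob_triangular:
  fixes x y :: "nat \<Rightarrow> 'a::comm_ring_1"
  assumes n: "n > 0" and k: "k > 0" and eq: "\<And>d. d dvd n * k \<Longrightarrow> d < n * k \<Longrightarrow> x d = y d"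
  shows "wfrob k x n - of_nat k * x (n * k) = wfrob k y n - of_nat k * y (n * k)"
proof -
  let ?h = "zeval (\<lambda>a. a) :: 'a zpoly \<Rightarrow> 'a"
  let ?X = "\<lambda>n. zvar (x n)" and ?Y = "\<lambda>n. zvar (y n)"
  have XY: "?X d = ?Y d" if "d dvd n * k" "d < n * k" for d using eq[OF that] by simp
  have lower: "wfrob k ?X d = wfrob k ?Y d" if d: "d dvd n" "d < n" for d
  proof (rule ghost_inj[OF torsion_free_zpoly divisor_closed_divisors])
    show "d > 0" using d n by (auto intro: Nat.gr0I)
    show "d \<in> {e. e dvd d}" by simp
    fix e assume "e \<in> {e. e dvd d}"
    hence ed: "e dvd d" by simp
    have "d > 0" using d n by (auto intro: Nat.gr0I)
    hence e: "e dvd n" "e < n" "e > 0" using d ed dvd_trans[OF ed d(1)] dvd_imp_le[OF ed]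
      by (auto intro: Nat.gr0I)
    have "ghost (e * k) ?X = ghost (e * k) ?Y"
    proof (rule ghost_cong)
      fix c assume c: "c dvd e * k"
      hence "c dvd n * k" using e(1) by (meson dvd_refl dvd_trans mult_dvd_mono)
      moreover have "c \<le> e * k" using c e k by (simp add: dvd_imp_le)
      ultimately show "?X c = ?Y c" using e k by (intro XY) (auto simp: le_less_trans)
    qed
    thus "ghost e (wfrob k ?X) = ghost e (wfrob k ?Y)" using e k by (simp add: ghost_wfrob)
  qed
  have nk: "n * k > 0" using n k by simp
  have expand: "of_nat n * (wfrob k u n - of_nat k * u (n * k))
      = (\<Sum>d | d dvd n * k \<and> d < n * k. of_nat d * u d ^ (n * k div d))
        - (\<Sum>d | d dvd n \<and> d < n. of_nat d * wfrob k u d ^ (n div d))"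
    for u :: "nat \<Rightarrow> 'a zpoly"
    using ghost_wfrob[OF n k, of u] unfolding ghost_split[OF n] ghost_split[OF nk]
    by (simp add: algebra_simps)
  have "(\<Sum>d | d dvd n \<and> d < n. of_nat d * wfrob k ?X d ^ (n div d)) = (\<Sum>d | d dvd n \<and>
      d < n. of_nat d * wfrob k ?Y d ^ (n div d))"
    by (rule sum.cong) (use lower in auto)
  moreover have "(\<Sum>d | d dvd n * k \<and> d < n * k. of_nat d * ?X d ^ (n * k div d)) = (\<Sum>d | d dvd n * k
      \<and> d < n * k. of_nat d * ?Y d ^ (n * k div d))"
    by (rule sum.cong) (use XY in auto)
  ultimately have "of_nat n * (wfrob k ?X n - of_nat k * ?X (n * k))
      = of_nat n * (wfrob k ?Y n - of_nat k * ?Y (n * k))"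
    using expand[of ?X] expand[of ?Y] by simp
  hence "wfrob k ?X n - of_nat k * ?X (n * k) = wfrob k ?Y n - of_nat k * ?Y (n * k)"
    by (rule torsion_freeD[OF torsion_free_zpoly n])
  from arg_cong[OF this, of ?h] show ?thesis
    by (simp add: map_witt_zeval zeval_diff zeval_mult zeval_of_nat)
qed

section \<open>Rings of Witt vectors\<close>

lemma wfrob_cong:
  assumes n: "n > 0" and k: "k > 0" and x: "\<And>d. d dvd n * k \<Longrightarrow> x d = y d"
  shows "wfrob k x n = wfrob k y n"
  using wfrob_triangular[OF n k, of x y] x by simp

lemma wneg_cong:
  assumes n: "n > 0" and x: "\<And>d. d dvd n \<Longrightarrow> x d = y d"
  shows "wneg x n = wneg y n"
proof -
  have pos: "d > 0" if "d dvd n" for d using that n by (auto intro: Nat.gr0I)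
  have z: "wadd (wneg y) y d = 0" "wadd (wneg x) x d = 0" if "d dvd n" for d
    using pos[OF that] by (rule wadd_neg)+
  have "wadd (wneg y) x d = 0" if d: "d dvd n" for d
    unfolding z(1)[OF d, symmetric]
    by (rule wadd_cong[OF pos[OF d] refl]) (use d x in \<open>blast intro: dvd_trans\<close>)
  hence z': "wadd x (wneg y) d = 0" if "d dvd n" for d
    using wadd_comm[OF pos[OF that], of x "wneg y"] that by simp
  have "wneg x n = wadd (wneg x) (\<lambda>_. 0) n" using n by (simp add: wadd_comm wadd_zero)
  also have "\<dots> = wadd (wneg x) (wadd x (wneg y)) n"
    by (rule wadd_cong[OF n]) (simp_all add: z')
  also have "\<dots> = wadd (wadd (wneg x) x) (wneg y) n" by (rule wadd_assoc[OF n, symmetric])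
  also have "\<dots> = wadd (\<lambda>_. 0) (wneg y) n"
    by (rule wadd_cong[OF n]) (simp_all add: z)
  also have "\<dots> = wneg y n" by (rule wadd_zero[OF n])
  finally show ?thesis .
qed

lemma carrier_witt: "carrier (witt_ring S) = S \<rightarrow>\<^sub>E UNIV"
  by (simp add: witt_ring_def)

lemma teichmueller_eq: "teichmueller S a = restrict (wteich a) S"
  by (auto simp: teichmueller_def wteich_def)

lemma witt_ops:
  "x \<oplus>\<^bsub>witt_ring S\<^esub> y = restrict (wadd x y) S"
  "x \<otimes>\<^bsub>witt_ring S\<^esub> y = restrict (wmult x y) S"
  "\<zero>\<^bsub>witt_ring S\<^esub> = restrict (\<lambda>_. 0) S"
  "\<one>\<^bsub>witt_ring S\<^esub> = restrict (wteich 1) S"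
  by (auto simp: witt_ring_def wadd_def[abs_def] wmult_def[abs_def] teichmueller_eq
      wteich_def[abs_def] restrict_def)

lemma restrict_witt [simp]: "restrict x S \<in> carrier (witt_ring S)"
  by (simp add: carrier_witt)

lemma witt_ext:
  assumes "x \<in> carrier (witt_ring S)" "y \<in> carrier (witt_ring S)" "\<And>n. n \<in> S \<Longrightarrow> x n = y n"
  shows "x = y"
  using assms by (auto simp: carrier_witt intro: PiE_ext)

lemma wfun_restrict:
  assumes "divisor_closed S" "n \<in> S"
  shows "wadd (restrict x S) y n = wadd x y n" "wadd x (restrict y S) n = wadd x y n"
    "wmult (restrict x S) y n = wmult x y n" "wmult x (restrict y S) n = wmult x y n"
    "wneg (restrict x S) n = wneg x n"
  using assms unfolding divisor_closed_def by (auto intro!: wadd_cong wmult_cong wneg_cong)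

text \<open>The component of index \<open>n\<close> of a sum or a product involves only divisors of \<open>n\<close>, so the laws for
  sequences survive the restriction to \<open>S\<close>.\<close>

lemma cring_witt:
  assumes S: "divisor_closed S"
  shows "cring (witt_ring S :: (nat \<Rightarrow> 'a::comm_ring_1) ring)"
proof -
  have S0: "n > 0" if "n \<in> S" for n using S that by (auto simp: divisor_closed_def)
  note simps = witt_ops wfun_restrict[OF S] S0
  show ?thesis
  proof (rule cringI)
    show "abelian_group (witt_ring S :: (nat \<Rightarrow> 'a) ring)"
    proof (rule abelian_groupI)
      fix x y z :: "nat \<Rightarrow> 'a"
      assume xyz: "x \<in> carrier (witt_ring S)" "y \<in> carrier (witt_ring S)" "z \<in> carrier (witt_ring S)"
      show "x \<oplus>\<^bsub>witt_ring S\<^esub> y \<oplus>\<^bsub>witt_ring S\<^esub> z = x \<oplus>\<^bsub>witt_ring S\<^esub> (y \<oplus>\<^bsub>witt_ring S\<^esub> z)"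
        by (rule witt_ext[of _ S]) (simp_all add: simps wadd_assoc)
    next
      fix x y :: "nat \<Rightarrow> 'a"
      show "x \<oplus>\<^bsub>witt_ring S\<^esub> y = y \<oplus>\<^bsub>witt_ring S\<^esub> x"
        by (rule witt_ext[of _ S]) (simp_all add: simps, simp add: S0 wadd_comm)
    next
      fix x :: "nat \<Rightarrow> 'a" assume x: "x \<in> carrier (witt_ring S)"
      show "\<zero>\<^bsub>witt_ring S\<^esub> \<oplus>\<^bsub>witt_ring S\<^esub> x = x"
        by (rule witt_ext[of _ S]) (use x in \<open>simp_all add: simps wadd_zero\<close>)
      show "\<exists>y\<in>carrier (witt_ring S). y \<oplus>\<^bsub>witt_ring S\<^esub> x = \<zero>\<^bsub>witt_ring S\<^esub>"
        by (rule bexI[of _ "restrict (wneg x) S"], rule witt_ext[of _ S]) (simp_all add: simps wadd_neg)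
    qed (simp_all add: witt_ops)
    show "comm_monoid (witt_ring S :: (nat \<Rightarrow> 'a) ring)"
    proof (rule comm_monoidI)
      fix x y z :: "nat \<Rightarrow> 'a"
      show "x \<otimes>\<^bsub>witt_ring S\<^esub> y \<otimes>\<^bsub>witt_ring S\<^esub> z = x \<otimes>\<^bsub>witt_ring S\<^esub> (y \<otimes>\<^bsub>witt_ring S\<^esub> z)"
        by (rule witt_ext[of _ S]) (simp_all add: simps wmult_assoc)
      show "x \<otimes>\<^bsub>witt_ring S\<^esub> y = y \<otimes>\<^bsub>witt_ring S\<^esub> x"
        by (rule witt_ext[of _ S]) (simp_all add: simps, simp add: S0 wmult_comm)
    next
      fix x :: "nat \<Rightarrow> 'a" assume x: "x \<in> carrier (witt_ring S)"
      show "\<one>\<^bsub>witt_ring S\<^esub> \<otimes>\<^bsub>witt_ring S\<^esub> x = x"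
        by (rule witt_ext[of _ S]) (use x in \<open>simp_all add: simps wmult_one\<close>)
    qed (simp_all add: witt_ops)
    fix x y z :: "nat \<Rightarrow> 'a"
    show "(x \<oplus>\<^bsub>witt_ring S\<^esub> y) \<otimes>\<^bsub>witt_ring S\<^esub> z = x \<otimes>\<^bsub>witt_ring S\<^esub> z \<oplus>\<^bsub>witt_ring S\<^esub> y \<otimes>\<^bsub>witt_ring S\<^esub> z"
      by (rule witt_ext[of _ S]) (simp_all add: simps wmult_distrib)
  qed
qed

lemma ring_hom_restrict_witt:
  assumes "divisor_closed S" "S \<subseteq> T"
  shows "(\<lambda>x. restrict x S) \<in> ring_hom (witt_ring T) (witt_ring S)"
proof (rule ring_hom_memI)
  fix x y :: "nat \<Rightarrow> 'a"
  have T: "n \<in> T" if "n \<in> S" for n using that assms by auto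
  have TS: "T \<inter> S = S" using assms by auto
  show "restrict (x \<otimes>\<^bsub>witt_ring T\<^esub> y) S = restrict x S \<otimes>\<^bsub>witt_ring S\<^esub> restrict y S"
    by (rule witt_ext[of _ S]) (simp_all add: witt_ops wfun_restrict assms T TS)
  show "restrict (x \<oplus>\<^bsub>witt_ring T\<^esub> y) S = restrict x S \<oplus>\<^bsub>witt_ring S\<^esub> restrict y S"
    by (rule witt_ext[of _ S]) (simp_all add: witt_ops wfun_restrict assms T TS)
  show "restrict \<one>\<^bsub>witt_ring T\<^esub> S = \<one>\<^bsub>witt_ring S\<^esub>"
    by (rule witt_ext[of _ S]) (simp_all add: witt_ops T TS)
qed simp

lemma cring_big_witt: "cring (big_witt :: (nat \<Rightarrow> 'a::comm_ring_1) ring)"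
  by (rule cring_witt[OF divisor_closed_positive])

lemma witt_F_eq: "witt_F k x = restrict (wfrob k x) {0<..}"
  by (simp add: witt_F_def wfrob_def[abs_def])

lemma wfrob_restrict: "n > 0 \<Longrightarrow> k > 0 \<Longrightarrow> wfrob k (restrict x {0<..}) n = wfrob k x n"
  by (rule wfrob_cong) (auto intro: Nat.gr0I)

lemma witt_F_closed [simp]: "witt_F k x \<in> carrier big_witt"
  by (simp add: witt_F_eq)

lemma ring_hom_witt_F:
  assumes k: "k > 0"
  shows "witt_F k \<in> ring_hom big_witt big_witt"
proof (rule ring_hom_memI)
  fix x y :: "nat \<Rightarrow> 'a"
  note simps = witt_ops witt_F_eq wfun_restrict[OF divisor_closed_positive] wfrob_restrict k
  show "witt_F k (x \<otimes>\<^bsub>big_witt\<^esub> y) = witt_F k x \<otimes>\<^bsub>big_witt\<^esub> witt_F k y"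
    by (rule witt_ext[of _ "{0<..}"]) (simp_all add: simps wfrob_wmult)
  show "witt_F k (x \<oplus>\<^bsub>big_witt\<^esub> y) = witt_F k x \<oplus>\<^bsub>big_witt\<^esub> witt_F k y"
    by (rule witt_ext[of _ "{0<..}"]) (simp_all add: simps wfrob_wadd)
  show "witt_F k \<one>\<^bsub>big_witt\<^esub> = \<one>\<^bsub>big_witt\<^esub>"
    by (rule witt_ext[of _ "{0<..}"]) (simp_all add: simps wfrob_wteich)
qed simp

definition witt_V :: "nat \<Rightarrow> (nat \<Rightarrow> 'a::comm_ring_1) \<Rightarrow> nat \<Rightarrow> 'a" where
  "witt_V k x = restrict (wver k x) {0<..}"

lemma witt_V_closed [simp]: "witt_V k x \<in> carrier big_witt"
  by (simp add: witt_V_def)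

lemma wver_restrict: "n > 0 \<Longrightarrow> k > 0 \<Longrightarrow> wver k (restrict x {0<..}) n = wver k x n"
  by (auto simp: wver_def div_greater_zero_iff dest: dvd_imp_le)

lemma witt_V_add:
  assumes k: "k > 0"
  shows "witt_V k (x \<oplus>\<^bsub>big_witt\<^esub> y) = witt_V k x \<oplus>\<^bsub>big_witt\<^esub> witt_V k y"
  by (rule witt_ext[of _ "{0<..}"])
     (simp_all add: witt_ops witt_V_def wver_restrict k wver_wadd wfun_restrict[OF
         divisor_closed_positive])

lemma witt_V_inj:
  assumes k: "k > 0" and "x \<in> carrier big_witt" "y \<in> carrier big_witt" "witt_V k x = witt_V k y"
  shows "x = y"
proof (rule witt_ext[OF assms(2,3)])
  fix n :: nat assume "n \<in> {0<..}"
  thus "x n = y n" using k fun_cong[OF assms(4), of "n * k"] by (simp add: witt_V_def wver_def)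
qed

lemma witt_F_teichmueller:
  "k > 0 \<Longrightarrow> witt_F k (teichmueller {0<..} a) = teichmueller {0<..} (a ^ k)"
  by (rule witt_ext[of _ "{0<..}"]) (simp_all add: witt_F_eq teichmueller_eq wfrob_restrict wfrob_wteich)

lemma teichmueller_mult:
  "divisor_closed S \<Longrightarrow> teichmueller S a \<otimes>\<^bsub>witt_ring S\<^esub> teichmueller S b = teichmueller S (a * b)"
  by (rule witt_ext[of _ S])
     (auto simp: witt_ops teichmueller_eq wfun_restrict divisor_closed_def wmult_wteich)

section \<open>Witt vectors as power series\<close>

\<comment> \<open>Until the end of this section, the dollar sign denotes coefficients of power series.\<close>
no_notation vec_index (infixl \<open>$\<close> 100)
no_notation Finite_Cartesian_Product.vec_nth (infixl \<open>$\<close> 90)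

definition wpartial :: "nat \<Rightarrow> (nat \<Rightarrow> 'a::comm_ring_1) \<Rightarrow> 'a fps" where
  "wpartial N x = (\<Prod>i<N. 1 - fps_const (x (Suc i)) * fps_X ^ Suc i)"

text \<open>The infinite product \<open>\<Prod> (1 - x\<^sub>n t\<^sup>n)\<close>, coefficient by coefficient.\<close>

definition wseries :: "(nat \<Rightarrow> 'a::comm_ring_1) \<Rightarrow> 'a fps" where
  "wseries x = Abs_fps (\<lambda>n. wpartial n x $ n)"

lemma wpartial_Suc_nth:
  "wpartial (Suc N) x $ n = wpartial N x $ n - (if n < Suc N then 0 else x (Suc N) * wpartial N x $
      (n - Suc N))"
proof -
  have "wpartial (Suc N) x = wpartial N x - fps_const (x (Suc N)) * (fps_X ^ Suc N * wpartial N x)"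
    by (simp only: wpartial_def prod.lessThan_Suc) (simp add: algebra_simps)
  thus ?thesis by (simp only: fps_sub_nth fps_mult_left_const_nth fps_X_power_mult_nth) simp
qed

lemma wpartial_stable: "n \<le> N \<Longrightarrow> wpartial N x $ n = wseries x $ n"
proof (induction N)
  case (Suc N)
  show ?case
  proof (cases "n = Suc N")
    case False
    thus ?thesis using Suc by (simp add: wpartial_Suc_nth)
  qed (simp add: wseries_def)
qed (simp add: wseries_def)

lemma wpartial_0_nth: "wpartial N x $ 0 = 1"
  by (induction N) (simp add: wpartial_def, simp add: wpartial_Suc_nth)

lemma wseries_0 [simp]: "wseries x $ 0 = 1"
  by (simp add: wseries_def wpartial_def)

lemma wseries_Suc: "wseries x $ Suc n = wpartial n x $ Suc n - x (Suc n)"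
  by (simp add: wseries_def wpartial_Suc_nth wpartial_0_nth)

lemma wpartial_cong: "(\<And>m. 0 < m \<Longrightarrow> m \<le> N \<Longrightarrow> x m = y m) \<Longrightarrow> wpartial N x = wpartial N y"
  unfolding wpartial_def by (rule prod.cong) auto

lemma wseries_inj_upto:
  assumes "\<And>m. m \<le> N \<Longrightarrow> wseries x $ m = wseries y $ m"
  shows "n > 0 \<Longrightarrow> n \<le> N \<Longrightarrow> x n = y n"
proof (induction n rule: less_induct)
  case (less n)
  then obtain m where m: "n = Suc m" by (cases n) auto
  have "wpartial m x = wpartial m y" by (rule wpartial_cong) (use less m in auto)
  thus ?case using wseries_Suc[of x m] wseries_Suc[of y m] assms[of n] less m by simp
qed

lemma wseries_inj: "wseries x = wseries y \<Longrightarrow> n > 0 \<Longrightarrow> x n = y n"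
  by (rule wseries_inj_upto[of n]) simp_all

text \<open>Course-of-values recursion for an arbitrary functional, used to solve triangular systems with
  infinitely many unknowns.\<close>

lemma nat_recursion:
  assumes "\<And>n x y. (\<And>m. m < n \<Longrightarrow> x m = y m) \<Longrightarrow> \<Phi> n x = \<Phi> n y"
  shows "\<exists>x. \<forall>n::nat. x n = \<Phi> n x"
proof (intro exI allI)
  let ?x = "wfrec less_than (\<lambda>f n. \<Phi> n f)"
  fix n
  have "?x n = \<Phi> n (cut ?x less_than n)" by (rule wfrec[OF wf_less_than])
  also have "\<dots> = \<Phi> n ?x" by (rule assms) (simp add: cut_apply)
  finally show "?x n = \<Phi> n ?x" .
qed

lemma wseries_surj:
  fixes f :: "'a::comm_ring_1 fps"
  assumes "f $ 0 = 1"
  shows "\<exists>x. wseries x = f"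
proof -
  have "\<exists>x. \<forall>n. x n = wpartial (n - 1) x $ n - f $ n"
  proof (rule nat_recursion)
    fix n and x y :: "nat \<Rightarrow> 'a" assume "\<And>m. m < n \<Longrightarrow> x m = y m"
    hence "wpartial (n - 1) x = wpartial (n - 1) y" by (intro wpartial_cong) auto
    thus "wpartial (n - 1) x $ n - f $ n = wpartial (n - 1) y $ n - f $ n" by simp
  qed
  then obtain x where x: "\<And>n. x n = wpartial (n - 1) x $ n - f $ n" by blast
  have "wseries x $ n = f $ n" for n
  proof (cases n)
    case (Suc m)
    thus ?thesis using x[of n] by (simp add: wseries_Suc)
  qed (use assms in simp)
  thus ?thesis by (intro exI fps_ext)
qed

lemma map_wpartial:
  assumes "comm_ring_hom h"
  shows "h (wpartial N x $ n) = wpartial N (\<lambda>n. h (x n)) $ n"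
proof -
  interpret comm_ring_hom h by fact
  show ?thesis
  proof (induction N arbitrary: n)
    case (Suc N)
    show ?case using Suc by (simp add: wpartial_Suc_nth hom_minus hom_mult)
  qed (simp add: wpartial_def)
qed

lemma map_wseries: "comm_ring_hom h \<Longrightarrow> h (wseries x $ n) = wseries (\<lambda>n. h (x n)) $ n"
  by (simp add: wseries_def map_wpartial)

text \<open>The logarithmic derivative of one factor is a geometric series; it is stated without division so
  that it makes sense over every ring.\<close>

lemma geometric_log_derivative:
  fixes c :: "'a::comm_ring_1"
  assumes m: "m > 0"
  defines "g \<equiv> Abs_fps (\<lambda>n. if n > 0 \<and> m dvd n then of_nat m * c ^ (n div m) else 0)"
  shows "fps_X * fps_deriv (1 - fps_const c * fps_X ^ m) = - (1 - fps_const c * fps_X ^ m) * g"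
proof (rule fps_ext)
  fix n
  have L: "(fps_X * fps_deriv (1 - fps_const c * fps_X ^ m)) $ n = (if n
      = m then - (of_nat m * c) else 0)"
    using m by (cases n) (auto simp: fps_X_power_nth)
  have "(- (1 - fps_const c * fps_X ^ m) * g) = fps_const c * (fps_X ^ m * g) - g"
    by (simp add: algebra_simps)
  hence R: "(- (1 - fps_const c * fps_X ^ m) * g) $ n = (if n < m then 0 else c * g $ (n - m)) - g $ n"
    by (simp only: fps_sub_nth fps_mult_left_const_nth fps_X_power_mult_nth) simp
  show "(fps_X * fps_deriv (1 - fps_const c * fps_X ^ m)) $ n
      = (- (1 - fps_const c * fps_X ^ m) * g) $ n"
  proof (cases "m dvd n \<and> n > 0")
    case True
    then obtain e' where e': "n = m * e'" "e' > 0" by auto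
    then obtain e where e: "n = m * Suc e" by (cases e') auto
    have nm: "n - m = m * e" using e by simp
    show ?thesis unfolding L R nm using m e by (cases e) (simp_all add: g_def)
  next
    case False
    hence "\<not> m dvd (n - m) \<or> n < m" using m by (auto simp: dvd_minus_self)
    thus ?thesis unfolding L R using False m by (auto simp: g_def)
  qed
qed

lemma wpartial_log_derivative:
  fixes x :: "nat \<Rightarrow> 'a::comm_ring_1"
  defines "g \<equiv> \<lambda>i. Abs_fps (\<lambda>n. if n > 0 \<and> Suc i dvd n then of_nat (Suc i) * x (Suc i) ^ (n div Suc
      i) else 0)"
  shows "fps_X * fps_deriv (wpartial N x) = - wpartial N x * (\<Sum>i<N. g i)"
proof (induction N)
  case (Suc N)
  let ?f = "1 - fps_const (x (Suc N)) * fps_X ^ Suc N"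
  have f: "fps_X * fps_deriv ?f = - ?f * g N" unfolding g_def by (rule geometric_log_derivative) simp
  have "wpartial (Suc N) x = wpartial N x * ?f" by (simp only: wpartial_def prod.lessThan_Suc)
  hence "fps_X * fps_deriv (wpartial (Suc N) x) = (fps_X * fps_deriv (wpartial N x)) * ?f + wpartial
      N x * (fps_X * fps_deriv ?f)"
    by (simp only: fps_deriv_mult) (simp add: algebra_simps)
  also have "\<dots> = - (wpartial N x * ?f) * ((\<Sum>i<N. g i) + g N)"
  proof -
    have "(- P * S) * f + P * (- f * u) = - (P * f) * (S + u)" for P S f u :: "'a fps"
      by (simp add: algebra_simps)
    thus ?thesis unfolding f Suc.IH .
  qed
  finally show ?case by (simp only: wpartial_def prod.lessThan_Suc sum.lessThan_Suc)
qed (simp add: wpartial_def)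

definition ghost_series :: "(nat \<Rightarrow> 'a::comm_ring_1) \<Rightarrow> 'a fps" where
  "ghost_series x = Abs_fps (\<lambda>n. if n = 0 then 0 else ghost n x)"

lemma wseries_log_derivative:
  "fps_X * fps_deriv (wseries x) = - wseries x * ghost_series x"
proof (rule fps_ext)
  fix n
  let ?g = "\<lambda>i. Abs_fps (\<lambda>n. if n > 0 \<and> Suc i dvd n then of_nat (Suc i) * x (Suc i) ^ (n div Suc i)
      else 0)"
  have g: "(\<Sum>i<n. ?g i) $ j = ghost_series x $ j" if "j \<le> n" for j
  proof (cases "j = 0")
    case False
    have pos: "d > 0" "d - Suc 0 < n" if "d dvd j" for d
    proof -
      show "d > 0" using that False by (auto intro: Nat.gr0I)
      moreover have "d \<le> j" using that False by (simp add: dvd_imp_le)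
      ultimately show "d - Suc 0 < n" using \<open>j \<le> n\<close> by linarith
    qed
    have "(\<Sum>i<n. ?g i) $ j = (\<Sum>i | i < n \<and> Suc i dvd j. of_nat (Suc i) * x (Suc i) ^ (j div Suc i))"
      using False unfolding fps_sum_nth by (intro sum.mono_neutral_cong_right) auto
    also have "\<dots> = (\<Sum>d | d dvd j. of_nat d * x d ^ (j div d))"
      by (rule sum.reindex_bij_witness[of _ "\<lambda>d. d - 1" Suc])
         (use False that pos in auto)
    finally show ?thesis using False by (simp add: ghost_series_def ghost_def)
  qed (simp add: fps_sum_nth ghost_series_def)
  have "(fps_X * fps_deriv (wseries x)) $ n = (fps_X * fps_deriv (wpartial n x)) $ n"
    by (cases n) (simp_all add: wpartial_stable)
  also have "\<dots> = (- wpartial n x * (\<Sum>i<n. ?g i)) $ n" by (simp only: wpartial_log_derivative)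
  also have "\<dots> = (- wseries x * ghost_series x) $ n"
    unfolding fps_mult_nth by (rule sum.cong) (auto simp: wpartial_stable g)
  finally show "(fps_X * fps_deriv (wseries x)) $ n = (- wseries x * ghost_series x) $ n" .
qed

text \<open>The coefficient of index \<open>n\<close> of \<open>f\<close>, multiplied by \<open>n\<close>, is determined by the lower coefficients
  and \<open>G\<close>.\<close>

lemma log_derivative_inj:
  fixes f g :: "'a::comm_ring_1 fps"
  assumes tf: "torsion_free TYPE('a)" and G: "G $ 0 = 0" and 0: "f $ 0 = g $ 0"
    and f: "fps_X * fps_deriv f = - f * G" and g: "fps_X * fps_deriv g = - g * G"
  shows "f = g"
proof (rule fps_ext)
  fix n show "f $ n = g $ n"
  proof (induction n rule: less_induct)
    case (less n)
    show ?case
    proof (cases "n = 0")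
      case False
      have eq: "of_nat n * u $ n = - (\<Sum>i=0..<n. u $ i * G $ (n - i))"
        if u: "fps_X * fps_deriv u = - u * G" for u :: "'a fps"
      proof -
        have "of_nat n * u $ n = (fps_X * fps_deriv u) $ n" using False by (cases n) simp_all
        also have "\<dots> = - (\<Sum>i=0..n. u $ i * G $ (n - i))" unfolding u by (simp add: fps_mult_nth sum_negf)
        also have "{0..n} = insert n {0..<n}" by auto
        finally show ?thesis by (simp add: G)
      qed
      have "(\<Sum>i=0..<n. f $ i * G $ (n - i)) = (\<Sum>i=0..<n. g $ i * G $ (n - i))"
        by (rule sum.cong) (use less in auto)
      hence "of_nat n * f $ n = of_nat n * g $ n" by (simp only: eq[OF f] eq[OF g])
      from torsion_freeD[OF tf _ this] show ?thesis using False by simp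
    qed (use 0 in simp)
  qed
qed

text \<open>The ghost components are the coefficients of minus the logarithmic derivative, so Witt vector
  addition becomes multiplication of series over a torsion-free ring, hence over every ring.\<close>

lemma wseries_wadd:
  fixes x y :: "nat \<Rightarrow> 'a::comm_ring_1"
  shows "wseries (wadd x y) = wseries x * wseries y"
proof (rule fps_ext)
  fix n
  let ?h = "zeval (\<lambda>a. a) :: 'a zpoly \<Rightarrow> 'a"
  interpret comm_ring_hom ?h by (rule comm_ring_hom_zeval)
  have h: "comm_ring_hom ?h" by (rule comm_ring_hom_zeval)
  let ?G = "ghost_series (wadd (wvar x) (wvar y))"
  have G: "?G = ghost_series (wvar x) + ghost_series (wvar y)"
    by (rule fps_ext) (simp add: ghost_series_def ghost_wadd)
  have "fps_X * fps_deriv (f * g) = - (f * g) * (F + G)"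
    if "fps_X * fps_deriv f = - f * F" "fps_X * fps_deriv g = - g * G" for f g F G :: "'a zpoly fps"
  proof -
    have "fps_X * fps_deriv (f * g) = (fps_X * fps_deriv f) * g + f * (fps_X * fps_deriv g)"
      by (simp only: fps_deriv_mult distrib_left mult_ac add_ac)
    thus ?thesis unfolding that by (simp add: algebra_simps)
  qed
  note prod = this[OF wseries_log_derivative wseries_log_derivative, of "wvar x" "wvar y", folded G]
  have "wseries (wadd (wvar x) (wvar y)) = wseries (wvar x) * wseries (wvar y)"
    by (rule log_derivative_inj[OF torsion_free_zpoly _ _ wseries_log_derivative prod])
       (simp_all only: ghost_series_def fps_nth_Abs_fps fps_mult_nth_0 wseries_0 mult_1 if_True refl)
  from arg_cong[OF this, of "\<lambda>f. ?h (f $ n)"] show "wseries (wadd x y) $ n = (wseries x * wseries y) $ n"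
    by (simp add: map_wseries[OF h] map_wadd[OF h] fps_mult_nth hom_sum hom_mult)
qed

lemma wseries_restrict: "wseries (restrict x {0<..}) = wseries x"
  unfolding wseries_def by (rule arg_cong[of _ _ Abs_fps],
      rule ext) (metis restrict_apply greaterThan_iff wpartial_cong)

lemma wseries_add: "wseries (x \<oplus>\<^bsub>big_witt\<^esub> y) = wseries x * wseries y"
  by (simp add: witt_ops wseries_restrict wseries_wadd)

lemma wseries_eq_iff:
  assumes "x \<in> carrier big_witt" "y \<in> carrier big_witt"
  shows "wseries x = wseries y \<longleftrightarrow> x = y"
  using wseries_inj[of x y] by (auto intro: witt_ext[OF assms])

lemma wseries_wver_wteich:
  assumes "k > 0" shows "wseries (wver k (wteich a)) = 1 - fps_const a * fps_X ^ k"
proof (rule fps_ext)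
  fix n
  let ?x = "wver k (wteich a)"
  have x: "?x m = (if m = k then a else 0)" for m
    using assms by (auto simp: wver_def wteich_def dvd_div_eq_mult)
  have 1: "wpartial N ?x = (if N \<ge> k then 1 - fps_const a * fps_X ^ k else 1)" for N
  proof (induction N)
    case (Suc N)
    have "wpartial (Suc N) ?x = wpartial N ?x * (1 - fps_const (?x (Suc N)) * fps_X ^ Suc N)"
      by (simp only: wpartial_def prod.lessThan_Suc)
    thus ?case unfolding Suc x by (auto simp: not_less_eq_eq)
  qed (use assms in \<open>auto simp: wpartial_def\<close>)
  show "wseries ?x $ n = (1 - fps_const a * fps_X ^ k) $ n"
    using wpartial_stable[of n "max n k" ?x] by (simp add: 1)
qed

lemma wseries_teichmueller: "wseries (teichmueller {0<..} a) = 1 - fps_const a * fps_X"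
proof -
  have "wver 1 (wteich a) = wteich a" by (simp add: fun_eq_iff wver_def)
  thus ?thesis using wseries_wver_wteich[of 1 a] by (simp add: teichmueller_eq wseries_restrict)
qed

text \<open>The partial products of \<open>prodinf\<close> stabilise in every coefficient, hence converge for power series.\<close>

lemma witt_series_eq:
  fixes x :: "nat \<Rightarrow> 'k::field"
  shows "witt_series x = inverse (wseries x)"
proof -
  let ?f = "\<lambda>n. inverse (1 - fps_const (x (Suc n)) * fps_X ^ Suc n)"
  have prod: "(\<Prod>i<N. ?f i) = inverse (wpartial N x)" for N
    by (induction N) (simp_all add: wpartial_def fps_inverse_mult del: power_Suc)
  have "(\<lambda>N. wpartial N x) \<longlonglongrightarrow> wseries x"
  proof (rule tendsto_fpsI)
    fix n show "eventually (\<lambda>N. wpartial N x $ n = wseries x $ n) at_top"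
      using eventually_ge_at_top[of n] by eventually_elim (rule wpartial_stable)
  qed
  hence "(\<lambda>N. inverse (wpartial N x)) \<longlonglongrightarrow> inverse (wseries x)"
    by (rule tendsto_inverse_fps) simp
  hence lim: "(\<lambda>N. \<Prod>i\<le>N. ?f i) \<longlonglongrightarrow> inverse (wseries x)"
    unfolding lessThan_Suc_atMost [symmetric] prod by (rule LIMSEQ_Suc)
  have nz: "?f i \<noteq> 0" for i
  proof
    assume "?f i = 0"
    hence "?f i $ 0 = 0" by simp
    thus False by simp
  qed
  have nz': "inverse (wseries x) \<noteq> 0"
  proof
    assume "inverse (wseries x) = 0"
    hence "inverse (wseries x) $ 0 = 0" by simp
    thus False by simp
  qed
  have hp: "?f has_prod inverse (wseries x)"
    unfolding has_prod_def raw_has_prod_def using lim nz' by simp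
  have "p = inverse (wseries x)" if "?f has_prod p" for p
  proof -
    have "(\<lambda>N. \<Prod>i\<le>N. ?f i) \<longlonglongrightarrow> p"
      using that nz unfolding has_prod_def raw_has_prod_def by auto
    thus ?thesis using lim by (rule LIMSEQ_unique)
  qed
  thus ?thesis unfolding witt_series_def prodinf_def using hp by (intro the_equality)
qed

no_notation fps_nth (infixl \<open>$\<close> 75)
notation vec_index (infixl \<open>$\<close> 100)

section \<open>Exact sequences of endomorphisms and their characteristic polynomials\<close>

text \<open>Over a field every short exact sequence of endomorphisms splits as a sequence of vector
  spaces.  Written with the splitting, exactness is a set of matrix identities, which survive
  Kronecker products.\<close>

definition splitting :: "nat \<Rightarrow> nat \<Rightarrow> nat \<Rightarrow> 'k::comm_ring_1 mat \<Rightarrow> 'k mat \<Rightarrow> 'k mat \<Rightarrow> 'k mat \<Rightarrow> bool" where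
  "splitting a b c G G' H H' \<longleftrightarrow>
     G \<in> carrier_mat b a \<and> G' \<in> carrier_mat a b \<and> H \<in> carrier_mat c b \<and> H' \<in> carrier_mat b c \<and>
     G' * G = 1\<^sub>m a \<and> H * H' = 1\<^sub>m c \<and> G * G' + H' * H = 1\<^sub>m b \<and>
     H * G = 0\<^sub>m c a \<and> G' * H' = 0\<^sub>m a c"

definition endo_split :: "'k::comm_ring_1 mat \<Rightarrow> 'k mat \<Rightarrow> 'k mat \<Rightarrow> bool" where
  "endo_split A B C \<longleftrightarrow> (\<exists>a b c G G' H H'.
     A \<in> carrier_mat a a \<and> B \<in> carrier_mat b b \<and> C \<in> carrier_mat c c \<and>
     splitting a b c G G' H H' \<and> G * A = B * G \<and> H * B = C * H)"

lemma mat_of_cols_fun: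
  assumes "\<And>j. j < m \<Longrightarrow> f j \<in> carrier_vec n"
  obtains M where "M \<in> carrier_mat n m" "\<And>j. j < m \<Longrightarrow> col M j = f j"
proof
  show "Matrix.mat n m (\<lambda>(i, j). vec_index (f j) i) \<in> carrier_mat n m" by simp
  show "col (Matrix.mat n m (\<lambda>(i, j). vec_index (f j) i)) j = f j" if "j < m" for j
    using assms[OF that] that by (intro eq_vecI) auto
qed

lemma mat_eq_if_cols:
  assumes "A \<in> carrier_mat n m" "B \<in> carrier_mat n m" "\<And>j. j < m \<Longrightarrow> col A j = col B j"
  shows "A = B"
  using assms by (intro mat_col_eqI) auto

lemma mult_unit_vec:
  fixes M :: "'a::comm_ring_1 mat"
  assumes "M \<in> carrier_mat n m" "j < m" shows "M *\<^sub>v unit_vec m j = col M j"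
  using assms by (intro eq_vecI) (auto simp: scalar_prod_def unit_vec_def if_distrib cong: if_cong)

lemma zero_mat_mult_vec: "u \<in> carrier_vec m \<Longrightarrow> 0\<^sub>m n m *\<^sub>v u = 0\<^sub>v n"
  by (intro eq_vecI) auto

lemma mat_mult_zero_vec: "M \<in> carrier_mat n m \<Longrightarrow> M *\<^sub>v 0\<^sub>v m = 0\<^sub>v n"
  by (intro eq_vecI) auto

lemma minus_zero_mat: "M \<in> carrier_mat n m \<Longrightarrow> M - 0\<^sub>m n m = (M :: 'a::ring_1 mat)"
  by (intro eq_matI) auto

lemma endo_exact_imp_split:
  fixes A B C :: "'k::field mat"
  assumes "endo_exact A B C"
  shows "endo_split A B C"
proof -
  define a b c where "a = dim_row A" "b = dim_row B" "c = dim_row C"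
  note dims = this
  from assms obtain G H where
    sq: "A \<in> carrier_mat a a" "B \<in> carrier_mat b b" "C \<in> carrier_mat c c"
    and G: "G \<in> carrier_mat b a" and H: "H \<in> carrier_mat c b"
    and GA: "G * A = B * G" and HB: "H * B = C * H"
    and inj: "inj_on (\<lambda>u. G *\<^sub>v u) (carrier_vec a)"
    and surj: "(\<lambda>v. H *\<^sub>v v) ` carrier_vec b = carrier_vec c"
    and ker: "(\<lambda>u. G *\<^sub>v u) ` carrier_vec a = {v \<in> carrier_vec b. H *\<^sub>v v = 0\<^sub>v c}"
    unfolding endo_exact_def dims carrier_mat_def square_mat.simps by auto
  have HG: "H * G = 0\<^sub>m c a"
  proof (rule mat_eq_if_cols)
    fix j assume j: "j < a"
    have "G *\<^sub>v unit_vec a j \<in> {v \<in> carrier_vec b. H *\<^sub>v v = 0\<^sub>v c}"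
      unfolding ker [symmetric] by simp
    moreover have "G *\<^sub>v unit_vec a j = col G j" using G j by (rule mult_unit_vec)
    ultimately have "H *\<^sub>v col G j = 0\<^sub>v c" by simp
    hence "col (H * G) j = 0\<^sub>v c" unfolding col_mult2[OF H G j] .
    thus "col (H * G) j = col (0\<^sub>m c a) j" using j by simp
  qed (use G H in auto)
  \<comment> \<open>A section of the surjection, column by column.\<close>
  have "\<forall>j\<in>{..<c}. \<exists>v. v \<in> carrier_vec b \<and> H *\<^sub>v v = unit_vec c j"
  proof
    fix j
    have "unit_vec c j \<in> (\<lambda>v. H *\<^sub>v v) ` carrier_vec b" unfolding surj by simp
    thus "\<exists>v. v \<in> carrier_vec b \<and> H *\<^sub>v v = unit_vec c j" by auto
  qed
  then obtain f where f: "\<And>j. j < c \<Longrightarrow> f j \<in> carrier_vec b \<and> H *\<^sub>v f j = unit_vec c j"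
    by (metis lessThan_iff)
  obtain H' where H': "H' \<in> carrier_mat b c" "\<And>j. j < c \<Longrightarrow> col H' j = f j"
    using mat_of_cols_fun[of c f b] f by auto
  have HH': "H * H' = 1\<^sub>m c"
  proof (rule mat_eq_if_cols[of _ c c])
    fix j assume j: "j < c"
    have "col (H * H') j = unit_vec c j" unfolding col_mult2[OF H H'(1) j] H'(2)[OF j] using f[OF j]
        by blast
    thus "col (H * H') j = col (1\<^sub>m c) j" using j by simp
  qed (use H H' in auto)
  \<comment> \<open>The complementary projection takes values in the image of \<open>G\<close>, which gives the retraction.\<close>
  define K where "K = 1\<^sub>m b - H' * H"
  have K: "K \<in> carrier_mat b b" unfolding K_def by (intro minus_carrier_mat mult_carrier_mat[OF H'(1) H])
  have HK: "H * K = 0\<^sub>m c b"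
  proof -
    have "H * K = H * 1\<^sub>m b - H * (H' * H)" unfolding K_def
      by (rule mult_minus_distrib_mat[of _ c b _ b]) (use H H' in auto)
    also have "H * (H' * H) = H" using H H' HH' by (simp flip: assoc_mult_mat[of _ c b _ c _ b])
    finally show ?thesis using H by simp
  qed
  have "\<forall>j\<in>{..<b}. \<exists>u. u \<in> carrier_vec a \<and> G *\<^sub>v u = col K j"
  proof
    fix j assume j: "j \<in> {..<b}"
    have "H *\<^sub>v col K j = col (H * K) j" using j by (intro col_mult2[OF H K, symmetric]) simp
    hence "col K j \<in> {v \<in> carrier_vec b. H *\<^sub>v v = 0\<^sub>v c}" using HK K j by auto
    thus "\<exists>u. u \<in> carrier_vec a \<and> G *\<^sub>v u = col K j" unfolding ker [symmetric] by auto
  qed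
  then obtain g where g: "\<And>j. j < b \<Longrightarrow> g j \<in> carrier_vec a \<and> G *\<^sub>v g j = col K j"
    by (metis lessThan_iff)
  obtain G' where G': "G' \<in> carrier_mat a b" "\<And>j. j < b \<Longrightarrow> col G' j = g j"
    using mat_of_cols_fun[of b g a] g by auto
  have GG': "G * G' = K"
  proof (rule mat_eq_if_cols[of _ b b])
    fix j assume j: "j < b"
    show "col (G * G') j = col K j" unfolding col_mult2[OF G G'(1) j] G'(2)[OF j] using g[OF j] by blast
  qed (use G G' K in auto)
  have cancel: "U = W" if U: "U \<in> carrier_mat a m" and W: "W \<in> carrier_mat a m" and eq: "G * U
      = G * W" for U W m
  proof (rule mat_eq_if_cols[OF U W])
    fix j assume j: "j < m"
    have "G *\<^sub>v col U j = G *\<^sub>v col W j" using arg_cong[OF eq, of "\<lambda>M. col M j"]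
      unfolding col_mult2[OF G U j] col_mult2[OF G W j] .
    thus "col U j = col W j" by (rule inj_onD[OF inj]) (use U W j in auto)
  qed
  have "G * (G' * G) = K * G" using G G' by (simp add: GG' flip: assoc_mult_mat[of _ b a _ b _ a])
  also have "\<dots> = 1\<^sub>m b * G - H' * H * G" unfolding K_def
    by (rule minus_mult_distrib_mat[of _ b b _ _ a]) (use G H H' in auto)
  also have "H' * H * G = 0\<^sub>m b a" using G H H' HG by simp
  finally have "G * (G' * G) = G * 1\<^sub>m a" using G by (simp add: minus_zero_mat)
  hence G'G: "G' * G = 1\<^sub>m a" by (rule cancel[rotated 2]) (use G G' in auto)
  have "G * (G' * H') = K * H'" using G G' H' by (simp add: GG' flip: assoc_mult_mat[of _ b a _ b _ c])
  also have "\<dots> = 1\<^sub>m b * H' - H' * H * H'" unfolding K_def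
    by (rule minus_mult_distrib_mat[of _ b b _ _ c]) (use H H' in auto)
  also have "H' * H * H' = H'" using H H' HH' by simp
  finally have "G * (G' * H') = G * 0\<^sub>m a c" using G H' by simp
  hence G'H': "G' * H' = 0\<^sub>m a c" by (rule cancel[rotated 2]) (use G' H' in auto)
  have "G * G' + H' * H = 1\<^sub>m b" unfolding GG' K_def by (rule eq_matI) (use H H' in auto)
  hence "splitting a b c G G' H H'" unfolding splitting_def using G G' H H' HG HH' G'G G'H' by blast
  thus ?thesis unfolding endo_split_def using sq GA HB by blast
qed

lemma endo_split_imp_exact:
  fixes A B C :: "'k::field mat"
  assumes "endo_split A B C"
  shows "endo_exact A B C"
proof -
  from assms obtain a b c G G' H H' where
    sq: "A \<in> carrier_mat a a" "B \<in> carrier_mat b b" "C \<in> carrier_mat c c"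
    and spl: "splitting a b c G G' H H'"
    and GA: "G * A = B * G" and HB: "H * B = C * H"
    unfolding endo_split_def by (elim exE conjE) (rule that)
  from spl have G: "G \<in> carrier_mat b a" and G': "G' \<in> carrier_mat a b"
    and H: "H \<in> carrier_mat c b" and H': "H' \<in> carrier_mat b c"
    and id: "G' * G = 1\<^sub>m a" "H * H' = 1\<^sub>m c" "G * G' + H' * H = 1\<^sub>m b" "H * G = 0\<^sub>m c a" "G' * H'
        = 0\<^sub>m a c"
    unfolding splitting_def by blast+
  have inj: "inj_on (\<lambda>u. G *\<^sub>v u) (carrier_vec a)"
  proof (rule inj_on_inverseI)
    fix u :: "'k Matrix.vec" assume "u \<in> carrier_vec a"
    thus "G' *\<^sub>v (G *\<^sub>v u) = u" using G G' id(1) by (simp flip: assoc_mult_mat_vec)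
  qed
  have surj: "(\<lambda>v. H *\<^sub>v v) ` carrier_vec b = carrier_vec c"
  proof (intro equalityI subsetI)
    fix w :: "'k Matrix.vec" assume w: "w \<in> carrier_vec c"
    have "H *\<^sub>v (H' *\<^sub>v w) = w" using H H' id(2) w by (simp flip: assoc_mult_mat_vec)
    thus "w \<in> (\<lambda>v. H *\<^sub>v v) ` carrier_vec b" using H' w by (intro image_eqI[of _ _ "H' *\<^sub>v w"]) auto
  qed (use H in auto)
  have ker: "(\<lambda>u. G *\<^sub>v u) ` carrier_vec a = {v \<in> carrier_vec b. H *\<^sub>v v = 0\<^sub>v c}"
  proof (intro equalityI subsetI)
    fix v assume "v \<in> (\<lambda>u. G *\<^sub>v u) ` carrier_vec a"
    then obtain u where u: "u \<in> carrier_vec a" "v = G *\<^sub>v u" by auto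
    have "H *\<^sub>v v = 0\<^sub>m c a *\<^sub>v u" using u G H id(4) by (simp flip: assoc_mult_mat_vec)
    thus "v \<in> {v \<in> carrier_vec b. H *\<^sub>v v = 0\<^sub>v c}" using u G by (simp add: zero_mat_mult_vec)
  next
    fix v assume v: "v \<in> {v \<in> carrier_vec b. H *\<^sub>v v = 0\<^sub>v c}"
    have "v = (G * G' + H' * H) *\<^sub>v v" using v id(3) by simp
    also have "\<dots> = G * G' *\<^sub>v v + H' * H *\<^sub>v v"
      by (rule add_mult_distrib_mat_vec) (use G G' H H' v in auto)
    also have "\<dots> = G *\<^sub>v (G' *\<^sub>v v)" using G G' H H' v by (simp add: mat_mult_zero_vec)
    finally show "v \<in> (\<lambda>u. G *\<^sub>v u) ` carrier_vec a" using G' v by (intro image_eqI[of _ _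
        "G' *\<^sub>v v"]) auto
  qed
  have dims: "dim_row A = a" "dim_row B = b" "dim_row C = c" "square_mat A" "square_mat B" "square_mat C"
    using sq by auto
  show ?thesis
    unfolding endo_exact_def dims
    by (intro conjI bexI[of _ G] bexI[of _ H]; fact | rule TrueI)
qed

text \<open>\<open>(G | H')\<close> has a two-sided inverse, and a matrix with such an inverse is square: padded with zero
  columns to a square matrix, it would otherwise be both invertible and singular.\<close>

lemma splitting_dim:
  fixes G :: "'k::field mat"
  assumes "splitting a b c G G' H H'"
  shows "b = a + c"
proof -
  have no_less: False
    if U: "U \<in> carrier_mat n m" and W: "W \<in> carrier_mat m n" and WU: "W * U = 1\<^sub>m m" and nm: "n < m"
    for U W :: "'k mat" and n m
  proof -
    define U' where "U' = Matrix.mat m m (\<lambda>(i, j). if i < n then U $$ (i, j) else 0)"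
    define W' where "W' = Matrix.mat m m (\<lambda>(i, j). if j < n then W $$ (i, j) else 0)"
    have c: "U' \<in> carrier_mat m m" "W' \<in> carrier_mat m m" by (simp_all add: U'_def W'_def)
    have "W' * U' = W * U"
    proof (rule eq_matI)
      fix i j assume ij: "i < dim_row (W * U)" "j < dim_col (W * U)"
      hence ij': "i < m" "j < m" using U W by auto
      have "(W' * U') $$ (i, j) = (\<Sum>k\<in>{0..<m}. W' $$ (i, k) * U' $$ (k, j))"
        using ij' c by (simp add: scalar_prod_def)
      also have "\<dots> = (\<Sum>k\<in>{0..<n}. W $$ (i, k) * U $$ (k, j))"
        by (rule sum.mono_neutral_cong_right) (use nm ij' in \<open>auto simp: U'_def W'_def\<close>)
      also have "\<dots> = (W * U) $$ (i, j)" using ij' U W by (simp add: scalar_prod_def)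
      finally show "(W' * U') $$ (i, j) = (W * U) $$ (i, j)" .
    qed (use U W c in auto)
    hence "U' * W' = 1\<^sub>m m" using mat_mult_left_right_inverse[OF c(2,1)] WU by simp
    moreover have "(U' * W') $$ (m - 1, m - 1) = 0" using nm c
      by (simp add: scalar_prod_def) (rule sum.neutral, auto simp: U'_def)
    ultimately show False using nm by simp
  qed
  from assms have G: "G \<in> carrier_mat b a" and G': "G' \<in> carrier_mat a b"
    and H: "H \<in> carrier_mat c b" and H': "H' \<in> carrier_mat b c"
    and id: "G' * G = 1\<^sub>m a" "H * H' = 1\<^sub>m c" "G * G' + H' * H = 1\<^sub>m b" "H * G = 0\<^sub>m c a" "G' * H'
        = 0\<^sub>m a c"
    unfolding splitting_def by blast+
  define P where "P = Matrix.mat b (a + c) (\<lambda>(i, j). if j < a then G $$ (i, j) else H' $$ (i, j - a))"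
  define Q where "Q = Matrix.mat (a + c) b (\<lambda>(i, j). if i < a then G' $$ (i, j) else H $$ (i - a, j))"
  have P: "P \<in> carrier_mat b (a + c)" and Q: "Q \<in> carrier_mat (a + c) b" by (simp_all add: P_def Q_def)
  have QP: "Q * P = 1\<^sub>m (a + c)"
  proof (rule eq_matI)
    fix i j assume "i < dim_row (1\<^sub>m (a + c))" "j < dim_col (1\<^sub>m (a + c))"
    hence ij: "i < a + c" "j < a + c" by auto
    have e: "(Q * P) $$ (i, j) = (\<Sum>k = 0..<b. Q $$ (i, k) * P $$ (k, j))"
      using ij P Q by (simp add: scalar_prod_def)
    have s: "(\<Sum>k = 0..<b. U $$ (i, k) * W $$ (k, j)) = (U * W) $$ (i, j)"
      if "U \<in> carrier_mat x b" "W \<in> carrier_mat b y" "i < x" "j < y" for U W :: "'k mat" and i j x y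
      using that by (simp add: scalar_prod_def)
    show "(Q * P) $$ (i, j) = 1\<^sub>m (a + c) $$ (i, j)"
    proof (cases "i < a"; cases "j < a")
      assume *: "i < a" "j < a"
      hence "(Q * P) $$ (i, j) = (G' * G) $$ (i, j)"
        unfolding e s[OF G' G *, symmetric] by (intro sum.cong) (auto simp: P_def Q_def)
      thus ?thesis using * id by simp
    next
      assume *: "i < a" "\<not> j < a"
      hence j': "j - a < c" using ij by auto
      have "(Q * P) $$ (i, j) = (G' * H') $$ (i, j - a)"
        unfolding e s[OF G' H' *(1) j', symmetric] using * ij by (intro sum.cong)
            (auto simp: P_def Q_def)
      thus ?thesis using * ij j' id by simp
    next
      assume *: "\<not> i < a" "j < a"
      hence i': "i - a < c" using ij by auto
      have "(Q * P) $$ (i, j) = (H * G) $$ (i - a, j)"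
        unfolding e s[OF H G i' *(2), symmetric] using * ij by (intro sum.cong) (auto simp: P_def Q_def)
      thus ?thesis using * ij i' id by simp
    next
      assume *: "\<not> i < a" "\<not> j < a"
      hence i': "i - a < c" "j - a < c" using ij by auto
      have "(Q * P) $$ (i, j) = (H * H') $$ (i - a, j - a)"
        unfolding e s[OF H H' i', symmetric] using * ij by (intro sum.cong) (auto simp: P_def Q_def)
      thus ?thesis using * ij i' id by auto
    qed
  qed (use P Q in auto)
  have PQ: "P * Q = 1\<^sub>m b"
  proof (rule eq_matI)
    fix i j assume "i < dim_row (1\<^sub>m b)" "j < dim_col (1\<^sub>m b)"
    hence ij: "i < b" "j < b" by auto
    have "(P * Q) $$ (i, j) = (\<Sum>k = 0..<a + c. P $$ (i, k) * Q $$ (k, j))"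
      using ij P Q by (simp add: scalar_prod_def)
    also have "\<dots> = (\<Sum>k = 0..<a. P $$ (i, k) * Q $$ (k, j)) + (\<Sum>k = a..<a + c. P $$ (i, k) * Q $$ (k, j))"
      by (rule sum.atLeastLessThan_concat [symmetric]) auto
    also have "(\<Sum>k = 0..<a. P $$ (i, k) * Q $$ (k, j)) = (G * G') $$ (i, j)"
      using ij G G' by (simp add: scalar_prod_def P_def Q_def)
    also have "(\<Sum>k = a..<a + c. P $$ (i, k) * Q $$ (k, j)) = (\<Sum>k = 0..<c. P $$ (i,
        k + a) * Q $$ (k + a, j))"
      using sum.shift_bounds_nat_ivl[of "\<lambda>k. P $$ (i, k) * Q $$ (k, j)" 0 a c] by (simp add: add.commute)
    also have "\<dots> = (H' * H) $$ (i, j)"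
      using ij H H' by (simp add: scalar_prod_def P_def Q_def)
    also have "(G * G') $$ (i, j) + (H' * H) $$ (i, j) = (G * G' + H' * H) $$ (i, j)" using ij H H'
        by simp
    finally show "(P * Q) $$ (i, j) = 1\<^sub>m b $$ (i, j)" by (simp only: id)
  qed (use P Q in auto)
  show ?thesis
    using no_less[OF P Q QP] no_less[OF Q P PQ] by (meson linorder_neqE_nat)
qed

text \<open>Both \<open>char_poly\<close> and \<open>det_series\<close> are determinants of a pencil \<open>u - v A\<close>, so
  their behaviour on exact sequences is established once.\<close>

definition pencil :: "('k::comm_ring_1 \<Rightarrow> 'r::comm_ring_1) \<Rightarrow> 'r \<Rightarrow> 'r \<Rightarrow> 'k mat \<Rightarrow> 'r mat" where
  "pencil \<phi> u v A = Matrix.mat (dim_row A) (dim_col A) (\<lambda>(i, j). (if i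
      = j then u else 0) - v * \<phi> (A $$ (i, j)))"

lemma pencil_carrier [simp]: "A \<in> carrier_mat n m \<Longrightarrow> pencil \<phi> u v A \<in> carrier_mat n m"
  by (auto simp: pencil_def)

lemma comm_ring_hom_const_poly: "comm_ring_hom (\<lambda>a::'a::comm_ring_1. [:a:])"
  by unfold_locales auto

lemma comm_ring_hom_fps_const: "comm_ring_hom (fps_const :: 'a::comm_ring_1 \<Rightarrow> _)"
  by unfold_locales auto

lemma char_poly_pencil: "A \<in> carrier_mat n n \<Longrightarrow> char_poly A = det (pencil (\<lambda>a. [:a:]) [:0, 1:] 1 A)"
  unfolding char_poly_defs by (intro arg_cong[of _ _ det] eq_matI) (auto simp: pencil_def)

lemma det_series_pencil: "A \<in> carrier_mat n n \<Longrightarrow> det_series A = det (pencil fps_const 1 fps_X A)"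
  unfolding det_series_def by (intro arg_cong[of _ _ det] eq_matI) (auto simp: pencil_def)

lemma pencil_mult:
  assumes \<phi>: "comm_ring_hom \<phi>" and S: "S \<in> carrier_mat m n" and A: "A \<in> carrier_mat n n" and T:
      "T \<in> carrier_mat n m"
    and ST: "S * T = 1\<^sub>m m"
  shows "map_mat \<phi> S * pencil \<phi> u v A * map_mat \<phi> T = pencil \<phi> u v (S * A * T)"
proof -
  interpret comm_ring_hom \<phi> by fact
  have p: "pencil \<phi> u v M = u \<cdot>\<^sub>m 1\<^sub>m k - v \<cdot>\<^sub>m map_mat \<phi> M" if "M \<in> carrier_mat k k" for M k
    using that by (intro eq_matI) (auto simp: pencil_def)
  have S': "map_mat \<phi> S \<in> carrier_mat m n" and T': "map_mat \<phi> T \<in> carrier_mat n m"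
    and A': "map_mat \<phi> A \<in> carrier_mat n n" using S T A by auto
  have "map_mat \<phi> S * pencil \<phi> u v A = map_mat \<phi> S * (u \<cdot>\<^sub>m 1\<^sub>m n) - map_mat \<phi> S * (v \<cdot>\<^sub>m map_mat \<phi> A)"
    unfolding p[OF A] by (rule mult_minus_distrib_mat) (use S' A' in auto)
  also have "map_mat \<phi> S * (u \<cdot>\<^sub>m 1\<^sub>m n) = u \<cdot>\<^sub>m map_mat \<phi> S"
    using S' by (subst mult_smult_distrib[OF S']) auto
  also have "map_mat \<phi> S * (v \<cdot>\<^sub>m map_mat \<phi> A) = v \<cdot>\<^sub>m (map_mat \<phi> S * map_mat \<phi> A)"
    by (rule mult_smult_distrib[OF S' A'])
  finally have "map_mat \<phi> S * pencil \<phi> u v A * map_mat \<phi> T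
     = (u \<cdot>\<^sub>m map_mat \<phi> S) * map_mat \<phi> T - (v \<cdot>\<^sub>m (map_mat \<phi> S * map_mat \<phi> A)) * map_mat \<phi> T"
    by (simp only:) (rule minus_mult_distrib_mat, use S' A' T' in auto)
  also have "(u \<cdot>\<^sub>m map_mat \<phi> S) * map_mat \<phi> T = u \<cdot>\<^sub>m 1\<^sub>m m"
    by (subst mult_smult_assoc_mat[OF S' T'], subst mat_hom_mult[OF S T, symmetric])
        (simp add: ST mat_hom_one)
  also have "(v \<cdot>\<^sub>m (map_mat \<phi> S * map_mat \<phi> A)) * map_mat \<phi> T = v \<cdot>\<^sub>m map_mat \<phi> (S * A * T)"
    using mult_smult_assoc_mat[OF mult_carrier_mat[OF S' A'] T'] mat_hom_mult[OF S A]
      mat_hom_mult[OF mult_carrier_mat[OF S A] T] by simp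
  also have "u \<cdot>\<^sub>m 1\<^sub>m m - v \<cdot>\<^sub>m map_mat \<phi> (S * A * T) = pencil \<phi> u v (S * A * T)"
    by (rule p [symmetric]) (use S A T in auto)
  finally show ?thesis .
qed

text \<open>In the basis given by the columns of \<open>G\<close> and \<open>H'\<close> the matrix \<open>B\<close> is block triangular with
  diagonal blocks \<open>A\<close> and \<open>C\<close>.\<close>

lemma det_pencil_split:
  fixes \<phi> :: "'k::field \<Rightarrow> 'r::idom"
  assumes \<phi>: "comm_ring_hom \<phi>" and split: "endo_split A B C"
  shows "det (pencil \<phi> u v B) = det (pencil \<phi> u v A) * det (pencil \<phi> u v C)"
proof -
  interpret comm_ring_hom \<phi> by fact
  from split obtain a b c G G' H H' where
    sq: "A \<in> carrier_mat a a" "B \<in> carrier_mat b b" "C \<in> carrier_mat c c"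
    and spl: "splitting a b c G G' H H'"
    and GA: "G * A = B * G" and HB: "H * B = C * H"
    unfolding endo_split_def by (elim exE conjE) (rule that)
  from spl have G: "G \<in> carrier_mat b a" and G': "G' \<in> carrier_mat a b"
    and H: "H \<in> carrier_mat c b" and H': "H' \<in> carrier_mat b c"
    and id: "G' * G = 1\<^sub>m a" "H * H' = 1\<^sub>m c" "G * G' + H' * H = 1\<^sub>m b" "H * G = 0\<^sub>m c a" "G' * H'
        = 0\<^sub>m a c"
    unfolding splitting_def by blast+
  have dim: "b = a + c" by (rule splitting_dim[OF spl])
  \<comment> \<open>The change of basis and its inverse, as block matrices with two empty blocks.\<close>
  define P where "P = four_block_mat G H' (0\<^sub>m 0 a) (0\<^sub>m 0 c)"
  define Q where "Q = four_block_mat G' (0\<^sub>m a 0) H (0\<^sub>m c 0)"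
  have P: "P \<in> carrier_mat b b" and Q: "Q \<in> carrier_mat b b"
    using G G' H H' dim by (auto simp: P_def Q_def)
  have QP: "Q * P = 1\<^sub>m b"
    unfolding P_def Q_def
    by (subst mult_four_block_mat[OF G' zero_carrier_mat H zero_carrier_mat G H' zero_carrier_mat
        zero_carrier_mat])
       (use G G' H H' in \<open>simp add: id dim\<close>)
  have Bblock: "B = four_block_mat B (0\<^sub>m b 0) (0\<^sub>m 0 b) (0\<^sub>m 0 0)" using sq by (intro eq_matI) auto
  have "B * P = four_block_mat (B * G) (B * H') (0\<^sub>m 0 a) (0\<^sub>m 0 c)"
  proof -
    have "four_block_mat B (0\<^sub>m b 0) (0\<^sub>m 0 b) (0\<^sub>m 0 0) * P
        = four_block_mat (B * G) (B * H') (0\<^sub>m 0 a) (0\<^sub>m 0 c)"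
      unfolding P_def
      by (subst mult_four_block_mat[OF sq(2) zero_carrier_mat zero_carrier_mat zero_carrier_mat G H'
          zero_carrier_mat zero_carrier_mat])
         (use sq G H' in simp)
    thus ?thesis by (simp only: Bblock [symmetric])
  qed
  hence "Q * (B * P) = four_block_mat (G' * (B * G)) (G' * (B * H')) (H * (B * G)) (H * (B * H'))"
    unfolding Q_def
    by (simp only:)
       (subst mult_four_block_mat[OF G' zero_carrier_mat H zero_carrier_mat mult_carrier_mat[OF
           sq(2) G] mult_carrier_mat[OF sq(2) H'] zero_carrier_mat zero_carrier_mat],
        use sq G G' H H' in simp)
  also have "G' * (B * G) = A" unfolding GA [symmetric] using G G' sq id
    by (simp flip: assoc_mult_mat[OF G' G sq(1)])
  also have "H * (B * G) = 0\<^sub>m c a"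
  proof -
    have "H * (B * G) = C * (H * G)"
      using assoc_mult_mat[OF H sq(2) G] assoc_mult_mat[OF sq(3) H G] HB by simp
    thus ?thesis using id sq by simp
  qed
  also have "H * (B * H') = C"
  proof -
    have "H * (B * H') = C * (H * H')"
      using assoc_mult_mat[OF H sq(2) H'] assoc_mult_mat[OF sq(3) H H'] HB by simp
    thus ?thesis using id sq by simp
  qed
  finally have QBP: "Q * B * P = four_block_mat A (G' * (B * H')) (0\<^sub>m c a) C"
    using assoc_mult_mat[OF Q sq(2) P] by simp
  let ?W = "G' * (B * H')"
  have W: "?W \<in> carrier_mat a c" using sq G' H' by auto
  let ?D = "\<lambda>M. det (pencil \<phi> u v M)"
  have "pencil \<phi> u v (four_block_mat A ?W (0\<^sub>m c a) C)
     = four_block_mat (pencil \<phi> u v A) (map_mat (\<lambda>x. - v * \<phi> x) ?W) (0\<^sub>m c a) (pencil \<phi> u v C)"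
    using sq W G' H' by (intro eq_matI) (auto simp: pencil_def)
  hence "?D (Q * B * P) = ?D A * ?D C"
    unfolding QBP using sq W by (simp only:) (rule det_four_block_mat_lower_left_zero[of _ a _ c], auto)
  moreover have "?D (Q * B * P) = ?D B"
  proof -
    have c: "map_mat \<phi> Q \<in> carrier_mat b b" "pencil \<phi> u v B \<in> carrier_mat b b"
        "map_mat \<phi> P \<in> carrier_mat b b"
      using P Q sq by auto
    have "?D (Q * B * P) = det (map_mat \<phi> Q) * ?D B * det (map_mat \<phi> P)"
      unfolding pencil_mult[OF \<phi> Q sq(2) P QP, symmetric]
        det_mult[OF mult_carrier_mat[OF c(1,2)] c(3)] det_mult[OF c(1,2)] ..
    also have "\<dots> = ?D B * (det (map_mat \<phi> Q) * det (map_mat \<phi> P))" by (simp only: mult_ac)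
    also have "det (map_mat \<phi> Q) * det (map_mat \<phi> P) = det (map_mat \<phi> (Q * P))"
      unfolding det_mult[OF c(1,3), symmetric] mat_hom_mult[OF Q P] ..
    also have "\<dots> = 1" unfolding QP mat_hom_one by simp
    finally show ?thesis by simp
  qed
  ultimately show ?thesis by simp
qed

lemma char_poly_split:
  assumes "endo_split A B (C :: 'k::field mat)"
  shows "char_poly B = char_poly A * char_poly C"
  using assms det_pencil_split[OF comm_ring_hom_const_poly assms]
  unfolding endo_split_def by (auto simp: char_poly_pencil)

lemma det_series_split:
  assumes "endo_split A B (C :: 'k::field mat)"
  shows "det_series B = det_series A * det_series C"
  using assms det_pencil_split[OF comm_ring_hom_fps_const assms]
  unfolding endo_split_def by (auto simp: det_series_pencil)

section \<open>Devissage to eigenvalues\<close>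

definition mat1 :: "'k \<Rightarrow> 'k mat" where
  "mat1 \<alpha> = Matrix.mat 1 1 (\<lambda>_. \<alpha>)"

lemma mat1_carrier: "mat1 \<alpha> \<in> carrier_mat 1 1"
  by (simp add: mat1_def)

lemmas [simp] = mat1_carrier[unfolded One_nat_def]

lemma mat_mult_entry:
  "A \<in> carrier_mat n m \<Longrightarrow> B \<in> carrier_mat m l \<Longrightarrow> i < n \<Longrightarrow> j < l \<Longrightarrow>
    (A * B) $$ (i, j) = (\<Sum>k = 0..<m. A $$ (i, k) * B $$ (k, j))"
  by (simp add: scalar_prod_def)

text \<open>An eigenvector \<open>w\<close> with \<open>w\<^sub>i \<noteq> 0\<close> spans the sub-object; the quotient is spanned by the
  other coordinates, after subtracting the multiple of \<open>w\<close> that kills the \<open>i\<close>-th one.\<close>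

lemma eigenvector_split:
  fixes A :: "'k::field mat"
  assumes A: "A \<in> carrier_mat d d" and d: "d > 0" and w: "w \<in> carrier_vec d" "w \<noteq> 0\<^sub>v d" and Aw:
      "A *\<^sub>v w = \<alpha> \<cdot>\<^sub>v w"
  obtains A' where "A' \<in> carrier_mat (d - 1) (d - 1)" "endo_split (mat1 \<alpha>) A A'"
proof -
  obtain i where i: "i < d" "vec_index w i \<noteq> 0"
    using w eq_vecI[of w "0\<^sub>v d"] by auto
  define skip where "skip j = (if j < i then j else Suc j)" for j
  have skip: "skip j \<noteq> i" "j < d - 1 \<Longrightarrow> skip j < d" for j by (auto simp: skip_def)
  have skip_eq [simp]: "skip j = skip k \<longleftrightarrow> j = k" for j k by (auto simp: skip_def)
  define G where "G = Matrix.mat d 1 (\<lambda>(r, _). vec_index w r)"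
  define G' where "G' = Matrix.mat 1 d (\<lambda>(_, s). if s = i then inverse (vec_index w i) else 0)"
  define H' where "H' = Matrix.mat d (d - 1) (\<lambda>(r, s). if r = skip s then 1 else (0::'k))"
  define H where "H = Matrix.mat (d - 1) d (\<lambda>(r, s). (if s = skip r then 1 else 0) -
     (if s = i then vec_index w (skip r) / vec_index w i else 0))"
  have c: "G \<in> carrier_mat d 1" "G' \<in> carrier_mat 1 d" "H \<in> carrier_mat (d - 1) d"
      "H' \<in> carrier_mat d (d - 1)"
    by (simp_all add: G_def G'_def H_def H'_def)
  have entries:
    "r < d \<Longrightarrow> G $$ (r, 0) = vec_index w r"
    "r < d \<Longrightarrow> G' $$ (0, r) = (if r = i then inverse (vec_index w i) else 0)"
    "r < d \<Longrightarrow> s < d - 1 \<Longrightarrow> H' $$ (r, s) = (if r = skip s then 1 else 0)"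
    "r < d - 1 \<Longrightarrow> s < d \<Longrightarrow> H $$ (r, s) = (if s = skip r then 1 else 0) -
       (if s = i then vec_index w (skip r) / vec_index w i else 0)" for r s
    by (simp_all add: G_def G'_def H_def H'_def)
  have 1: "G' * G = 1\<^sub>m 1"
  proof (rule eq_matI)
    fix r s assume "r < dim_row (1\<^sub>m 1)" "s < dim_col (1\<^sub>m 1)"
    hence rs: "r = 0" "s = 0" by auto
    have z: "(0::nat) < 1" by simp
    have "(G' * G) $$ (0, 0) = (\<Sum>k = 0..<d. if k = i then inverse (vec_index w k) * vec_index w k
        else 0)"
      by (subst mat_mult_entry[OF c(2,1) z z], rule sum.cong) (auto simp: entries)
    also have "\<dots> = 1" using i by simp
    finally show "(G' * G) $$ (r, s) = 1\<^sub>m 1 $$ (r, s)" using rs by simp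
  qed (use c in auto)
  have 2: "H * H' = 1\<^sub>m (d - 1)"
  proof (rule eq_matI)
    fix r s assume "r < dim_row (1\<^sub>m (d - 1))" "s < dim_col (1\<^sub>m (d - 1))"
    hence rs: "r < d - 1" "s < d - 1" by auto
    have "(H * H') $$ (r, s) = (\<Sum>k = 0..<d. if k = skip s then H $$ (r, k) else 0)"
      by (subst mat_mult_entry[OF c(3,4) rs], rule sum.cong) (use rs in \<open>auto simp: entries\<close>)
    also have "\<dots> = H $$ (r, skip s)" using skip(2)[OF rs(2)] by simp
    finally show "(H * H') $$ (r, s) = 1\<^sub>m (d - 1) $$ (r, s)"
      using rs skip(1)[of s] skip(2)[OF rs(2)] by (auto simp: entries)
  qed (use c in auto)
  have 3: "H * G = 0\<^sub>m (d - 1) 1"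
  proof (rule eq_matI)
    fix r s assume "r < dim_row (0\<^sub>m (d - 1) 1 :: 'k mat)" "s < dim_col (0\<^sub>m (d - 1) 1 :: 'k mat)"
    hence rs: "r < d - 1" "s = 0" by auto
    have "(H * G) $$ (r, 0) = (\<Sum>k = 0..<d. (if k = skip r then vec_index w k else 0) -
        (if k = i then vec_index w (skip r) / vec_index w i * vec_index w k else 0))"
      by (subst mat_mult_entry[OF c(3,1) rs(1)], simp, rule sum.cong)
          (use rs in \<open>auto simp: entries left_diff_distrib\<close>)
    also have "\<dots> = 0" unfolding sum_subtractf
      using i skip(2)[OF rs(1)] by simp
    finally show "(H * G) $$ (r, s) = 0\<^sub>m (d - 1) 1 $$ (r, s)" using rs by simp
  qed (use c in auto)
  have 4: "G' * H' = 0\<^sub>m 1 (d - 1)"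
  proof (rule eq_matI)
    fix r s assume "r < dim_row (0\<^sub>m 1 (d - 1) :: 'k mat)" "s < dim_col (0\<^sub>m 1 (d - 1) :: 'k mat)"
    hence rs: "r = 0" "s < d - 1" by auto
    have "(G' * H') $$ (0, s) = (\<Sum>k = 0..<d. 0)"
      by (subst mat_mult_entry[OF c(2,4) _ rs(2)], simp, rule sum.cong)
          (use rs skip(1)[of s] in \<open>auto simp: entries\<close>)
    thus "(G' * H') $$ (r, s) = 0\<^sub>m 1 (d - 1) $$ (r, s)" using rs by simp
  qed (use c in auto)
  have 5: "G * G' + H' * H = 1\<^sub>m d"
  proof (rule eq_matI)
    fix r s assume "r < dim_row (1\<^sub>m d)" "s < dim_col (1\<^sub>m d)"
    hence rs: "r < d" "s < d" by auto
    have gg: "(G * G') $$ (r, s) = (if s = i then vec_index w r / vec_index w i else 0)"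
      by (subst mat_mult_entry[OF c(1,2) rs]) (simp add: entries rs divide_inverse)
    have hh: "(H' * H) $$ (r, s) = (\<Sum>k = 0..<d - 1. (if r = skip k then H $$ (k, s) else 0))"
      by (subst mat_mult_entry[OF c(4,3) rs], rule sum.cong) (use rs in \<open>auto simp: entries\<close>)
    have "(H' * H) $$ (r, s) = (if r = s then 1 else 0) - (if s
        = i then vec_index w r / vec_index w i else 0)"
    proof (cases "r = i")
      case True
      have "(\<Sum>k = 0..<d - 1. (if r = skip k then H $$ (k, s) else 0)) = 0"
        by (rule sum.neutral) (use True skip in auto)
      thus ?thesis unfolding hh using True i by auto
    next
      case False
      define k where "k = (if r < i then r else r - 1)"
      have k: "r = skip k" "k < d - 1" using False rs i by (auto simp: k_def skip_def)
      have "(\<Sum>k = 0..<d - 1. (if r = skip k then H $$ (k, s) else 0)) = (\<Sum>j = 0..<d - 1. (if j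
          = k then H $$ (j, s) else 0))"
        by (rule sum.cong) (auto simp: k)
      also have "\<dots> = H $$ (k, s)" using k by simp
      finally show ?thesis unfolding hh using k rs skip(1)[of k] by (simp add: entries)
    qed
    thus "(G * G' + H' * H) $$ (r, s) = 1\<^sub>m d $$ (r, s)" using gg rs c by simp
  qed (use c in auto)
  have AG: "G * mat1 \<alpha> = A * G"
  proof (rule eq_matI)
    fix r s assume "r < dim_row (A * G)" "s < dim_col (A * G)"
    hence rs: "r < d" "s = 0" using A c by auto
    have "(A * G) $$ (r, s) = vec_index (A *\<^sub>v w) r"
      using rs A w by (simp add: G_def scalar_prod_def)
    thus "(G * mat1 \<alpha>) $$ (r, s) = (A * G) $$ (r, s)"
      using rs w unfolding Aw by (simp add: G_def mat1_def scalar_prod_def mult.commute)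
  qed (use A c in \<open>auto simp: mat1_def\<close>)
  define A' where "A' = H * A * H'"
  have A': "A' \<in> carrier_mat (d - 1) (d - 1)" using A c by (simp add: A'_def)
  have "H * A * (G * G' + H' * H) = H * A * (G * G') + H * A * (H' * H)"
    by (rule mult_add_distrib_mat[of _ "d - 1" d _ d]) (use A c in auto)
  also have "H * A * (G * G') = H * (A * G) * G'"
    by (simp only: assoc_mult_mat[OF mult_carrier_mat[OF c(3) A] c(1,2),
        symmetric] assoc_mult_mat[OF c(3) A c(1)])
  also have "H * (A * G) = H * G * mat1 \<alpha>" unfolding AG [symmetric]
    by (rule assoc_mult_mat[OF c(3,1) mat1_carrier, symmetric])
  also have "H * G * mat1 \<alpha> * G' = 0\<^sub>m (d - 1) d" unfolding 3
    by (simp only: left_mult_zero_mat[OF mat1_carrier] left_mult_zero_mat[OF c(2)])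
  also have "H * A * (H' * H) = A' * H" unfolding A'_def
    by (simp only: assoc_mult_mat[OF mult_carrier_mat[OF c(3) A] c(4,3)])
  finally have "H * A = A' * H" unfolding 5 using A c A' by simp
  moreover have "splitting 1 d (d - 1) G G' H H'" unfolding splitting_def using c 1 2 3 4 5 by blast
  ultimately have "endo_split (mat1 \<alpha>) A A'" unfolding endo_split_def using A A' AG
      by (blast intro: mat1_carrier)
  thus ?thesis by (rule that[OF A'])
qed

text \<open>The field being algebraically closed, a non-empty matrix has an eigenvector, whose line is a
  sub-object; induction applies to the quotient.\<close>

lemma devissage [consumes 1, case_names empty extend]:
  fixes A :: "'k::alg_closed_field mat"
  assumes "A \<in> carrier_mat d d"
    and "\<And>A. A \<in> carrier_mat 0 0 \<Longrightarrow> P A"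
    and "\<And>\<alpha> A A' d. A \<in> carrier_mat d d \<Longrightarrow> A' \<in> carrier_mat (d - 1) (d - 1) \<Longrightarrow>
        endo_split (mat1 \<alpha>) A A' \<Longrightarrow> P A' \<Longrightarrow> P A"
  shows "P A"
  using assms(1)
proof (induction d arbitrary: A)
  case 0
  thus ?case by (rule assms(2))
next
  case (Suc d)
  have "Polynomial.degree (char_poly A) = Suc d" using degree_monic_char_poly[OF Suc.prems] by simp
  then obtain \<alpha> where "poly (char_poly A) \<alpha> = 0" using alg_closed_imp_poly_has_root[of
      "char_poly A"] by auto
  hence "eigenvalue A \<alpha>" by (simp add: eigenvalue_root_char_poly[OF Suc.prems])
  then obtain w where w: "w \<in> carrier_vec (Suc d)" "w \<noteq> 0\<^sub>v (Suc d)" "A *\<^sub>v w = \<alpha> \<cdot>\<^sub>v w"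
    using Suc.prems unfolding eigenvalue_def eigenvector_def by auto
  obtain A' where A': "A' \<in> carrier_mat d d" "endo_split (mat1 \<alpha>) A A'"
    using eigenvector_split[OF Suc.prems _ w] by auto
  show ?case by (rule assms(3)[OF Suc.prems _ A'(2)]) (use A' Suc.IH in auto)
qed

section \<open>Kronecker products, powers and the Verschiebung of matrices\<close>

lemma sum_div_mod:
  fixes f :: "nat \<Rightarrow> nat \<Rightarrow> 'a::comm_monoid_add"
  shows "(\<Sum>k = 0..<b * d. f (k div d) (k mod d)) = (\<Sum>i = 0..<b. \<Sum>j = 0..<d. f i j)"
proof -
  have "(\<Sum>i = 0..<b. \<Sum>j = 0..<d. f i j) = (\<Sum>(i, j)\<in>{0..<b} \<times> {0..<d}. f i j)"
    by (rule sum.cartesian_product)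
  also have "\<dots> = (\<Sum>k = 0..<b * d. f (k div d) (k mod d))"
  proof (rule sum.reindex_bij_witness[of _ "\<lambda>k. (k div d, k mod d)" "\<lambda>(i, j). i * d + j"])
    fix x assume x: "x \<in> {0..<b} \<times> {0..<d}"
    then obtain i j where ij: "x = (i, j)" "i < b" "j < d" by auto
    have "Suc i * d \<le> b * d" using ij by (intro mult_le_mono1) simp
    thus "(case x of (i, j) \<Rightarrow> i * d + j) \<in> {0..<b * d}" using ij by simp
    show "((case x of (i, j) \<Rightarrow> i * d + j) div d, (case x of (i, j) \<Rightarrow> i * d + j) mod d) = x" using ij
        by simp
    show "f ((case x of (i, j) \<Rightarrow> i * d + j) div d) ((case x of (i, j) \<Rightarrow> i * d + j) mod d)
        = (case x of (i, j) \<Rightarrow> f i j)"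
      using ij by simp
  next
    fix k assume k: "k \<in> {0..<b * d}"
    hence "d > 0" by (auto intro: Nat.gr0I)
    thus "(k div d, k mod d) \<in> {0..<b} \<times> {0..<d}" using k by (auto simp: less_mult_imp_div_less)
    show "(case (k div d, k mod d) of (i, j) \<Rightarrow> i * d + j) = k" by simp
  qed
  finally show ?thesis by simp
qed

lemma div_mod_less: "i < a * c \<Longrightarrow> i div c < a \<and> i mod c < (c::nat)"
  by (cases "c = 0") (auto simp: less_mult_imp_div_less)

lemma kronecker_carrier [simp]:
  "A \<in> carrier_mat a b \<Longrightarrow> B \<in> carrier_mat c d \<Longrightarrow> kronecker A B \<in> carrier_mat (a * c) (b * d)"
  by (auto simp: kronecker_def)

lemma kronecker_entry:
  "A \<in> carrier_mat a b \<Longrightarrow> B \<in> carrier_mat c d \<Longrightarrow> i < a * c \<Longrightarrow> j < b * d \<Longrightarrow>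
    kronecker A B $$ (i, j) = A $$ (i div c, j div d) * B $$ (i mod c, j mod d)"
  by (auto simp: kronecker_def)

lemma kronecker_mult:
  fixes A :: "'k::comm_ring_1 mat"
  assumes A: "A \<in> carrier_mat a b" and B: "B \<in> carrier_mat c d" and A': "A' \<in> carrier_mat b e"
      and B': "B' \<in> carrier_mat d f"
  shows "kronecker A B * kronecker A' B' = kronecker (A * A') (B * B')"
proof (rule eq_matI)
  note K = kronecker_carrier[OF A B] and K' = kronecker_carrier[OF A' B']
  note AA = mult_carrier_mat[OF A A'] and BB = mult_carrier_mat[OF B B']
  note KK = kronecker_carrier[OF AA BB]
  fix i j assume "i < dim_row (kronecker (A * A') (B * B'))" "j < dim_col (kronecker (A * A') (B * B'))"
  hence ij: "i < a * c" "j < e * f" using KK by auto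
  note di = div_mod_less[OF ij(1)] and dj = div_mod_less[OF ij(2)]
  have "(kronecker A B * kronecker A' B') $$ (i, j) = (\<Sum>k = 0..<b * d. kronecker A B $$ (i,
      k) * kronecker A' B' $$ (k, j))"
    by (rule mat_mult_entry[OF K K' ij])
  also have "\<dots> = (\<Sum>k = 0..<b * d. (\<lambda>k l. (A $$ (i div c, k) * B $$ (i mod c, l)) * (A' $$ (k,
      j div f) * B' $$ (l, j mod f))) (k div d) (k mod d))"
    by (rule sum.cong) (use ij in \<open>auto simp: kronecker_entry[OF A B] kronecker_entry[OF A' B']\<close>)
  also have "\<dots> = (\<Sum>k = 0..<b. \<Sum>l = 0..<d. (A $$ (i div c, k) * B $$ (i mod c, l)) * (A' $$ (k,
      j div f) * B' $$ (l, j mod f)))"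
    by (rule sum_div_mod)
  also have "\<dots> = (\<Sum>k = 0..<b. A $$ (i div c, k) * A' $$ (k, j div f)) * (\<Sum>l = 0..<d. B $$ (i mod c,
      l) * B' $$ (l, j mod f))"
    unfolding sum_product by (intro sum.cong) (auto simp: mult_ac)
  also have "\<dots> = (A * A') $$ (i div c, j div f) * (B * B') $$ (i mod c, j mod f)"
    using di dj by (simp only: mat_mult_entry[OF A A'] mat_mult_entry[OF B B'])
  also have "\<dots> = kronecker (A * A') (B * B') $$ (i, j)"
    by (rule kronecker_entry[OF AA BB ij, symmetric])
  finally show "(kronecker A B * kronecker A' B') $$ (i, j) = kronecker (A * A') (B * B') $$ (i, j)" .
qed (use assms in \<open>auto simp: kronecker_def\<close>)

lemma kronecker_one: "kronecker (1\<^sub>m a) (1\<^sub>m b) = (1\<^sub>m (a * b) :: 'k::comm_ring_1 mat)"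
proof (rule eq_matI)
  fix i j assume "i < dim_row (1\<^sub>m (a * b) :: 'k mat)" "j < dim_col (1\<^sub>m (a * b) :: 'k mat)"
  hence ij: "i < a * b" "j < a * b" by auto
  have "i = j" if "i div b = j div b" "i mod b = j mod b" using that by (metis div_mod_decomp)
  thus "kronecker (1\<^sub>m a) (1\<^sub>m b) $$ (i, j) = (1\<^sub>m (a * b) :: 'k mat) $$ (i, j)"
    using ij div_mod_less[OF ij(1)] div_mod_less[OF ij(2)]
    by (auto simp: kronecker_entry[OF one_carrier_mat one_carrier_mat])
qed (auto simp: kronecker_def)

lemma kronecker_zero:
  "B \<in> carrier_mat c d \<Longrightarrow> kronecker (0\<^sub>m a b) B = (0\<^sub>m (a * c) (b * d) :: 'k::comm_ring_1 mat)"
  "A \<in> carrier_mat a b \<Longrightarrow> kronecker A (0\<^sub>m c d) = (0\<^sub>m (a * c) (b * d) :: 'k::comm_ring_1 mat)"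
  by (rule eq_matI; auto simp: kronecker_def div_mod_less)+

lemma kronecker_add:
  fixes A :: "'k::comm_ring_1 mat"
  shows "A \<in> carrier_mat a b \<Longrightarrow> A' \<in> carrier_mat a b \<Longrightarrow> B \<in> carrier_mat c d \<Longrightarrow>
      kronecker (A + A') B = kronecker A B + kronecker A' B" (is "_ \<Longrightarrow> _ \<Longrightarrow> _ \<Longrightarrow> ?L")
    and "A \<in> carrier_mat a b \<Longrightarrow> B \<in> carrier_mat c d \<Longrightarrow> B' \<in> carrier_mat c d \<Longrightarrow>
      kronecker A (B + B') = kronecker A B + kronecker A B'" (is "_ \<Longrightarrow> _ \<Longrightarrow> _ \<Longrightarrow> ?R")
proof -
  have d: "i mod c < c" if "i < a * c" for i a c :: nat using div_mod_less[OF that] ..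
  show ?L if "A \<in> carrier_mat a b" "A' \<in> carrier_mat a b" "B \<in> carrier_mat c d"
    using that by (intro eq_matI) (auto simp: kronecker_def div_mod_less d algebra_simps)
  show ?R if "A \<in> carrier_mat a b" "B \<in> carrier_mat c d" "B' \<in> carrier_mat c d"
    using that by (intro eq_matI) (auto simp: kronecker_def div_mod_less d[of _ a] d[of _ b]
        algebra_simps)
qed

lemma kronecker_assoc:
  fixes A :: "'k::comm_ring_1 mat"
  shows "kronecker (kronecker A B) C = kronecker A (kronecker B C)"
proof -
  obtain a b c d e f where A: "A \<in> carrier_mat a b" and B: "B \<in> carrier_mat c d" and C:
      "C \<in> carrier_mat e f" by blast
  note AB = kronecker_carrier[OF A B] and BC = kronecker_carrier[OF B C]
  note L = kronecker_carrier[OF AB C] and R = kronecker_carrier[OF A BC]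
  show ?thesis
  proof (rule eq_matI)
    fix i j assume "i < dim_row (kronecker A (kronecker B C))"
        "j < dim_col (kronecker A (kronecker B C))"
    hence ij': "i < a * (c * e)" "j < b * (d * f)" using R by auto
    hence ij: "i < a * c * e" "j < b * d * f" by (simp_all add: mult_ac)
    note d = div_mod_less[OF ij(1)] div_mod_less[OF ij(2)] div_mod_less[OF ij'(1)] div_mod_less[OF
        ij'(2)]
    have m: "x mod (y * z) div z = x div z mod y" for x y z :: nat
      by (cases "z = 0") (simp_all add: mod_mult2_eq mult.commute[of y z])
    have m': "x mod (y * z) mod z = x mod z" for x y z :: nat by (simp add: mod_mod_cancel)
    have m'': "x div (y * z) = x div z div y" for x y z :: nat by
        (simp add: div_mult2_eq mult.commute[of y z])
    note d' = d[THEN conjunct1] d[THEN conjunct2]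
    have "kronecker (kronecker A B) C $$ (i, j) = kronecker A B $$ (i div e,
        j div f) * C $$ (i mod e, j mod f)"
      by (rule kronecker_entry[OF AB C ij])
    also have "kronecker A B $$ (i div e, j div f) = A $$ (i div e div c,
        j div f div d) * B $$ (i div e mod c, j div f mod d)"
      by (rule kronecker_entry[OF A B d'(1,2)])
    finally have l: "kronecker (kronecker A B) C $$ (i, j) = \<dots> * C $$ (i mod e, j mod f)" .
    have "kronecker A (kronecker B C) $$ (i, j) = A $$ (i div (c * e),
        j div (d * f)) * kronecker B C $$ (i mod (c * e), j mod (d * f))"
      by (rule kronecker_entry[OF A BC ij'])
    also have "kronecker B C $$ (i mod (c * e), j mod (d * f)) =
       B $$ (i mod (c * e) div e, j mod (d * f) div f) * C $$ (i mod (c * e) mod e, j mod (d * f) mod f)"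
      by (rule kronecker_entry[OF B C d'(7,8)])
    finally show "kronecker (kronecker A B) C $$ (i, j) = kronecker A (kronecker B C) $$ (i, j)"
      unfolding l by (simp only: m m' m'' mult.assoc)
  qed (use L R in \<open>auto simp: mult_ac\<close>)
qed

lemma kronecker_unit:
  fixes A :: "'k::comm_ring_1 mat"
  shows "kronecker (1\<^sub>m 1) A = A" "kronecker A (1\<^sub>m 1) = A"
proof -
  obtain a b where A: "A \<in> carrier_mat a b" by blast
  have "kronecker (1\<^sub>m 1) A $$ (i, j) = A $$ (i, j)" "kronecker A (1\<^sub>m 1) $$ (i, j) = A $$ (i, j)"
      if "i < a" "j < b" for i j
    using that kronecker_entry[OF one_carrier_mat A, of i 1 j] kronecker_entry[OF A one_carrier_mat,
        of i 1 j] by simp_all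
  thus "kronecker (1\<^sub>m 1) A = A" "kronecker A (1\<^sub>m 1) = A"
    using A by (auto intro!: eq_matI simp: kronecker_def)
qed

lemma splitting_kronecker:
  fixes G :: "'k::comm_ring_1 mat"
  assumes "splitting a b c G G' H H'"
  shows "splitting (a * n) (b * n) (c * n) (kronecker G (1\<^sub>m n)) (kronecker G' (1\<^sub>m n)) (kronecker H
      (1\<^sub>m n)) (kronecker H' (1\<^sub>m n))"
    and "splitting (n * a) (n * b) (n * c) (kronecker (1\<^sub>m n) G) (kronecker (1\<^sub>m n) G') (kronecker
        (1\<^sub>m n) H) (kronecker (1\<^sub>m n) H')"
proof -
  from assms have G: "G \<in> carrier_mat b a" and G': "G' \<in> carrier_mat a b"
    and H: "H \<in> carrier_mat c b" and H': "H' \<in> carrier_mat b c"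
    and id: "G' * G = 1\<^sub>m a" "H * H' = 1\<^sub>m c" "G * G' + H' * H = 1\<^sub>m b" "H * G = 0\<^sub>m c a" "G' * H'
        = 0\<^sub>m a c"
    unfolding splitting_def by blast+
  note I = one_carrier_mat[of n, where 'a = 'k]
  have II: "1\<^sub>m n * 1\<^sub>m n = (1\<^sub>m n :: 'k mat)" by simp
  note mult1 = kronecker_mult[OF G' I G I] kronecker_mult[OF H I H' I] kronecker_mult[OF G I G' I]
    kronecker_mult[OF H' I H I] kronecker_mult[OF H I G I] kronecker_mult[OF G' I H' I]
  note mult2 = kronecker_mult[OF I G' I G] kronecker_mult[OF I H I H'] kronecker_mult[OF I G I G']
    kronecker_mult[OF I H' I H] kronecker_mult[OF I H I G] kronecker_mult[OF I G' I H']
  note GG = mult_carrier_mat[OF G G'] mult_carrier_mat[OF H' H]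
  show "splitting (a * n) (b * n) (c * n) (kronecker G (1\<^sub>m n)) (kronecker G' (1\<^sub>m n)) (kronecker H
      (1\<^sub>m n)) (kronecker H' (1\<^sub>m n))"
    unfolding splitting_def mult1 II id kronecker_add(1)[OF GG I,
        symmetric] kronecker_one kronecker_zero(1)[OF I]
    using G G' H H' by simp
  show "splitting (n * a) (n * b) (n * c) (kronecker (1\<^sub>m n) G) (kronecker (1\<^sub>m n) G') (kronecker
      (1\<^sub>m n) H) (kronecker (1\<^sub>m n) H')"
    unfolding splitting_def mult2 II id kronecker_add(2)[OF I GG,
        symmetric] kronecker_one kronecker_zero(2)[OF I]
    using G G' H H' by simp
qed

lemma endo_splitE:
  assumes "endo_split A B C"
  obtains a b c G G' H H' where "A \<in> carrier_mat a a" "B \<in> carrier_mat b b" "C \<in> carrier_mat c c"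
    "G \<in> carrier_mat b a" "H \<in> carrier_mat c b"
    "splitting a b c G G' H H'" "G * A = B * G" "H * B = C * H"
proof -
  from assms obtain a b c G G' H H' where *: "A \<in> carrier_mat a a" "B \<in> carrier_mat b b"
      "C \<in> carrier_mat c c"
    "splitting a b c G G' H H'" "G * A = B * G" "H * B = C * H"
    unfolding endo_split_def by (elim exE conjE) (rule that)
  from *(4) have "G \<in> carrier_mat b a" "H \<in> carrier_mat c b" unfolding splitting_def by blast+
  with * show ?thesis by (intro that)
qed

lemma endo_splitI:
  assumes "A \<in> carrier_mat a a" "B \<in> carrier_mat b b" "C \<in> carrier_mat c c"
    "splitting a b c G G' H H'" "G * A = B * G" "H * B = C * H"
  shows "endo_split A B C"
  unfolding endo_split_def using assms by (intro exI conjI)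

lemma endo_split_kronecker:
  fixes A B C D :: "'k::comm_ring_1 mat"
  assumes "endo_split A B C" and D: "D \<in> carrier_mat n n"
  shows "endo_split (kronecker A D) (kronecker B D) (kronecker C D)"
    and "endo_split (kronecker D A) (kronecker D B) (kronecker D C)"
proof -
  obtain a b c G G' H H' where *: "A \<in> carrier_mat a a" "B \<in> carrier_mat b b" "C \<in> carrier_mat c c"
    "G \<in> carrier_mat b a" "H \<in> carrier_mat c b"
    "splitting a b c G G' H H'" "G * A = B * G" "H * B = C * H"
    by (rule endo_splitE[OF assms(1)])
  note I = one_carrier_mat[of n, where 'a = 'k]
  have DI: "D * 1\<^sub>m n = D" "1\<^sub>m n * D = D" using D by auto
  show "endo_split (kronecker A D) (kronecker B D) (kronecker C D)"
    by (rule endo_splitI[OF _ _ _ splitting_kronecker(1)[OF *(6), of n]])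
       (use * D in \<open>simp_all add: kronecker_mult[OF *(4) I *(1) D] kronecker_mult[OF *(2) D *(4) I]
         kronecker_mult[OF *(5) I *(2) D] kronecker_mult[OF *(3) D *(5) I] DI\<close>)
  show "endo_split (kronecker D A) (kronecker D B) (kronecker D C)"
    by (rule endo_splitI[OF _ _ _ splitting_kronecker(2)[OF *(6), of n]])
       (use * D in \<open>simp_all add: kronecker_mult[OF I *(4) D *(1)] kronecker_mult[OF D *(2) I *(4)]
         kronecker_mult[OF I *(5) D *(2)] kronecker_mult[OF D *(3) I *(5)] DI\<close>)
qed

lemma intertwine_pow:
  fixes G :: "'k::comm_ring_1 mat"
  assumes "G \<in> carrier_mat b a" "A \<in> carrier_mat a a" "B \<in> carrier_mat b b" "G * A = B * G"
  shows "G * (A ^\<^sub>m n) = (B ^\<^sub>m n) * G"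
proof (induction n)
  case 0
  thus ?case using assms by simp
next
  case (Suc n)
  have c: "A ^\<^sub>m n \<in> carrier_mat a a" "B ^\<^sub>m n \<in> carrier_mat b b" using assms by auto
  have "G * (A ^\<^sub>m Suc n) = G * (A ^\<^sub>m n) * A" using assoc_mult_mat[OF assms(1) c(1) assms(2)] by simp
  also have "\<dots> = (B ^\<^sub>m n) * (G * A)" unfolding Suc by (rule assoc_mult_mat[OF c(2) assms(1,2)])
  also have "\<dots> = (B ^\<^sub>m Suc n) * G" unfolding assms(4) using assoc_mult_mat[OF c(2) assms(3,1)] by simp
  finally show ?case .
qed

lemma endo_split_pow:
  fixes A B C :: "'k::comm_ring_1 mat"
  assumes "endo_split A B C"
  shows "endo_split (A ^\<^sub>m n) (B ^\<^sub>m n) (C ^\<^sub>m n)"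
proof -
  obtain a b c G G' H H' where *: "A \<in> carrier_mat a a" "B \<in> carrier_mat b b" "C \<in> carrier_mat c c"
    "G \<in> carrier_mat b a" "H \<in> carrier_mat c b"
    "splitting a b c G G' H H'" "G * A = B * G" "H * B = C * H"
    by (rule endo_splitE[OF assms(1)])
  show ?thesis
    by (rule endo_splitI[OF _ _ _ *(6)])
       (use * intertwine_pow[OF *(4,1,2,7)] intertwine_pow[OF *(5,2,3,8)] in auto)
qed

definition shift_mat :: "nat \<Rightarrow> 'k::comm_ring_1 mat" where
  "shift_mat n = Matrix.mat n n (\<lambda>(i, j). if i = Suc j then 1 else 0)"

definition corner_mat :: "nat \<Rightarrow> 'k::comm_ring_1 mat" where
  "corner_mat n = Matrix.mat n n (\<lambda>(i, j). if i = 0 \<and> j = n - 1 then 1 else 0)"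

lemma verschiebung_carrier [simp]:
  "A \<in> carrier_mat d d \<Longrightarrow> verschiebung_mat n A \<in> carrier_mat (n * d) (n * d)"
  by (auto simp: verschiebung_mat_def Let_def)

text \<open>\<open>V\<^sub>n A = N \<otimes> 1 + E \<otimes> A\<close> with \<open>N\<close> the shift and \<open>E\<close> a matrix unit: in this form the
  Verschiebung visibly respects exact sequences.\<close>

lemma verschiebung_kronecker:
  fixes A :: "'k::field mat"
  assumes n: "n > 0" and A: "A \<in> carrier_mat d d"
  shows "verschiebung_mat n A = kronecker (shift_mat n) (1\<^sub>m d) + kronecker (corner_mat n) A"
proof (rule eq_matI)
  have S: "(shift_mat n :: 'k mat) \<in> carrier_mat n n" "(corner_mat n :: 'k mat) \<in> carrier_mat n n"
      by (simp_all add: shift_mat_def corner_mat_def)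
  fix i j assume "i < dim_row (kronecker (shift_mat n) (1\<^sub>m d) + kronecker (corner_mat n) A)"
    "j < dim_col (kronecker (shift_mat n) (1\<^sub>m d) + kronecker (corner_mat n) A)"
  hence ij: "i < n * d" "j < n * d" using A by (auto simp: kronecker_def corner_mat_def)
  note di = div_mod_less[OF ij(1)] and dj = div_mod_less[OF ij(2)]
  have d: "d > 0" using ij by (auto intro: Nat.gr0I)
  have R: "(kronecker (shift_mat n) (1\<^sub>m d) + kronecker (corner_mat n) A) $$ (i, j) =
     (if i div d = Suc (j div d) \<and> i mod d = j mod d then 1 else 0)
     + (if i div d = 0 \<and> j div d = n - 1 then A $$ (i mod d, j mod d) else 0)"
    using ij A S di dj by (simp add: kronecker_entry[OF S(1) one_carrier_mat] kronecker_entry[OF S(2) A])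
      (auto simp: shift_mat_def corner_mat_def kronecker_def)
  have L: "verschiebung_mat n A $$ (i, j) = (if i < d then (if (n - 1) * d \<le> j then A $$ (i,
      j - (n - 1) * d) else 0)
     else (if j = i - d then 1 else 0))"
    using ij A by (simp add: verschiebung_mat_def Let_def)
  show "verschiebung_mat n A $$ (i, j) = (kronecker (shift_mat n) (1\<^sub>m d) + kronecker (corner_mat n)
      A) $$ (i, j)"
  proof (cases "i < d")
    case True
    have top: "j div d = n - 1 \<longleftrightarrow> (n - 1) * d \<le> j"
    proof
      assume "j div d = n - 1"
      thus "(n - 1) * d \<le> j" by (metis div_times_less_eq_dividend)
    next
      assume "(n - 1) * d \<le> j"
      hence "n - 1 \<le> j div d" using d by (simp add: less_eq_div_iff_mult_less_eq)
      thus "j div d = n - 1" using dj n by linarith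
    qed
    have "j mod d = j - (n - 1) * d" if "(n - 1) * d \<le> j"
      using that top by (metis minus_div_mult_eq_mod)
    thus ?thesis unfolding L R using True top by auto
  next
    case False
    hence "i div d > 0" using d by (simp add: div_greater_zero_iff)
    moreover have "i div d = Suc (j div d) \<and> i mod d = j mod d \<longleftrightarrow> j = i - d"
    proof
      assume *: "i div d = Suc (j div d) \<and> i mod d = j mod d"
      have "i = Suc (j div d) * d + j mod d" using * by (metis div_mult_mod_eq)
      thus "j = i - d" by simp
    next
      assume "j = i - d"
      hence "i = j + d" using False by simp
      thus "i div d = Suc (j div d) \<and> i mod d = j mod d" using d by simp
    qed
    ultimately show ?thesis unfolding L R using False by auto
  qed
qed (use A in \<open>auto simp: verschiebung_mat_def kronecker_def corner_mat_def Let_def\<close>)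

lemma endo_split_verschiebung:
  fixes A B C :: "'k::field mat"
  assumes "endo_split A B C" and n: "n > 0"
  shows "endo_split (verschiebung_mat n A) (verschiebung_mat n B) (verschiebung_mat n C)"
proof -
  obtain a b c G G' H H' where *: "A \<in> carrier_mat a a" "B \<in> carrier_mat b b" "C \<in> carrier_mat c c"
    "G \<in> carrier_mat b a" "H \<in> carrier_mat c b"
    "splitting a b c G G' H H'" "G * A = B * G" "H * B = C * H"
    by (rule endo_splitE[OF assms(1)])
  have S: "(shift_mat n :: 'k mat) \<in> carrier_mat n n" "(corner_mat n :: 'k mat) \<in> carrier_mat n n"
      by (simp_all add: shift_mat_def corner_mat_def)
  have inter: "kronecker (1\<^sub>m n) G * verschiebung_mat n A = verschiebung_mat n B * kronecker (1\<^sub>m n) G"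
    if G: "G \<in> carrier_mat b a" and A: "A \<in> carrier_mat a a" and B: "B \<in> carrier_mat b b" and GA:
        "G * A = B * G"
    for G A B :: "'k mat" and a b
  proof -
    note I = one_carrier_mat[of n, where 'a = 'k] and Ia = one_carrier_mat[of a, where 'a = 'k]
        and Ib = one_carrier_mat[of b, where 'a = 'k]
    have "kronecker (1\<^sub>m n) G * verschiebung_mat n A
      = kronecker (1\<^sub>m n) G * kronecker (shift_mat n) (1\<^sub>m a) + kronecker (1\<^sub>m n) G * kronecker
          (corner_mat n) A"
      unfolding verschiebung_kronecker[OF n A]
      by (rule mult_add_distrib_mat[OF kronecker_carrier[OF I G] kronecker_carrier[OF S(1) Ia]
          kronecker_carrier[OF S(2) A]])
    also have "\<dots> = kronecker (shift_mat n) G + kronecker (corner_mat n) (B * G)"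
      unfolding kronecker_mult[OF I G S(1) Ia] kronecker_mult[OF I G S(2) A] GA using S G by simp
    also have "\<dots> = kronecker (shift_mat n) (1\<^sub>m b) * kronecker (1\<^sub>m n) G + kronecker (corner_mat n)
        B * kronecker (1\<^sub>m n) G"
      unfolding kronecker_mult[OF S(1) Ib I G] kronecker_mult[OF S(2) B I G] using S G by simp
    also have "\<dots> = verschiebung_mat n B * kronecker (1\<^sub>m n) G"
      unfolding verschiebung_kronecker[OF n B]
      by (rule add_mult_distrib_mat[OF kronecker_carrier[OF S(1) Ib] kronecker_carrier[OF S(2) B]
          kronecker_carrier[OF I G], symmetric])
    finally show ?thesis .
  qed
  show ?thesis
    by (rule endo_splitI[OF _ _ _ splitting_kronecker(2)[OF *(6), of n]])
       (use * in \<open>auto intro!: inter\<close>)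
qed

lemma kronecker_mat1: "kronecker (mat1 \<alpha>) (mat1 \<beta>) = mat1 (\<alpha> * \<beta> :: 'k::comm_ring_1)"
  by (rule eq_matI) (auto simp: kronecker_def mat1_def)

lemma pow_mat1: "mat1 \<alpha> ^\<^sub>m n = mat1 (\<alpha> ^ n :: 'k::comm_ring_1)"
proof (induction n)
  case 0
  show ?case by (rule eq_matI) (auto simp: mat1_def)
next
  case (Suc n)
  have "mat1 (\<alpha> ^ n) * mat1 \<alpha> = mat1 (\<alpha> ^ Suc n)"
    by (rule eq_matI) (auto simp: mat1_def scalar_prod_def mult.commute)
  thus ?case using Suc by simp
qed

lemma det_pencil_mat1: "det (pencil \<phi> u v (mat1 \<alpha>)) = u - v * \<phi> \<alpha>"
proof -
  have "det (pencil \<phi> u v (mat1 \<alpha>)) = pencil \<phi> u v (mat1 \<alpha>) $$ (0, 0)"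
    by (rule det_single) (rule pencil_carrier[OF mat1_carrier])
  thus ?thesis by (simp add: pencil_def mat1_def)
qed

text \<open>Laplace expansion along the last column, whose two non-zero entries have triangular minors.\<close>

lemma det_companion:
  fixes M :: "'r::comm_ring_1 mat"
  assumes M: "M \<in> carrier_mat n n" and n: "n \<ge> 2"
    and entry: "\<And>i j. i < n \<Longrightarrow> j < n \<Longrightarrow> M $$ (i, j) =
      (if i = j then u else 0) - (if i = 0 then (if j = n - 1 then w else 0) else if j
          = i - 1 then v else 0)"
  shows "det M = u ^ n - v ^ (n - 1) * w"
proof -
  obtain m where m: "n = Suc m" "m > 0" using n by (cases n) auto
  let ?U = "mat_delete M 0 m" and ?L = "mat_delete M m m"
  have U: "?U \<in> carrier_mat m m" and L: "?L \<in> carrier_mat m m"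
    using M m by (auto simp: mat_delete_def)
  have eU: "?U $$ (i, j) = (if Suc i = j then u else 0) - (if i = j then v else 0)" if "i < m"
      "j < m" for i j
    using that M m by (auto simp: mat_delete_def entry)
  have eL: "?L $$ (i, j) = (if i = j then u else 0) - (if i = Suc j then v else 0)" if "i < m"
      "j < m" for i j
    using that M m by (auto simp: mat_delete_def entry)
  have "det ?U = prod_list (diag_mat ?U)"
    by (rule det_upper_triangular[OF _ U]) (use U in \<open>auto simp: upper_triangular_def eU carrier_matD\<close>)
  also have "\<dots> = (\<Prod>i = 0..<m. - v)"
    unfolding prod_list_diag_prod using carrier_matD(1)[OF U] by (intro prod.cong)
        (auto simp only: atLeastLessThan_iff eU, auto)
  finally have dU: "det ?U = (- v) ^ m" by simp
  have "det ?L = prod_list (diag_mat ?L)"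
    by (rule det_lower_triangular[OF _ L]) (auto simp: eL)
  also have "\<dots> = (\<Prod>i = 0..<m. u)"
    unfolding prod_list_diag_prod using carrier_matD(1)[OF L] by (intro prod.cong)
        (auto simp only: atLeastLessThan_iff eL, auto)
  finally have dL: "det ?L = u ^ m" by simp
  have "det M = (\<Sum>i<n. M $$ (i, m) * cofactor M i m)"
    by (rule laplace_expansion_column[OF M]) (use m in simp)
  also have "\<dots> = (\<Sum>i\<in>{0, m}. M $$ (i, m) * cofactor M i m)"
    by (rule sum.mono_neutral_right) (use m in \<open>auto simp: entry\<close>)
  also have "\<dots> = M $$ (0, m) * cofactor M 0 m + M $$ (m, m) * cofactor M m m" using m by simp
  also have "cofactor M 0 m = (-1) ^ m * (- v) ^ m" by (simp add: cofactor_def dU)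
  also have "\<dots> = v ^ m" by (simp flip: power_mult_distrib)
  also have "cofactor M m m = u ^ m" by (simp add: cofactor_def dL)
  also have "M $$ (0, m) = - w" using m by (simp add: entry)
  also have "M $$ (m, m) = u" using m by (simp add: entry)
  finally show ?thesis using m by (simp add: mult.commute)
qed

text \<open>\<open>V\<^sub>n (\<alpha>)\<close> is the companion matrix of \<open>X\<^sup>n - \<alpha>\<close>; its characteristic polynomial and determinant
  series are the two specializations of the following pencil.\<close>

lemma verschiebung_mat1_carrier: "verschiebung_mat n (mat1 \<alpha>) \<in> carrier_mat n n"
  using verschiebung_carrier[OF mat1_carrier, of n \<alpha>] by simp

lemma det_pencil_verschiebung_mat1:
  fixes \<phi> :: "'k::field \<Rightarrow> 'r::idom"
  assumes \<phi>: "comm_ring_hom \<phi>" and n: "n > 0"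
  shows "det (pencil \<phi> u v (verschiebung_mat n (mat1 \<alpha>))) = u ^ n - v ^ n * \<phi> \<alpha>"
proof (cases "n = 1")
  case True
  have "verschiebung_mat 1 (mat1 \<alpha>) = mat1 \<alpha>" by (rule eq_matI)
      (auto simp: verschiebung_mat_def mat1_def Let_def)
  thus ?thesis using True by (simp add: det_pencil_mat1)
next
  case False
  interpret comm_ring_hom \<phi> by fact
  have "det (pencil \<phi> u v (verschiebung_mat n (mat1 \<alpha>))) = u ^ n - v ^ (n - 1) * (v * \<phi> \<alpha>)"
    by (rule det_companion[OF pencil_carrier[OF verschiebung_mat1_carrier]])
       (use n False in \<open>auto simp: pencil_def verschiebung_mat_def mat1_def Let_def\<close>)
  thus ?thesis using n by (cases n) (simp_all add: mult_ac)
qed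

lemma char_poly_mat1: "char_poly (mat1 \<alpha>) = [:- \<alpha>, 1:]"
  unfolding char_poly_pencil[OF mat1_carrier] det_pencil_mat1 by simp

lemma det_series_mat1: "det_series (mat1 \<alpha>) = 1 - fps_const \<alpha> * fps_X"
  unfolding det_series_pencil[OF mat1_carrier] det_pencil_mat1 by (simp add: mult.commute)

lemma char_poly_verschiebung_mat1:
  fixes \<alpha> :: "'k::field"
  assumes "n > 0" shows "char_poly (verschiebung_mat n (mat1 \<alpha>)) = Polynomial.monom 1 n - [:\<alpha>:]"
  unfolding char_poly_pencil[OF verschiebung_mat1_carrier] det_pencil_verschiebung_mat1[OF
      comm_ring_hom_const_poly assms]
  by (simp add: monom_altdef)

lemma det_series_verschiebung_mat1:
  fixes \<alpha> :: "'k::field"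
  assumes "n > 0" shows "det_series (verschiebung_mat n (mat1 \<alpha>)) = 1 - fps_const \<alpha> * fps_X ^ n"
  unfolding det_series_pencil[OF verschiebung_mat1_carrier] det_pencil_verschiebung_mat1[OF
      comm_ring_hom_fps_const assms]
  by (simp add: mult.commute)

section \<open>The group \<open>\<rat>/\<int>\<close>\<close>

lemma qz_of_rat_surj: "\<exists>q. \<gamma> = qz_of_rat q"
  by transfer (metis Ints_0 diff_self)

lemma qz_of_rat_eq_iff: "qz_of_rat q = qz_of_rat q' \<longleftrightarrow> q - q' \<in> \<int>"
  by transfer simp

lemma qz_of_rat_0: "qz_of_rat 0 = 0" by transfer simp

lemma qz_of_rat_eq_0_iff: "qz_of_rat q = 0 \<longleftrightarrow> q \<in> \<int>"
  using qz_of_rat_eq_iff[of q 0] by (simp add: qz_of_rat_0)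

lemma qz_scale_of_rat: "qz_scale n (qz_of_rat q) = qz_of_rat (of_nat n * q)"
  by transfer simp

lemma qz_scale_add: "qz_scale n (\<gamma> + \<delta>) = qz_scale n \<gamma> + qz_scale n \<delta>"
  by transfer (simp add: distrib_left)

lemma qz_scale_0_right [simp]: "qz_scale n 0 = 0"
  by transfer simp

lemma qz_scale_diff: "qz_scale n (\<gamma> - \<delta>) = qz_scale n \<gamma> - qz_scale n \<delta>"
  using qz_scale_add[of n "\<gamma> - \<delta>" \<delta>] by simp

lemma qz_scale_0 [simp]: "qz_scale 0 \<gamma> = 0"
  by transfer simp

lemma qz_scale_1 [simp]: "qz_scale (Suc 0) \<gamma> = \<gamma>"
  by transfer simp

lemma qz_scale_plus: "qz_scale (m + n) \<gamma> = qz_scale m \<gamma> + qz_scale n \<gamma>"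
  by transfer (simp add: distrib_right)

lemma qz_scale_scale: "qz_scale m (qz_scale n \<gamma>) = qz_scale (m * n) \<gamma>"
  by transfer (simp add: mult.assoc)

lemma qz_scale_commute: "qz_scale m (qz_scale n \<gamma>) = qz_scale n (qz_scale m \<gamma>)"
  by (simp add: qz_scale_scale mult.commute)

lemma qz_divisible: "n > 0 \<Longrightarrow> \<exists>\<delta>. qz_scale n \<delta> = \<gamma>"
proof -
  assume n: "n > 0"
  obtain q where q: "\<gamma> = qz_of_rat q" using qz_of_rat_surj by blast
  have "qz_scale n (qz_of_rat (q / of_nat n)) = \<gamma>" using n by (simp add: qz_scale_of_rat q)
  thus ?thesis by blast
qed

lemma qz_scale_eq_0_iff:
  assumes n: "n > 0" shows "qz_scale n \<gamma> = 0 \<longleftrightarrow> (\<exists>a. \<gamma> = qz_frac a n)"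
proof
  assume "qz_scale n \<gamma> = 0"
  moreover obtain q where q: "\<gamma> = qz_of_rat q" using qz_of_rat_surj by blast
  ultimately have "of_nat n * q \<in> \<int>" by (simp add: qz_scale_of_rat qz_of_rat_eq_0_iff)
  then obtain a where "of_nat n * q = of_int a" by (elim Ints_cases)
  hence "q = of_int a / of_nat n" using n by (simp add: field_simps)
  thus "\<exists>a. \<gamma> = qz_frac a n" using q by (auto simp: qz_frac_def)
next
  assume "\<exists>a. \<gamma> = qz_frac a n"
  thus "qz_scale n \<gamma> = 0" using n by (auto simp: qz_frac_def qz_scale_of_rat qz_of_rat_eq_0_iff)
qed

lemma qz_torsion: "\<exists>n>0. qz_scale n \<gamma> = 0"
proof -
  obtain q where q: "\<gamma> = qz_of_rat q" using qz_of_rat_surj by blast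
  obtain a b where ab: "q = of_int a / of_int b" "b > 0"
    using quotient_of_div quotient_of_denom_pos by (metis surj_pair)
  have "qz_scale (nat b) \<gamma> = 0" using ab q by (simp add: qz_scale_of_rat qz_of_rat_eq_0_iff)
  thus ?thesis using ab by (intro exI[of _ "nat b"]) simp
qed

lemma qz_torsion_card:
  assumes n: "n > 0" shows "finite {\<gamma>. qz_scale n \<gamma> = 0}" "card {\<gamma>. qz_scale n \<gamma> = 0} = n"
proof -
  let ?f = "\<lambda>a. qz_frac (int a) n"
  have inj: "inj_on ?f {0..<n}"
  proof (rule inj_onI)
    fix a b assume ab: "a \<in> {0..<n}" "b \<in> {0..<n}" "?f a = ?f b"
    have "of_int (int a) / of_nat n - of_int (int b) / (of_nat n :: rat) \<in> \<int>"
      using ab(3) unfolding qz_frac_def qz_of_rat_eq_iff .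
    then obtain k where "of_int (int a) / of_nat n - of_int (int b) / (of_nat n :: rat) = of_int k"
        by (elim Ints_cases)
    hence "((of_int (int a) - of_int (int b)) / of_nat n :: rat) = of_int k" by
        (simp add: diff_divide_distrib)
    hence "(of_int (int a) - of_int (int b) :: rat) = of_int k * of_nat n" using n by
        (simp add: divide_eq_eq)
    hence "(of_int (int a - int b) :: rat) = of_int (k * int n)" by simp
    hence e: "int a - int b = k * int n" by (simp only: of_int_eq_iff)
    hence "int a mod int n = int b mod int n" by (simp add: mod_eq_dvd_iff)
    thus "a = b" using ab by (simp flip: zmod_int)
  qed
  have "{\<gamma>. qz_scale n \<gamma> = 0} = ?f ` {0..<n}"
  proof (intro equalityI subsetI)
    fix \<gamma> assume "\<gamma> \<in> {\<gamma>. qz_scale n \<gamma> = 0}"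
    then obtain a where a: "\<gamma> = qz_frac a n" using qz_scale_eq_0_iff[OF n] by auto
    define q r where "q = a div int n" and "r = a mod int n"
    have "a = int n * q + r" by (simp add: q_def r_def)
    hence "(of_int a :: rat) - of_int r = of_int q * of_nat n" by simp
    hence "(of_int a :: rat) - of_int (a mod int n) = of_int (a div int n) * of_nat n" by
        (simp only: q_def r_def)
    hence "(of_int a - of_int (a mod int n)) / (of_nat n :: rat) = of_int (a div int n)"
      using n by (simp add: divide_eq_eq)
    hence "of_int a / of_nat n - of_int (a mod int n) / (of_nat n :: rat) = of_int (a div int n)"
      by (simp only: diff_divide_distrib)
    hence "qz_frac a n = qz_frac (a mod int n) n"
      unfolding qz_frac_def qz_of_rat_eq_iff by simp
    also have "\<dots> = ?f (nat (a mod int n))" using n by simp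
    finally show "\<gamma> \<in> ?f ` {0..<n}" using a n by (intro image_eqI[of _ _ "nat (a mod int n)"])
        (auto simp: nat_less_iff)
  qed (use qz_scale_eq_0_iff[OF n] in auto)
  thus "finite {\<gamma>. qz_scale n \<gamma> = 0}" "card {\<gamma>. qz_scale n \<gamma> = 0} = n"
    using card_image[OF inj] by simp_all
qed

lemma qz_fibre_translate:
  assumes "qz_scale n \<delta> = \<gamma>" shows "{\<gamma>'. qz_scale n \<gamma>' = \<gamma>} = (\<lambda>x. x + \<delta>) ` {x. qz_scale n x = 0}"
proof (intro equalityI subsetI)
  fix \<gamma>' assume "\<gamma>' \<in> {\<gamma>'. qz_scale n \<gamma>' = \<gamma>}"
  thus "\<gamma>' \<in> (\<lambda>x. x + \<delta>) ` {x. qz_scale n x = 0}"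
    using assms by (intro image_eqI[of _ _ "\<gamma>' - \<delta>"]) (auto simp: qz_scale_diff)
qed (use assms in \<open>auto simp: qz_scale_add\<close>)

lemma qz_fibre_card:
  assumes n: "n > 0" shows "finite {\<gamma>'. qz_scale n \<gamma>' = \<gamma>}" "card {\<gamma>'. qz_scale n \<gamma>' = \<gamma>} = n"
proof -
  obtain \<delta> where d: "qz_scale n \<delta> = \<gamma>" using qz_divisible[OF n] by blast
  have inj: "inj_on (\<lambda>x. x + \<delta>) {x. qz_scale n x = 0}" by (auto intro: inj_onI)
  show "finite {\<gamma>'. qz_scale n \<gamma>' = \<gamma>}" "card {\<gamma>'. qz_scale n \<gamma>' = \<gamma>} = n"
    unfolding qz_fibre_translate[OF d] using qz_torsion_card[OF n] card_image[OF inj] by simp_all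
qed

lemma qz_coprime_torsion:
  assumes "coprime m n" "qz_scale m \<gamma> = 0" "qz_scale n \<gamma> = 0" shows "\<gamma> = 0"
proof (cases "m = 0")
  case False
  then obtain x y where xy: "m * x = n * y + 1" using bezout_nat[of m n] assms(1) by auto
  have "qz_scale (x * m) \<gamma> = qz_scale (y * n) \<gamma> + \<gamma>"
    using qz_scale_plus[of "n * y" 1 \<gamma>] xy by (simp add: mult.commute)
  thus ?thesis using assms(2,3) by (simp flip: qz_scale_scale)
qed (use assms in auto)

locale char_prime =
  fixes p :: nat
  assumes prime: "Factorial_Ring.prime p"
begin

lemma p_pos [simp]: "p > 0" using prime by (rule prime_gt_0_nat)

lemma p_split: "n > 0 \<Longrightarrow> \<exists>a m. n = p ^ a * m \<and> m \<in> I_prime_to p"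
proof -
  assume n: "n > 0"
  obtain a m where am: "n = p ^ a * m" "\<not> p dvd m" by (rule split_prime_power[OF prime n])
  have "coprime m p" using prime_imp_coprime[OF prime am(2)] by (simp only: coprime_commute)
  moreover have "m > 0" using am(1) n by (auto intro: Nat.gr0I)
  ultimately show ?thesis using am(1) by (auto simp: I_prime_to_def)
qed

lemma I_prime_to_mult: "m \<in> I_prime_to p \<Longrightarrow> n \<in> I_prime_to p \<Longrightarrow> m * n \<in> I_prime_to p"
  by (auto simp: I_prime_to_def)

lemma I_prime_to_1 [simp]: "Suc 0 \<in> I_prime_to p"
  by (simp add: I_prime_to_def)

lemma I_prime_to_pos: "n \<in> I_prime_to p \<Longrightarrow> n > 0"
  by (simp add: I_prime_to_def)

lemma qz_prime_to_iff: "\<gamma> \<in> qz_prime_to p \<longleftrightarrow> (\<exists>n\<in>I_prime_to p. qz_scale n \<gamma> = 0)"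
  unfolding qz_prime_to_def using qz_scale_eq_0_iff by (auto simp: I_prime_to_def)

lemma qz_p_part_iff: "\<gamma> \<in> qz_p_part p \<longleftrightarrow> (\<exists>k. qz_scale (p ^ k) \<gamma> = 0)"
proof -
  have "qz_scale (p ^ k) \<gamma> = 0 \<longleftrightarrow> (\<exists>a. \<gamma> = qz_frac a (p ^ k))" for k
    by (rule qz_scale_eq_0_iff) simp
  thus ?thesis unfolding qz_p_part_def by auto
qed

lemma qz_prime_to_add:
  assumes "\<gamma> \<in> qz_prime_to p" "\<delta> \<in> qz_prime_to p" shows "\<gamma> + \<delta> \<in> qz_prime_to p" "\<gamma> - \<delta> \<in> qz_prime_to p"
proof -
  from assms obtain m n where mn: "m \<in> I_prime_to p" "qz_scale m \<gamma> = 0" "n \<in> I_prime_to p"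
      "qz_scale n \<delta> = 0"
    unfolding qz_prime_to_iff by blast
  have "qz_scale (n * m) \<gamma> = 0" "qz_scale (m * n) \<delta> = 0" using mn by (simp_all flip: qz_scale_scale)
  thus "\<gamma> + \<delta> \<in> qz_prime_to p" "\<gamma> - \<delta> \<in> qz_prime_to p"
    unfolding qz_prime_to_iff using mn
    by (auto intro!: bexI[of _ "m * n"] simp: qz_scale_add qz_scale_diff I_prime_to_mult mult.commute)
qed

lemma qz_p_part_add:
  assumes "\<gamma> \<in> qz_p_part p" "\<delta> \<in> qz_p_part p" shows "\<gamma> + \<delta> \<in> qz_p_part p" "\<gamma> - \<delta> \<in> qz_p_part p"
proof -
  from assms obtain m n where mn: "qz_scale (p ^ m) \<gamma> = 0" "qz_scale (p ^ n) \<delta> = 0"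
    unfolding qz_p_part_iff by blast
  have "qz_scale (p ^ n * p ^ m) \<gamma> = 0" "qz_scale (p ^ m * p ^ n) \<delta> = 0" using mn by
      (simp_all flip: qz_scale_scale)
  thus "\<gamma> + \<delta> \<in> qz_p_part p" "\<gamma> - \<delta> \<in> qz_p_part p"
    unfolding qz_p_part_iff
    by (auto intro!: exI[of _ "m + n"] simp: qz_scale_add qz_scale_diff power_add mult.commute)
qed

lemma qz_prime_to_scale: "\<gamma> \<in> qz_prime_to p \<Longrightarrow> qz_scale n \<gamma> \<in> qz_prime_to p"
  unfolding qz_prime_to_iff by (metis qz_scale_scale mult.commute qz_scale_0_right)

lemma qz_p_part_scale: "\<gamma> \<in> qz_p_part p \<Longrightarrow> qz_scale n \<gamma> \<in> qz_p_part p"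
  unfolding qz_p_part_iff by (metis qz_scale_scale mult.commute qz_scale_0_right)

lemma qz_prime_to_p_part:
  assumes "\<gamma> \<in> qz_prime_to p" "\<gamma> \<in> qz_p_part p" shows "\<gamma> = 0"
proof -
  from assms obtain m k where mk: "m \<in> I_prime_to p" "qz_scale m \<gamma> = 0" "qz_scale (p ^ k) \<gamma> = 0"
    unfolding qz_prime_to_iff qz_p_part_iff by blast
  have "coprime m (p ^ k)" using mk(1) by (simp add: I_prime_to_def)
  thus ?thesis using mk(2,3) by (rule qz_coprime_torsion)
qed

lemma qz_decompose: "\<exists>\<gamma>'. \<gamma>' \<in> qz_prime_to p \<and> \<gamma> - \<gamma>' \<in> qz_p_part p"
proof -
  obtain n where n: "n > 0" "qz_scale n \<gamma> = 0" using qz_torsion by blast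
  obtain a m where am: "n = p ^ a * m" "m \<in> I_prime_to p" using p_split[OF n(1)] by blast
  have "coprime (p ^ a) m" using am(2) by (simp add: I_prime_to_def coprime_commute)
  then obtain x y where xy: "p ^ a * x = m * y + 1" using bezout_nat[of "p ^ a" m] by auto
  let ?g = "qz_scale (p ^ a * x) \<gamma>"
  have "qz_scale m ?g = qz_scale x (qz_scale n \<gamma>)" unfolding qz_scale_scale am(1) by (simp add: mult_ac)
  hence 1: "?g \<in> qz_prime_to p" unfolding qz_prime_to_iff using am(2) n(2) by auto
  have "?g = qz_scale (m * y) \<gamma> + \<gamma>" unfolding xy qz_scale_plus by simp
  hence "qz_scale (p ^ a) (?g - \<gamma>) = qz_scale y (qz_scale n \<gamma>)" unfolding am(1) by
      (simp add: qz_scale_scale mult_ac)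
  hence "?g - \<gamma> \<in> qz_p_part p" unfolding qz_p_part_iff using n(2) by auto
  moreover have "0 \<in> qz_p_part p" unfolding qz_p_part_iff by auto
  ultimately have "0 - (?g - \<gamma>) \<in> qz_p_part p" by (rule qz_p_part_add(2)[rotated])
  thus ?thesis using 1 by (intro exI[of _ ?g]) simp
qed

lemma qz_decompose_unique:
  assumes "\<gamma>1 \<in> qz_prime_to p" "\<gamma> - \<gamma>1 \<in> qz_p_part p" "\<gamma>2 \<in> qz_prime_to p" "\<gamma> - \<gamma>2 \<in> qz_p_part p"
  shows "\<gamma>1 = \<gamma>2"
proof -
  have "\<gamma>1 - \<gamma>2 \<in> qz_prime_to p" using assms by (simp add: qz_prime_to_add)
  moreover have "\<gamma>1 - \<gamma>2 \<in> qz_p_part p" using qz_p_part_add(2)[OF assms(4,2)] by simp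
  ultimately show ?thesis using qz_prime_to_p_part by fastforce
qed

lemma qz_proj: "qz_proj p \<gamma> \<in> qz_prime_to p" "\<gamma> - qz_proj p \<gamma> \<in> qz_p_part p"
proof -
  have "\<exists>!\<gamma>'. \<gamma>' \<in> qz_prime_to p \<and> \<gamma> - \<gamma>' \<in> qz_p_part p"
    using qz_decompose qz_decompose_unique by blast
  from theI'[OF this] show "qz_proj p \<gamma> \<in> qz_prime_to p" "\<gamma> - qz_proj p \<gamma> \<in> qz_p_part p"
    unfolding qz_proj_def by blast+
qed

lemma qz_proj_eqI: "\<gamma>' \<in> qz_prime_to p \<Longrightarrow> \<gamma> - \<gamma>' \<in> qz_p_part p \<Longrightarrow> qz_proj p \<gamma> = \<gamma>'"
  using qz_decompose_unique qz_proj by blast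

lemma qz_0_mem [simp]: "0 \<in> qz_prime_to p" "0 \<in> qz_p_part p"
  unfolding qz_prime_to_iff qz_p_part_iff by (auto intro!: exI[of _ "Suc 0"])

lemma qz_proj_id: "\<gamma> \<in> qz_prime_to p \<Longrightarrow> qz_proj p \<gamma> = \<gamma>"
  by (rule qz_proj_eqI) auto

lemma qz_proj_add: "qz_proj p (\<gamma> + \<delta>) = qz_proj p \<gamma> + qz_proj p \<delta>"
proof (rule qz_proj_eqI)
  have "\<gamma> + \<delta> - (qz_proj p \<gamma> + qz_proj p \<delta>) = (\<gamma> - qz_proj p \<gamma>) + (\<delta> - qz_proj p \<delta>)" by simp
  thus "\<gamma> + \<delta> - (qz_proj p \<gamma> + qz_proj p \<delta>) \<in> qz_p_part p" using qz_proj qz_p_part_add by metis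
qed (simp add: qz_proj qz_prime_to_add)

lemma qz_proj_scale: "qz_proj p (qz_scale n \<gamma>) = qz_scale n (qz_proj p \<gamma>)"
  by (rule qz_proj_eqI) (simp_all add: qz_proj qz_prime_to_scale qz_p_part_scale flip: qz_scale_diff)

lemma qz_proj_eq_iff: "qz_proj p \<gamma> = qz_proj p \<delta> \<longleftrightarrow> \<gamma> - \<delta> \<in> qz_p_part p"
proof
  assume "qz_proj p \<gamma> = qz_proj p \<delta>"
  hence "\<gamma> - \<delta> = (\<gamma> - qz_proj p \<gamma>) - (\<delta> - qz_proj p \<delta>)" by simp
  thus "\<gamma> - \<delta> \<in> qz_p_part p" using qz_proj qz_p_part_add by metis
next
  assume "\<gamma> - \<delta> \<in> qz_p_part p"
  moreover have "\<gamma> - qz_proj p \<delta> = (\<gamma> - \<delta>) + (\<delta> - qz_proj p \<delta>)" by simp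
  ultimately have "\<gamma> - qz_proj p \<delta> \<in> qz_p_part p" using qz_proj qz_p_part_add by metis
  thus "qz_proj p \<gamma> = qz_proj p \<delta>" by (intro qz_proj_eqI qz_proj)
qed

end

section \<open>Roots of unity in the residue field\<close>

lemma proots_linear_factors: "proots (\<Prod>x\<in>#A. [:- x, 1:]) = (A :: 'a::idom multiset)"
proof (induction A)
  case (add a A)
  have "(\<Prod>x\<in>#A. [:- x, 1:]) \<noteq> 0" by (auto simp: prod_mset_zero_iff)
  thus ?case using add by (simp add: proots_mult del: mult_pCons_left)
qed simp

locale residue_character = char_prime p for p +
  fixes \<sigma> :: "'k::alg_closed_field \<Rightarrow> qz"
  assumes char: "CHAR('k) = p"
    and \<sigma>_mult: "\<And>x y. x \<noteq> 0 \<Longrightarrow> y \<noteq> 0 \<Longrightarrow> \<sigma> (x * y) = \<sigma> x + \<sigma> y"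
    and \<sigma>_inj: "inj_on \<sigma> (UNIV - {0})"
begin

lemma of_nat_p: "(of_nat p :: 'k) = 0"
  using of_nat_CHAR[where 'a = 'k] by (simp add: char)

lemma of_nat_prime_to: "n \<in> I_prime_to p \<Longrightarrow> (of_nat n :: 'k) \<noteq> 0"
proof
  assume n: "n \<in> I_prime_to p" and "(of_nat n :: 'k) = 0"
  hence "p dvd n" by (simp add: of_nat_eq_0_iff_char_dvd char)
  hence "p dvd 1" using n by (auto simp: I_prime_to_def coprime_common_divisor)
  thus False using prime by (simp add: prime_nat_iff)
qed

lemma frobenius_diff: "(x - y :: 'k) ^ p = x ^ p - y ^ p"
proof -
  have "(x - y + y) ^ p = (x - y) ^ p + y ^ p"
    by (rule freshmans_dream) (simp_all only: char prime)
  thus ?thesis by (simp add: eq_diff_eq)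
qed

lemma frobenius_inj: "x ^ p = y ^ p \<Longrightarrow> x = (y :: 'k)"
  using frobenius_diff[of x y] by simp

lemma frobenius_power_inj: "x ^ (p ^ a) = y ^ (p ^ a) \<Longrightarrow> x = (y :: 'k)"
  by (induction a) (auto simp: power_mult mult.commute[of p] dest: frobenius_inj)

lemma \<sigma>_1 [simp]: "\<sigma> 1 = 0"
  using \<sigma>_mult[of 1 1] by simp

lemma \<sigma>_power: "x \<noteq> 0 \<Longrightarrow> \<sigma> (x ^ n) = qz_scale n (\<sigma> x)"
  by (induction n) (simp_all add: \<sigma>_mult qz_scale_plus[of 1, simplified])

lemma \<sigma>_eq_0: "x \<noteq> 0 \<Longrightarrow> \<sigma> x = 0 \<Longrightarrow> x = 1"
  using \<sigma>_inj by (auto dest: inj_onD[of _ _ x 1])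

lemma \<sigma>_prime_to:
  assumes x: "x \<noteq> 0" shows "\<sigma> x \<in> qz_prime_to p"
proof -
  obtain n where n: "n > 0" "qz_scale n (\<sigma> x) = 0" using qz_torsion by blast
  obtain a m where am: "n = p ^ a * m" "m \<in> I_prime_to p" using p_split[OF n(1)] by blast
  have "\<sigma> (x ^ n) = 0" using n(2) by (simp add: \<sigma>_power x)
  hence "x ^ n = 1" using x by (intro \<sigma>_eq_0) auto
  hence "(x ^ m) ^ (p ^ a) = 1 ^ (p ^ a)" by (simp add: am(1) mult.commute flip: power_mult)
  hence "x ^ m = 1" by (rule frobenius_power_inj)
  hence "qz_scale m (\<sigma> x) = 0" using \<sigma>_power[OF x, of m] by simp
  thus ?thesis unfolding qz_prime_to_iff using am(2) by blast
qed

text \<open>\<open>X\<^sup>n - 1\<close> has no multiple root, since \<open>n\<close> is invertible in \<open>k\<close>.\<close>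

lemma card_roots_of_unity:
  assumes n: "n \<in> I_prime_to p" shows "card {x::'k. x ^ n = 1} = n" "finite {x::'k. x ^ n = 1}"
proof -
  have n0: "n > 0" using n by (rule I_prime_to_pos)
  let ?P = "Polynomial.monom 1 n - 1 :: 'k poly"
  have deg: "Polynomial.degree ?P = n"
  proof -
    have "Polynomial.degree (Polynomial.monom 1 n + (- 1) :: 'k poly)
        = Polynomial.degree (Polynomial.monom 1 n :: 'k poly)"
      by (rule degree_add_eq_left) (use n0 in \<open>simp add: degree_monom_eq\<close>)
    thus ?thesis by (simp add: degree_monom_eq)
  qed
  hence P0: "?P \<noteq> 0" using n0 by auto
  obtain A c where A: "size A = n" "?P = Polynomial.smult c (\<Prod>x\<in>#A. [:-x, 1:])" and c: "c \<noteq> 0"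
  proof -
    obtain A where *: "size A = Polynomial.degree ?P" "?P
        = Polynomial.smult (Polynomial.lead_coeff ?P) (\<Prod>x\<in>#A. [:-x, 1:])"
      using alg_closed_imp_factorization[OF P0] by blast
    show thesis
    proof (rule that[OF _ *(2)])
      show "size A = n" using *(1) deg by (simp only:)
      show "Polynomial.lead_coeff ?P \<noteq> 0" using P0 by (simp only: leading_coeff_0_iff not_False_eq_True)
    qed
  qed
  have roots: "{x. x ^ n = 1} = set_mset A"
  proof -
    have "proots ?P = A"
      unfolding A(2) using c by (simp add: proots_linear_factors)
    hence "set_mset A = {x. poly ?P x = 0}" using set_count_proots[OF P0] by simp
    thus ?thesis by (auto simp: poly_monom)
  qed
  have "count A x \<le> 1" for x
  proof (rule ccontr)
    assume "\<not> count A x \<le> 1"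
    hence "{#x, x#} \<subseteq># A" by (auto simp: subseteq_mset_def)
    then obtain B where B: "A = add_mset x (add_mset x B)" by (auto simp: mset_subset_eq_exists_conv)
    define Q where "Q = Polynomial.smult c (\<Prod>x\<in>#B. [:-x, 1:])"
    have P: "?P = [:-x, 1:] * ([:-x, 1:] * Q)" by (subst A(2)) (simp add: B Q_def)
    have "poly (pderiv ?P) x = 0" unfolding P pderiv_mult by (simp add: pderiv_pCons)
    hence "of_nat n * x ^ (n - 1) = 0" by (simp add: pderiv_diff pderiv_monom poly_monom)
    moreover have "x \<noteq> 0"
    proof
      assume "x = 0"
      moreover have "x ^ n = 1" using roots B by auto
      ultimately show False using n0 by (simp add: zero_power)
    qed
    ultimately show False using of_nat_prime_to[OF n] by simp
  qed
  hence "A = mset_set (set_mset A)"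
    by (metis (no_types, lifting) count_mset_set' dual_order.antisym finite_set_mset multiset_eqI
        not_in_iff
        One_nat_def Suc_leI count_greater_zero_iff)
  hence "card (set_mset A) = n" using A(1) by (metis size_mset_set)
  thus "card {x::'k. x ^ n = 1} = n" "finite {x::'k. x ^ n = 1}" unfolding roots by auto
qed

text \<open>A count: \<open>k\<close> has exactly \<open>n\<close> roots of unity of order dividing \<open>n\<close>, and \<open>\<rat>/\<int>\<close> exactly \<open>n\<close>
  elements of order dividing \<open>n\<close>.\<close>

lemma \<sigma>_surj:
  assumes "\<gamma> \<in> qz_prime_to p" shows "\<exists>x. x \<noteq> 0 \<and> \<sigma> x = \<gamma>"
proof -
  obtain n where n: "n \<in> I_prime_to p" "qz_scale n \<gamma> = 0" using assms unfolding qz_prime_to_iff by blast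
  have n0: "n > 0" using n(1) by (rule I_prime_to_pos)
  let ?R = "{x::'k. x ^ n = 1}"
  have R0: "x \<noteq> 0" if "x \<in> ?R" for x using that n0 by (auto simp: zero_power)
  have "card (\<sigma> ` ?R) = n"
    using card_roots_of_unity[OF n(1)] R0 by (subst card_image) (auto intro: inj_on_subset[OF \<sigma>_inj])
  moreover have "\<sigma> ` ?R \<subseteq> {\<gamma>. qz_scale n \<gamma> = 0}"
    using \<sigma>_power R0 by (auto simp flip: \<sigma>_power)
  ultimately have "\<sigma> ` ?R = {\<gamma>. qz_scale n \<gamma> = 0}"
    using qz_torsion_card[OF n0] by (intro card_subset_eq) auto
  hence "\<gamma> \<in> \<sigma> ` ?R" using n(2) by simp
  then obtain x where "x \<in> ?R" "\<gamma> = \<sigma> x" by blast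
  thus ?thesis using R0 by blast
qed

text \<open>The inverse of \<open>\<sigma>\<close>, extended to a character of all of \<open>\<rat>/\<int>\<close> that is trivial on the \<open>p\<close>-part.\<close>

definition chi :: "qz \<Rightarrow> 'k" where
  "chi \<gamma> = sigma_inv \<sigma> (qz_proj p \<gamma>)"

lemma sigma_inv:
  assumes "\<gamma> \<in> qz_prime_to p" shows "sigma_inv \<sigma> \<gamma> \<noteq> 0" "\<sigma> (sigma_inv \<sigma> \<gamma>) = \<gamma>"
proof -
  have "\<gamma> \<in> \<sigma> ` (UNIV - {0})" using \<sigma>_surj[OF assms] by auto
  thus "sigma_inv \<sigma> \<gamma> \<noteq> 0" "\<sigma> (sigma_inv \<sigma> \<gamma>) = \<gamma>"
    unfolding sigma_inv_def using inv_into_into[of \<gamma> \<sigma> "UNIV - {0}"] f_inv_into_f[of \<gamma> \<sigma>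
        "UNIV - {0}"] by blast+
qed

lemma sigma_inv_sigma: "x \<noteq> 0 \<Longrightarrow> sigma_inv \<sigma> (\<sigma> x) = x"
  unfolding sigma_inv_def using \<sigma>_inj by (simp add: inv_into_f_f)

lemma chi_nonzero [simp]: "chi \<gamma> \<noteq> 0"
  unfolding chi_def by (rule sigma_inv(1)[OF qz_proj(1)])

lemma sigma_chi: "\<sigma> (chi \<gamma>) = qz_proj p \<gamma>"
  unfolding chi_def by (rule sigma_inv(2)[OF qz_proj(1)])

lemma chi_sigma: "x \<noteq> 0 \<Longrightarrow> chi (\<sigma> x) = x"
  by (simp add: chi_def qz_proj_id \<sigma>_prime_to sigma_inv_sigma)

lemma chi_eq_iff: "chi \<gamma> = chi \<delta> \<longleftrightarrow> qz_proj p \<gamma> = qz_proj p \<delta>"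
proof
  assume "chi \<gamma> = chi \<delta>"
  from arg_cong[OF this, of \<sigma>] show "qz_proj p \<gamma> = qz_proj p \<delta>" by (simp only: sigma_chi)
qed (simp add: chi_def)

lemma chi_eqI: "x \<noteq> 0 \<Longrightarrow> \<sigma> x = qz_proj p \<gamma> \<Longrightarrow> chi \<gamma> = x"
  unfolding chi_def using sigma_inv_sigma[of x] by simp

lemma chi_add: "chi (\<gamma> + \<delta>) = chi \<gamma> * chi \<delta>"
  by (rule chi_eqI) (simp_all add: \<sigma>_mult sigma_chi qz_proj_add)

lemma chi_scale: "chi (qz_scale n \<gamma>) = chi \<gamma> ^ n"
  by (rule chi_eqI) (simp_all add: \<sigma>_power sigma_chi qz_proj_scale)

text \<open>The fibres of multiplication by \<open>n\<close> on \<open>\<rat>/\<int>\<close> parametrise the \<open>n\<close>-th roots in the residue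
  field with their multiplicities: for \<open>n\<close> prime to \<open>p\<close> the roots are distinct, and for \<open>n = p\<close>
  the \<open>p\<close> points of a fibre all give the unique \<open>p\<close>-th root.\<close>

lemma root_polynomial_prime_to:
  assumes n: "n \<in> I_prime_to p"
  shows "Polynomial.monom 1 n - [:chi \<gamma>:] = (\<Prod>\<gamma>' | qz_scale n \<gamma>' = \<gamma>. [:- chi \<gamma>', 1:])"
proof -
  have n0: "n > 0" using n by (rule I_prime_to_pos)
  let ?S = "{\<gamma>'. qz_scale n \<gamma>' = \<gamma>}" and ?P = "Polynomial.monom 1 n - [:chi \<gamma>:]"
  let ?Q = "\<Prod>\<gamma>'\<in>?S. [:- chi \<gamma>', 1:]"
  have inj: "inj_on chi ?S"
  proof (rule inj_onI)
    fix x y assume xy: "x \<in> ?S" "y \<in> ?S" "chi x = chi y"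
    hence "x - y \<in> qz_p_part p" by (simp add: chi_eq_iff qz_proj_eq_iff)
    moreover have "qz_scale n (x - y) = 0" using xy by (simp add: qz_scale_diff)
    hence "x - y \<in> qz_prime_to p" unfolding qz_prime_to_iff using n by blast
    ultimately have "x - y = 0" by (intro qz_prime_to_p_part)
    thus "x = y" by simp
  qed
  have degQ: "Polynomial.degree ?Q = n"
    using qz_fibre_card(2)[OF n0, of \<gamma>] by (simp add: degree_prod_eq_sum_degree)
  have leadQ: "Polynomial.lead_coeff ?Q = 1" unfolding lead_coeff_prod by simp
  have degP: "Polynomial.degree ?P = n"
  proof -
    have "?P = Polynomial.monom 1 n + [:- chi \<gamma>:]" by simp
    moreover have "Polynomial.degree (Polynomial.monom 1 n + [:- chi \<gamma>:])
        = Polynomial.degree (Polynomial.monom 1 n :: 'k poly)"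
      by (rule degree_add_eq_left) (use n0 in \<open>simp add: degree_monom_eq\<close>)
    ultimately show ?thesis by (simp only: degree_monom_eq[OF one_neq_zero])
  qed
  have leadP: "poly.coeff ?P n = 1" using n0 by (cases n) simp_all
  show ?thesis
  proof (rule ccontr)
    assume neq: "?P \<noteq> ?Q"
    have "Polynomial.degree (?P - ?Q) \<le> n" using degP degQ by (metis degree_diff_le order_refl)
    moreover have "poly.coeff (?P - ?Q) n = 0" using leadP leadQ degQ by simp
    ultimately have deg: "Polynomial.degree (?P - ?Q) < n"
      using neq by (metis eq_iff_diff_eq_0 le_neq_implies_less leading_coeff_0_iff)
    have "chi ` ?S \<subseteq> {x. poly (?P - ?Q) x = 0}"
      using qz_fibre_card(1)[OF n0, of \<gamma>] by (auto simp: poly_monom poly_prod chi_scale[symmetric])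
    hence "card (chi ` ?S) \<le> card {x. poly (?P - ?Q) x = 0}"
      using neq by (intro card_mono poly_roots_finite) auto
    also have "\<dots> \<le> Polynomial.degree (?P - ?Q)" using neq by (intro card_poly_roots_bound) auto
    finally show False using deg card_image[OF inj] qz_fibre_card(2)[OF n0, of \<gamma>] by simp
  qed
qed

lemma root_polynomial_p:
  "Polynomial.monom 1 p - [:chi \<gamma>:] = (\<Prod>\<gamma>' | qz_scale p \<gamma>' = \<gamma>. [:- chi \<gamma>', 1:])"
proof -
  obtain \<delta> where d: "qz_scale p \<delta> = \<gamma>" using qz_divisible[of p] by auto
  have c: "chi \<delta> ^ p = chi \<gamma>" using d by (metis chi_scale)
  have "chi \<gamma>' = chi \<delta>" if "qz_scale p \<gamma>' = \<gamma>" for \<gamma>'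
    using that c by (metis chi_scale frobenius_inj)
  hence "(\<Prod>\<gamma>' | qz_scale p \<gamma>' = \<gamma>. [:- chi \<gamma>', 1:]) = (\<Prod>\<gamma>' | qz_scale p \<gamma>' = \<gamma>. [:- chi \<delta>, 1:])"
    by (intro prod.cong) auto
  also have "\<dots> = [:- chi \<delta>, 1:] ^ p" using qz_fibre_card(2)[of p \<gamma>] by simp
  also have "\<dots> = Polynomial.monom 1 p - [:chi \<gamma>:]"
  proof -
    have "([:- chi \<delta>, 1:] + [:chi \<delta>:]) ^ p = [:- chi \<delta>, 1:] ^ p + [:chi \<delta>:] ^ p"
      using ncong_freshmans_dream[OF prime, of "[:- chi \<delta>, 1:]" "[:chi \<delta>:]"] by
          (simp add: ncong_def of_nat_poly of_nat_p)
    moreover have "[:chi \<delta>:] ^ p = [:chi \<gamma>:]" by (simp add: poly_const_pow c)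
    ultimately show ?thesis by (simp add: monom_altdef eq_diff_eq)
  qed
  finally show ?thesis ..
qed

text \<open>An \<open>m n\<close>-th root is extracted in two steps, so that \<open>n\<close> prime to \<open>p\<close> and \<open>n = p\<close> are the only
  cases to be treated directly.\<close>

lemma root_polynomial_mult:
  assumes mn: "m > 0" "n > 0"
    and m: "\<And>\<gamma>. Polynomial.monom 1 m - [:chi \<gamma>:] = (\<Prod>\<gamma>' | qz_scale m \<gamma>' = \<gamma>. [:- chi \<gamma>', 1:])"
    and n: "\<And>\<gamma>. Polynomial.monom 1 n - [:chi \<gamma>:] = (\<Prod>\<gamma>' | qz_scale n \<gamma>' = \<gamma>. [:- chi \<gamma>', 1:])"
  shows "Polynomial.monom 1 (m * n) - [:chi \<gamma>:] = (\<Prod>\<gamma>' | qz_scale (m * n) \<gamma>' = \<gamma>. [:- chi \<gamma>', 1:])"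
proof -
  have comp: "pcompose [:-c, 1:] (Polynomial.monom 1 k) = Polynomial.monom 1 k - [:c:]" for c :: 'k and k
    by (simp add: pcompose_pCons)
  have "Polynomial.monom 1 (m * n) - [:chi \<gamma>:] = pcompose (Polynomial.monom 1 m - [:chi \<gamma>:])
      (Polynomial.monom 1 n)"
    by (simp add: pcompose_diff monom_altdef pcompose_hom.hom_power pcompose_pCons flip: power_mult)
        (simp add: mult.commute)
  also have "\<dots> = (\<Prod>\<gamma>' | qz_scale m \<gamma>' = \<gamma>. Polynomial.monom 1 n - [:chi \<gamma>':])"
    unfolding m pcompose_prod comp ..
  also have "\<dots> = (\<Prod>\<gamma>' | qz_scale m \<gamma>' = \<gamma>. \<Prod>\<gamma>'' | qz_scale n \<gamma>'' = \<gamma>'. [:- chi \<gamma>'', 1:])"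
    unfolding n ..
  also have "\<dots> = (\<Prod>\<gamma>''\<in>(\<Union>\<gamma>'\<in>{\<gamma>'. qz_scale m \<gamma>' = \<gamma>}. {\<gamma>''. qz_scale n \<gamma>'' = \<gamma>'}). [:- chi \<gamma>'', 1:])"
    by (rule prod.UNION_disjoint [symmetric]) (use qz_fibre_card mn in auto)
  also have "(\<Union>\<gamma>'\<in>{\<gamma>'. qz_scale m \<gamma>' = \<gamma>}. {\<gamma>''. qz_scale n \<gamma>'' = \<gamma>'}) = {\<gamma>'. qz_scale (m * n) \<gamma>' = \<gamma>}"
    by (auto simp: qz_scale_scale)
  finally show ?thesis .
qed

lemma root_polynomial:
  assumes n: "n > 0"
  shows "Polynomial.monom 1 n - [:chi \<gamma>:] = (\<Prod>\<gamma>' | qz_scale n \<gamma>' = \<gamma>. [:- chi \<gamma>', 1:])"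
proof -
  obtain a m where am: "n = p ^ a * m" "m \<in> I_prime_to p" using p_split[OF n] by blast
  have "Polynomial.monom 1 (p ^ a * m) - [:chi \<gamma>:] = (\<Prod>\<gamma>' | qz_scale (p ^ a * m) \<gamma>' = \<gamma>. [:- chi \<gamma>',
      1:])" for \<gamma>
  proof (induction a arbitrary: \<gamma>)
    case 0
    show ?case using root_polynomial_prime_to[OF am(2)] by simp
  next
    case (Suc a)
    have "p ^ a * m > 0" using I_prime_to_pos[OF am(2)] by simp
    from root_polynomial_mult[OF p_pos this root_polynomial_p Suc.IH, of \<gamma>]
    show ?case by (simp only: power_Suc mult.assoc)
  qed
  thus ?thesis using am(1) by simp
qed

end

section \<open>Monoid rings\<close>

lemma frag_extend_add_fun: "frag_extend (\<lambda>a. f a + g a) c = frag_extend f c + frag_extend g c"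
  by (simp add: frag_extend_def frag_cmul_distrib2 sum.distrib)

lemma frag_extend_diff_fun: "frag_extend (\<lambda>a. f a - g a) c = frag_extend f c - frag_extend g c"
  using frag_extend_add_fun[of "\<lambda>a. f a - g a" g c] by simp

lemma frag_extend_zero_fun: "frag_extend (\<lambda>a. 0) c = 0"
  by (simp add: frag_extend_def)

definition mr_mult :: "('m \<Rightarrow> 'm \<Rightarrow> 'm) \<Rightarrow> ('m \<Rightarrow>\<^sub>0 int) \<Rightarrow> ('m \<Rightarrow>\<^sub>0 int) \<Rightarrow> 'm \<Rightarrow>\<^sub>0 int" where
  "mr_mult f x y = frag_extend (\<lambda>a. frag_extend (\<lambda>b. frag_of (f a b)) y) x"

lemma mr_mult_simps [simp]:
  "mr_mult f 0 y = 0" "mr_mult f x 0 = 0"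
  "mr_mult f (x - x') y = mr_mult f x y - mr_mult f x' y"
  "mr_mult f x (y - y') = mr_mult f x y - mr_mult f x y'"
  "mr_mult f (frag_of a) (frag_of b) = frag_of (f a b)"
  by (simp_all add: mr_mult_def frag_extend_diff frag_extend_diff_fun frag_extend_zero_fun)

lemma mr_mult_add:
  "mr_mult f (x + x') y = mr_mult f x y + mr_mult f x' y"
  "mr_mult f x (y + y') = mr_mult f x y + mr_mult f x y'"
  by (simp_all add: mr_mult_def frag_extend_add frag_extend_add_fun)

lemma monoid_ring_simps:
  "carrier (monoid_ring G) = {c. Poly_Mapping.keys c \<subseteq> carrier G}"
  "x \<otimes>\<^bsub>monoid_ring G\<^esub> y = mr_mult (\<lambda>a b. a \<otimes>\<^bsub>G\<^esub> b) x y"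
  "x \<oplus>\<^bsub>monoid_ring G\<^esub> y = x + y"
  "\<one>\<^bsub>monoid_ring G\<^esub> = frag_of \<one>\<^bsub>G\<^esub>"
  "\<zero>\<^bsub>monoid_ring G\<^esub> = 0"
  by (simp_all add: monoid_ring_def mr_mult_def)

lemma keys_subset_add: "Poly_Mapping.keys x \<subseteq> S \<Longrightarrow> Poly_Mapping.keys y \<subseteq> S \<Longrightarrow>
    Poly_Mapping.keys (x + y) \<subseteq> S"
  using Poly_Mapping.keys_add[of x y] by blast

lemma keys_subset_diff: "Poly_Mapping.keys x \<subseteq> S \<Longrightarrow> Poly_Mapping.keys y \<subseteq> S \<Longrightarrow>
    Poly_Mapping.keys (x - y :: 'a \<Rightarrow>\<^sub>0 int) \<subseteq> S"
  using keys_subset_add[of x S "- y"] by simp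

lemma keys_subset_mr_mult:
  assumes "\<And>a b. a \<in> S \<Longrightarrow> b \<in> S \<Longrightarrow> f a b \<in> S" "Poly_Mapping.keys x \<subseteq> S" "Poly_Mapping.keys y \<subseteq> S"
  shows "Poly_Mapping.keys (mr_mult f x y) \<subseteq> S"
proof -
  have 1: "Poly_Mapping.keys (frag_extend (\<lambda>b. frag_of (f a b)) y) \<subseteq> S" if a: "a \<in> S" for a
  proof (rule order_trans[OF keys_frag_extend UN_least])
    fix b assume "b \<in> Poly_Mapping.keys y"
    hence "f a b \<in> S" using assms(1)[OF a] assms(3) by blast
    thus "Poly_Mapping.keys (frag_of (f a b)) \<subseteq> S" by (simp only: keys_frag_of) simp
  qed
  show ?thesis unfolding mr_mult_def
    by (rule order_trans[OF keys_frag_extend UN_least], rule 1) (use assms(2) in blast)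
qed

lemma mr_mult_assoc:
  assumes S: "\<And>a b c. a \<in> S \<Longrightarrow> b \<in> S \<Longrightarrow> c \<in> S \<Longrightarrow> f (f a b) c = f a (f b c)"
    and x: "Poly_Mapping.keys x \<subseteq> S" and y: "Poly_Mapping.keys y \<subseteq> S" and z: "Poly_Mapping.keys z \<subseteq> S"
  shows "mr_mult f (mr_mult f x y) z = mr_mult f x (mr_mult f y z)"
  using x
proof (induction x rule: frag_induction)
  case (one a)
  show ?case using y
  proof (induction y rule: frag_induction)
    case (one b)
    show ?case using z
      by (induction z rule: frag_induction) (use S one \<open>a \<in> S\<close> in simp_all)
  qed simp_all
qed simp_all

lemma mr_mult_one:
  assumes "\<And>a. a \<in> S \<Longrightarrow> f e a = a" "\<And>a. a \<in> S \<Longrightarrow> f a e = a" and x: "Poly_Mapping.keys x \<subseteq> S"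
  shows "mr_mult f (frag_of e) x = x" "mr_mult f x (frag_of e) = x"
  using x by (induction x rule: frag_induction) (simp_all add: assms)

lemma ring_monoid_ring:
  assumes "monoid G" shows "ring (monoid_ring G)"
proof -
  interpret G: monoid G by fact
  show ?thesis
  proof (rule ringI)
    show "abelian_group (monoid_ring G)"
    proof (rule abelian_groupI)
      fix x assume "x \<in> carrier (monoid_ring G)"
      thus "\<exists>y\<in>carrier (monoid_ring G). y \<oplus>\<^bsub>monoid_ring G\<^esub> x = \<zero>\<^bsub>monoid_ring G\<^esub>"
        by (intro bexI[of _ "- x"]) (simp_all add: monoid_ring_simps)
    qed (simp_all add: monoid_ring_simps keys_subset_add add_ac)
    show "monoid (monoid_ring G)"
      by (rule monoidI)
         (simp_all add: monoid_ring_simps keys_subset_mr_mult mr_mult_assoc[of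
             "carrier G"] mr_mult_one[of "carrier G"] G.m_assoc)
  qed (simp_all add: monoid_ring_simps mr_mult_add)
qed

lemma monoid_ring_minus:
  assumes "monoid G" "x \<in> carrier (monoid_ring G)" "y \<in> carrier (monoid_ring G)"
  shows "\<ominus>\<^bsub>monoid_ring G\<^esub> x = - x" "y \<ominus>\<^bsub>monoid_ring G\<^esub> x = y - x"
proof -
  interpret ring "monoid_ring G" by (rule ring_monoid_ring[OF assms(1)])
  have m: "- x \<in> carrier (monoid_ring G)" using assms(2) by (simp add: monoid_ring_simps)
  have "- x \<oplus>\<^bsub>monoid_ring G\<^esub> x = \<zero>\<^bsub>monoid_ring G\<^esub>" by (simp add: monoid_ring_simps)
  from minus_equality[OF this assms(2) m] show 1: "\<ominus>\<^bsub>monoid_ring G\<^esub> x = - x" .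
  show "y \<ominus>\<^bsub>monoid_ring G\<^esub> x = y - x" unfolding a_minus_def 1 by (simp add: monoid_ring_simps)
qed

lemma qz_ring_induct [case_names zero one diff]:
  fixes y :: qz_ring
  assumes "P 0" "\<And>\<gamma>. P (frag_of \<gamma>)" "\<And>a b. P a \<Longrightarrow> P b \<Longrightarrow> P (a - b)" shows "P y"
  by (rule frag_induction[of y UNIV]) (use assms in auto)

section \<open>The group ring of \<open>\<rat>/\<int>\<close>\<close>

lemma bc_ops_diff:
  "bc_sigma n (x - y) = bc_sigma n x - bc_sigma n y" "bc_rho n (x - y) = bc_rho n x - bc_rho n y"
      "bc_r p (x - y) = bc_r p x - bc_r p y"
  by (simp_all add: bc_sigma_def bc_rho_def bc_r_def frag_extend_diff)

lemma bc_ops_add: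
  "bc_sigma n (x + y) = bc_sigma n x + bc_sigma n y" "bc_rho n (x + y) = bc_rho n x + bc_rho n y"
      "bc_r p (x + y) = bc_r p x + bc_r p y"
  by (simp_all add: bc_sigma_def bc_rho_def bc_r_def frag_extend_add)

lemma bc_ops_0 [simp]: "bc_sigma n 0 = 0" "bc_rho n 0 = 0" "bc_r p 0 = 0"
  by (simp_all add: bc_sigma_def bc_rho_def bc_r_def)

lemma bc_ops_sum:
  "bc_sigma n (sum f S) = (\<Sum>i\<in>S. bc_sigma n (f i))" "bc_rho n (sum f S) = (\<Sum>i\<in>S. bc_rho n (f i))"
      "bc_r p (sum f S) = (\<Sum>i\<in>S. bc_r p (f i))"
  by (induction S rule: infinite_finite_induct; simp add: bc_ops_add)+

lemma bc_ops_of [simp]: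
  "bc_sigma n (frag_of \<gamma>) = frag_of (qz_scale n \<gamma>)"
  "bc_rho n (frag_of \<gamma>) = (\<Sum>\<gamma>' | qz_scale n \<gamma>' = \<gamma>. frag_of \<gamma>')"
  "bc_r p (frag_of \<gamma>) = frag_of (qz_proj p \<gamma>)"
  by (simp_all add: bc_sigma_def bc_rho_def bc_r_def)

lemma frag_of_mult: "frag_of \<gamma> * frag_of \<delta> = (frag_of (\<gamma> + \<delta>) :: qz_ring)"
  by (simp add: mult_single)

lemma bc_sigma_mult: "bc_sigma n (x * y) = bc_sigma n x * bc_sigma n y"
proof (induction x rule: qz_ring_induct)
  case (one \<gamma>)
  show ?case by (induction y rule: qz_ring_induct)
    (simp_all add: frag_of_mult qz_scale_add right_diff_distrib bc_ops_diff)
qed (simp_all add: left_diff_distrib bc_ops_diff)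

text \<open>The projection formula for multiplication by \<open>n\<close>: a translate of a fibre is a fibre.\<close>

lemma bc_rho_mult_sigma:
  assumes n: "n > 0" shows "bc_rho n (bc_sigma n x * y) = x * bc_rho n y"
proof (induction x rule: qz_ring_induct)
  case (one \<delta>)
  show ?case
  proof (induction y rule: qz_ring_induct)
    case (one \<gamma>)
    have "bc_rho n (bc_sigma n (frag_of \<delta>) * frag_of \<gamma>) = (\<Sum>\<gamma>' | qz_scale n \<gamma>'
        = qz_scale n \<delta> + \<gamma>. frag_of \<gamma>')"
      by (simp add: frag_of_mult)
    also have "\<dots> = (\<Sum>\<gamma>' | qz_scale n \<gamma>' = \<gamma>. frag_of (\<delta> + \<gamma>'))"
      by (rule sum.reindex_bij_witness[of _ "\<lambda>x. \<delta> + x" "\<lambda>x. x - \<delta>"])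
          (auto simp: qz_scale_add qz_scale_diff)
    also have "\<dots> = frag_of \<delta> * bc_rho n (frag_of \<gamma>)" by (simp add: sum_distrib_left frag_of_mult)
    finally show ?case .
  qed (simp_all add: right_diff_distrib bc_ops_diff)
qed (simp_all add: left_diff_distrib bc_ops_diff)

lemma bc_sigma_sigma: "bc_sigma m (bc_sigma n x) = bc_sigma (m * n) x"
  by (induction x rule: qz_ring_induct) (simp_all add: bc_ops_diff qz_scale_scale)

lemma bc_rho_rho:
  assumes "m > 0" "n > 0" shows "bc_rho m (bc_rho n x) = bc_rho (n * m) x"
proof (induction x rule: qz_ring_induct)
  case (one \<gamma>)
  have "bc_rho m (bc_rho n (frag_of \<gamma>)) = (\<Sum>\<gamma>' | qz_scale n \<gamma>' = \<gamma>. \<Sum>\<gamma>'' | qz_scale m \<gamma>''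
      = \<gamma>'. frag_of \<gamma>'')"
    by (simp add: bc_ops_sum)
  also have "\<dots> = (\<Sum>\<gamma>''\<in>(\<Union>\<gamma>'\<in>{\<gamma>'. qz_scale n \<gamma>' = \<gamma>}. {\<gamma>''. qz_scale m \<gamma>'' = \<gamma>'}). frag_of \<gamma>'')"
    by (rule sum.UNION_disjoint [symmetric]) (use qz_fibre_card assms in auto)
  also have "(\<Union>\<gamma>'\<in>{\<gamma>'. qz_scale n \<gamma>' = \<gamma>}. {\<gamma>''. qz_scale m \<gamma>'' = \<gamma>'}) = {\<gamma>'. qz_scale (n * m) \<gamma>' = \<gamma>}"
    by (auto simp: qz_scale_scale)
  finally show ?case by simp
qed (simp_all add: bc_ops_diff)

lemma frag_cmul_diff_distrib2: "frag_cmul c (x - y) = frag_cmul c x - frag_cmul c y"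
  by (rule poly_mapping_eqI) (simp add: lookup_minus right_diff_distrib)

lemma sum_constant_frag: "finite S \<Longrightarrow> (\<Sum>i\<in>S. x) = frag_cmul (int (card S)) x"
  by (induction S rule: finite_induct) (simp_all add: frag_cmul_distrib)

lemma bc_sigma_rho:
  assumes n: "n > 0" shows "bc_sigma n (bc_rho n x) = frag_cmul (int n) x"
proof (induction x rule: qz_ring_induct)
  case (one \<gamma>)
  have "bc_sigma n (bc_rho n (frag_of \<gamma>)) = (\<Sum>\<gamma>' | qz_scale n \<gamma>' = \<gamma>. frag_of \<gamma>)"
    unfolding bc_ops_of bc_ops_sum by (rule sum.cong) auto
  also have "\<dots> = frag_cmul (int n) (frag_of \<gamma>)"
    using qz_fibre_card[OF n, of \<gamma>] by (simp only: sum_constant_frag)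
  finally show ?case .
qed (simp_all add: bc_ops_diff frag_cmul_diff_distrib2)

text \<open>Multiplication by \<open>m\<close> is bijective between the fibres of multiplication by \<open>n\<close> over \<open>\<gamma>\<close> and
  over \<open>m \<gamma>\<close>.\<close>

lemma bc_rho_sigma_coprime:
  assumes mn: "m > 0" "n > 0" "coprime n m" shows "bc_rho n (bc_sigma m x) = bc_sigma m (bc_rho n x)"
proof (induction x rule: qz_ring_induct)
  case (one \<gamma>)
  obtain s' t' where st': "m * s' = n * t' + gcd m n" using bezout_nat[of m n] mn by blast
  have "gcd m n = 1" using mn(3) by (simp only: coprime_iff_gcd_eq_1 gcd.commute)
  hence id: "qz_scale (m * s') x = qz_scale (n * t') x + x" for x
    unfolding st' qz_scale_plus by simp
  have bij: "bij_betw (qz_scale m) {\<gamma>'. qz_scale n \<gamma>' = \<gamma>} {\<gamma>'. qz_scale n \<gamma>' = qz_scale m \<gamma>}"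
  proof (rule bij_betwI')
    fix x y assume xy: "x \<in> {\<gamma>'. qz_scale n \<gamma>' = \<gamma>}" "y \<in> {\<gamma>'. qz_scale n \<gamma>' = \<gamma>}"
    show "qz_scale m x = qz_scale m y \<longleftrightarrow> x = y"
    proof
      assume "qz_scale m x = qz_scale m y"
      hence "qz_scale n (x - y) = 0" "qz_scale m (x - y) = 0" using xy by (simp_all add: qz_scale_diff)
      from qz_coprime_torsion[OF mn(3) this] show "x = y" by simp
    qed simp
  next
    fix x assume "x \<in> {\<gamma>'. qz_scale n \<gamma>' = \<gamma>}"
    thus "qz_scale m x \<in> {\<gamma>'. qz_scale n \<gamma>' = qz_scale m \<gamma>}" using qz_scale_commute[of n m x] by simp
  next
    fix y assume y: "y \<in> {\<gamma>'. qz_scale n \<gamma>' = qz_scale m \<gamma>}"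
    \<comment> \<open>The preimage combines \<open>y\<close> and \<open>\<gamma>\<close> with Bezout coefficients of \<open>m\<close> and \<open>n\<close>.\<close>
    let ?x = "qz_scale s' y - qz_scale t' \<gamma>"
    have y': "qz_scale n y = qz_scale m \<gamma>" using y by simp
    have "qz_scale n ?x = qz_scale s' (qz_scale n y) - qz_scale n (qz_scale t' \<gamma>)"
      by (simp only: qz_scale_diff qz_scale_commute[of n s'])
    also have "\<dots> = qz_scale (m * s') \<gamma> - qz_scale (n * t') \<gamma>"
      by (simp only: y' qz_scale_scale mult.commute[of s' m])
    finally have "qz_scale n ?x = \<dots>" .
    hence 1: "qz_scale n ?x = \<gamma>" using id[of \<gamma>] by simp
    have "qz_scale m ?x = qz_scale m (qz_scale s' y) - qz_scale t' (qz_scale m \<gamma>)"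
      by (simp only: qz_scale_diff qz_scale_commute[of m t'])
    also have "\<dots> = qz_scale (m * s') y - qz_scale (n * t') y"
      by (simp only: y'[symmetric] qz_scale_scale mult.commute[of t' n])
    finally have "qz_scale m ?x = \<dots>" .
    hence "y = qz_scale m ?x" using id[of y] by simp
    thus "\<exists>x\<in>{\<gamma>'. qz_scale n \<gamma>' = \<gamma>}. y = qz_scale m x" using 1 by blast
  qed
  have "bc_sigma m (bc_rho n (frag_of \<gamma>)) = (\<Sum>\<gamma>' | qz_scale n \<gamma>' = \<gamma>. frag_of (qz_scale m \<gamma>'))"
    by (simp add: bc_ops_sum)
  also have "\<dots> = (\<Sum>\<gamma>' | qz_scale n \<gamma>' = qz_scale m \<gamma>. frag_of \<gamma>')"
    by (rule sum.reindex_bij_betw[OF bij])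
  finally show ?case by simp
qed (simp_all add: bc_ops_diff)

context char_prime
begin

lemma bc_r_mult: "bc_r p (x * y) = bc_r p x * bc_r p y"
proof (induction x rule: qz_ring_induct)
  case (one \<gamma>)
  show ?case by (induction y rule: qz_ring_induct)
    (simp_all add: frag_of_mult qz_proj_add right_diff_distrib bc_ops_diff)
qed (simp_all add: left_diff_distrib bc_ops_diff)

lemma bc_r_sigma: "bc_r p (bc_sigma n x) = bc_sigma n (bc_r p x)"
  by (induction x rule: qz_ring_induct) (simp_all add: bc_ops_diff qz_proj_scale)

lemma bc_r_r: "bc_r p (bc_r p x) = bc_r p x"
  by (induction x rule: qz_ring_induct) (simp_all add: bc_ops_diff qz_proj_id[OF qz_proj(1)])

text \<open>The \<open>p\<close>-part of \<open>\<rat>/\<int>\<close> is divisible, so a fibre of multiplication by \<open>n\<close> over \<open>\<gamma>\<close> is the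
  translate, by an element of the \<open>p\<close>-part, of the fibre over the projection of \<open>\<gamma>\<close>.\<close>

lemma bc_r_rho:
  assumes n: "n > 0" shows "bc_r p (bc_rho n (bc_r p x)) = bc_r p (bc_rho n x)"
proof (induction x rule: qz_ring_induct)
  case (one \<gamma>)
  let ?e = "\<gamma> - qz_proj p \<gamma>"
  obtain \<delta>0 where d0: "qz_scale n \<delta>0 = ?e" using qz_divisible[OF n] by blast
  define \<delta> where "\<delta> = \<delta>0 - qz_proj p \<delta>0"
  have "qz_proj p ?e = 0" using qz_proj(2)[of \<gamma>] by (intro qz_proj_eqI) auto
  hence d: "qz_scale n \<delta> = ?e" unfolding \<delta>_def qz_scale_diff d0 qz_proj_scale[symmetric] by simp
  have dp: "\<delta> \<in> qz_p_part p" unfolding \<delta>_def by (rule qz_proj(2))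
  have proj: "qz_proj p (x + \<delta>) = qz_proj p x" for x using dp by (simp add: qz_proj_eq_iff)
  have "(\<Sum>\<gamma>' | qz_scale n \<gamma>' = qz_proj p \<gamma>. frag_of (qz_proj p \<gamma>')) = (\<Sum>\<gamma>' | qz_scale n \<gamma>'
      = \<gamma>. frag_of (qz_proj p \<gamma>'))"
    by (rule sum.reindex_bij_witness[of _ "\<lambda>x. x - \<delta>" "\<lambda>x. x + \<delta>"])
       (use proj proj[of "_ - \<delta>"] in \<open>auto simp: qz_scale_add qz_scale_diff d\<close>)
  thus ?case by (simp add: bc_ops_sum)
qed (simp_all add: bc_ops_diff)

end

section \<open>The ring \<open>\<bbbW>\<^sub>0\<close> and its eigenvalue description\<close>

lemma sum_mset_count:
  fixes g :: "'a \<Rightarrow> 'b \<Rightarrow>\<^sub>0 int"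
  assumes "finite V" "set_mset M \<subseteq> V"
  shows "(\<Sum>\<alpha>\<in>#M. g \<alpha>) = (\<Sum>\<alpha>\<in>V. frag_cmul (int (count M \<alpha>)) (g \<alpha>))"
  using assms(2)
proof (induction M)
  case (add x M)
  have "(\<Sum>\<alpha>\<in>V. frag_cmul (int (count (add_mset x M) \<alpha>)) (g \<alpha>)) =
    (\<Sum>\<alpha>\<in>V. (if \<alpha> = x then g x else 0) + frag_cmul (int (count M \<alpha>)) (g \<alpha>))"
    by (rule sum.cong) (auto simp: frag_cmul_distrib)
  also have "\<dots> = g x + (\<Sum>\<alpha>\<in>#M. g \<alpha>)"
    using add assms(1) by (simp add: sum.distrib)
  finally show ?case by simp
qed simp

lemma monoid_kronecker: "monoid \<lparr>carrier = {A :: 'k::comm_ring_1 mat. square_mat A}, mult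
    = kronecker, one = 1\<^sub>m 1\<rparr>"
proof -
  have "square_mat (kronecker A B)" if "square_mat A" "square_mat B" for A B :: "'k mat"
    using that by (simp add: kronecker_def)
  thus ?thesis by (intro monoidI) (simp_all add: kronecker_assoc kronecker_unit[unfolded One_nat_def])
qed

lemma end_free_simps:
  "carrier end_free = {c. Poly_Mapping.keys c \<subseteq> {A. square_mat A}}"
  "x \<otimes>\<^bsub>end_free\<^esub> y = mr_mult kronecker x y"
  "x \<oplus>\<^bsub>end_free\<^esub> y = x + y"
  "\<one>\<^bsub>end_free\<^esub> = frag_of (1\<^sub>m 1)"
  "\<zero>\<^bsub>end_free\<^esub> = 0"
  by (simp_all add: end_free_def monoid_ring_simps)

lemma ring_end_free: "ring (end_free :: ('k::field mat \<Rightarrow>\<^sub>0 int) ring)"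
  unfolding end_free_def by (rule ring_monoid_ring[OF monoid_kronecker])

lemma end_free_minus:
  "x \<in> carrier end_free \<Longrightarrow> y \<in> carrier end_free \<Longrightarrow> y \<ominus>\<^bsub>end_free\<^esub> x = y - x"
  "x \<in> carrier end_free \<Longrightarrow> \<ominus>\<^bsub>end_free\<^esub> x = - x"
  unfolding end_free_def using monoid_ring_minus[OF monoid_kronecker] by blast+

lemma end_free_closed:
  assumes "x \<in> carrier end_free" "y \<in> carrier end_free"
  shows "x + y \<in> carrier end_free" "x - y \<in> carrier end_free"
  using assms unfolding end_free_simps by (simp_all add: keys_subset_add keys_subset_diff)

lemma frag_of_end_free: "square_mat A \<Longrightarrow> frag_of A \<in> carrier end_free"
  by (simp add: end_free_simps)

lemma square_carrier: "square_mat A \<Longrightarrow> A \<in> carrier_mat (dim_row A) (dim_row A)"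
  by (rule carrier_matI) (simp_all only: square_mat.simps)

lemma square_mat_carrier: "A \<in> carrier_mat d d \<Longrightarrow> square_mat A"
  by auto

context residue_character
begin

definition root_frag :: "'k \<Rightarrow> qz_ring" where
  "root_frag \<alpha> = (if \<alpha> = 0 then 0 else frag_of (\<sigma> \<alpha>))"

definition eigen_sum :: "'k mat \<Rightarrow> qz_ring" where
  "eigen_sum A = (\<Sum>\<alpha> | \<alpha> \<noteq> 0 \<and> eigenvalue A \<alpha>.
     frag_cmul (int (Polynomial.order \<alpha> (char_poly A))) (frag_of (\<sigma> \<alpha>)))"

lemma char_poly_nonzero: "A \<in> carrier_mat d d \<Longrightarrow> char_poly A \<noteq> (0 :: 'k poly)"
  using degree_monic_char_poly[of A d] by auto

lemma eigen_sum_proots: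
  assumes A: "A \<in> carrier_mat d d"
  shows "eigen_sum A = (\<Sum>\<alpha>\<in>#proots (char_poly A). root_frag \<alpha>)"
proof -
  let ?V = "{\<alpha>. poly (char_poly A) \<alpha> = 0}"
  have fin: "finite ?V" by (rule poly_roots_finite[OF char_poly_nonzero[OF A]])
  have "(\<Sum>\<alpha>\<in>#proots (char_poly A). root_frag \<alpha>) = (\<Sum>\<alpha>\<in>?V. frag_cmul (int (Polynomial.order \<alpha>
      (char_poly A))) (root_frag \<alpha>))"
    using char_poly_nonzero[OF A] by (subst sum_mset_count[OF fin]) auto
  also have "\<dots> = eigen_sum A" unfolding eigen_sum_def eigenvalue_root_char_poly[OF A]
    by (rule sum.mono_neutral_cong_right) (use fin in \<open>auto simp: root_frag_def\<close>)
  finally show ?thesis ..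
qed

lemma eigen_sum_split:
  assumes "endo_split A B C" shows "eigen_sum B = eigen_sum A + eigen_sum C"
proof -
  obtain a b c where d: "A \<in> carrier_mat a a" "B \<in> carrier_mat b b" "C \<in> carrier_mat c c"
    using assms by (rule endo_splitE)
  show ?thesis
    by (simp add: eigen_sum_proots[OF d(1)] eigen_sum_proots[OF d(2)] eigen_sum_proots[OF d(3)]
        char_poly_split[OF assms] proots_mult char_poly_nonzero[OF d(1)] char_poly_nonzero[OF d(3)])
qed

lemma eigen_sum_mat1: "eigen_sum (mat1 \<alpha>) = root_frag \<alpha>"
  by (simp add: eigen_sum_proots[OF mat1_carrier] char_poly_mat1)

lemma eigen_sum_empty:
  assumes "A \<in> carrier_mat 0 0" shows "eigen_sum A = 0"
proof -
  have "Polynomial.degree (char_poly A) = 0" using degree_monic_char_poly[OF assms] by simp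
  then obtain c where "char_poly A = [:c:]" by (metis degree_eq_zeroE)
  thus ?thesis by (simp add: eigen_sum_proots[OF assms])
qed

lemma eigen_sum_zero: "eigen_sum (0\<^sub>m d d) = 0"
proof -
  have "\<not> (\<alpha> \<noteq> 0 \<and> eigenvalue (0\<^sub>m d d) \<alpha>)" for \<alpha> :: 'k
  proof
    assume a: "\<alpha> \<noteq> 0 \<and> eigenvalue (0\<^sub>m d d) \<alpha>"
    then obtain v :: "'k Matrix.vec" where v: "v \<in> carrier_vec d" "v \<noteq> 0\<^sub>v d" "0\<^sub>m d d *\<^sub>v v = \<alpha> \<cdot>\<^sub>v v"
      unfolding eigenvalue_def eigenvector_def by auto
    have "v = 0\<^sub>v d"
    proof (rule eq_vecI)
      fix i assume i: "i < dim_vec (0\<^sub>v d :: 'k Matrix.vec)"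
      have "vec_index (\<alpha> \<cdot>\<^sub>v v) i = vec_index (0\<^sub>v d) i" using v zero_mat_mult_vec[OF v(1), of d] by simp
      thus "vec_index v i = vec_index (0\<^sub>v d) i" using a i v(1) by simp
    qed (use v in simp)
    thus False using v by simp
  qed
  hence "{\<alpha> :: 'k. \<alpha> \<noteq> 0 \<and> eigenvalue (0\<^sub>m d d) \<alpha>} = {}" by blast
  thus ?thesis unfolding eigen_sum_def by (simp only: sum.empty)
qed

lemma root_frag_mult: "root_frag (\<alpha> * \<beta>) = root_frag \<alpha> * root_frag \<beta>"
  by (simp add: root_frag_def \<sigma>_mult frag_of_mult)

text \<open>By devissage in both factors the statement reduces to one-dimensional matrices, where it says that
  \<open>\<sigma>\<close> is a homomorphism.\<close>

lemma eigen_sum_kronecker: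
  assumes A: "A \<in> carrier_mat a a" and B: "B \<in> carrier_mat b b"
  shows "eigen_sum (kronecker A B) = eigen_sum A * eigen_sum B"
  using A
proof (induction rule: devissage)
  case (empty A)
  have "kronecker A B \<in> carrier_mat 0 0" using kronecker_carrier[OF empty B] by simp
  thus ?case using empty by (simp add: eigen_sum_empty)
next
  case (extend \<alpha> A A' d)
  have "eigen_sum (kronecker (mat1 \<alpha>) B) = root_frag \<alpha> * eigen_sum B"
    using B
  proof (induction rule: devissage)
    case (empty B)
    have "kronecker (mat1 \<alpha>) B \<in> carrier_mat 0 0" using kronecker_carrier[OF mat1_carrier empty] by simp
    thus ?case using empty by (simp add: eigen_sum_empty)
  next
    case (extend \<beta> B B' d)
    show ?case
      using eigen_sum_split[OF endo_split_kronecker(2)[OF extend(3) mat1_carrier,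
          of \<alpha>]] eigen_sum_split[OF extend(3)] extend(4)
      by (simp add: kronecker_mat1 eigen_sum_mat1 root_frag_mult distrib_left)
  qed
  thus ?case
    using eigen_sum_split[OF endo_split_kronecker(1)[OF extend(3) B]] eigen_sum_split[OF extend(3)]
        extend(4)
    by (simp add: eigen_sum_mat1 distrib_right)
qed

lemma eigen_sum_pow:
  assumes n: "n > 0" and A: "A \<in> carrier_mat a a"
  shows "eigen_sum (A ^\<^sub>m n) = bc_sigma n (eigen_sum A)"
  using A
proof (induction rule: devissage)
  case (empty A)
  thus ?case by (simp add: eigen_sum_empty)
next
  case (extend \<alpha> A A' d)
  have "root_frag (\<alpha> ^ n) = bc_sigma n (root_frag \<alpha>)"
    using n by (simp add: root_frag_def \<sigma>_power)
  thus ?case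
    using eigen_sum_split[OF endo_split_pow[OF extend(3), of n]] eigen_sum_split[OF extend(3)] extend(4)
    by (simp add: pow_mat1 eigen_sum_mat1 bc_ops_add)
qed

lemma root_frag_chi: "root_frag (chi \<gamma>) = frag_of (qz_proj p \<gamma>)"
  by (simp add: root_frag_def sigma_chi)

lemma proots_prod_linear: "finite S \<Longrightarrow> (\<Sum>\<alpha>\<in>#proots (\<Prod>x\<in>S. [:- f x, 1:] :: 'k poly). g \<alpha>)
    = (\<Sum>x\<in>S. g (f x))"
proof (induction S rule: finite_induct)
  case (insert x S)
  have "(\<Prod>x\<in>S. [:- f x, 1:] :: 'k poly) \<noteq> 0" using insert(1) by simp
  thus ?case using insert by (simp add: proots_mult del: mult_pCons_left)
qed simp

text \<open>On an eigenvalue \<open>\<alpha>\<close> the Verschiebung is the companion matrix of \<open>X\<^sup>n - \<alpha>\<close>, whose roots are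
  parametrised by the fibre of multiplication by \<open>n\<close> over \<open>\<sigma> \<alpha>\<close>.\<close>

lemma eigen_sum_verschiebung:
  assumes n: "n > 0" and A: "A \<in> carrier_mat a a"
  shows "eigen_sum (verschiebung_mat n A) = bc_r p (bc_rho n (eigen_sum A))"
  using A
proof (induction rule: devissage)
  case (empty A)
  have "verschiebung_mat n A \<in> carrier_mat 0 0" using verschiebung_carrier[OF empty, of n] by simp
  thus ?case using empty by (simp add: eigen_sum_empty)
next
  case (extend \<alpha> A A' d)
  have "eigen_sum (verschiebung_mat n (mat1 \<alpha>)) = bc_r p (bc_rho n (root_frag \<alpha>))"
  proof (cases "\<alpha> = 0")
    case True
    have "proots (Polynomial.monom 1 n :: 'k poly) = replicate_mset n 0"
    proof -
      have "[:0, 1:] = ([:- 0, 1:] :: 'k poly)" by simp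
      moreover have "repeat_mset n {#0::'k#} = replicate_mset n 0" by (rule multiset_eqI) simp
      ultimately show ?thesis unfolding monom_altdef by (simp add: proots_power)
    qed
    thus ?thesis using True
      by (simp add: eigen_sum_proots[OF verschiebung_mat1_carrier] char_poly_verschiebung_mat1[OF n]
          root_frag_def)
  next
    case False
    have "eigen_sum (verschiebung_mat n (mat1 \<alpha>)) = (\<Sum>\<alpha>\<in>#proots (\<Prod>\<gamma>' | qz_scale n \<gamma>'
        = \<sigma> \<alpha>. [:- chi \<gamma>', 1:]). root_frag \<alpha>)"
      unfolding eigen_sum_proots[OF verschiebung_mat1_carrier] char_poly_verschiebung_mat1[OF n]
        root_polynomial[OF n, symmetric] chi_sigma[OF False] ..
    also have "\<dots> = (\<Sum>\<gamma>' | qz_scale n \<gamma>' = \<sigma> \<alpha>. frag_of (qz_proj p \<gamma>'))"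
      using qz_fibre_card(1)[OF n] by (simp add: proots_prod_linear root_frag_chi)
    finally show ?thesis using False by (simp add: root_frag_def bc_ops_sum)
  qed
  thus ?case
    using eigen_sum_split[OF endo_split_verschiebung[OF extend(3) n]] eigen_sum_split[OF extend(3)]
        extend(4)
    by (simp add: eigen_sum_mat1 bc_ops_add)
qed

text \<open>Up to passage to the quotient this is \<open>\<sigma>\<close>-tilde.\<close>

definition eigen_hom :: "('k mat \<Rightarrow>\<^sub>0 int) \<Rightarrow> qz_ring" where
  "eigen_hom = frag_extend eigen_sum"

lemma eigen_hom_simps [simp]:
  "eigen_hom 0 = 0" "eigen_hom (frag_of A) = eigen_sum A" "eigen_hom (x - y)
      = eigen_hom x - eigen_hom y" "eigen_hom (x + y) = eigen_hom x + eigen_hom y" "eigen_hom (- x)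
      = - eigen_hom x"
  by (simp_all add: eigen_hom_def frag_extend_diff frag_extend_add frag_extend_minus)

lemma end_free_induct [consumes 1, case_names zero one diff]:
  fixes c :: "'k mat \<Rightarrow>\<^sub>0 int"
  assumes "c \<in> carrier end_free" "P 0" "\<And>A. A \<in> carrier_mat (dim_row A) (dim_row A) \<Longrightarrow> P (frag_of A)"
    "\<And>a b. P a \<Longrightarrow> P b \<Longrightarrow> P (a - b)"
  shows "P c"
  by (rule frag_induction[of c "{A. square_mat A}"]) (use assms square_carrier in \<open>auto simp:
      end_free_simps\<close>)

lemma eigen_hom_mult:
  assumes "x \<in> carrier end_free" "y \<in> carrier end_free"
  shows "eigen_hom (mr_mult kronecker x y) = eigen_hom x * eigen_hom y"
  using assms(1)
proof (induction x rule: end_free_induct)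
  case (one A)
  show ?case using assms(2)
    by (induction y rule: end_free_induct) (simp_all add: eigen_sum_kronecker[OF one] right_diff_distrib)
qed (simp_all add: left_diff_distrib)

text \<open>A section of \<open>eigen_hom\<close>, up to the projection \<open>r\<close>, by sums of one-dimensional endomorphisms.\<close>

definition diag_of :: "qz_ring \<Rightarrow> 'k mat \<Rightarrow>\<^sub>0 int" where
  "diag_of = frag_extend (\<lambda>\<gamma>. frag_of (mat1 (chi \<gamma>)))"

lemma diag_of_simps [simp]:
  "diag_of 0 = 0" "diag_of (frag_of \<gamma>) = frag_of (mat1 (chi \<gamma>))" "diag_of (x - y)
      = diag_of x - diag_of y" "diag_of (x + y) = diag_of x + diag_of y"
  by (simp_all add: diag_of_def frag_extend_diff frag_extend_add)

lemma diag_of_closed: "diag_of y \<in> carrier end_free"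
proof (induction y rule: qz_ring_induct)
  case (diff a b)
  thus ?case by (simp add: end_free_simps keys_subset_diff)
qed (simp_all add: end_free_simps mat1_def)

lemma eigen_hom_diag_of: "eigen_hom (diag_of y) = bc_r p y"
  by (induction y rule: qz_ring_induct) (simp_all add: eigen_sum_mat1 root_frag_chi bc_ops_diff)

abbreviation W0gens :: "('k mat \<Rightarrow>\<^sub>0 int) set" where
  "W0gens \<equiv> {frag_of B - (frag_of A + frag_of C) | A B C. endo_exact A B C} \<union> {frag_of (0\<^sub>m d d) |
      d. True}"

lemma W0gens_closed: "W0gens \<subseteq> carrier end_free"
proof -
  have "frag_of B - (frag_of A + frag_of C) \<in> carrier end_free" if "endo_exact A B C" for A B C ::
      "'k mat"
    using that unfolding endo_exact_def by (intro end_free_closed frag_of_end_free) blast+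
  moreover have "frag_of (0\<^sub>m d d :: 'k mat) \<in> carrier end_free" for d by (rule frag_of_end_free) simp
  ultimately show ?thesis by blast
qed

lemma ideal_W0: "ideal W0_ideal (end_free :: ('k mat \<Rightarrow>\<^sub>0 int) ring)"
  unfolding W0_ideal_def by (rule ring.genideal_ideal[OF ring_end_free W0gens_closed])

lemma W0gens_subset: "W0gens \<subseteq> W0_ideal"
  unfolding W0_ideal_def by (rule ring.genideal_self[OF ring_end_free W0gens_closed])

lemma ideal_kernel: "ideal {c \<in> carrier end_free. eigen_hom c = 0} end_free"
proof -
  interpret ring "end_free :: ('k mat \<Rightarrow>\<^sub>0 int) ring" by (rule ring_end_free)
  show ?thesis
  proof (rule idealI[OF ring_end_free])
    show "subgroup {c \<in> carrier end_free. eigen_hom c = 0} (add_monoid end_free)"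
    proof (rule add.subgroupI)
      fix a assume a: "a \<in> {c \<in> carrier end_free. eigen_hom c = 0}"
      thus "\<ominus>\<^bsub>end_free\<^esub> a \<in> {c \<in> carrier end_free. eigen_hom c = 0}"
        using end_free_minus(2)[of a] by (simp add: end_free_simps)
    next
      fix a b assume "a \<in> {c \<in> carrier end_free. eigen_hom c = 0}"
          "b \<in> {c \<in> carrier end_free. eigen_hom c = 0}"
      thus "a \<oplus>\<^bsub>end_free\<^esub> b \<in> {c \<in> carrier end_free. eigen_hom c = 0}"
        by (simp add: end_free_simps keys_subset_add)
    qed (auto simp: end_free_simps intro!: exI[of _ 0])
  next
    fix a x :: "'k mat \<Rightarrow>\<^sub>0 int" assume ax: "a \<in> {c \<in> carrier end_free. eigen_hom c = 0}"
        "x \<in> carrier end_free"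
    have "x \<otimes>\<^bsub>end_free\<^esub> a \<in> carrier end_free" "a \<otimes>\<^bsub>end_free\<^esub> x \<in> carrier end_free" using ax by auto
    thus "x \<otimes>\<^bsub>end_free\<^esub> a \<in> {c \<in> carrier end_free. eigen_hom c = 0}"
        "a \<otimes>\<^bsub>end_free\<^esub> x \<in> {c \<in> carrier end_free. eigen_hom c = 0}"
      using ax by (simp_all add: end_free_simps(2) eigen_hom_mult)
  qed
qed

lemma W0_ideal_diff:
  assumes "a \<in> W0_ideal" "b \<in> W0_ideal" shows "a - b \<in> (W0_ideal :: ('k mat \<Rightarrow>\<^sub>0 int) set)"
proof -
  interpret ideal W0_ideal "end_free :: ('k mat \<Rightarrow>\<^sub>0 int) ring" by (rule ideal_W0)
  have c: "a \<in> carrier end_free" "b \<in> carrier end_free" using assms a_subset by auto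
  have "a \<oplus>\<^bsub>end_free\<^esub> (\<ominus>\<^bsub>end_free\<^esub> b) \<in> W0_ideal"
    using assms by (intro additive_subgroup.a_closed[OF ideal.axioms(1)[OF ideal_W0]]
        additive_subgroup.a_inv_closed[OF ideal.axioms(1)[OF ideal_W0]])
  thus ?thesis using end_free_minus(2)[OF c(2)] by (simp add: end_free_simps)
qed

lemma W0_ideal_zero: "0 \<in> (W0_ideal :: ('k mat \<Rightarrow>\<^sub>0 int) set)"
proof -
  have "frag_of (0\<^sub>m 0 0 :: 'k mat) \<in> W0_ideal" by (rule subsetD[OF W0gens_subset]) blast
  from W0_ideal_diff[OF this this] show ?thesis by simp
qed

lemma W0_ideal_add:
  assumes "a \<in> W0_ideal" "b \<in> W0_ideal" shows "a + b \<in> (W0_ideal :: ('k mat \<Rightarrow>\<^sub>0 int) set)"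
  using W0_ideal_diff[OF assms(1) W0_ideal_diff[OF W0_ideal_zero assms(2)]] by simp

lemma W0_ideal_reduce_mat:
  assumes "A \<in> carrier_mat d d" shows "frag_of A - diag_of (eigen_sum A) \<in> W0_ideal"
  using assms
proof (induction rule: devissage)
  case (empty A)
  hence "A = 0\<^sub>m 0 0" by auto
  hence "frag_of A \<in> W0_ideal" using W0gens_subset by blast
  thus ?case using eigen_sum_empty[OF empty] by simp
next
  case (extend \<alpha> A A' d)
  have "frag_of (mat1 \<alpha>) - diag_of (root_frag \<alpha>) \<in> W0_ideal"
  proof (cases "\<alpha> = 0")
    case True
    have "mat1 0 = (0\<^sub>m 1 1 :: 'k mat)" by (rule eq_matI) (auto simp: mat1_def)
    hence "frag_of (mat1 \<alpha>) \<in> W0_ideal" using True W0gens_subset by auto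
    thus ?thesis using True by (simp add: root_frag_def)
  qed (simp add: root_frag_def chi_sigma W0_ideal_zero)
  moreover have "frag_of A - (frag_of (mat1 \<alpha>) + frag_of A') \<in> W0_ideal"
    using endo_split_imp_exact[OF extend(3)] W0gens_subset by blast
  ultimately have "(frag_of A - (frag_of (mat1 \<alpha>) + frag_of A')) + ((frag_of (mat1 \<alpha>) - diag_of
      (root_frag \<alpha>)) + (frag_of A' - diag_of (eigen_sum A'))) \<in> W0_ideal"
    using extend(4) by (intro W0_ideal_add)
  thus ?case using eigen_sum_split[OF extend(3)] by (simp add: eigen_sum_mat1 algebra_simps)
qed

text \<open>Devissage shows that every class is a sum of one-dimensional ones; hence a combination with
  vanishing eigenvalue sum already lies in the ideal of relations.\<close>

lemma W0_ideal_reduce: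
  assumes "c \<in> carrier end_free" shows "c - diag_of (eigen_hom c) \<in> W0_ideal"
  using assms
proof (induction c rule: end_free_induct)
  case (diff a b)
  thus ?case using W0_ideal_diff[OF diff] by (simp add: algebra_simps)
qed (simp_all add: W0_ideal_zero W0_ideal_reduce_mat)

lemma W0_ideal_eq: "W0_ideal = {c \<in> carrier end_free. eigen_hom c = 0}"
proof (intro equalityI subsetI)
  have "W0gens \<subseteq> {c \<in> carrier end_free. eigen_hom c = 0}"
  proof -
    have "eigen_hom (frag_of B - (frag_of A + frag_of C)) = 0" if "endo_exact A B C" for A B C
      using eigen_sum_split[OF endo_exact_imp_split[OF that]] by simp
    moreover have "eigen_hom (frag_of (0\<^sub>m d d)) = 0" for d by (simp add: eigen_sum_zero)
    ultimately have "\<forall>c\<in>W0gens. eigen_hom c = 0" by blast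
    thus ?thesis using W0gens_closed by blast
  qed
  hence "W0_ideal \<subseteq> {c \<in> carrier end_free. eigen_hom c = 0}"
    unfolding W0_ideal_def by (rule ring.genideal_minimal[OF ring_end_free ideal_kernel])
  thus "c \<in> {c \<in> carrier end_free. eigen_hom c = 0}" if "c \<in> W0_ideal" for c using that by blast
  show "c \<in> W0_ideal" if "c \<in> {c \<in> carrier end_free. eigen_hom c = 0}" for c
    using W0_ideal_reduce[of c] that by simp
qed

definition W0_class :: "('k mat \<Rightarrow>\<^sub>0 int) \<Rightarrow> ('k mat \<Rightarrow>\<^sub>0 int) set" where
  "W0_class c = W0_ideal +>\<^bsub>end_free\<^esub> c"

lemma W0_class_eq:
  assumes c: "c \<in> carrier end_free"
  shows "W0_class c = {c' \<in> carrier end_free. eigen_hom c' = eigen_hom c}"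
proof -
  have coset: "W0_class c = {i + c | i. i \<in> W0_ideal}"
    unfolding W0_class_def a_r_coset_def' end_free_simps(3) by blast
  show ?thesis
  proof (intro equalityI subsetI)
    fix c' assume "c' \<in> W0_class c"
    then obtain i where i: "i \<in> carrier end_free" "eigen_hom i = 0" "c' = i + c"
      unfolding coset W0_ideal_eq by blast
    have "eigen_hom c' = eigen_hom c" unfolding i(3) eigen_hom_simps i(2) by simp
    thus "c' \<in> {c' \<in> carrier end_free. eigen_hom c' = eigen_hom c}"
      using end_free_closed(1)[OF i(1) c] i(3) by blast
  next
    fix c' assume c': "c' \<in> {c' \<in> carrier end_free. eigen_hom c' = eigen_hom c}"
    hence "c' - c \<in> carrier end_free" "eigen_hom (c' - c) = 0" using end_free_closed(2)[OF _ c]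
        by simp_all
    hence "c' - c \<in> W0_ideal" unfolding W0_ideal_eq by blast
    moreover have "c' = (c' - c) + c" by simp
    ultimately show "c' \<in> W0_class c" unfolding coset by blast
  qed
qed

lemma W0_class_eq_iff:
  assumes "c \<in> carrier end_free" "c' \<in> carrier end_free"
  shows "W0_class c = W0_class c' \<longleftrightarrow> eigen_hom c = eigen_hom c'"
  using assms by (auto simp: W0_class_eq)

lemma W0_class_hom: "W0_class \<in> ring_hom end_free W0"
  unfolding W0_class_def[abs_def] W0_def by (rule ideal.rcos_ring_hom[OF ideal_W0])

lemma ring_W0: "ring (W0 :: ('k mat \<Rightarrow>\<^sub>0 int) set ring)"
  unfolding W0_def by (rule ideal.quotient_is_ring[OF ideal_W0])

lemma carrier_W0: "carrier W0 = W0_class ` carrier end_free"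
  unfolding W0_def FactRing_def A_RCOSETS_def' W0_class_def by auto

lemma W0_induced_W0_class:
  assumes c: "c \<in> carrier end_free" and g: "\<And>c'. c' \<in> carrier end_free \<Longrightarrow> eigen_hom c' = eigen_hom c
      \<Longrightarrow> g c' = g c"
  shows "W0_induced g (W0_class c) = g c"
proof -
  have "c \<in> W0_class c" using c by (simp add: W0_class_eq)
  moreover have "g c' = g c" if "c' \<in> W0_class c" for c'
    using that unfolding W0_class_eq[OF c] by (intro g) simp_all
  ultimately have "g ` W0_class c = {g c}" by blast
  moreover have "W0_class c \<in> carrier W0" using c by (auto simp: carrier_W0)
  ultimately show ?thesis by (simp add: W0_induced_def)
qed

text \<open>A surjection from \<open>\<int>[\<rat>/\<int>]\<close> onto \<open>\<bbbW>\<^sub>0\<close> which sends \<open>e(\<gamma>)\<close> to a one-dimensional class and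
  through which all operators on \<open>\<bbbW>\<^sub>0\<close> are computed; it is \<open>r\<close> followed by the inverse of
  \<open>\<sigma>\<close>-tilde.\<close>

definition W0_of :: "qz_ring \<Rightarrow> ('k mat \<Rightarrow>\<^sub>0 int) set" where
  "W0_of y = W0_class (diag_of y)"

lemma W0_of_closed [simp]: "W0_of y \<in> carrier W0"
  unfolding W0_of_def carrier_W0 using diag_of_closed by auto

lemma W0_class_W0_of: "c \<in> carrier end_free \<Longrightarrow> W0_class c = W0_of (eigen_hom c)"
proof -
  assume c: "c \<in> carrier end_free"
  have "eigen_hom (c - diag_of (eigen_hom c)) = 0" using W0_ideal_reduce[OF c] by (simp add: W0_ideal_eq)
  thus ?thesis unfolding W0_of_def using c by (simp add: W0_class_eq_iff diag_of_closed)
qed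

lemma W0_of_surj: "\<xi> \<in> carrier W0 \<Longrightarrow> \<exists>y. \<xi> = W0_of y"
  unfolding carrier_W0 using W0_class_W0_of by auto

lemma W0_of_eq_iff: "W0_of x = W0_of y \<longleftrightarrow> bc_r p x = bc_r p y"
  unfolding W0_of_def by (simp add: W0_class_eq_iff diag_of_closed eigen_hom_diag_of)

lemma W0_of_r: "W0_of (bc_r p y) = W0_of y"
  by (simp add: W0_of_eq_iff bc_r_r)

lemma W0_of_add: "W0_of (x + y) = W0_of x \<oplus>\<^bsub>W0\<^esub> W0_of y"
  using ring_hom_add[OF W0_class_hom diag_of_closed diag_of_closed] by
      (simp add: W0_of_def end_free_simps)

lemma W0_of_mult: "W0_of (x * y) = W0_of x \<otimes>\<^bsub>W0\<^esub> W0_of y"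
proof -
  interpret ring "end_free :: ('k mat \<Rightarrow>\<^sub>0 int) ring" by (rule ring_end_free)
  have "W0_class (diag_of x \<otimes>\<^bsub>end_free\<^esub> diag_of y) = W0_of (eigen_hom (diag_of x \<otimes>\<^bsub>end_free\<^esub> diag_of y))"
    by (rule W0_class_W0_of) (simp add: diag_of_closed)
  also have "\<dots> = W0_of (x * y)"
    by (simp add: end_free_simps(2) eigen_hom_mult diag_of_closed eigen_hom_diag_of W0_of_r flip:
        bc_r_mult)
  finally show ?thesis unfolding W0_of_def ring_hom_mult[OF W0_class_hom diag_of_closed
      diag_of_closed] by simp
qed

lemma sigma_tilde_W0_of: "sigma_tilde \<sigma> (W0_of y) = bc_r p y"
proof -
  have "sigma_tilde \<sigma> = W0_induced eigen_hom"
    unfolding sigma_tilde_def eigen_hom_def eigen_sum_def[abs_def] ..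
  thus ?thesis unfolding W0_of_def by (simp add: W0_induced_W0_class diag_of_closed eigen_hom_diag_of)
qed

lemma inv_sigma_tilde: "inv_into (carrier W0) (sigma_tilde \<sigma>) (bc_r p y) = W0_of y"
proof -
  have "inj_on (sigma_tilde \<sigma>) (carrier W0)"
    by (rule inj_onI) (metis W0_of_surj sigma_tilde_W0_of W0_of_eq_iff)
  from inv_into_f_f[OF this W0_of_closed, of y] show ?thesis by (simp only: sigma_tilde_W0_of)
qed

text \<open>An operation on matrices that acts on eigenvalue sums through \<open>h\<close> induces \<open>h\<close> on \<open>\<bbbW>\<^sub>0\<close>; the last
  condition makes \<open>h\<close> compatible with the projection \<open>r\<close>.\<close>

lemma W0_op_W0_of:
  assumes op: "\<And>A. A \<in> carrier_mat (dim_row A) (dim_row A) \<Longrightarrow> square_mat (f A) \<and> eigen_sum (f A)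
      = h (eigen_sum A)"
    and h: "h 0 = 0" "\<And>x y. h (x - y) = h x - h y" "\<And>y. bc_r p (h (bc_r p y)) = bc_r p (h y)"
  shows "W0_induced (\<lambda>c. W0_ideal +>\<^bsub>end_free\<^esub> frag_extend (\<lambda>A. frag_of (f A)) c) (W0_of y)
      = W0_of (h y)"
proof -
  let ?F = "frag_extend (\<lambda>A. frag_of (f A))"
  have F: "?F c \<in> carrier end_free \<and> eigen_hom (?F c) = h (eigen_hom c)" if "c \<in> carrier end_free" for c
    using that
  proof (induction c rule: end_free_induct)
    case (one A)
    show ?case using op[OF one] by (simp add: end_free_simps)
  next
    case (diff a b)
    thus ?case by (simp add: frag_extend_diff end_free_simps keys_subset_diff h)
  qed (simp add: h end_free_simps)
  have g: "W0_class (?F c) = W0_of (h (eigen_hom c))" if "c \<in> carrier end_free" for c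
    using F[OF that] by (simp add: W0_class_W0_of)
  have "W0_induced (\<lambda>c. W0_class (?F c)) (W0_of y) = W0_class (?F (diag_of y))"
    unfolding W0_of_def by (rule W0_induced_W0_class) (simp_all add: diag_of_closed g)
  also have "\<dots> = W0_of (h y)" by (simp add: g diag_of_closed eigen_hom_diag_of W0_of_eq_iff h)
  finally show ?thesis by (simp only: W0_class_def)
qed

lemma W0_F_W0_of:
  assumes n: "n > 0" shows "W0_F n (W0_of y) = W0_of (bc_sigma n y)"
  unfolding W0_F_def
proof (rule W0_op_W0_of)
  fix A :: "'k mat" assume A: "A \<in> carrier_mat (dim_row A) (dim_row A)"
  show "square_mat (A ^\<^sub>m n) \<and> eigen_sum (A ^\<^sub>m n) = bc_sigma n (eigen_sum A)"
    by (intro conjI square_mat_carrier[OF pow_carrier_mat[OF A]] eigen_sum_pow[OF n A])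
next
  show "bc_r p (bc_sigma n (bc_r p y)) = bc_r p (bc_sigma n y)" for y
    by (simp only: bc_r_sigma bc_r_r)
qed (simp_all only: bc_ops_0 bc_ops_diff)

lemma W0_V_W0_of:
  assumes n: "n > 0" shows "W0_V n (W0_of y) = W0_of (bc_rho n y)"
proof -
  have "W0_V n (W0_of y) = W0_of (bc_r p (bc_rho n y))"
    unfolding W0_V_def
  proof (rule W0_op_W0_of)
    fix A :: "'k mat" assume A: "A \<in> carrier_mat (dim_row A) (dim_row A)"
    show "square_mat (verschiebung_mat n A) \<and> eigen_sum (verschiebung_mat n A)
        = bc_r p (bc_rho n (eigen_sum A))"
      by (intro conjI square_mat_carrier[OF verschiebung_carrier[OF A]] eigen_sum_verschiebung[OF n A])
  next
    show "bc_r p (bc_r p (bc_rho n (bc_r p y))) = bc_r p (bc_r p (bc_rho n y))" for y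
      by (simp only: bc_r_r bc_r_rho[OF n])
  qed (simp_all only: bc_ops_0 bc_ops_diff)
  thus ?thesis by (simp only: W0_of_r)
qed

lemma W0_ext: "W0_F n \<in> extensional (carrier W0)" "W0_V n \<in> extensional (carrier W0)"
  by (simp_all add: W0_F_def W0_V_def W0_induced_def)

end

section \<open>Representations of the integral BC-algebra\<close>

abbreviation bc_words :: "bc_gen list set" where
  "bc_words \<equiv> lists {g. bc_gen_ok g}"

lemma monoid_words: "monoid \<lparr>carrier = bc_words, mult = (@), one = []\<rparr>"
  by (rule monoidI) auto

lemma bc_free_simps:
  "carrier bc_free = {c. Poly_Mapping.keys c \<subseteq> bc_words}"
  "x \<otimes>\<^bsub>bc_free\<^esub> y = mr_mult (@) x y"
  "x \<oplus>\<^bsub>bc_free\<^esub> y = x + y"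
  "\<one>\<^bsub>bc_free\<^esub> = frag_of []"
  "\<zero>\<^bsub>bc_free\<^esub> = 0"
  by (simp_all add: bc_free_def monoid_ring_simps)

lemma ring_bc_free: "ring bc_free"
  unfolding bc_free_def by (rule ring_monoid_ring[OF monoid_words])

lemma bc_free_minus:
  "x \<in> carrier bc_free \<Longrightarrow> y \<in> carrier bc_free \<Longrightarrow> y \<ominus>\<^bsub>bc_free\<^esub> x = y - x"
  "x \<in> carrier bc_free \<Longrightarrow> \<ominus>\<^bsub>bc_free\<^esub> x = - x"
  unfolding bc_free_def using monoid_ring_minus[OF monoid_words] by blast+

lemma bc_free_closed:
  "x \<in> carrier bc_free \<Longrightarrow> y \<in> carrier bc_free \<Longrightarrow> x - y \<in> carrier bc_free"
  "x \<in> carrier bc_free \<Longrightarrow> y \<in> carrier bc_free \<Longrightarrow> x + y \<in> carrier bc_free"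
  "x \<in> carrier bc_free \<Longrightarrow> - x \<in> carrier bc_free"
  "w \<in> bc_words \<Longrightarrow> frag_of w \<in> carrier bc_free"
  "w \<in> bc_words \<Longrightarrow> frag_cmul k (frag_of w) \<in> carrier bc_free"
  "0 \<in> carrier bc_free"
  unfolding bc_free_simps
  by (simp_all add: keys_subset_diff keys_subset_add keys_frag_of order_trans[OF keys_cmul])

lemma bc_relations_closed: "bc_relations \<subseteq> carrier bc_free"
proof -
  have w: "[Elt x] \<in> bc_words" "[Elt x, Elt y] \<in> bc_words" "[] \<in> bc_words" for x y by auto
  have w': "[Mu_tilde n, Elt x, Mu_star n] \<in> bc_words" "[Mu_star n, Elt x] \<in> bc_words" "[Elt x,
      Mu_star n] \<in> bc_words"
    "[Elt x, Mu_tilde n] \<in> bc_words" "[Mu_tilde n, Elt x] \<in> bc_words" "[Mu_tilde n] \<in> bc_words"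
        "[Mu_star n] \<in> bc_words"
    if "n > 0" for n x using that by auto
  have w'': "[Mu_tilde n, Mu_tilde m] \<in> bc_words" "[Mu_star n, Mu_star m] \<in> bc_words" "[Mu_star n,
      Mu_tilde m] \<in> bc_words" "[Mu_tilde n, Mu_star m] \<in> bc_words"
    if "n > 0" "m > 0" for n m using that by auto
  show ?thesis
    unfolding bc_relations_def
    by (intro Un_least subsetI) (auto intro!: bc_free_closed w w' w'' mult_pos_pos simp del:
        mr_mult_simps)
qed

lemma ideal_bc: "ideal bc_ideal bc_free"
  unfolding bc_ideal_def by (rule ring.genideal_ideal[OF ring_bc_free bc_relations_closed])

definition bc_quot :: "(bc_gen list \<Rightarrow>\<^sub>0 int) \<Rightarrow> (bc_gen list \<Rightarrow>\<^sub>0 int) set" where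
  "bc_quot c = bc_ideal +>\<^bsub>bc_free\<^esub> c"

lemma bc_class_eq: "bc_class g = bc_quot (frag_of [g])"
  by (simp add: bc_class_def bc_quot_def)

lemma bc_quot_hom: "bc_quot \<in> ring_hom bc_free bc_algebra"
  unfolding bc_quot_def[abs_def] bc_algebra_def by (rule ideal.rcos_ring_hom[OF ideal_bc])

lemma ring_bc_algebra: "ring bc_algebra"
  unfolding bc_algebra_def by (rule ideal.quotient_is_ring[OF ideal_bc])

lemma carrier_bc_algebra: "carrier bc_algebra = bc_quot ` carrier bc_free"
  unfolding bc_algebra_def FactRing_def A_RCOSETS_def' bc_quot_def by auto

lemma bc_quot_closed: "c \<in> carrier bc_free \<Longrightarrow> bc_quot c \<in> carrier bc_algebra"
  by (auto simp: carrier_bc_algebra)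

lemma bc_class_closed: "bc_gen_ok g \<Longrightarrow> bc_class g \<in> carrier bc_algebra"
  unfolding bc_class_eq by (rule bc_quot_closed, rule bc_free_closed) simp

lemma bc_quot_diff:
  assumes "a \<in> carrier bc_free" "b \<in> carrier bc_free"
  shows "bc_quot (a - b) = bc_quot a \<ominus>\<^bsub>bc_algebra\<^esub> bc_quot b"
proof -
  interpret H: ring_hom_ring bc_free bc_algebra bc_quot
    by (rule ring_hom_ringI2[OF ring_bc_free ring_bc_algebra bc_quot_hom])
  have "bc_quot (a \<ominus>\<^bsub>bc_free\<^esub> b) = bc_quot a \<ominus>\<^bsub>bc_algebra\<^esub> bc_quot b"
    using assms by (simp add: a_minus_def)
  thus ?thesis using assms by (simp add: bc_free_minus)
qed

lemma bc_quot_eqD: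
  assumes "a \<in> carrier bc_free" "b \<in> carrier bc_free" "bc_quot a = bc_quot b"
  shows "a - b \<in> bc_ideal"
proof -
  have "a = 0 + a" by simp
  moreover have "0 \<in> bc_ideal" using additive_subgroup.zero_closed[OF ideal.axioms(1)[OF ideal_bc]]
      by (simp add: bc_free_simps)
  ultimately have "a \<in> bc_quot a" unfolding bc_quot_def a_r_coset_def' bc_free_simps(3) by blast
  then obtain i where "i \<in> bc_ideal" "a = i + b" unfolding assms(3) unfolding bc_quot_def
      a_r_coset_def' bc_free_simps(3) by blast
  thus ?thesis by simp
qed

lemma bc_algebra_induct [consumes 1, case_names gen one mult diff]:
  assumes h: "h \<in> carrier bc_algebra"
    and gen: "\<And>g. bc_gen_ok g \<Longrightarrow> P (bc_class g)" and one: "P \<one>\<^bsub>bc_algebra\<^esub>"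
    and mult: "\<And>a b. a \<in> carrier bc_algebra \<Longrightarrow> b \<in> carrier bc_algebra \<Longrightarrow> P a \<Longrightarrow> P b \<Longrightarrow> P (a \<otimes>\<^bsub>bc_algebra\<^esub> b)"
    and diff: "\<And>a b. a \<in> carrier bc_algebra \<Longrightarrow> b \<in> carrier bc_algebra \<Longrightarrow> P a \<Longrightarrow> P b \<Longrightarrow> P (a \<ominus>\<^bsub>bc_algebra\<^esub> b)"
  shows "P h"
proof -
  interpret R: ring bc_algebra by (rule ring_bc_algebra)
  obtain c where c: "c \<in> carrier bc_free" "h = bc_quot c" using h unfolding carrier_bc_algebra by auto
  have word: "P (bc_quot (frag_of w))" if "w \<in> bc_words" for w
    using that
  proof (induction w)
    case Nil
    have "bc_quot (frag_of []) = \<one>\<^bsub>bc_algebra\<^esub>" using ring_hom_one[OF bc_quot_hom] by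
        (simp only: bc_free_simps)
    thus ?case using one by simp
  next
    case (Cons g w)
    hence gw: "bc_gen_ok g" "w \<in> bc_words" by auto
    have "frag_of (g # w) = frag_of [g] \<otimes>\<^bsub>bc_free\<^esub> frag_of w" by (simp add: bc_free_simps)
    hence "bc_quot (frag_of (g # w)) = bc_class g \<otimes>\<^bsub>bc_algebra\<^esub> bc_quot (frag_of w)"
      unfolding bc_class_eq using ring_hom_mult[OF bc_quot_hom, of "frag_of [g]" "frag_of w"] gw by
          (simp add: bc_free_closed)
    thus ?case using mult[OF bc_class_closed bc_quot_closed gen Cons.IH] gw by (simp add: bc_free_closed)
  qed
  have "c \<in> carrier bc_free \<and> P (bc_quot c)"
    using c(1)[unfolded bc_free_simps(1), simplified]
  proof (induction c rule: frag_induction)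
    case zero
    have 1: "frag_of [] \<in> carrier bc_free" by (rule bc_free_closed) simp
    have "P (bc_quot (frag_of [] - frag_of []))"
      unfolding bc_quot_diff[OF 1 1] by (rule diff[OF bc_quot_closed[OF 1] bc_quot_closed[OF 1]])
          (rule word; simp)+
    thus ?case by (simp add: bc_free_closed)
  next
    case (one w)
    thus ?case using word by (simp add: bc_free_closed)
  next
    case (diff a b)
    thus ?case using assms(5)[of "bc_quot a" "bc_quot b"] by
        (simp add: bc_quot_diff bc_free_closed bc_quot_closed)
  qed
  thus ?thesis using c(2) by simp
qed

lemma End_ring_simps:
  "carrier (End_ring M) = {f \<in> extensional (carrier M). f \<in> carrier M \<rightarrow> carrier M \<and>
                (\<forall>x\<in>carrier M. \<forall>y\<in>carrier M. f (x \<oplus>\<^bsub>M\<^esub> y) = f x \<oplus>\<^bsub>M\<^esub> f y)}"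
  "f \<otimes>\<^bsub>End_ring M\<^esub> g = compose (carrier M) f g"
  "\<one>\<^bsub>End_ring M\<^esub> = (\<lambda>x\<in>carrier M. x)"
  "\<zero>\<^bsub>End_ring M\<^esub> = (\<lambda>x\<in>carrier M. \<zero>\<^bsub>M\<^esub>)"
  "f \<oplus>\<^bsub>End_ring M\<^esub> g = (\<lambda>x\<in>carrier M. f x \<oplus>\<^bsub>M\<^esub> g x)"
  by (simp_all add: End_ring_def)

lemma End_ring_ext:
  "f \<in> carrier (End_ring M) \<Longrightarrow> g \<in> carrier (End_ring M) \<Longrightarrow> (\<And>x. x \<in> carrier M \<Longrightarrow> f x = g x) \<Longrightarrow> f = g"
  unfolding End_ring_simps by (auto intro: extensionalityI)

text \<open>A representation is determined by the generators; evaluated pointwise, a difference in the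
  algebra is recovered by cancellation in \<open>M\<close>.\<close>

lemma representation_diff:
  assumes M: "ring M" and \<pi>: "representation bc_algebra M \<pi>" and ab: "a \<in> carrier bc_algebra"
      "b \<in> carrier bc_algebra" and x: "x \<in> carrier M"
  shows "\<pi> (a \<ominus>\<^bsub>bc_algebra\<^esub> b) x = \<pi> a x \<ominus>\<^bsub>M\<^esub> \<pi> b x"
proof -
  interpret M: ring M by fact
  interpret R: ring bc_algebra by (rule ring_bc_algebra)
  have hom: "\<pi> \<in> ring_hom bc_algebra (End_ring M)" using \<pi> by (simp add: representation_def)
  let ?d = "a \<ominus>\<^bsub>bc_algebra\<^esub> b"
  have d: "?d \<in> carrier bc_algebra" using ab by simp
  have "?d \<oplus>\<^bsub>bc_algebra\<^esub> b = a" using ab by (simp add: a_minus_def R.a_assoc R.l_neg)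
  hence "\<pi> a = \<pi> ?d \<oplus>\<^bsub>End_ring M\<^esub> \<pi> b" using ring_hom_add[OF hom d ab(2)] by simp
  hence eq: "\<pi> a x = \<pi> ?d x \<oplus>\<^bsub>M\<^esub> \<pi> b x" using x by (simp add: End_ring_simps)
  have c: "\<pi> ?d x \<in> carrier M" "\<pi> b x \<in> carrier M"
    using ring_hom_closed[OF hom d] ring_hom_closed[OF hom ab(2)] x by (auto simp: End_ring_simps)
  show ?thesis unfolding eq using c by (simp add: a_minus_def M.a_assoc M.r_neg)
qed

lemma representation_eqI:
  assumes M: "ring M" and \<pi>: "representation bc_algebra M \<pi>" and \<pi>': "representation bc_algebra M \<pi>'"
    and gen: "\<And>g. bc_gen_ok g \<Longrightarrow> \<pi> (bc_class g) = \<pi>' (bc_class g)"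
  shows "\<pi> = \<pi>'"
proof -
  interpret R: ring bc_algebra by (rule ring_bc_algebra)
  have hom: "\<pi> \<in> ring_hom bc_algebra (End_ring M)" "\<pi>' \<in> ring_hom bc_algebra (End_ring M)"
    using \<pi> \<pi>' by (simp_all add: representation_def)
  have "\<pi> h = \<pi>' h" if "h \<in> carrier bc_algebra" for h
    using that
  proof (induction h rule: bc_algebra_induct)
    case (gen g)
    thus ?case by (rule assms(4))
  next
    case one
    show ?case using ring_hom_one[OF hom(1)] ring_hom_one[OF hom(2)] by simp
  next
    case (mult a b)
    thus ?case using ring_hom_mult[OF hom(1)] ring_hom_mult[OF hom(2)] by simp
  next
    case (diff a b)
    have d: "a \<ominus>\<^bsub>bc_algebra\<^esub> b \<in> carrier bc_algebra" using diff by simp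
    show ?case
      by (rule End_ring_ext[OF ring_hom_closed[OF hom(1) d] ring_hom_closed[OF hom(2) d]])
         (simp add: representation_diff[OF M \<pi> diff(1,2)] representation_diff[OF M \<pi>' diff(1,2)] diff)
  qed
  thus ?thesis using \<pi> \<pi>' by (intro extensionalityI[of \<pi> "carrier bc_algebra"])
      (simp_all add: representation_def)
qed

text \<open>The tautological action on \<open>\<int>[\<rat>/\<int>]\<close>, from which the representations on \<open>\<bbbW>\<^sub>0\<close> and on the big Witt
  vectors are deduced.\<close>

fun act_gen :: "bc_gen \<Rightarrow> qz_ring \<Rightarrow> qz_ring" where
  "act_gen (Elt x) y = x * y"
| "act_gen (Mu_tilde n) y = bc_rho n y"
| "act_gen (Mu_star n) y = bc_sigma n y"

definition act :: "(bc_gen list \<Rightarrow>\<^sub>0 int) \<Rightarrow> qz_ring \<Rightarrow> qz_ring" where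
  "act c y = frag_extend (\<lambda>w. foldr act_gen w y) c"

lemma act_gen_diff: "act_gen g (x - y) = act_gen g x - act_gen g y"
  by (cases g) (simp_all add: right_diff_distrib bc_ops_diff)

lemma foldr_act_gen_diff: "foldr act_gen w (x - y) = foldr act_gen w x - foldr act_gen w y"
  by (induction w) (simp_all add: act_gen_diff)

lemma act_simps [simp]:
  "act 0 y = 0" "act (frag_of w) y = foldr act_gen w y" "act (c - c') y = act c y - act c' y"
      "act (c + c') y = act c y + act c' y"
  "act (- c) y = - act c y" "act (frag_cmul k c) y = frag_cmul k (act c y)"
  by (simp_all add: act_def frag_extend_diff frag_extend_add frag_extend_minus frag_extend_cmul)

lemma act_diff: "act c (x - y) = act c x - act c y"
  by (simp add: act_def foldr_act_gen_diff frag_extend_diff_fun)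

lemma act_0: "act c 0 = 0"
  using act_diff[of c 0 0] by simp

lemma act_add: "act c (x + y) = act c x + act c y"
  using act_diff[of c "x + y" y] by (simp add: algebra_simps)

lemma bc_free_induct [case_names zero one diff]:
  fixes c :: "bc_gen list \<Rightarrow>\<^sub>0 int"
  assumes "P 0" "\<And>w. P (frag_of w)" "\<And>a b. P a \<Longrightarrow> P b \<Longrightarrow> P (a - b)" shows "P c"
  by (rule frag_induction[of c UNIV]) (use assms in auto)

lemma foldr_act_gen_0: "foldr act_gen w 0 = 0"
  using foldr_act_gen_diff[of w 0 0] by simp

lemma act_mult: "act (mr_mult (@) c c') y = act c (act c' y)"
proof (induction c rule: bc_free_induct)
  case (one w)
  show ?case
    by (induction c' rule: bc_free_induct) (simp_all add: foldr_act_gen_diff foldr_act_gen_0)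
qed simp_all

text \<open>The elements acting by zero form an ideal; once it contains the relations it contains the ideal
  that they generate.\<close>

lemma ideal_act: "ideal {c \<in> carrier bc_free. \<forall>y. act c y = 0} bc_free"
proof -
  interpret ring bc_free by (rule ring_bc_free)
  show ?thesis
  proof (rule idealI[OF ring_bc_free])
    show "subgroup {c \<in> carrier bc_free. \<forall>y. act c y = 0} (add_monoid bc_free)"
    proof (rule add.subgroupI)
      fix a assume a: "a \<in> {c \<in> carrier bc_free. \<forall>y. act c y = 0}"
      hence "\<ominus>\<^bsub>bc_free\<^esub> a = - a" by (intro bc_free_minus) simp
      thus "\<ominus>\<^bsub>bc_free\<^esub> a \<in> {c \<in> carrier bc_free. \<forall>y. act c y = 0}" using a by (simp add: bc_free_closed)
    next
      fix a b assume "a \<in> {c \<in> carrier bc_free. \<forall>y. act c y = 0}"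
          "b \<in> {c \<in> carrier bc_free. \<forall>y. act c y = 0}"
      thus "a \<oplus>\<^bsub>bc_free\<^esub> b \<in> {c \<in> carrier bc_free. \<forall>y. act c y = 0}" by
          (simp add: bc_free_simps(3) bc_free_closed)
    next
      have "0 \<in> {c \<in> carrier bc_free. \<forall>y. act c y = 0}" by (simp add: bc_free_closed)
      thus "{c \<in> carrier bc_free. \<forall>y. act c y = 0} \<noteq> {}" by blast
    qed auto
  next
    fix a x assume ax: "a \<in> {c \<in> carrier bc_free. \<forall>y. act c y = 0}" "x \<in> carrier bc_free"
    have "x \<otimes>\<^bsub>bc_free\<^esub> a \<in> carrier bc_free" "a \<otimes>\<^bsub>bc_free\<^esub> x \<in> carrier bc_free" using ax by auto
    thus "x \<otimes>\<^bsub>bc_free\<^esub> a \<in> {c \<in> carrier bc_free. \<forall>y. act c y = 0}"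
        "a \<otimes>\<^bsub>bc_free\<^esub> x \<in> {c \<in> carrier bc_free. \<forall>y. act c y = 0}"
      using ax by (simp_all add: bc_free_simps(2) act_mult act_0)
  qed
qed

lemma act_bc_ideal:
  assumes "c \<in> bc_ideal" shows "act c y = 0"
proof -
  \<comment> \<open>The relations require the identities of the group ring with the factors in this order.\<close>
  have rho_right: "bc_rho n (x * bc_sigma n y) = bc_rho n x * y" if "n > 0" for n x y
    using bc_rho_mult_sigma[OF that, of y x] by (simp only: mult.commute)
  have rho_rho: "bc_rho n (bc_rho m y) = bc_rho (n * m) y" if "n > 0" "m > 0" for n m y
    using bc_rho_rho[OF that] by (simp only: mult.commute)
  have "bc_relations \<subseteq> {c \<in> carrier bc_free. \<forall>y. act c y = 0}"
  proof
    fix c assume c: "c \<in> bc_relations"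
    have "act c y = 0" for y
      using c unfolding bc_relations_def
      by (elim UnE)
         (auto simp: distrib_right mult.assoc bc_rho_mult_sigma rho_right bc_sigma_mult rho_rho
             bc_sigma_sigma bc_sigma_rho
           bc_rho_sigma_coprime)
    thus "c \<in> {c \<in> carrier bc_free. \<forall>y. act c y = 0}" using c bc_relations_closed by auto
  qed
  hence "bc_ideal \<subseteq> {c \<in> carrier bc_free. \<forall>y. act c y = 0}"
    unfolding bc_ideal_def by (rule ring.genideal_minimal[OF ring_bc_free ideal_act])
  thus ?thesis using assms by auto
qed

definition bc_rep :: "(bc_gen list \<Rightarrow>\<^sub>0 int) set \<Rightarrow> bc_gen list \<Rightarrow>\<^sub>0 int" where
  "bc_rep h = (SOME c. c \<in> carrier bc_free \<and> h = bc_quot c)"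

lemma bc_rep:
  assumes "h \<in> carrier bc_algebra" shows "bc_rep h \<in> carrier bc_free" "h = bc_quot (bc_rep h)"
proof -
  have "\<exists>c. c \<in> carrier bc_free \<and> h = bc_quot c" using assms unfolding carrier_bc_algebra by auto
  from someI_ex[OF this] show "bc_rep h \<in> carrier bc_free" "h = bc_quot (bc_rep h)"
      unfolding bc_rep_def by blast+
qed

lemma act_bc_rep:
  assumes "c \<in> carrier bc_free" shows "act (bc_rep (bc_quot c)) y = act c y"
proof -
  have "bc_quot c \<in> carrier bc_algebra" using assms by (rule bc_quot_closed)
  from bc_rep[OF this] have "bc_rep (bc_quot c) - c \<in> bc_ideal" using assms
      by (intro bc_quot_eqD) simp_all
  from act_bc_ideal[OF this, of y] show ?thesis by simp
qed

context residue_character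
begin

text \<open>Each generator preserves the kernel of \<open>r\<close>, so the action passes to the quotient \<open>\<bbbW>\<^sub>0\<close>.\<close>

lemma bc_r_act:
  assumes "c \<in> carrier bc_free" shows "bc_r p (act c (bc_r p y)) = bc_r p (act c y)"
proof -
  have word: "bc_r p (foldr act_gen w (bc_r p y)) = bc_r p (foldr act_gen w y)" if "w \<in> bc_words" for w
    using that
  proof (induction w)
    case (Cons g w)
    hence g: "bc_gen_ok g" and IH: "bc_r p (foldr act_gen w (bc_r p y))
        = bc_r p (foldr act_gen w y)" by auto
    have "bc_r p (act_gen g u) = bc_r p (act_gen g v)" if "bc_r p u = bc_r p v" for u v
    proof (cases g)
      case (Elt x)
      thus ?thesis using that by (simp add: bc_r_mult)
    next
      case (Mu_tilde n)
      hence n: "n > 0" using g by simp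
      have "bc_r p (bc_rho n u) = bc_r p (bc_rho n v)"
        using bc_r_rho[OF n, of u] bc_r_rho[OF n, of v] that by simp
      thus ?thesis using Mu_tilde by simp
    next
      case (Mu_star n)
      thus ?thesis using that by (simp add: bc_r_sigma)
    qed
    from this[OF IH] show ?case by simp
  qed (simp add: bc_r_r)
  show ?thesis using assms[unfolded bc_free_simps(1), simplified]
    by (induction c rule: frag_induction) (simp_all add: word bc_ops_diff)
qed

text \<open>A definition by representatives: neither the choice of \<open>bc_rep h\<close> nor the passage through
  \<open>\<sigma>\<close>-tilde affects the value (\<open>W0_rep_W0_of\<close>).\<close>

definition W0_rep :: "(bc_gen list \<Rightarrow>\<^sub>0 int) set \<Rightarrow> ('k mat \<Rightarrow>\<^sub>0 int) set \<Rightarrow> ('k mat \<Rightarrow>\<^sub>0 int) set" where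
  "W0_rep = (\<lambda>h\<in>carrier bc_algebra. \<lambda>\<xi>\<in>carrier W0. W0_of (act (bc_rep h) (sigma_tilde \<sigma> \<xi>)))"

lemma W0_rep_W0_of:
  assumes "c \<in> carrier bc_free" shows "W0_rep (bc_quot c) (W0_of y) = W0_of (act c y)"
  using assms
  by (simp add: W0_rep_def bc_quot_closed act_bc_rep sigma_tilde_W0_of W0_of_eq_iff bc_r_act)

lemma representation_W0_rep: "representation bc_algebra W0 W0_rep"
proof -
  interpret F: ring bc_free by (rule ring_bc_free)
  have "W0_rep \<in> ring_hom bc_algebra (End_ring W0)"
  proof (rule ring_hom_memI)
    fix h assume h: "h \<in> carrier bc_algebra"
    then obtain c where c: "c \<in> carrier bc_free" "h = bc_quot c" unfolding carrier_bc_algebra by auto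
    have rep: "W0_rep h (W0_of y) = W0_of (act c y)" for y unfolding c(2) by (rule W0_rep_W0_of[OF c(1)])
    have add: "W0_rep h (\<xi> \<oplus>\<^bsub>W0\<^esub> \<eta>) = W0_rep h \<xi> \<oplus>\<^bsub>W0\<^esub> W0_rep h \<eta>" if *: "\<xi> \<in> carrier W0"
        "\<eta> \<in> carrier W0" for \<xi> \<eta>
    proof -
      obtain y z where yz: "\<xi> = W0_of y" "\<eta> = W0_of z" using W0_of_surj[OF *(1)] W0_of_surj[OF *(2)]
          by blast
      show ?thesis unfolding yz W0_of_add[symmetric] rep act_add ..
    qed
    have closed: "W0_rep h \<xi> \<in> carrier W0" if *: "\<xi> \<in> carrier W0" for \<xi>
    proof -
      obtain y where y: "\<xi> = W0_of y" using W0_of_surj[OF *] by blast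
      show ?thesis unfolding y rep by simp
    qed
    have "W0_rep h \<in> extensional (carrier W0)" using h by (simp add: W0_rep_def)
    thus "W0_rep h \<in> carrier (End_ring W0)" unfolding End_ring_simps using add closed by simp
  next
    fix h h' assume "h \<in> carrier bc_algebra" "h' \<in> carrier bc_algebra"
    then obtain c c' where c: "c \<in> carrier bc_free" "h = bc_quot c" "c' \<in> carrier bc_free" "h'
        = bc_quot c'"
      unfolding carrier_bc_algebra by auto
    have cc: "mr_mult (@) c c' \<in> carrier bc_free" "c + c' \<in> carrier bc_free"
      using F.m_closed[OF c(1,3)] F.a_closed[OF c(1,3)] by (simp_all add: bc_free_simps(2,3))
    have hh: "h \<otimes>\<^bsub>bc_algebra\<^esub> h' = bc_quot (mr_mult (@) c c')" "h \<oplus>\<^bsub>bc_algebra\<^esub> h' = bc_quot (c + c')"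
      using ring_hom_mult[OF bc_quot_hom c(1,3)] ring_hom_add[OF bc_quot_hom c(1,3)] c by
          (simp_all add: bc_free_simps(2,3))
    have rep: "W0_rep h (W0_of y) = W0_of (act c y)" "W0_rep h' (W0_of y) = W0_of (act c' y)" for y
      unfolding c(2,4) by (rule W0_rep_W0_of[OF c(1)], rule W0_rep_W0_of[OF c(3)])
    have rep': "W0_rep (h \<otimes>\<^bsub>bc_algebra\<^esub> h') (W0_of y) = W0_of (act c (act c' y))"
      "W0_rep (h \<oplus>\<^bsub>bc_algebra\<^esub> h') (W0_of y) = W0_of (act c y) \<oplus>\<^bsub>W0\<^esub> W0_of (act c' y)" for y
      unfolding hh W0_rep_W0_of[OF cc(1)] W0_rep_W0_of[OF cc(2)] by
          (simp_all only: act_mult act_simps W0_of_add)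
    have ext: "W0_rep (h \<otimes>\<^bsub>bc_algebra\<^esub> h') \<in> extensional (carrier W0)"
        "W0_rep (h \<oplus>\<^bsub>bc_algebra\<^esub> h') \<in> extensional (carrier W0)"
      unfolding hh using bc_quot_closed[OF cc(1)] bc_quot_closed[OF cc(2)] by (simp_all add: W0_rep_def)
    show "W0_rep (h \<otimes>\<^bsub>bc_algebra\<^esub> h') = W0_rep h \<otimes>\<^bsub>End_ring W0\<^esub> W0_rep h'"
    proof (rule extensionalityI[OF ext(1)])
      fix \<xi> :: "('k mat \<Rightarrow>\<^sub>0 int) set" assume "\<xi> \<in> carrier W0"
      then obtain y where y: "\<xi> = W0_of y" using W0_of_surj by blast
      show "W0_rep (h \<otimes>\<^bsub>bc_algebra\<^esub> h') \<xi> = (W0_rep h \<otimes>\<^bsub>End_ring W0\<^esub> W0_rep h') \<xi>"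
        unfolding y rep' End_ring_simps compose_eq[OF W0_of_closed] rep ..
    qed (simp add: End_ring_simps)
    show "W0_rep (h \<oplus>\<^bsub>bc_algebra\<^esub> h') = W0_rep h \<oplus>\<^bsub>End_ring W0\<^esub> W0_rep h'"
    proof (rule extensionalityI[OF ext(2)])
      fix \<xi> :: "('k mat \<Rightarrow>\<^sub>0 int) set" assume "\<xi> \<in> carrier W0"
      then obtain y where y: "\<xi> = W0_of y" using W0_of_surj by blast
      show "W0_rep (h \<oplus>\<^bsub>bc_algebra\<^esub> h') \<xi> = (W0_rep h \<oplus>\<^bsub>End_ring W0\<^esub> W0_rep h') \<xi>"
        unfolding y rep' End_ring_simps restrict_apply'[OF W0_of_closed] rep ..
    qed (simp add: End_ring_simps)
  next
    have 1: "frag_of [] \<in> carrier bc_free" by (rule bc_free_closed) simp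
    have one: "\<one>\<^bsub>bc_algebra\<^esub> = bc_quot (frag_of [])" using ring_hom_one[OF bc_quot_hom] by
        (simp only: bc_free_simps)
    show "W0_rep \<one>\<^bsub>bc_algebra\<^esub> = \<one>\<^bsub>End_ring W0\<^esub>"
    proof (rule extensionalityI[of _ "carrier W0"])
      fix \<xi> :: "('k mat \<Rightarrow>\<^sub>0 int) set" assume "\<xi> \<in> carrier W0"
      then obtain y where y: "\<xi> = W0_of y" using W0_of_surj by blast
      show "W0_rep \<one>\<^bsub>bc_algebra\<^esub> \<xi> = \<one>\<^bsub>End_ring W0\<^esub> \<xi>"
        unfolding one y End_ring_simps by (simp add: W0_rep_W0_of 1)
    qed (simp_all add: W0_rep_def one bc_quot_closed 1 End_ring_simps)
  qed
  thus ?thesis by (simp add: representation_def W0_rep_def)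
qed

lemma W0_rep_gen:
  "bc_gen_ok g \<Longrightarrow> W0_rep (bc_class g) (W0_of y) = W0_of (act_gen g y)"
  unfolding bc_class_eq by (subst W0_rep_W0_of) (simp_all add: bc_free_closed)

lemma W0_rep_ext: "h \<in> carrier bc_algebra \<Longrightarrow> W0_rep h \<in> extensional (carrier W0)"
  by (simp add: W0_rep_def)

lemma W0_representation_W0_rep: "W0_representation p \<sigma> W0_rep"
proof -
  have eq: "W0_rep (bc_class g) = f" if g: "bc_gen_ok g" and f: "f \<in> extensional (carrier W0)"
      and y: "\<And>y. f (W0_of y) = W0_of (act_gen g y)" for g f
  proof (rule extensionalityI[OF W0_rep_ext[OF bc_class_closed[OF g]] f])
    fix \<xi> :: "('k mat \<Rightarrow>\<^sub>0 int) set" assume "\<xi> \<in> carrier W0"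
    then obtain z where "\<xi> = W0_of z" using W0_of_surj by blast
    thus "W0_rep (bc_class g) \<xi> = f \<xi>" by (simp add: W0_rep_gen g y)
  qed
  show ?thesis
    unfolding W0_representation_def
    by (intro conjI allI impI representation_W0_rep eq)
       (simp_all add: W0_ext inv_sigma_tilde W0_of_mult W0_F_W0_of W0_V_W0_of)
qed

lemma W0_representation_unique:
  assumes "W0_representation p \<sigma> \<pi>0" shows "\<pi>0 = W0_rep"
proof (rule representation_eqI[OF ring_W0])
  show "representation bc_algebra W0 \<pi>0" using assms by (simp add: W0_representation_def)
  show "representation bc_algebra W0 W0_rep" by (rule representation_W0_rep)
  fix g assume "bc_gen_ok g"
  thus "\<pi>0 (bc_class g) = W0_rep (bc_class g)"
    using assms W0_representation_W0_rep unfolding W0_representation_def by (cases g) simp_all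
qed

end

section \<open>The product topology on big Witt vectors\<close>

text \<open>The basic neighbourhoods of \<open>x\<close> in the product topology.\<close>

definition cylinder :: "(nat \<Rightarrow> 'a) \<Rightarrow> nat \<Rightarrow> (nat \<Rightarrow> 'a) set" where
  "cylinder x N = {y \<in> {0<..} \<rightarrow>\<^sub>E UNIV. \<forall>m. 0 < m \<and> m \<le> N \<longrightarrow> y m = x m}"

lemma topspace_witt: "topspace witt_topology = {0<..} \<rightarrow>\<^sub>E UNIV"
  by (simp add: witt_topology_def)

lemma openin_cylinder: "openin witt_topology (cylinder x N)"
proof -
  define S where "S m = (if m \<le> N then {x m} else UNIV)" for m
  have cylinder: "cylinder x N = PiE {0<..} S"
  proof (rule Set.set_eqI)
    fix y
    show "y \<in> cylinder x N \<longleftrightarrow> y \<in> PiE {0<..} S"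
      by (simp add: cylinder_def PiE_iff S_def Ball_def) blast
  qed
  have "S m \<noteq> UNIV \<Longrightarrow> m \<le> N" for m by (rule ccontr) (simp add: S_def)
  hence "{m \<in> {0<..}. S m \<noteq> UNIV} \<subseteq> {..N}" by blast
  hence "finite {m \<in> {0<..}. S m \<noteq> UNIV}" by (rule finite_subset) (rule finite_atMost)
  thus ?thesis
    unfolding cylinder witt_topology_def openin_PiE_gen by
        (simp only: topspace_discrete_topology openin_discrete_topology subset_UNIV simp_thms ball_triv)
qed

lemma cylinder_subset:
  assumes "openin witt_topology U" "x \<in> U" shows "\<exists>N. cylinder x N \<subseteq> U"
proof -
  from assms obtain V where V: "finite {i \<in> {0<..}. V i \<noteq> UNIV}" "x \<in> PiE {0<..} V" "PiE {0<..} V \<subseteq> U"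
    unfolding witt_topology_def openin_product_topology_alt by auto
  then obtain N where N: "\<And>i. i \<in> {i \<in> {0<..}. V i \<noteq> UNIV} \<Longrightarrow> i \<le> N"
    using finite_nat_set_iff_bounded_le by (metis (lifting))
  have "cylinder x N \<subseteq> PiE {0<..} V"
  proof
    fix y assume y: "y \<in> cylinder x N"
    have "y i \<in> V i" if i: "i \<in> {0<..}" for i
    proof (cases "V i = UNIV")
      case False
      hence "i \<le> N" using i by (intro N) simp
      hence "y i = x i" using y i by (simp add: cylinder_def)
      thus ?thesis using V(2) i by auto
    qed simp
    thus "y \<in> PiE {0<..} V" using y by (auto simp: cylinder_def PiE_iff)
  qed
  thus ?thesis using V(3) by blast
qed

lemma cylinder_self: "x \<in> {0<..} \<rightarrow>\<^sub>E UNIV \<Longrightarrow> x \<in> cylinder x N"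
  by (simp add: cylinder_def)

lemma continuous_witt_iff:
  fixes f :: "(nat \<Rightarrow> 'a::comm_ring_1) \<Rightarrow> nat \<Rightarrow> 'b::comm_ring_1"
  shows
  "continuous_map witt_topology witt_topology f \<longleftrightarrow>
     f \<in> carrier big_witt \<rightarrow> carrier big_witt \<and> (\<forall>x\<in>carrier big_witt. \<forall>n>0. \<exists>N. \<forall>y\<in>cylinder x N. f y
         n = f x n)"
  (is "?L \<longleftrightarrow> ?R")
proof
  assume L: ?L
  have f: "f \<in> carrier big_witt \<rightarrow> carrier big_witt"
    using continuous_map_funspace[OF L] by (simp add: topspace_witt carrier_witt)
  moreover have "\<exists>N. \<forall>y\<in>cylinder x N. f y n = f x n" if x: "x \<in> carrier big_witt" and n: "n > 0" for x n
  proof -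
    let ?U = "{y \<in> topspace witt_topology. f y \<in> cylinder (f x) n}"
    have "openin witt_topology ?U" using openin_continuous_map_preimage[OF L openin_cylinder] .
    moreover have "f x \<in> carrier big_witt" using f x by auto
    hence "x \<in> ?U" using x by (simp add: topspace_witt carrier_witt cylinder_self)
    ultimately obtain N where "cylinder x N \<subseteq> ?U" using cylinder_subset by blast
    hence "f y n = f x n" if "y \<in> cylinder x N" for y using that n by (auto simp: cylinder_def)
    thus ?thesis by blast
  qed
  ultimately show ?R by blast
next
  assume R: ?R
  show ?L
    unfolding continuous_map_def
  proof (intro conjI allI impI)
    show "f \<in> topspace witt_topology \<rightarrow> topspace witt_topology" using R by
        (simp add: topspace_witt carrier_witt)
    fix U :: "(nat \<Rightarrow> 'b) set" assume U: "openin witt_topology U"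
    show "openin witt_topology {x \<in> topspace witt_topology. f x \<in> U}"
    proof (subst openin_subopen, intro ballI)
      fix x assume x: "x \<in> {x \<in> topspace witt_topology. f x \<in> U}"
      hence xc: "x \<in> carrier big_witt" by (simp add: topspace_witt carrier_witt)
      obtain M where M: "cylinder (f x) M \<subseteq> U" using cylinder_subset[OF U, of "f x"] x by auto
      have "\<exists>g. \<forall>n. n > 0 \<longrightarrow> (\<forall>y\<in>cylinder x (g n). f y n = f x n)" using R xc by (intro choice) blast
      then obtain g where g: "\<And>n y. n > 0 \<Longrightarrow> y \<in> cylinder x (g n) \<Longrightarrow> f y n = f x n" by blast
      define N where "N = (\<Sum>n\<le>M. g n)"
      have gN: "g n \<le> N" if "n \<le> M" for n unfolding N_def using that by (intro member_le_sum) auto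
      have "cylinder x N \<subseteq> {x \<in> topspace witt_topology. f x \<in> U}"
      proof
        fix y assume y: "y \<in> cylinder x N"
        hence yc: "y \<in> {0<..} \<rightarrow>\<^sub>E UNIV" by (simp add: cylinder_def)
        hence fy: "f y \<in> {0<..} \<rightarrow>\<^sub>E UNIV" using R by (auto simp: carrier_witt)
        have "f y n = f x n" if n: "0 < n" "n \<le> M" for n
        proof (rule g[OF n(1)])
          show "y \<in> cylinder x (g n)" using y gN[OF n(2)] by (auto simp: cylinder_def)
        qed
        hence "f y \<in> cylinder (f x) M" using fy by (simp add: cylinder_def)
        thus "y \<in> {x \<in> topspace witt_topology. f x \<in> U}" using M yc by (auto simp: topspace_witt)
      qed
      thus "\<exists>T. openin witt_topology T \<and> x \<in> T \<and> T \<subseteq> {x \<in> topspace witt_topology. f x \<in> U}"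
        using openin_cylinder xc by (intro exI[of _ "cylinder x N"])
            (simp add: cylinder_self carrier_witt)
    qed
  qed
qed

text \<open>It suffices that the component of index \<open>n\<close> of the value depends on the components up to \<open>B n\<close>.\<close>

lemma continuous_wittI:
  fixes f :: "(nat \<Rightarrow> 'a::comm_ring_1) \<Rightarrow> nat \<Rightarrow> 'b::comm_ring_1"
  assumes "\<And>x. x \<in> carrier big_witt \<Longrightarrow> f x \<in> carrier big_witt"
    and "\<And>x y n. n > 0 \<Longrightarrow> x \<in> carrier big_witt \<Longrightarrow> y \<in> carrier big_witt \<Longrightarrow> (\<And>m. 0 < m \<Longrightarrow> m \<le> B n \<Longrightarrow> y m
        = x m) \<Longrightarrow> f y n = f x n"
  shows "continuous_map witt_topology witt_topology f"
  unfolding continuous_witt_iff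
proof (intro conjI ballI allI impI)
  fix x :: "nat \<Rightarrow> 'a" and n assume "x \<in> carrier big_witt" "(0::nat) < n"
  thus "\<exists>N. \<forall>y\<in>cylinder x N. f y n = f x n"
    by (intro exI[of _ "B n"] ballI assms(2)) (auto simp: cylinder_def carrier_witt)
qed (use assms(1) in auto)

lemma continuous_witt_eqI:
  fixes f g :: "(nat \<Rightarrow> 'a::comm_ring_1) \<Rightarrow> nat \<Rightarrow> 'b::comm_ring_1"
  assumes f: "continuous_map witt_topology witt_topology f" and g:
      "continuous_map witt_topology witt_topology g"
    and dense: "\<And>x N. x \<in> carrier big_witt \<Longrightarrow> \<exists>d\<in>D. d \<in> cylinder x N" and eq: "\<And>d. d \<in> D \<Longrightarrow> f d = g d"
    and x: "x \<in> carrier big_witt"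
  shows "f x = g x"
proof (rule witt_ext)
  show "f x \<in> carrier big_witt" "g x \<in> carrier big_witt" using f g x unfolding continuous_witt_iff
      by auto
  fix n :: nat assume "n \<in> {0<..}"
  hence n: "n > 0" by simp
  obtain N where N: "\<And>y. y \<in> cylinder x N \<Longrightarrow> f y n = f x n" using f x n unfolding continuous_witt_iff
      by blast
  obtain M where M: "\<And>y. y \<in> cylinder x M \<Longrightarrow> g y n = g x n" using g x n unfolding continuous_witt_iff
      by blast
  obtain d where d: "d \<in> D" "d \<in> cylinder x (max N M)" using dense[OF x] by blast
  have "d \<in> cylinder x N" "d \<in> cylinder x M" using d(2) by (auto simp: cylinder_def)
  hence "f d n = f x n" "g d n = g x n" by (simp_all only: N M)
  thus "f x n = g x n" using eq[OF d(1)] by simp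
qed

text \<open>Restriction to the divisors of \<open>n\<close> is a ring homomorphism.\<close>

lemma witt_minus_cong:
  assumes "u \<in> carrier big_witt" "u' \<in> carrier big_witt" "v \<in> carrier big_witt"
      "v' \<in> carrier big_witt" and n: "n > 0"
    and eq: "\<And>m. m dvd n \<Longrightarrow> u m = u' m" "\<And>m. m dvd n \<Longrightarrow> v m = v' m"
  shows "(u \<ominus>\<^bsub>big_witt\<^esub> v) n = (u' \<ominus>\<^bsub>big_witt\<^esub> v') n"
proof -
  let ?S = "{m. m dvd n}"
  have S: "divisor_closed ?S" "?S \<subseteq> {0<..}" using n by (auto intro: divisor_closed_divisors Nat.gr0I)
  interpret W: cring "big_witt :: (nat \<Rightarrow> 'a) ring" by (rule cring_big_witt)
  interpret V: cring "witt_ring ?S :: (nat \<Rightarrow> 'a) ring" by (rule cring_witt[OF S(1)])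
  interpret H: ring_hom_ring big_witt "witt_ring ?S" "\<lambda>x :: nat \<Rightarrow> 'a. restrict x ?S"
    by (rule ring_hom_ringI2[OF W.ring_axioms V.ring_axioms ring_hom_restrict_witt[OF S]])
  have "restrict u ?S = restrict u' ?S" "restrict v ?S = restrict v' ?S" using eq by auto
  hence "restrict (u \<ominus>\<^bsub>big_witt\<^esub> v) ?S = restrict (u' \<ominus>\<^bsub>big_witt\<^esub> v') ?S"
    using assms(1-4) by (simp add: a_minus_def)
  from fun_cong[OF this, of n] show ?thesis by simp
qed

section \<open>The embedding of \<open>\<bbbW>\<^sub>0\<close> into the big Witt vectors\<close>

lemma fps_mult_unit_cancel:
  fixes u :: "'a::idom fps"
  assumes "a * u = b" "c * u = b" "fps_nth u 0 \<noteq> 0" shows "a = c"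
proof -
  have "u \<noteq> 0" using assms(3) by auto
  thus ?thesis using assms by (metis mult_right_cancel)
qed

lemma powi_diff_eq:
  fixes f g :: "'a::field fps"
  assumes "fps_nth f 0 \<noteq> 0" shows "f powi (int m - int n) = f ^ m * inverse f ^ n"
proof -
  have fg: "f * inverse f = 1" using assms by (simp add: inverse_mult_eq_1')
  show ?thesis
  proof (cases "n \<le> m")
    case True
    then obtain k where k: "m = n + k" by (metis le_Suc_ex)
    have "f ^ m * inverse f ^ n = f ^ k * (f * inverse f) ^ n" by
        (simp add: k power_add power_mult_distrib mult_ac)
    thus ?thesis using k fg by (simp add: power_int_def)
  next
    case False
    then obtain k where k: "n = m + k" "k > 0" using less_imp_add_positive[of m n] by auto
    have "f ^ m * inverse f ^ n = (f * inverse f) ^ m * inverse f ^ k" by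
        (simp add: k power_add power_mult_distrib mult_ac)
    thus ?thesis using k fg by (simp add: power_int_def)
  qed
qed

lemma powi_add_fps:
  fixes f :: "'a::field fps"
  assumes "fps_nth f 0 \<noteq> 0" shows "f powi (a + b) = f powi a * f powi b"
proof -
  obtain m n m' n' where ab: "a = int m - int n" "b = int m' - int n'"
    using int_diff_cases[of a] int_diff_cases[of b] by metis
  have s: "a + b = int (m + m') - int (n + n')" using ab by simp
  show ?thesis unfolding s unfolding ab powi_diff_eq[OF assms] by (simp add: power_add mult_ac)
qed

text \<open>The series \<open>\<Prod> F\<^sub>A\<^bsup>-c(A)\<^esup>\<close> of a formal combination \<open>c\<close> of matrices, multiplicative in \<open>c\<close>.\<close>

definition series_prod :: "('m \<Rightarrow> 'a::field fps) \<Rightarrow> ('m \<Rightarrow>\<^sub>0 int) \<Rightarrow> 'a fps" where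
  "series_prod F c = (\<Prod>A\<in>Poly_Mapping.keys c. F A powi (- Poly_Mapping.lookup c A))"

lemma series_prod_superset:
  assumes "finite V" "Poly_Mapping.keys c \<subseteq> V"
  shows "series_prod F c = (\<Prod>A\<in>V. F A powi (- Poly_Mapping.lookup c A))"
  unfolding series_prod_def by (rule prod.mono_neutral_left) (use assms in \<open>auto simp: in_keys_iff\<close>)

lemma series_prod_add:
  fixes c c' :: "'m \<Rightarrow>\<^sub>0 int"
  assumes "\<And>A. A \<in> Poly_Mapping.keys c \<union> Poly_Mapping.keys c' \<Longrightarrow> fps_nth (F A) 0 \<noteq> 0"
  shows "series_prod F (c + c') = series_prod F c * series_prod F c'"
proof -
  let ?V = "Poly_Mapping.keys c \<union> Poly_Mapping.keys c'"
  have "series_prod F (c + c') = (\<Prod>A\<in>?V. F A powi (- Poly_Mapping.lookup (c + c') A))"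
    by (rule series_prod_superset) (use Poly_Mapping.keys_add[of c c'] in auto)
  also have "\<dots> = (\<Prod>A\<in>?V. F A powi (- Poly_Mapping.lookup c A) * F A powi (- Poly_Mapping.lookup c' A))"
    by (rule prod.cong[OF refl]) (use assms in \<open>simp add: lookup_add powi_add_fps flip: powi_add_fps\<close>)
  also have "\<dots> = series_prod F c * series_prod F c'"
    unfolding prod.distrib by (subst (1 2) series_prod_superset[of ?V]) auto
  finally show ?thesis .
qed

lemma series_prod_0 [simp]: "series_prod F 0 = 1"
  by (simp add: series_prod_def)

lemma series_prod_of [simp]: "series_prod F (frag_of A) = inverse (F A)"
  by (simp add: series_prod_def keys_frag_of power_int_def)

context residue_character
begin

lemma det_series_nth_0:
  assumes "A \<in> carrier_mat d d" shows "fps_nth (det_series (A :: 'k mat)) 0 = 1"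
  using assms
proof (induction rule: devissage)
  case (empty A)
  thus ?case unfolding det_series_pencil[OF empty] by (subst det_dim_zero) auto
next
  case (extend \<alpha> A A' d)
  thus ?case by (simp add: det_series_split[OF extend(3)] det_series_mat1)
qed

abbreviation char_series :: "('k mat \<Rightarrow>\<^sub>0 int) \<Rightarrow> 'k fps" where
  "char_series \<equiv> series_prod det_series"

lemma char_series_add:
  assumes "a \<in> carrier end_free" "b \<in> carrier end_free" shows "char_series (a + b)
      = char_series a * char_series b"
proof (rule series_prod_add)
  fix A assume "A \<in> Poly_Mapping.keys a \<union> Poly_Mapping.keys b"
  hence "square_mat A" using assms by (auto simp: end_free_simps)
  from det_series_nth_0[OF square_carrier[OF this]] show "fps_nth (det_series A) 0 \<noteq> 0" by simp
qed

lemma char_series_diff: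
  assumes "a \<in> carrier end_free" "b \<in> carrier end_free" shows "char_series (a - b) * char_series b
      = char_series a"
  using char_series_add[OF end_free_closed(2)[OF assms] assms(2)] by simp

lemma char_series_diag_of_0: "fps_nth (char_series (diag_of y)) 0 = 1"
proof (induction y rule: qz_ring_induct)
  case (diff a b)
  have "fps_nth (char_series (diag_of a - diag_of b) * char_series (diag_of b)) 0
      = fps_nth (char_series (diag_of a)) 0"
    by (simp only: char_series_diff[OF diag_of_closed diag_of_closed])
  thus ?case using diff by simp
qed (simp_all add: det_series_mat1)

text \<open>By devissage the determinant series depends only on the eigenvalues, and zero eigenvalues
  contribute the factor \<open>1\<close>.\<close>

lemma char_series_diag_of_eq:
  assumes "c \<in> carrier end_free" shows "char_series c = char_series (diag_of (eigen_hom c))"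
proof -
  have mat: "char_series (frag_of A) = char_series (diag_of (eigen_sum A))" if "A \<in> carrier_mat d d"
      for A d
    using that
  proof (induction rule: devissage)
    case (empty A)
    hence "det_series A = 1" using det_series_pencil[OF empty] by (simp add: det_dim_zero)
    thus ?case unfolding eigen_sum_empty[OF empty] series_prod_of by simp
  next
    case (extend \<alpha> A A' d)
    have m: "inverse (det_series (mat1 \<alpha>)) = char_series (diag_of (root_frag \<alpha>))"
      by (simp add: root_frag_def chi_sigma det_series_mat1)
    have "char_series (diag_of (eigen_sum A)) = char_series (diag_of (root_frag \<alpha>)) * char_series
        (diag_of (eigen_sum A'))"
      unfolding eigen_sum_split[OF extend(3)] eigen_sum_mat1 diag_of_simps char_series_add[OF
          diag_of_closed diag_of_closed] ..
    moreover have "char_series (frag_of A) = inverse (det_series (mat1 \<alpha>)) * char_series (frag_of A')"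
      unfolding series_prod_of det_series_split[OF extend(3)] fps_inverse_mult ..
    ultimately show ?case unfolding m extend(4) by metis
  qed
  have "c \<in> carrier end_free \<and> char_series c = char_series (diag_of (eigen_hom c))"
    using assms
  proof (induction c rule: end_free_induct)
    case (one A)
    thus ?case unfolding eigen_hom_simps using mat[OF one] frag_of_end_free[OF square_mat_carrier[OF
        one]] by metis
  next
    case (diff a b)
    have 1: "char_series (a - b) * char_series b = char_series a" by (rule char_series_diff)
        (use diff in simp_all)
    have "char_series (diag_of (eigen_hom (a - b))) * char_series (diag_of (eigen_hom b))
        = char_series (diag_of (eigen_hom a))"
      unfolding eigen_hom_simps diag_of_simps by (rule char_series_diff[OF diag_of_closed
          diag_of_closed])
    hence 2: "char_series (diag_of (eigen_hom (a - b))) * char_series b = char_series a" using diff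
        by metis
    have "fps_nth (char_series b) 0 = 1" using diff char_series_diag_of_0 by metis
    hence "fps_nth (char_series b) 0 \<noteq> 0" by simp
    from fps_mult_unit_cancel[OF 1 2 this] show ?case using end_free_closed(2)[of a b] diff by metis
  qed (simp_all add: end_free_simps)
  thus ?thesis ..
qed

definition embed :: "qz_ring \<Rightarrow> nat \<Rightarrow> 'k" where
  "embed y = W0_embed (W0_of y)"

lemma embed: "embed y \<in> carrier big_witt" "wseries (embed y) * char_series (diag_of y) = 1"
proof -
  let ?g = "\<lambda>c. inv_into (carrier big_witt) witt_series (char_series c)"
  have "W0_embed = W0_induced ?g" by (simp add: W0_embed_def series_prod_def)
  moreover have g: "?g c = ?g c'" if "c \<in> carrier end_free" "c' \<in> carrier end_free" "eigen_hom c
      = eigen_hom c'" for c c'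
    using char_series_diag_of_eq[OF that(1)] char_series_diag_of_eq[OF that(2)] that(3) by metis
  ultimately have e: "embed y = ?g (diag_of y)"
    unfolding embed_def W0_of_def using W0_induced_W0_class[OF diag_of_closed,
        of y ?g] g diag_of_closed by metis
  have u: "fps_nth (char_series (diag_of y)) 0 \<noteq> 0" using char_series_diag_of_0 by simp
  obtain x where "wseries x = inverse (char_series (diag_of y))"
    using wseries_surj[of "inverse (char_series (diag_of y))"] char_series_diag_of_0[of y] by auto
  hence x: "wseries (restrict x {0<..}) = inverse (char_series (diag_of y))" by
      (simp add: wseries_restrict)
  have "char_series (diag_of y) = witt_series (restrict x {0<..})"
    unfolding witt_series_eq x by (rule fps_inverse_idempotent[OF u, symmetric])
  hence mem: "char_series (diag_of y) \<in> witt_series ` carrier big_witt"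
      by (rule image_eqI[OF _ restrict_witt])
  show c: "embed y \<in> carrier big_witt" unfolding e by (rule inv_into_into[OF mem])
  have "witt_series (embed y) = char_series (diag_of y)" unfolding e by (rule f_inv_into_f[OF mem])
  hence "inverse (wseries (embed y)) = char_series (diag_of y)" unfolding witt_series_eq .
  moreover have "wseries (embed y) * inverse (wseries (embed y)) = 1" by (rule inverse_mult_eq_1') simp
  ultimately show "wseries (embed y) * char_series (diag_of y) = 1" by metis
qed

text \<open>The product \<open>\<Prod> (1 - x\<^sub>n t\<^sup>n)\<close> of the embedded element \<open>x\<close> is inverse to
  \<open>char_series\<close>; testing it avoids the infinite product of inverses in \<open>witt_series\<close>.\<close>

lemma embed_eqI:
  assumes "x \<in> carrier big_witt" "wseries x * char_series (diag_of y) = 1" shows "embed y = x"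
proof -
  have "wseries (embed y) = wseries x"
    by (rule fps_mult_unit_cancel[OF embed(2) assms(2)]) (simp add: char_series_diag_of_0)
  thus ?thesis using wseries_eq_iff[OF embed(1) assms(1)] by simp
qed

lemma embed_add: "embed (x + y) = embed x \<oplus>\<^bsub>big_witt\<^esub> embed y"
proof (rule embed_eqI)
  show "embed x \<oplus>\<^bsub>big_witt\<^esub> embed y \<in> carrier big_witt" by (simp add: witt_ops)
  have "wseries (embed x) * wseries (embed y) * (char_series (diag_of x) * char_series (diag_of y))
      = (wseries (embed x) * char_series (diag_of x)) * (wseries (embed y) * char_series (diag_of y))"
    by (simp only: mult_ac)
  thus "wseries (embed x \<oplus>\<^bsub>big_witt\<^esub> embed y) * char_series (diag_of (x + y)) = 1"
    by (simp add: wseries_add char_series_add[OF diag_of_closed diag_of_closed] embed(2))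
qed

lemma embed_diff: "embed (x - y) = embed x \<ominus>\<^bsub>big_witt\<^esub> embed y"
proof -
  interpret W: cring "big_witt :: (nat \<Rightarrow> 'k) ring" by (rule cring_big_witt)
  have "embed x = embed (x - y) \<oplus>\<^bsub>big_witt\<^esub> embed y" using embed_add[of "x - y" y] by simp
  thus ?thesis using embed(1) by (simp add: a_minus_def W.a_assoc W.r_neg)
qed

lemma embed_of: "embed (frag_of \<gamma>) = teichmueller {0<..} (chi \<gamma>)"
  by (rule embed_eqI) (simp_all add: teichmueller_eq wseries_teichmueller[unfolded teichmueller_eq]
      det_series_mat1 inverse_mult_eq_1')

lemma embed_induct:
  assumes f: "\<And>x y. f (x - y) = f x \<ominus>\<^bsub>big_witt\<^esub> f y" and g: "\<And>x y. g (x - y) = g x \<ominus>\<^bsub>big_witt\<^esub> g y"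
    and c: "\<And>x. f x \<in> carrier big_witt" "\<And>x. g x \<in> carrier big_witt"
    and eq: "\<And>\<gamma>. f (frag_of \<gamma>) = g (frag_of \<gamma>)"
  shows "f y = (g (y :: qz_ring) :: nat \<Rightarrow> 'k)"
proof (induction y rule: qz_ring_induct)
  case zero
  interpret W: cring "big_witt :: (nat \<Rightarrow> 'k) ring" by (rule cring_big_witt)
  have "f 0 = f 0 \<ominus>\<^bsub>big_witt\<^esub> f 0" "g 0 = g 0 \<ominus>\<^bsub>big_witt\<^esub> g 0" using f[of 0 0] g[of 0 0] by simp_all
  thus ?case using c by (metis W.r_neg a_minus_def)
qed (simp_all add: f g eq)

lemma embed_mult: "embed (x * y) = embed x \<otimes>\<^bsub>big_witt\<^esub> embed y"
proof -
  interpret W: cring "big_witt :: (nat \<Rightarrow> 'k) ring" by (rule cring_big_witt)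
  have l: "(a \<ominus>\<^bsub>big_witt\<^esub> b) \<otimes>\<^bsub>big_witt\<^esub> c = a \<otimes>\<^bsub>big_witt\<^esub> c \<ominus>\<^bsub>big_witt\<^esub> b \<otimes>\<^bsub>big_witt\<^esub> c"
    if "a \<in> carrier big_witt" "b \<in> carrier big_witt" "c \<in> carrier big_witt" for a b c :: "nat \<Rightarrow> 'k"
    unfolding a_minus_def using that by (simp only: W.l_distr W.l_minus W.a_inv_closed)
  have r: "c \<otimes>\<^bsub>big_witt\<^esub> (a \<ominus>\<^bsub>big_witt\<^esub> b) = c \<otimes>\<^bsub>big_witt\<^esub> a \<ominus>\<^bsub>big_witt\<^esub> c \<otimes>\<^bsub>big_witt\<^esub> b"
    if "a \<in> carrier big_witt" "b \<in> carrier big_witt" "c \<in> carrier big_witt" for a b c :: "nat \<Rightarrow> 'k"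
    unfolding a_minus_def using that by (simp only: W.r_distr W.r_minus W.a_inv_closed)
  have of: "embed (frag_of \<gamma> * y) = embed (frag_of \<gamma>) \<otimes>\<^bsub>big_witt\<^esub> embed y" for \<gamma>
  proof (rule embed_induct[of "\<lambda>y. embed (frag_of \<gamma> * y)" "\<lambda>y. embed (frag_of \<gamma>) \<otimes>\<^bsub>big_witt\<^esub> embed y"])
    fix \<delta>
    show "embed (frag_of \<gamma> * frag_of \<delta>) = embed (frag_of \<gamma>) \<otimes>\<^bsub>big_witt\<^esub> embed (frag_of \<delta>)"
      unfolding frag_of_mult embed_of teichmueller_mult[OF divisor_closed_positive] chi_add ..
  qed (simp_all only: right_diff_distrib embed_diff r embed(1) W.m_closed)
  show ?thesis
    by (rule embed_induct[of "\<lambda>x. embed (x * y)" "\<lambda>x. embed x \<otimes>\<^bsub>big_witt\<^esub> embed y"])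
       (simp_all only: left_diff_distrib embed_diff l embed(1) W.m_closed of)
qed

lemma embed_F:
  assumes n: "n > 0" shows "embed (bc_sigma n y) = witt_F n (embed y)"
proof -
  interpret W: cring "big_witt :: (nat \<Rightarrow> 'k) ring" by (rule cring_big_witt)
  interpret F: ring_hom_ring "big_witt :: (nat \<Rightarrow> 'k) ring" big_witt "witt_F n"
    by (rule ring_hom_ringI2[OF W.ring_axioms W.ring_axioms ring_hom_witt_F[OF n]])
  have F: "witt_F n (a \<ominus>\<^bsub>big_witt\<^esub> b) = witt_F n a \<ominus>\<^bsub>big_witt\<^esub> witt_F n b"
    if "a \<in> carrier big_witt" "b \<in> carrier big_witt" for a b :: "nat \<Rightarrow> 'k"
    unfolding a_minus_def using that by (simp only: F.hom_add F.hom_a_inv W.a_inv_closed)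
  show ?thesis
  proof (rule embed_induct[of "\<lambda>y. embed (bc_sigma n y)" "\<lambda>y. witt_F n (embed y)"])
    fix \<gamma>
    show "embed (bc_sigma n (frag_of \<gamma>)) = witt_F n (embed (frag_of \<gamma>))"
      by (simp only: bc_ops_of embed_of chi_scale witt_F_teichmueller[OF n])
  qed (simp_all only: bc_ops_diff embed_diff embed(1) F witt_F_closed)
qed

lemma embed_verschiebung:
  assumes n: "n > 0"
  shows "embed (eigen_sum (verschiebung_mat n (mat1 \<alpha>))) = restrict (wver n (wteich \<alpha>)) {0<..}"
proof (rule embed_eqI)
  have "char_series (diag_of (eigen_sum (verschiebung_mat n (mat1 \<alpha>))))
      = inverse (det_series (verschiebung_mat n (mat1 \<alpha>)))"
    using char_series_diag_of_eq[of "frag_of (verschiebung_mat n (mat1 \<alpha>))"] frag_of_end_free[OF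
        square_mat_carrier[OF verschiebung_mat1_carrier[of n \<alpha>]]] by simp
  thus "wseries (restrict (wver n (wteich \<alpha>)) {0<..}) * char_series (diag_of (eigen_sum
      (verschiebung_mat n (mat1 \<alpha>)))) = 1"
    using n by (simp add: wseries_restrict wseries_wver_wteich det_series_verschiebung_mat1
        inverse_mult_eq_1')
qed simp

lemma embed_r: "embed (bc_r p y) = embed y"
  by (simp add: embed_def W0_of_r)

text \<open>For \<open>e(\<gamma>)\<close> the fibre sum is, up to \<open>r\<close>, the eigenvalue sum of the companion matrix
  \<open>V\<^sub>n (\<chi>(\<gamma>))\<close>, whose determinant series \<open>1 - \<chi>(\<gamma>) t\<^sup>n\<close> belongs to the Verschiebung of a
  Teichmueller representative.\<close>

lemma embed_V:
  assumes n: "n > 0" shows "embed (bc_rho n y) = witt_V n (embed y)"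
proof -
  interpret W: cring "big_witt :: (nat \<Rightarrow> 'k) ring" by (rule cring_big_witt)
  have V: "witt_V n (a \<ominus>\<^bsub>big_witt\<^esub> b) = witt_V n a \<ominus>\<^bsub>big_witt\<^esub> witt_V n b" if ab:
      "a \<in> carrier big_witt" "b \<in> carrier big_witt" for a b :: "nat \<Rightarrow> 'k"
  proof -
    have "witt_V n (a \<ominus>\<^bsub>big_witt\<^esub> b) \<oplus>\<^bsub>big_witt\<^esub> witt_V n b = witt_V n a"
      unfolding witt_V_add[OF n, symmetric] using ab by (simp add: a_minus_def W.a_assoc W.l_neg)
    hence "witt_V n a \<ominus>\<^bsub>big_witt\<^esub> witt_V n b = (witt_V n (a \<ominus>\<^bsub>big_witt\<^esub> b) \<oplus>\<^bsub>big_witt\<^esub> witt_V n b)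
        \<ominus>\<^bsub>big_witt\<^esub> witt_V n b" by simp
    also have "\<dots> = witt_V n (a \<ominus>\<^bsub>big_witt\<^esub> b)"
      unfolding a_minus_def by (subst W.a_assoc) (simp_all add: witt_V_closed W.r_neg)
    finally show ?thesis ..
  qed
  show ?thesis
  proof (rule embed_induct[of "\<lambda>y. embed (bc_rho n y)" "\<lambda>y. witt_V n (embed y)"])
    fix \<gamma>
    have "embed (bc_rho n (frag_of \<gamma>)) = embed (bc_r p (bc_rho n (bc_r p (frag_of \<gamma>))))"
      by (simp only: bc_r_rho[OF n] embed_r)
    also have "bc_r p (bc_rho n (bc_r p (frag_of \<gamma>))) = eigen_sum (verschiebung_mat n (mat1 (chi \<gamma>)))"
      by (simp only: eigen_sum_verschiebung[OF n mat1_carrier] eigen_sum_mat1 root_frag_chi bc_ops_of)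
    also have "embed \<dots> = restrict (wver n (wteich (chi \<gamma>))) {0<..}" by (rule embed_verschiebung[OF n])
    also have "\<dots> = witt_V n (embed (frag_of \<gamma>))"
      by (rule witt_ext[of _ "{0<..}"]) (simp_all add: witt_V_def embed_of teichmueller_eq
          wver_restrict n)
    finally show "embed (bc_rho n (frag_of \<gamma>)) = witt_V n (embed (frag_of \<gamma>))" .
  qed (simp_all add: bc_ops_diff embed_diff embed V)
qed

text \<open>Density: the finite products \<open>\<Prod> (1 - x\<^sub>n t\<^sup>n)\<close> are determinants of sums of companion
  matrices, and they agree with the infinite product up to any given degree.\<close>

lemma embed_dense:
  assumes x: "x \<in> carrier big_witt" shows "\<exists>y. embed y \<in> cylinder x N"
proof -
  have "\<exists>y. wseries (embed y) = wpartial N x" for N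
  proof (induction N)
    case 0
    have "wseries (embed 0) * char_series (diag_of 0) = 1" by (rule embed(2))
    thus ?case by (intro exI[of _ 0]) (simp add: wpartial_def)
  next
    case (Suc N)
    then obtain y where y: "wseries (embed y) = wpartial N x" by blast
    let ?v = "eigen_sum (verschiebung_mat (Suc N) (mat1 (x (Suc N))))"
    have "wseries (embed (y + ?v)) = wpartial N x * (1 - fps_const (x (Suc N)) * fps_X ^ Suc N)"
      unfolding embed_add wseries_add y embed_verschiebung[OF zero_less_Suc] wseries_restrict
          wseries_wver_wteich[OF zero_less_Suc] ..
    thus ?case by (intro exI[of _ "y + ?v"]) (simp only: wpartial_def prod.lessThan_Suc)
  qed
  then obtain y where y: "wseries (embed y) = wpartial N x" by blast
  have "embed y m = x m" if "0 < m" "m \<le> N" for m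
    by (rule wseries_inj_upto[OF _ that]) (simp add: y wpartial_stable)
  thus ?thesis using embed(1)[of y] by (intro exI[of _ y]) (simp add: cylinder_def carrier_witt)
qed

end

section \<open>Extending the representation by continuity\<close>

lemma End_ring_diff:
  assumes M: "ring M" and T: "T \<in> carrier (End_ring M)" and ab: "a \<in> carrier M" "b \<in> carrier M"
  shows "T (a \<ominus>\<^bsub>M\<^esub> b) = T a \<ominus>\<^bsub>M\<^esub> T b"
proof -
  interpret M: ring M by fact
  have c: "T x \<in> carrier M" if "x \<in> carrier M" for x using T that by (auto simp: End_ring_simps)
  have d: "a \<ominus>\<^bsub>M\<^esub> b \<in> carrier M" using ab by simp
  have "T ((a \<ominus>\<^bsub>M\<^esub> b) \<oplus>\<^bsub>M\<^esub> b) = T (a \<ominus>\<^bsub>M\<^esub> b) \<oplus>\<^bsub>M\<^esub> T b" using T d ab(2) by (simp add: End_ring_simps)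
  moreover have "(a \<ominus>\<^bsub>M\<^esub> b) \<oplus>\<^bsub>M\<^esub> b = a" using ab by (simp add: a_minus_def M.a_assoc M.l_neg)
  ultimately have eq: "T a = T (a \<ominus>\<^bsub>M\<^esub> b) \<oplus>\<^bsub>M\<^esub> T b" by simp
  show ?thesis unfolding eq using c[OF d] c[OF ab(2)] by (simp add: a_minus_def M.a_assoc M.r_neg)
qed

lemma continuous_witt_cylinder:
  fixes f :: "(nat \<Rightarrow> 'a::comm_ring_1) \<Rightarrow> nat \<Rightarrow> 'b::comm_ring_1"
  assumes f: "continuous_map witt_topology witt_topology f" and x: "x \<in> carrier big_witt"
  shows "\<exists>N. \<forall>y\<in>cylinder x N. f y \<in> cylinder (f x) n"
proof -
  let ?U = "{y \<in> topspace witt_topology. f y \<in> cylinder (f x) n}"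
  have "openin witt_topology ?U" using openin_continuous_map_preimage[OF f openin_cylinder] .
  moreover have "f x \<in> {0<..} \<rightarrow>\<^sub>E UNIV" using f x unfolding continuous_witt_iff by
      (auto simp: carrier_witt)
  hence "x \<in> ?U" using x by (simp add: topspace_witt carrier_witt cylinder_self)
  ultimately obtain N where "cylinder x N \<subseteq> ?U" using cylinder_subset by blast
  thus ?thesis by blast
qed

lemma continuous_witt_minus:
  fixes f g :: "(nat \<Rightarrow> 'a::comm_ring_1) \<Rightarrow> nat \<Rightarrow> 'b::comm_ring_1"
  assumes f: "continuous_map witt_topology witt_topology f" and g:
      "continuous_map witt_topology witt_topology g"
  shows "continuous_map witt_topology witt_topology (\<lambda>x\<in>carrier big_witt. f x \<ominus>\<^bsub>big_witt\<^esub> g x)"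
proof -
  interpret W: cring "big_witt :: (nat \<Rightarrow> 'b) ring" by (rule cring_big_witt)
  have c: "f x \<in> carrier big_witt" "g x \<in> carrier big_witt" if "x \<in> carrier big_witt" for x
    using f g that unfolding continuous_witt_iff by auto
  show ?thesis
    unfolding continuous_witt_iff
  proof (intro conjI ballI allI impI)
    show "(\<lambda>x\<in>carrier big_witt. f x \<ominus>\<^bsub>big_witt\<^esub> g x) \<in> carrier big_witt \<rightarrow> carrier big_witt"
      using c by simp
    fix x :: "nat \<Rightarrow> 'a" and n :: nat assume x: "x \<in> carrier big_witt" and n: "0 < n"
    obtain N where N: "\<And>y. y \<in> cylinder x N \<Longrightarrow> f y \<in> cylinder (f x) n"
        using continuous_witt_cylinder[OF f x] by blast
    obtain M where M: "\<And>y. y \<in> cylinder x M \<Longrightarrow> g y \<in> cylinder (g x) n"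
        using continuous_witt_cylinder[OF g x] by blast
    have "(\<lambda>x\<in>carrier big_witt. f x \<ominus>\<^bsub>big_witt\<^esub> g x) y n
        = (\<lambda>x\<in>carrier big_witt. f x \<ominus>\<^bsub>big_witt\<^esub> g x) x n" if y: "y \<in> cylinder x (max N M)" for y
    proof -
      have yc: "y \<in> carrier big_witt" using y by (simp add: cylinder_def carrier_witt)
      have "y \<in> cylinder x N" "y \<in> cylinder x M" using y by (auto simp: cylinder_def)
      hence fg: "f y \<in> cylinder (f x) n" "g y \<in> cylinder (g x) n" using N M by blast+
      have d: "0 < m \<and> m \<le> n" if "m dvd n" for m using that n by (auto intro: Nat.gr0I dvd_imp_le)
      have "(f y \<ominus>\<^bsub>big_witt\<^esub> g y) n = (f x \<ominus>\<^bsub>big_witt\<^esub> g x) n"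
      proof (rule witt_minus_cong[OF c(1)[OF yc] c(1)[OF x] c(2)[OF yc] c(2)[OF x] n])
        fix m assume "m dvd n"
        from d[OF this] show "f y m = f x m" "g y m = g x m" using fg by (simp_all add: cylinder_def)
      qed
      thus ?thesis using x yc by simp
    qed
    thus "\<exists>N. \<forall>y\<in>cylinder x N. (\<lambda>x\<in>carrier big_witt. f x \<ominus>\<^bsub>big_witt\<^esub> g x) y n
        = (\<lambda>x\<in>carrier big_witt. f x \<ominus>\<^bsub>big_witt\<^esub> g x) x n"
      by blast
  qed
qed

text \<open>The continuous additive operators.  They include the operators of the generators and are closed
  under products and differences, hence under everything that the generators generate.\<close>

abbreviation continuous_End :: "((nat \<Rightarrow> 'a::comm_ring_1) \<Rightarrow> nat \<Rightarrow> 'a) set" where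
  "continuous_End \<equiv> {T \<in> carrier (End_ring big_witt). continuous_map witt_topology witt_topology T}"

lemma continuous_End_minus:
  fixes T :: "(nat \<Rightarrow> 'a::comm_ring_1) \<Rightarrow> nat \<Rightarrow> 'a"
  assumes "T \<in> continuous_End" "U \<in> continuous_End"
  shows "(\<lambda>x\<in>carrier big_witt. T x \<ominus>\<^bsub>big_witt\<^esub> U x) \<in> continuous_End"
proof -
  interpret W: cring "big_witt :: (nat \<Rightarrow> 'a) ring" by (rule cring_big_witt)
  have c: "T x \<in> carrier big_witt" "U x \<in> carrier big_witt" if "x \<in> carrier big_witt" for x
    using assms that by (auto simp: End_ring_simps)
  have a: "T (x \<oplus>\<^bsub>big_witt\<^esub> y) = T x \<oplus>\<^bsub>big_witt\<^esub> T y" "U (x \<oplus>\<^bsub>big_witt\<^esub> y) = U x \<oplus>\<^bsub>big_witt\<^esub> U y"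
    if "x \<in> carrier big_witt" "y \<in> carrier big_witt" for x y
    using assms that by (auto simp: End_ring_simps)
  have "T (x \<oplus>\<^bsub>big_witt\<^esub> y) \<ominus>\<^bsub>big_witt\<^esub> U (x \<oplus>\<^bsub>big_witt\<^esub> y)
      = (T x \<ominus>\<^bsub>big_witt\<^esub> U x) \<oplus>\<^bsub>big_witt\<^esub> (T y \<ominus>\<^bsub>big_witt\<^esub> U y)"
    if xy: "x \<in> carrier big_witt" "y \<in> carrier big_witt" for x y
    unfolding a[OF xy] a_minus_def
    by (simp only: W.minus_add[OF c(2)[OF xy(1)] c(2)[OF xy(2)]])
       (use c[OF xy(1)] c[OF xy(2)] in \<open>simp only: W.a_ac W.a_inv_closed W.a_closed\<close>)
  moreover have "T x \<ominus>\<^bsub>big_witt\<^esub> U x \<in> carrier big_witt" if "x \<in> carrier big_witt" for x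
    using c[OF that] by simp
  ultimately have "(\<lambda>x\<in>carrier big_witt. T x \<ominus>\<^bsub>big_witt\<^esub> U x) \<in> carrier (End_ring big_witt)"
    by (simp add: End_ring_simps)
  thus ?thesis using assms continuous_witt_minus[of T U] by simp
qed

lemma continuous_End_compose:
  fixes T :: "(nat \<Rightarrow> 'a::comm_ring_1) \<Rightarrow> nat \<Rightarrow> 'a"
  assumes T: "T \<in> continuous_End" and U: "U \<in> continuous_End"
  shows "compose (carrier big_witt) T U \<in> continuous_End"
proof -
  interpret W: cring "big_witt :: (nat \<Rightarrow> 'a) ring" by (rule cring_big_witt)
  have "continuous_map witt_topology witt_topology (T \<circ> U)"
    using assms continuous_map_compose[of witt_topology witt_topology U witt_topology T] by simp
  moreover have "(T \<circ> U) x = compose (carrier big_witt) T U x" if "x \<in> topspace witt_topology" for x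
    using that by (simp add: compose_def topspace_witt carrier_witt)
  ultimately have "continuous_map witt_topology witt_topology (compose (carrier big_witt) T U)"
    using continuous_map_eq by blast
  moreover have "compose (carrier big_witt) T U \<in> carrier (End_ring big_witt)"
  proof -
    have "U x \<in> carrier big_witt" "T x \<in> carrier big_witt" if "x \<in> carrier big_witt" for x
      using assms that by (auto simp: End_ring_simps)
    thus ?thesis using assms by (simp add: End_ring_simps compose_def)
  qed
  ultimately show ?thesis by simp
qed

lemma continuous_End_id: "(\<lambda>x\<in>carrier big_witt. x) \<in> continuous_End"
proof -
  interpret W: cring "big_witt :: (nat \<Rightarrow> 'a) ring" by (rule cring_big_witt)
  have "continuous_map witt_topology witt_topology (\<lambda>x::nat \<Rightarrow> 'a\<in>carrier big_witt. x)"
    by (rule continuous_wittI[where B = "\<lambda>n. n"]) simp_all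
  thus ?thesis by (simp add: End_ring_simps)
qed

lemma continuous_End_mult:
  assumes a: "(a :: nat \<Rightarrow> 'a::comm_ring_1) \<in> carrier big_witt"
  shows "(\<lambda>x\<in>carrier big_witt. a \<otimes>\<^bsub>big_witt\<^esub> x) \<in> continuous_End"
proof -
  interpret W: cring "big_witt :: (nat \<Rightarrow> 'a) ring" by (rule cring_big_witt)
  have "continuous_map witt_topology witt_topology (\<lambda>x\<in>carrier big_witt. a \<otimes>\<^bsub>big_witt\<^esub> x)"
  proof (rule continuous_wittI[where B = "\<lambda>n. n"])
    fix x y :: "nat \<Rightarrow> 'a" and n :: nat assume n: "n > 0" and xy: "x \<in> carrier big_witt"
        "y \<in> carrier big_witt"
      and eq: "\<And>m. 0 < m \<Longrightarrow> m \<le> n \<Longrightarrow> y m = x m"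
    have "y d = x d" if "d dvd n" for d using that n by (intro eq) (auto intro: Nat.gr0I dvd_imp_le)
    hence "wmult a y n = wmult a x n" by (intro wmult_cong[OF n]) simp_all
    thus "(\<lambda>x\<in>carrier big_witt. a \<otimes>\<^bsub>big_witt\<^esub> x) y n = (\<lambda>x\<in>carrier big_witt. a \<otimes>\<^bsub>big_witt\<^esub> x) x n"
      using xy n by (simp add: witt_ops)
  qed (use a in simp)
  thus ?thesis using a by (simp add: End_ring_simps W.r_distr)
qed

lemma continuous_End_F:
  assumes k: "k > 0" shows "restrict (witt_F k) (carrier big_witt) \<in> (continuous_End :: ((nat \<Rightarrow>
      'a::comm_ring_1) \<Rightarrow> nat \<Rightarrow> 'a) set)"
proof -
  interpret W: cring "big_witt :: (nat \<Rightarrow> 'a) ring" by (rule cring_big_witt)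
  have "continuous_map witt_topology witt_topology (restrict (witt_F k) (carrier (big_witt :: (nat \<Rightarrow>
      'a) ring)))"
  proof (rule continuous_wittI[where B = "\<lambda>n. n * k"])
    fix x y :: "nat \<Rightarrow> 'a" and n :: nat assume n: "n > 0" and xy: "x \<in> carrier big_witt"
        "y \<in> carrier big_witt"
      and eq: "\<And>m. 0 < m \<Longrightarrow> m \<le> n * k \<Longrightarrow> y m = x m"
    have "n * k > 0" using n k by simp
    hence "y d = x d" if "d dvd n * k" for d using that
        by (intro eq) (metis Nat.gr0I dvd_0_left_iff less_irrefl, rule dvd_imp_le)
    from wfrob_cong[OF n k this] show "restrict (witt_F k) (carrier big_witt) y n
        = restrict (witt_F k) (carrier big_witt) x n"
      using xy n by (simp add: witt_F_eq)
  qed simp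
  thus ?thesis by (simp add: End_ring_simps ring_hom_add[OF ring_hom_witt_F[OF k]])
qed

lemma continuous_End_V:
  assumes k: "k > 0" shows "restrict (witt_V k) (carrier big_witt) \<in> (continuous_End :: ((nat \<Rightarrow>
      'a::comm_ring_1) \<Rightarrow> nat \<Rightarrow> 'a) set)"
proof -
  interpret W: cring "big_witt :: (nat \<Rightarrow> 'a) ring" by (rule cring_big_witt)
  have "continuous_map witt_topology witt_topology (restrict (witt_V k) (carrier (big_witt :: (nat \<Rightarrow>
      'a) ring)))"
  proof (rule continuous_wittI[where B = "\<lambda>n. n"])
    fix x y :: "nat \<Rightarrow> 'a" and n :: nat assume n: "n > 0" and xy: "x \<in> carrier big_witt"
        "y \<in> carrier big_witt"
      and eq: "\<And>m. 0 < m \<Longrightarrow> m \<le> n \<Longrightarrow> y m = x m"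
    have "y (n div k) = x (n div k)" if "k dvd n"
      using that n k by (intro eq) (auto simp: div_greater_zero_iff dest: dvd_imp_le)
    thus "restrict (witt_V k) (carrier big_witt) y n = restrict (witt_V k) (carrier big_witt) x n"
      using xy n by (simp add: witt_V_def wver_def)
  qed simp
  thus ?thesis by (simp add: End_ring_simps witt_V_add[OF k])
qed

context residue_character
begin

lemma continuous_End_eqI:
  assumes T: "T \<in> continuous_End" and U: "U \<in> continuous_End" and eq: "\<And>y. T (embed y) = U (embed y)"
  shows "T = U"
proof (rule End_ring_ext[where M = big_witt])
  fix x :: "nat \<Rightarrow> 'k" assume x: "x \<in> carrier big_witt"
  show "T x = U x"
  proof (rule continuous_witt_eqI[where D = "range embed", OF _ _ _ _ x])
    fix x :: "nat \<Rightarrow> 'k" and N assume "x \<in> carrier big_witt"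
    thus "\<exists>d\<in>range embed. d \<in> cylinder x N" using embed_dense by blast
  next
    fix d :: "nat \<Rightarrow> 'k" assume "d \<in> range embed"
    thus "T d = U d" using eq by blast
  qed (use T U in simp_all)
qed (use T U in simp_all)

text \<open>The Teichmueller representatives span a dense subgroup.\<close>

lemma continuous_End_eqI_teichmueller:
  assumes T: "T \<in> continuous_End" and U: "U \<in> continuous_End"
    and eq: "\<And>a::'k. T (teichmueller {0<..} a) = U (teichmueller {0<..} a)"
  shows "T = U"
proof (rule continuous_End_eqI[OF T U])
  have R: "ring (big_witt :: (nat \<Rightarrow> 'k) ring)" using cring_big_witt by (rule cring.axioms)
  have TU: "T \<in> carrier (End_ring big_witt)" "U \<in> carrier (End_ring big_witt)" using T U by simp_all
  fix y
  show "T (embed y) = U (embed y)"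
  proof (rule embed_induct[of "\<lambda>y. T (embed y)" "\<lambda>y. U (embed y)"])
    show "T (embed (x - y)) = T (embed x) \<ominus>\<^bsub>big_witt\<^esub> T (embed y)" "U (embed (x - y))
        = U (embed x) \<ominus>\<^bsub>big_witt\<^esub> U (embed y)" for x y
      unfolding embed_diff by (rule End_ring_diff[OF R TU(1) embed(1) embed(1)],
          rule End_ring_diff[OF R TU(2) embed(1) embed(1)])
    show "T (embed x) \<in> carrier big_witt" "U (embed x) \<in> carrier big_witt" for x
      using TU embed(1) unfolding End_ring_simps by blast+
  qed (simp only: embed_of eq)
qed

lemma W0_of_diff: "W0_of (x - y) = W0_of x \<ominus>\<^bsub>W0\<^esub> W0_of y"
proof -
  interpret W: ring "W0 :: ('k mat \<Rightarrow>\<^sub>0 int) set ring" by (rule ring_W0)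
  have "W0_of x = W0_of (x - y) \<oplus>\<^bsub>W0\<^esub> W0_of y" using W0_of_add[of "x - y" y] by simp
  thus ?thesis by (simp add: a_minus_def W.a_assoc W.r_neg)
qed

text \<open>As such a \<open>T\<close> is unique, \<open>h \<mapsto> T\<close> is automatically compatible with the ring operations; existence
  is inherited from the generators.\<close>

definition extends :: "(bc_gen list \<Rightarrow>\<^sub>0 int) set \<Rightarrow> ((nat \<Rightarrow> 'k) \<Rightarrow> nat \<Rightarrow> 'k) \<Rightarrow> bool" where
  "extends h T \<longleftrightarrow> T \<in> continuous_End \<and> (\<forall>\<xi>\<in>carrier W0. T (W0_embed \<xi>) = W0_embed (W0_rep h \<xi>))"

lemma extends_iff:
  "extends h T \<longleftrightarrow> T \<in> continuous_End \<and> (\<forall>y. T (embed y) = W0_embed (W0_rep h (W0_of y)))"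
  unfolding extends_def embed_def using W0_of_surj W0_of_closed by metis

lemma extends_unique: "extends h T \<Longrightarrow> extends h U \<Longrightarrow> T = U"
  unfolding extends_iff by (intro continuous_End_eqI) auto

lemma extends_gen:
  "extends (bc_class (Elt x)) (\<lambda>w\<in>carrier big_witt. embed x \<otimes>\<^bsub>big_witt\<^esub> w)"
  "n > 0 \<Longrightarrow> extends (bc_class (Mu_star n)) (restrict (witt_F n) (carrier big_witt))"
  "n > 0 \<Longrightarrow> extends (bc_class (Mu_tilde n)) (restrict (witt_V n) (carrier big_witt))"
proof -
  have e: "W0_embed (W0_of y) = embed y" for y by (simp only: embed_def)
  show "extends (bc_class (Elt x)) (\<lambda>w\<in>carrier big_witt. embed x \<otimes>\<^bsub>big_witt\<^esub> w)"
    unfolding extends_iff by (intro conjI allI continuous_End_mult embed(1))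
        (simp only: W0_rep_gen bc_gen_ok.simps act_gen.simps e embed_mult restrict_apply' embed(1))
  show "n > 0 \<Longrightarrow> extends (bc_class (Mu_star n)) (restrict (witt_F n) (carrier big_witt))"
    unfolding extends_iff by (intro conjI allI continuous_End_F)
        (simp_all only: W0_rep_gen bc_gen_ok.simps act_gen.simps e embed_F restrict_apply' embed(1))
  show "n > 0 \<Longrightarrow> extends (bc_class (Mu_tilde n)) (restrict (witt_V n) (carrier big_witt))"
    unfolding extends_iff by (intro conjI allI continuous_End_V)
        (simp_all only: W0_rep_gen bc_gen_ok.simps act_gen.simps e embed_V restrict_apply' embed(1))
qed

lemma W0_rep_closed: "h \<in> carrier bc_algebra \<Longrightarrow> \<xi> \<in> carrier W0 \<Longrightarrow> W0_rep h \<xi> \<in> carrier W0"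
  using representation_W0_rep unfolding representation_def
  by (auto dest!: ring_hom_closed simp: End_ring_simps)

lemma extends_one: "extends \<one>\<^bsub>bc_algebra\<^esub> (\<lambda>x\<in>carrier big_witt. x)"
proof -
  have "W0_rep \<one>\<^bsub>bc_algebra\<^esub> = (\<lambda>x\<in>carrier W0. x)"
    using representation_W0_rep ring_hom_one[of W0_rep bc_algebra "End_ring W0"] by
        (simp add: representation_def End_ring_simps)
  hence "W0_rep \<one>\<^bsub>bc_algebra\<^esub> (W0_of y) = W0_of y" for y by simp
  thus ?thesis unfolding extends_iff using continuous_End_id embed(1) by (simp flip: embed_def)
qed

lemma extends_mult:
  assumes h: "h \<in> carrier bc_algebra" "h' \<in> carrier bc_algebra" and T: "extends h T" "extends h' T'"
  shows "extends (h \<otimes>\<^bsub>bc_algebra\<^esub> h') (compose (carrier big_witt) T T')"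
proof -
  have "W0_rep (h \<otimes>\<^bsub>bc_algebra\<^esub> h') = compose (carrier W0) (W0_rep h) (W0_rep h')"
    using representation_W0_rep ring_hom_mult[of W0_rep bc_algebra "End_ring W0", OF _ h] by
        (simp add: representation_def End_ring_simps)
  hence r: "W0_rep (h \<otimes>\<^bsub>bc_algebra\<^esub> h') (W0_of y) = W0_rep h (W0_rep h' (W0_of y))" for y by
      (simp add: compose_def)
  have "T (W0_embed (W0_rep h' (W0_of y))) = W0_embed (W0_rep h (W0_rep h' (W0_of y)))" for y
    using T(1) W0_rep_closed[OF h(2) W0_of_closed] unfolding extends_def by blast
  hence "compose (carrier big_witt) T T' (embed y) = W0_embed (W0_rep (h \<otimes>\<^bsub>bc_algebra\<^esub> h') (W0_of
      y))" for y
    unfolding r compose_eq[OF embed(1)] using T(2)[unfolded extends_iff] by simp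
  moreover have "compose (carrier big_witt) T T' \<in> continuous_End"
    by (rule continuous_End_compose) (use T in \<open>simp_all add: extends_def\<close>)
  ultimately show ?thesis unfolding extends_iff by blast
qed

lemma extends_diff:
  assumes h: "h \<in> carrier bc_algebra" "h' \<in> carrier bc_algebra" and T: "extends h T" "extends h' T'"
  shows "extends (h \<ominus>\<^bsub>bc_algebra\<^esub> h') (\<lambda>x\<in>carrier big_witt. T x \<ominus>\<^bsub>big_witt\<^esub> T' x)"
proof -
  have "W0_embed (W0_rep (h \<ominus>\<^bsub>bc_algebra\<^esub> h') (W0_of y))
      = W0_embed (W0_rep h (W0_of y)) \<ominus>\<^bsub>big_witt\<^esub> W0_embed (W0_rep h' (W0_of y))" for y
  proof -
    obtain u v where uv: "W0_rep h (W0_of y) = W0_of u" "W0_rep h' (W0_of y) = W0_of v"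
      using W0_of_surj[OF W0_rep_closed[OF h(1) W0_of_closed[of y]]] W0_of_surj[OF W0_rep_closed[OF
          h(2) W0_of_closed[of y]]] by blast
    show ?thesis
      unfolding representation_diff[OF ring_W0 representation_W0_rep h W0_of_closed] uv
          W0_of_diff[symmetric] embed_def[symmetric]
      by (rule embed_diff)
  qed
  hence "(\<lambda>x\<in>carrier big_witt. T x \<ominus>\<^bsub>big_witt\<^esub> T' x) (embed y)
      = W0_embed (W0_rep (h \<ominus>\<^bsub>bc_algebra\<^esub> h') (W0_of y))" for y
    unfolding restrict_apply'[OF embed(1)] using T[unfolded extends_iff] by simp
  moreover have "(\<lambda>x\<in>carrier big_witt. T x \<ominus>\<^bsub>big_witt\<^esub> T' x) \<in> continuous_End"
    by (rule continuous_End_minus) (use T in \<open>simp_all add: extends_def\<close>)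
  ultimately show ?thesis unfolding extends_iff by blast
qed

lemma extends_exists:
  assumes "h \<in> carrier bc_algebra" shows "\<exists>T. extends h T"
  using assms
proof (induction h rule: bc_algebra_induct)
  case (gen g)
  thus ?case by (cases g) (simp, blast intro: extends_gen)+
next
  case one
  show ?case using extends_one by blast
next
  case (mult a b)
  thus ?case using extends_mult by blast
next
  case (diff a b)
  thus ?case using extends_diff by blast
qed

definition ext_rep :: "(bc_gen list \<Rightarrow>\<^sub>0 int) set \<Rightarrow> (nat \<Rightarrow> 'k) \<Rightarrow> nat \<Rightarrow> 'k" where
  "ext_rep = (\<lambda>h\<in>carrier bc_algebra. SOME T. extends h T)"

lemma extends_ext_rep: "h \<in> carrier bc_algebra \<Longrightarrow> extends h (ext_rep h)"
  using someI_ex[OF extends_exists] by (simp add: ext_rep_def)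

lemma ext_rep_eqI: "h \<in> carrier bc_algebra \<Longrightarrow> extends h T \<Longrightarrow> ext_rep h = T"
  using extends_unique extends_ext_rep by blast

lemma ext_rep_closed: "h \<in> carrier bc_algebra \<Longrightarrow> ext_rep h \<in> continuous_End"
  using extends_ext_rep by (simp add: extends_def)

text \<open>A sum is recovered from the compatibility with differences by cancellation.\<close>

lemma ext_rep_add:
  assumes h: "h \<in> carrier bc_algebra" "h' \<in> carrier bc_algebra"
  shows "ext_rep (h \<oplus>\<^bsub>bc_algebra\<^esub> h') = ext_rep h \<oplus>\<^bsub>End_ring big_witt\<^esub> ext_rep h'"
proof -
  interpret B: ring bc_algebra by (rule ring_bc_algebra)
  interpret W: cring "big_witt :: (nat \<Rightarrow> 'k) ring" by (rule cring_big_witt)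
  let ?s = "h \<oplus>\<^bsub>bc_algebra\<^esub> h'"
  have s: "?s \<in> carrier bc_algebra" using h by simp
  have "?s \<ominus>\<^bsub>bc_algebra\<^esub> h' = h" using h by (simp add: a_minus_def B.a_assoc B.r_neg)
  hence e: "ext_rep h = (\<lambda>x\<in>carrier big_witt. ext_rep ?s x \<ominus>\<^bsub>big_witt\<^esub> ext_rep h' x)"
    using ext_rep_eqI[OF h(1)] extends_diff[OF s h(2) extends_ext_rep[OF s] extends_ext_rep[OF
        h(2)]] by simp
  have c: "ext_rep ?s x \<in> carrier big_witt" "ext_rep h' x \<in> carrier big_witt" if
      "x \<in> carrier big_witt" for x
    using ext_rep_closed[OF s] ext_rep_closed[OF h(2)] that by (auto simp: End_ring_simps)
  show ?thesis
  proof (rule extensionalityI[of _ "carrier big_witt"])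
    show "ext_rep ?s \<in> extensional (carrier big_witt)" using ext_rep_closed[OF s] by
        (simp add: End_ring_simps)
    fix x :: "nat \<Rightarrow> 'k" assume x: "x \<in> carrier big_witt"
    show "ext_rep ?s x = (ext_rep h \<oplus>\<^bsub>End_ring big_witt\<^esub> ext_rep h') x"
      unfolding e End_ring_simps restrict_apply'[OF x] using c[OF x] by
          (simp add: a_minus_def W.a_assoc W.l_neg)
  qed (simp add: End_ring_simps)
qed

lemma representation_ext_rep: "representation bc_algebra big_witt ext_rep"
proof -
  interpret B: ring bc_algebra by (rule ring_bc_algebra)
  have "ext_rep \<in> ring_hom bc_algebra (End_ring big_witt)"
  proof (rule ring_hom_memI)
    fix h h' assume h: "h \<in> carrier bc_algebra" "h' \<in> carrier bc_algebra"
    show "ext_rep (h \<oplus>\<^bsub>bc_algebra\<^esub> h') = ext_rep h \<oplus>\<^bsub>End_ring big_witt\<^esub> ext_rep h'"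
        by (rule ext_rep_add[OF h])
    show "ext_rep (h \<otimes>\<^bsub>bc_algebra\<^esub> h') = ext_rep h \<otimes>\<^bsub>End_ring big_witt\<^esub> ext_rep h'"
      unfolding End_ring_simps
      by (rule ext_rep_eqI[OF B.m_closed[OF h] extends_mult[OF h extends_ext_rep[OF h(1)]
          extends_ext_rep[OF h(2)]]])
  next
    show "ext_rep \<one>\<^bsub>bc_algebra\<^esub> = \<one>\<^bsub>End_ring big_witt\<^esub>"
      unfolding End_ring_simps by (rule ext_rep_eqI[OF B.one_closed extends_one])
  qed (use ext_rep_closed in blast)
  thus ?thesis by (simp add: representation_def ext_rep_def)
qed

lemma continuous_extension_iff: "continuous_extension W0_rep \<pi> \<longleftrightarrow> \<pi> = ext_rep"
proof
  assume \<pi>: "continuous_extension W0_rep \<pi>"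
  hence rep: "representation bc_algebra big_witt \<pi>" by (simp add: continuous_extension_def)
  show "\<pi> = ext_rep"
  proof (rule extensionalityI[of _ "carrier bc_algebra"])
    fix h assume h: "h \<in> carrier bc_algebra"
    have "\<pi> h \<in> carrier (End_ring big_witt)" using rep h unfolding representation_def
        by (blast dest: ring_hom_closed)
    hence "extends h (\<pi> h)" using \<pi> h unfolding continuous_extension_def extends_def by blast
    from ext_rep_eqI[OF h this] show "\<pi> h = ext_rep h" by simp
  qed (use rep in \<open>simp_all add: representation_def ext_rep_def\<close>)
next
  assume "\<pi> = ext_rep"
  thus "continuous_extension W0_rep \<pi>"
    using representation_ext_rep extends_ext_rep by (simp add: continuous_extension_def extends_def)
qed

lemma ext_rep_gen:
  "ext_rep (bc_class (Elt x)) = (\<lambda>w\<in>carrier big_witt. embed x \<otimes>\<^bsub>big_witt\<^esub> w)"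
  "n > 0 \<Longrightarrow> ext_rep (bc_class (Mu_star n)) = restrict (witt_F n) (carrier big_witt)"
  "n > 0 \<Longrightarrow> ext_rep (bc_class (Mu_tilde n)) = restrict (witt_V n) (carrier big_witt)"
  by (rule ext_rep_eqI; simp add: bc_class_closed extends_gen)+

end

section \<open>Multiples in additive groups\<close>

lemma End_ring_add_pow:
  fixes n :: nat
  shows "[n] \<cdot>\<^bsub>End_ring M\<^esub> T = (\<lambda>x\<in>carrier M. [n] \<cdot>\<^bsub>M\<^esub> T x)"
  by (induction n) (auto simp: add_pow_def nat_pow_def End_ring_simps fun_eq_iff)

lemma ring_hom_add_pow:
  fixes n :: nat
  assumes "h \<in> ring_hom R S" "ring R" "ring S" "x \<in> carrier R"
  shows "h ([n] \<cdot>\<^bsub>R\<^esub> x) = [n] \<cdot>\<^bsub>S\<^esub> h x"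
proof -
  interpret R: ring R by fact
  interpret S: ring S by fact
  show ?thesis
    by (induction n)
       (simp_all add: ring_hom_zero[OF assms(1-3)] ring_hom_add[OF assms(1)] assms(4)
           R.add.nat_pow_closed)
qed

lemma restrict_wmultiple:
  assumes "divisor_closed S" shows "restrict (wmultiple n x) S = [n] \<cdot>\<^bsub>witt_ring S\<^esub> restrict x S"
proof -
  interpret W: cring "witt_ring S :: (nat \<Rightarrow> 'a) ring" by (rule cring_witt[OF assms])
  show ?thesis
  proof (induction n)
    case (Suc n)
    have "restrict (wmultiple (Suc n) x) S = restrict (wmultiple n x) S \<oplus>\<^bsub>witt_ring S\<^esub> restrict x S"
      by (rule witt_ext[of _ S]) (simp_all add: witt_ops wfun_restrict[OF assms])
    also have "\<dots> = [Suc n] \<cdot>\<^bsub>witt_ring S\<^esub> restrict x S"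
      unfolding Suc by (simp only: W.add.nat_pow_Suc)
    finally show ?case .
  qed (simp add: witt_ops)
qed

lemma wseries_add_pow:
  fixes x :: "nat \<Rightarrow> 'a::comm_ring_1" and n :: nat
  shows "wseries ([n] \<cdot>\<^bsub>big_witt\<^esub> x) = wseries x ^ n"
proof -
  have z: "wseries (\<lambda>_. 0 :: 'a) = 1"
    by (rule fps_ext) (simp add: wseries_def wpartial_def)
  interpret W: cring "big_witt :: (nat \<Rightarrow> 'a) ring" by (rule cring_big_witt)
  show ?thesis
  proof (induction n)
    case 0
    show ?case by (simp only: W.add.nat_pow_0 witt_ops(3) wseries_restrict z power_0)
  next
    case (Suc n)
    thus ?case by (simp only: W.add.nat_pow_Suc wseries_add power_Suc2)
  qed
qed

text \<open>Roots with constant term \<open>1\<close> are unique when their order is invertible; additively this is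
  torsion-freeness of the big Witt vectors.\<close>

lemma fps_power_inj:
  fixes f g :: "'a::field fps"
  assumes eq: "f ^ n = g ^ n" and c: "fps_nth f 0 = 1" "fps_nth g 0 = 1" and n: "(of_nat n :: 'a) \<noteq> 0"
  shows "f = g"
proof -
  \<comment> \<open>The cofactor of \<open>f - g\<close> in \<open>f\<^sup>n - g\<^sup>n\<close>; its constant term is \<open>n\<close>.\<close>
  let ?s = "\<Sum>i<n. g ^ (n - Suc i) * f ^ i"
  have "(f - g) * ?s = 0" using power_diff_sumr2[of f n g] eq by simp
  moreover have "fps_nth ?s 0 = of_nat n" using c by (simp add: fps_sum_nth fps_power_zeroth)
  hence "?s \<noteq> 0" using n by (metis fps_zero_nth)
  ultimately show ?thesis by simp
qed

lemma big_witt_torsion_free: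
  fixes x y :: "nat \<Rightarrow> 'a::field"
  assumes "x \<in> carrier big_witt" "y \<in> carrier big_witt" "(of_nat n :: 'a) \<noteq> 0"
    and "[n] \<cdot>\<^bsub>big_witt\<^esub> x = [n] \<cdot>\<^bsub>big_witt\<^esub> y"
  shows "x = y"
proof -
  have "wseries x ^ n = wseries y ^ n" using assms(4) by (metis wseries_add_pow)
  hence "wseries x = wseries y" by (rule fps_power_inj) (use assms(3) in simp_all)
  thus ?thesis using wseries_eq_iff[OF assms(1,2)] by simp
qed

section \<open>The \<open>p\<close>-adic coordinates\<close>

context char_prime
begin

lemma p_powers_pos: "i \<in> p_powers p \<Longrightarrow> i > 0"
  by (auto simp: p_powers_def)

lemma p_powers_subset: "p_powers p \<subseteq> {0<..}"
  using p_powers_pos by auto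

lemmas divisor_closed_p = divisor_closed_p_powers[OF prime]

lemma cring_p_witt: "cring (p_witt p :: (nat \<Rightarrow> 'a::comm_ring_1) ring)"
  by (rule cring_witt[OF divisor_closed_p])

lemma p_split_unique:
  assumes "i * m = j * n" "i \<in> p_powers p" "j \<in> p_powers p" "m \<in> I_prime_to p" "n \<in> I_prime_to p"
  shows "i = j \<and> m = n"
proof -
  have cop: "coprime i n" "coprime j m" using assms(2-5) by
      (auto simp: p_powers_def I_prime_to_def coprime_commute)
  have "i dvd j * n" "j dvd i * m" using assms(1) by (metis dvd_triv_left)+
  hence "i dvd j" "j dvd i" using cop by (simp_all add: coprime_dvd_mult_left_iff)
  hence "i = j" by (rule dvd_antisym)
  thus ?thesis using assms(1) p_powers_pos[OF assms(2)] by simp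
qed

lemma p_split': "N > 0 \<Longrightarrow> \<exists>i\<in>p_powers p. \<exists>m\<in>I_prime_to p. N = i * m"
  using p_split[of N] by (auto simp: p_powers_def)

lemma Theta_nth: "m \<in> I_prime_to p \<Longrightarrow> Theta p x m = restrict (wfrob m x) (p_powers p)"
  using p_powers_pos by (auto simp: Theta_def witt_F_eq fun_eq_iff restrict_def)

lemma Theta_carrier: "Theta p x \<in> I_prime_to p \<rightarrow>\<^sub>E carrier (p_witt p)"
  by (auto simp: Theta_nth PiE_iff) (simp add: Theta_def)

lemma Theta_closed [simp]: "m \<in> I_prime_to p \<Longrightarrow> Theta p x m \<in> carrier (p_witt p)"
  by (simp add: Theta_nth)

lemma Theta_hom:
  assumes m: "m \<in> I_prime_to p" shows "(\<lambda>x :: nat \<Rightarrow> 'a::comm_ring_1. Theta p x m) \<in> ring_hom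
      big_witt (p_witt p)"
proof -
  have "(\<lambda>x. restrict x (p_powers p)) \<circ> (witt_F m :: (nat \<Rightarrow> 'a) \<Rightarrow> _) \<in> ring_hom big_witt (p_witt p)"
    by (rule ring_hom_trans[OF ring_hom_witt_F ring_hom_restrict_witt[OF divisor_closed_p
        p_powers_subset]])
       (rule I_prime_to_pos[OF m])
  moreover have "(\<lambda>x. restrict x (p_powers p)) \<circ> (witt_F m :: (nat \<Rightarrow> 'a) \<Rightarrow> _) = (\<lambda>x. Theta p x m)"
    using m p_powers_pos by (auto simp: fun_eq_iff Theta_nth witt_F_eq restrict_def)
  ultimately show ?thesis by (simp only:)
qed

lemma Theta_add: "m \<in> I_prime_to p \<Longrightarrow> x \<in> carrier big_witt \<Longrightarrow> y \<in> carrier big_witt \<Longrightarrow>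
    Theta p (x \<oplus>\<^bsub>big_witt\<^esub> y) m = Theta p x m \<oplus>\<^bsub>p_witt p\<^esub> Theta p y m"
  using ring_hom_add[OF Theta_hom] .

lemma Theta_mult: "m \<in> I_prime_to p \<Longrightarrow> x \<in> carrier big_witt \<Longrightarrow> y \<in> carrier big_witt \<Longrightarrow>
    Theta p (x \<otimes>\<^bsub>big_witt\<^esub> y) m = Theta p x m \<otimes>\<^bsub>p_witt p\<^esub> Theta p y m"
  using ring_hom_mult[OF Theta_hom] .

lemma ring_big_witt: "ring (big_witt :: (nat \<Rightarrow> 'a::comm_ring_1) ring)"
  using cring_big_witt by (rule cring.axioms)

lemma ring_p_witt: "ring (p_witt p :: (nat \<Rightarrow> 'a::comm_ring_1) ring)"
  using cring_p_witt by (rule cring.axioms)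

lemma Theta_zero: "m \<in> I_prime_to p \<Longrightarrow> Theta p \<zero>\<^bsub>big_witt\<^esub> m = \<zero>\<^bsub>p_witt p\<^esub>"
  by (rule ring_hom_zero[OF Theta_hom ring_big_witt ring_p_witt])

lemma Theta_teichmueller:
  assumes m: "m \<in> I_prime_to p" shows "Theta p (teichmueller {0<..} a) m
      = teichmueller (p_powers p) (a ^ m)"
proof -
  have "wfrob m (restrict (wteich a) {0<..}) i = wteich (a ^ m) i" if "i \<in> p_powers p" for i
    using p_powers_pos[OF that] I_prime_to_pos[OF m] by (simp add: wfrob_restrict wfrob_wteich)
  thus ?thesis unfolding Theta_nth[OF m] teichmueller_eq by (auto simp: restrict_def fun_eq_iff)
qed

lemma teichmueller_pow: "teichmueller (p_powers p) a [^]\<^bsub>p_witt p\<^esub> m = teichmueller (p_powers p) (a ^ m)"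
proof (induction m)
  case 0
  show ?case by (simp add: nat_pow_def witt_ops teichmueller_eq)
next
  case (Suc m)
  have "teichmueller (p_powers p) a [^]\<^bsub>p_witt p\<^esub> Suc m
    = teichmueller (p_powers p) a [^]\<^bsub>p_witt p\<^esub> m \<otimes>\<^bsub>p_witt p\<^esub> teichmueller (p_powers p) a"
    by (simp add: nat_pow_def)
  also have "\<dots> = teichmueller (p_powers p) (a ^ m * a)"
    unfolding Suc by (rule teichmueller_mult[OF divisor_closed_p])
  finally show ?case by (simp only: power_Suc2)
qed

lemma Theta_F:
  assumes n: "n > 0" "m * n \<in> I_prime_to p" and m: "m \<in> I_prime_to p"
  shows "Theta p (witt_F n x) m = Theta p x (m * n)"
proof -
  have "wfrob m (restrict (wfrob n x) {0<..}) i = wfrob (m * n) x i" if "i \<in> p_powers p" for i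
    using p_powers_pos[OF that] I_prime_to_pos[OF m] n by (simp add: wfrob_restrict wfrob_wfrob)
  thus ?thesis unfolding Theta_nth[OF m] Theta_nth[OF n(2)] witt_F_eq by
      (auto simp: restrict_def fun_eq_iff)
qed

lemma I_prime_to_div:
  assumes "m \<in> I_prime_to p" "n dvd m" shows "m div n \<in> I_prime_to p"
proof -
  obtain k where k: "m = n * k" using assms(2) by (rule dvdE)
  hence "n > 0" "k > 0" using assms(1) by (auto simp: I_prime_to_def intro: Nat.gr0I)
  thus ?thesis using assms(1) k by (simp add: I_prime_to_def)
qed

lemma Theta_V:
  assumes n: "n \<in> I_prime_to p" and m: "m \<in> I_prime_to p"
  shows "Theta p (witt_V n x) m = (if n dvd m then [n] \<cdot>\<^bsub>p_witt p\<^esub> Theta p x (m div n) else \<zero>\<^bsub>p_witt p\<^esub>)"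
proof -
  have n': "n > 0" "coprime n p" using n by (simp_all add: I_prime_to_def)
  have "wfrob m (restrict (wver n x) {0<..}) i = (if n dvd m then wmultiple n (wfrob (m div n) x) i
      else 0)"
    if "i \<in> p_powers p" for i
    using p_powers_pos[OF that] I_prime_to_pos[OF m] wfrob_wver_p_powers[OF prime I_prime_to_pos[OF
        m] n' that, of x]
    by (simp add: wfrob_restrict)
  hence "Theta p (witt_V n x) m = restrict (if n dvd m then wmultiple n (wfrob (m div n) x) else
      (\<lambda>_. 0)) (p_powers p)"
    unfolding Theta_nth[OF m] witt_V_def by (auto simp: restrict_def fun_eq_iff)
  thus ?thesis
    using I_prime_to_div[OF m] by (simp add: restrict_wmultiple[OF divisor_closed_p] Theta_nth witt_ops)
qed

end

context residue_character
begin

text \<open>The component of index \<open>i m\<close>, for a power \<open>i\<close> of \<open>p\<close> and \<open>m\<close> prime to \<open>p\<close>, enters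
  the \<open>i\<close>-th component of \<open>F\<^sub>m\<close> with the invertible coefficient \<open>m\<close>; all other contributions come
  from proper divisors.\<close>

lemma Theta_eqI:
  fixes x y :: "nat \<Rightarrow> 'k"
  assumes x: "x \<in> carrier big_witt" and y: "y \<in> carrier big_witt"
    and eq: "\<And>m. m \<in> I_prime_to p \<Longrightarrow> Theta p x m = Theta p y m"
  shows "x = y"
proof (rule witt_ext[OF x y])
  fix N :: nat assume "N \<in> {0<..}"
  hence "N > 0" by simp
  thus "x N = y N"
  proof (induction N rule: less_induct)
    case (less N)
    obtain i m where im: "i \<in> p_powers p" "m \<in> I_prime_to p" "N = i * m"
        using p_split'[OF less.prems] by blast
    have "wfrob m x i - of_nat m * x (i * m) = wfrob m y i - of_nat m * y (i * m)"
    proof (rule wfrob_triangular[OF p_powers_pos[OF im(1)] I_prime_to_pos[OF im(2)]])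
      fix d assume "d dvd i * m" "d < i * m"
      thus "x d = y d" using im(3) less.prems by (intro less.IH) (auto intro: Nat.gr0I)
    qed
    moreover have "wfrob m x i = wfrob m y i"
      using fun_cong[OF eq[OF im(2)], of i] im(1,2) by (simp add: Theta_nth)
    ultimately have "of_nat m * x (i * m) = of_nat m * y (i * m)" by simp
    thus ?case using of_nat_prime_to[OF im(2)] im(3) by simp
  qed
qed

text \<open>The same triangular system is solved by recursion on the index.\<close>

lemma Theta_surj:
  assumes y: "y \<in> I_prime_to p \<rightarrow>\<^sub>E carrier (p_witt p :: (nat \<Rightarrow> 'k) ring)"
  shows "\<exists>x\<in>carrier big_witt. Theta p x = y"
proof -
  have "\<exists>f. \<forall>N>0. fst (f N) \<in> p_powers p \<and> snd (f N) \<in> I_prime_to p \<and> N = fst (f N) * snd (f N)"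
    using p_split' by (intro choice) (metis fst_conv snd_conv)
  then obtain f where f: "\<And>N. N > 0 \<Longrightarrow> fst (f N) \<in> p_powers p \<and> snd (f N) \<in> I_prime_to p \<and> N
      = fst (f N) * snd (f N)"
    by blast
  define \<Phi> where "\<Phi> N x = (if N = 0 then 0 else
    (y (snd (f N)) (fst (f N)) - (wfrob (snd (f N)) x (fst (f N)) - of_nat (snd (f N)) * x (fst (f
        N) * snd (f N)))) / of_nat (snd (f N)))" for N and x :: "nat \<Rightarrow> 'k"
  have "\<exists>x. \<forall>N::nat. x N = \<Phi> N x"
  proof (rule nat_recursion)
    fix N and x x' :: "nat \<Rightarrow> 'k" assume eq: "\<And>m. m < N \<Longrightarrow> x m = x' m"
    show "\<Phi> N x = \<Phi> N x'"
    proof (cases "N = 0")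
      case False
      hence N: "N > 0" by simp
      note fN = f[OF N]
      have "wfrob (snd (f N)) x (fst (f N)) - of_nat (snd (f N)) * x (fst (f N) * snd (f N))
        = wfrob (snd (f N)) x' (fst (f N)) - of_nat (snd (f N)) * x' (fst (f N) * snd (f N))"
      proof (rule wfrob_triangular)
        show "fst (f N) > 0" "snd (f N) > 0" using fN p_powers_pos I_prime_to_pos by blast+
        fix d assume "d < fst (f N) * snd (f N)"
        thus "x d = x' d" using fN by (intro eq) metis
      qed
      thus ?thesis by (simp only: \<Phi>_def)
    qed (simp add: \<Phi>_def)
  qed
  then obtain x where x: "\<And>N. x N = \<Phi> N x" by blast
  have key: "wfrob m x i = y m i" if im: "i \<in> p_powers p" "m \<in> I_prime_to p" for i m
  proof -
    have N: "i * m > 0" using p_powers_pos[OF im(1)] I_prime_to_pos[OF im(2)] by simp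
    have s: "i = fst (f (i * m))" "m = snd (f (i * m))"
      using p_split_unique[of i m "fst (f (i * m))" "snd (f (i * m))"] im f[OF N] by blast+
    have "x (i * m) = (y m i - (wfrob m x i - of_nat m * x (i * m))) / of_nat m"
      using x[of "i * m"] unfolding \<Phi>_def s[symmetric] if_not_P[OF N[THEN less_imp_neq, symmetric]] .
    thus ?thesis using of_nat_prime_to[OF im(2)] by (simp add: field_simps)
  qed
  have "Theta p (restrict x {0<..}) = y"
  proof (rule PiE_ext[OF Theta_carrier y])
    fix m assume m: "m \<in> I_prime_to p"
    have "wfrob m (restrict x {0<..}) i = y m i" if "i \<in> p_powers p" for i
      using key[OF that m] p_powers_pos[OF that] I_prime_to_pos[OF m] by (simp add: wfrob_restrict)
    moreover have "y m \<in> carrier (p_witt p)" using y m by auto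
    ultimately show "Theta p (restrict x {0<..}) m = y m"
      unfolding Theta_nth[OF m] by (intro witt_ext[of _ "p_powers p"]) simp_all
  qed
  thus ?thesis by (intro bexI[of _ "restrict x {0<..}"]) simp_all
qed

lemma Theta_inv:
  assumes "y \<in> I_prime_to p \<rightarrow>\<^sub>E carrier (p_witt p :: (nat \<Rightarrow> 'k) ring)"
  shows "Theta_inv p y \<in> carrier big_witt" "Theta p (Theta_inv p y) = y"
proof -
  have "y \<in> Theta p ` carrier big_witt" using Theta_surj[OF assms] by auto
  thus "Theta_inv p y \<in> carrier big_witt" "Theta p (Theta_inv p y) = y"
    unfolding Theta_inv_def by (rule inv_into_into, rule f_inv_into_f)
qed

lemma Theta_inv_restrict:
  assumes "\<And>m. m \<in> I_prime_to p \<Longrightarrow> y m \<in> carrier (p_witt p :: (nat \<Rightarrow> 'k) ring)"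
  shows "Theta_inv p (restrict y (I_prime_to p)) \<in> carrier big_witt"
    and "m \<in> I_prime_to p \<Longrightarrow> Theta p (Theta_inv p (restrict y (I_prime_to p))) m = y m"
proof -
  have *: "restrict y (I_prime_to p) \<in> I_prime_to p \<rightarrow>\<^sub>E carrier (p_witt p)" using assms by auto
  show "Theta_inv p (restrict y (I_prime_to p)) \<in> carrier big_witt" by (rule Theta_inv(1)[OF *])
  show "m \<in> I_prime_to p \<Longrightarrow> Theta p (Theta_inv p (restrict y (I_prime_to p))) m = y m" by
      (simp add: Theta_inv(2)[OF *])
qed

lemma O_scale:
  assumes c: "c \<in> carrier (p_witt p :: (nat \<Rightarrow> 'k) ring)"
  shows "O_scale p c x \<in> carrier big_witt"
    and "m \<in> I_prime_to p \<Longrightarrow> Theta p (O_scale p c x) m = c \<otimes>\<^bsub>p_witt p\<^esub> Theta p x m"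
proof -
  interpret P: cring "p_witt p :: (nat \<Rightarrow> 'k) ring" by (rule cring_p_witt)
  have *: "c \<otimes>\<^bsub>p_witt p\<^esub> Theta p x m \<in> carrier (p_witt p)" if "m \<in> I_prime_to p" for m using c that
      by simp
  show "O_scale p c x \<in> carrier big_witt" unfolding O_scale_def by (rule Theta_inv_restrict(1)[OF *])
  show "m \<in> I_prime_to p \<Longrightarrow> Theta p (O_scale p c x) m = c \<otimes>\<^bsub>p_witt p\<^esub> Theta p x m"
    unfolding O_scale_def by (rule Theta_inv_restrict(2)[OF *])
qed

lemma witt_eps:
  "(witt_eps p m :: nat \<Rightarrow> 'k) \<in> carrier big_witt"
  "n \<in> I_prime_to p \<Longrightarrow> Theta p (witt_eps p m :: nat \<Rightarrow> 'k) n = (if n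
      = m then \<one>\<^bsub>p_witt p\<^esub> else \<zero>\<^bsub>p_witt p\<^esub>)"
proof -
  interpret P: cring "p_witt p :: (nat \<Rightarrow> 'k) ring" by (rule cring_p_witt)
  have *: "(if n = m then \<one>\<^bsub>p_witt p\<^esub> else \<zero>\<^bsub>p_witt p\<^esub>) \<in> carrier (p_witt p :: (nat \<Rightarrow> 'k) ring)"
      for n by simp
  show "(witt_eps p m :: nat \<Rightarrow> 'k) \<in> carrier big_witt" unfolding witt_eps_def
      by (rule Theta_inv_restrict(1)[OF *])
  show "n \<in> I_prime_to p \<Longrightarrow> Theta p (witt_eps p m :: nat \<Rightarrow> 'k) n = (if n
      = m then \<one>\<^bsub>p_witt p\<^esub> else \<zero>\<^bsub>p_witt p\<^esub>)"
    unfolding witt_eps_def by (rule Theta_inv_restrict(2)[OF *])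
qed

lemma O_linearI:
  assumes T: "T \<in> carrier (End_ring (big_witt :: (nat \<Rightarrow> 'k) ring))"
    and eq: "\<And>c x m. c \<in> carrier (p_witt p) \<Longrightarrow> x \<in> carrier big_witt \<Longrightarrow> m \<in> I_prime_to p \<Longrightarrow>
      Theta p (T (O_scale p c x)) m = c \<otimes>\<^bsub>p_witt p\<^esub> Theta p (T x) m"
  shows "O_linear p T"
  unfolding O_linear_def
proof (intro conjI ballI T)
  fix c x :: "nat \<Rightarrow> 'k" assume cx: "c \<in> carrier (p_witt p)" "x \<in> carrier big_witt"
  show "T (O_scale p c x) = O_scale p c (T x)"
  proof (rule Theta_eqI)
    show "T (O_scale p c x) \<in> carrier big_witt" using T O_scale(1)[OF cx(1)] by
        (auto simp: End_ring_simps)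
  qed (simp_all add: O_scale cx eq)
qed

text \<open>The transposed shift in the coordinates \<open>\<Theta>\<close>; \<open>V_div_multiple\<close> shows that its \<open>n\<close>-fold multiple
  is \<open>V\<^sub>n\<close>.\<close>

definition V_div :: "nat \<Rightarrow> (nat \<Rightarrow> 'k) \<Rightarrow> nat \<Rightarrow> 'k" where
  "V_div n = (\<lambda>x\<in>carrier big_witt. Theta_inv p
     (\<lambda>m\<in>I_prime_to p. if n dvd m then Theta p x (m div n) else \<zero>\<^bsub>p_witt p\<^esub>))"

lemma V_div:
  assumes x: "x \<in> carrier big_witt"
  shows "V_div n x \<in> carrier big_witt"
    and "m \<in> I_prime_to p \<Longrightarrow> Theta p (V_div n x) m = (if n dvd m then Theta p x (m div n) else
        \<zero>\<^bsub>p_witt p\<^esub>)"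
proof -
  interpret P: cring "p_witt p :: (nat \<Rightarrow> 'k) ring" by (rule cring_p_witt)
  have *: "(if n dvd m then Theta p x (m div n) else \<zero>\<^bsub>p_witt p\<^esub>) \<in> carrier (p_witt p)" if
      "m \<in> I_prime_to p" for m
    using I_prime_to_div[OF that] by simp
  show "V_div n x \<in> carrier big_witt" unfolding V_div_def restrict_apply'[OF x]
      by (rule Theta_inv_restrict(1)[OF *])
  show "m \<in> I_prime_to p \<Longrightarrow> Theta p (V_div n x) m = (if n dvd m then Theta p x (m div n) else
      \<zero>\<^bsub>p_witt p\<^esub>)"
    unfolding V_div_def restrict_apply'[OF x] by (rule Theta_inv_restrict(2)[OF *])
qed

lemma V_div_End: "V_div n \<in> carrier (End_ring big_witt)"
proof -
  interpret P: cring "p_witt p :: (nat \<Rightarrow> 'k) ring" by (rule cring_p_witt)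
  interpret W: cring "big_witt :: (nat \<Rightarrow> 'k) ring" by (rule cring_big_witt)
  have "V_div n (x \<oplus>\<^bsub>big_witt\<^esub> y) = V_div n x \<oplus>\<^bsub>big_witt\<^esub> V_div n y" if xy: "x \<in> carrier big_witt"
      "y \<in> carrier big_witt" for x y
    by (rule Theta_eqI) (use xy I_prime_to_div in \<open>simp_all add: V_div Theta_add\<close>)
  moreover have "V_div n \<in> extensional (carrier big_witt)" by (simp add: V_div_def)
  ultimately show ?thesis using V_div(1) by (simp add: End_ring_simps)
qed

lemma V_div_multiple:
  assumes n: "n \<in> I_prime_to p" and x: "x \<in> carrier big_witt"
  shows "[n] \<cdot>\<^bsub>big_witt\<^esub> V_div n x = witt_V n x"
proof -
  interpret P: cring "p_witt p :: (nat \<Rightarrow> 'k) ring" by (rule cring_p_witt)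
  interpret W: cring "big_witt :: (nat \<Rightarrow> 'k) ring" by (rule cring_big_witt)
  show ?thesis
  proof (rule Theta_eqI)
    fix m assume m: "m \<in> I_prime_to p"
    have "Theta p ([n] \<cdot>\<^bsub>big_witt\<^esub> V_div n x) m = [n] \<cdot>\<^bsub>p_witt p\<^esub> Theta p (V_div n x) m"
      by (rule ring_hom_add_pow[OF Theta_hom[OF m] W.ring_axioms P.ring_axioms V_div(1)[OF x]])
    thus "Theta p ([n] \<cdot>\<^bsub>big_witt\<^esub> V_div n x) m = Theta p (witt_V n x) m"
      by (simp add: V_div(2)[OF x m] Theta_V[OF n m])
  qed (use V_div(1)[OF x] in simp_all)
qed

end

section \<open>The Frobenius at \<open>p\<close>\<close>

context residue_character
begin

lemma comm_ring_hom_frobenius: "comm_ring_hom (\<lambda>a::'k. a ^ p)"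
proof
  fix x y :: 'k
  show "(x + y) ^ p = x ^ p + y ^ p" by (rule freshmans_dream) (simp_all only: char prime)
qed (simp_all add: power_mult_distrib zero_power)

definition frob :: "(nat \<Rightarrow> 'k) \<Rightarrow> nat \<Rightarrow> 'k" where
  "frob x = restrict (\<lambda>n. x n ^ p) {0<..}"

lemma continuous_End_frob: "restrict frob (carrier big_witt) \<in> continuous_End"
proof -
  interpret W: cring "big_witt :: (nat \<Rightarrow> 'k) ring" by (rule cring_big_witt)
  have c: "continuous_map witt_topology witt_topology (restrict frob (carrier big_witt))"
  proof (rule continuous_wittI[where B = "\<lambda>n. n"])
    show "restrict frob (carrier big_witt) x \<in> carrier big_witt" if "x \<in> carrier big_witt" for x
      using that by (simp add: frob_def)
    fix x y :: "nat \<Rightarrow> 'k" and n :: nat assume n: "n > 0" and xy: "x \<in> carrier big_witt"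
        "y \<in> carrier big_witt"
      and eq: "\<And>m. 0 < m \<Longrightarrow> m \<le> n \<Longrightarrow> y m = x m"
    show "restrict frob (carrier big_witt) y n = restrict frob (carrier big_witt) x n"
      unfolding restrict_apply'[OF xy(1)] restrict_apply'[OF xy(2)] frob_def using eq[OF n] by simp
  qed
  have add: "frob (x \<oplus>\<^bsub>big_witt\<^esub> y) = frob x \<oplus>\<^bsub>big_witt\<^esub> frob y" for x y
  proof (rule witt_ext[of _ "{0<..}"])
    fix n :: nat assume n: "n \<in> {0<..}"
    have "frob (x \<oplus>\<^bsub>big_witt\<^esub> y) n = wadd (\<lambda>n. x n ^ p) (\<lambda>n. y n ^ p) n"
      using n map_wadd[OF comm_ring_hom_frobenius, of x y n] by (simp add: frob_def witt_ops)
    thus "frob (x \<oplus>\<^bsub>big_witt\<^esub> y) n = (frob x \<oplus>\<^bsub>big_witt\<^esub> frob y) n"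
      using n by (simp add: frob_def witt_ops wfun_restrict[OF divisor_closed_positive])
  qed (simp_all add: frob_def)
  have "restrict frob (carrier big_witt) \<in> carrier (End_ring big_witt)"
    by (simp add: End_ring_simps add) (simp add: frob_def)
  thus ?thesis using c by simp
qed

text \<open>On Teichmueller representatives both sides are \<open>[\<alpha>] \<mapsto> [\<alpha>\<^sup>p]\<close>, and these span a dense
  subgroup.\<close>

lemma witt_F_p: "restrict (witt_F p) (carrier big_witt) = restrict frob (carrier big_witt)"
proof (rule continuous_End_eqI_teichmueller[OF continuous_End_F[OF p_pos] continuous_End_frob])
  fix a :: 'k
  have c: "teichmueller {0<..} a \<in> carrier big_witt" by (simp add: teichmueller_eq)
  have "frob (teichmueller {0<..} a) = teichmueller {0<..} (a ^ p)"
    by (rule witt_ext[of _ "{0<..}"]) (auto simp: frob_def teichmueller_eq wteich_def zero_power)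
  thus "restrict (witt_F p) (carrier big_witt) (teichmueller {0<..} a)
      = restrict frob (carrier big_witt) (teichmueller {0<..} a)"
    unfolding restrict_apply'[OF c] witt_F_teichmueller[OF p_pos] ..
qed

lemma witt_F_p_eq: "x \<in> carrier big_witt \<Longrightarrow> witt_F p x = frob x"
  using fun_cong[OF witt_F_p, of x] by simp

lemma frobenius_series: "(1 - fps_const (a::'k) * fps_X) ^ p = 1 - fps_const (a ^ p) * fps_X ^ p"
proof -
  \<comment> \<open>Additivity of the \<open>p\<close>-th power avoids the sign of \<open>(- 1)\<^sup>p\<close>.\<close>
  have "(1 - fps_const a * fps_X + fps_const a * fps_X) ^ p
      = (1 - fps_const a * fps_X) ^ p + (fps_const a * fps_X) ^ p"
    by (rule freshmans_dream) (simp_all only: semiring_char_fps char prime)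
  thus ?thesis by (simp add: power_mult_distrib fps_const_power eq_diff_eq)
qed

text \<open>Multiplication by \<open>p\<close> is \<open>V\<^sub>p F\<^sub>p\<close> in characteristic \<open>p\<close>: on \<open>[\<alpha>]\<close> this is
  \<open>(1 - \<alpha> t)\<^sup>p = 1 - \<alpha>\<^sup>p t\<^sup>p\<close>.\<close>

lemma p_multiple:
  assumes x: "x \<in> carrier big_witt"
  shows "[p] \<cdot>\<^bsub>big_witt\<^esub> x = witt_V p (witt_F p (x :: nat \<Rightarrow> 'k))"
proof -
  interpret W: cring "big_witt :: (nat \<Rightarrow> 'k) ring" by (rule cring_big_witt)
  let ?B = "carrier (big_witt :: (nat \<Rightarrow> 'k) ring)" and ?p = "[p] \<cdot>\<^bsub>big_witt\<^esub> \<one>\<^bsub>big_witt\<^esub> :: nat \<Rightarrow> 'k"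
  have pc: "?p \<in> ?B" by (rule W.add.nat_pow_closed) simp
  have mult: "?p \<otimes>\<^bsub>big_witt\<^esub> y = [p] \<cdot>\<^bsub>big_witt\<^esub> y" if "y \<in> ?B" for y
    using W.add_pow_ldistr[of "\<one>\<^bsub>big_witt\<^esub>" y p] that by simp
  \<comment> \<open>Multiplication by \<open>p\<close> is written as a product with \<open>p \<cdot> 1\<close>, which makes its continuity evident.\<close>
  have eq: "(\<lambda>x\<in>?B. ?p \<otimes>\<^bsub>big_witt\<^esub> x) = compose ?B (restrict (witt_V p) ?B) (restrict (witt_F p) ?B)"
  proof (rule continuous_End_eqI_teichmueller[OF continuous_End_mult[OF pc]
      continuous_End_compose[OF continuous_End_V[OF p_pos] continuous_End_F[OF p_pos]]])
    fix a :: 'k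
    have c: "teichmueller {0<..} b \<in> ?B" for b :: 'k by (simp add: teichmueller_eq)
    have V: "witt_V p (teichmueller {0<..} (a ^ p)) = restrict (wver p (wteich (a ^ p))) {0<..}"
      by (rule witt_ext[of _ "{0<..}"]) (simp_all add: witt_V_def teichmueller_eq wver_restrict)
    have "wseries ([p] \<cdot>\<^bsub>big_witt\<^esub> teichmueller {0<..} a)
        = wseries (witt_V p (teichmueller {0<..} (a ^ p)))"
      unfolding wseries_add_pow wseries_teichmueller frobenius_series V wseries_restrict
          wseries_wver_wteich[OF p_pos] ..
    hence "[p] \<cdot>\<^bsub>big_witt\<^esub> teichmueller {0<..} a = witt_V p (teichmueller {0<..} (a ^ p))"
      by (subst (asm) wseries_eq_iff[OF W.add.nat_pow_closed[OF c, simplified] witt_V_closed])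
    thus "(\<lambda>x\<in>?B. ?p \<otimes>\<^bsub>big_witt\<^esub> x) (teichmueller {0<..} a)
      = compose ?B (restrict (witt_V p) ?B) (restrict (witt_F p) ?B) (teichmueller {0<..} a)"
      unfolding compose_eq[OF c] restrict_apply'[OF c] mult[OF c] witt_F_teichmueller[OF p_pos]
          restrict_apply'[OF c] .
  qed
  show ?thesis
    using fun_cong[OF eq, of x] unfolding compose_eq[OF x] restrict_apply'[OF x] mult[OF x]
        restrict_apply'[OF witt_F_closed] .
qed

lemma witt_F_p_inj:
  assumes "x \<in> carrier big_witt" "y \<in> carrier big_witt" "witt_F p x = witt_F p (y :: nat \<Rightarrow> 'k)"
      shows "x = y"
proof (rule witt_ext[OF assms(1,2)])
  fix n :: nat assume n: "n \<in> {0<..}"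
  have "frob x n = frob y n" using assms by (simp add: witt_F_p_eq)
  thus "x n = y n" using n frobenius_inj by (simp add: frob_def)
qed

lemma witt_F_p_surj:
  assumes y: "y \<in> carrier big_witt" shows "\<exists>x\<in>carrier big_witt. witt_F p x = (y :: nat \<Rightarrow> 'k)"
proof -
  have "\<exists>x. \<forall>n. x n ^ p = y n" by (intro choice allI nth_root_exists) simp
  then obtain x where x: "\<And>n. x n ^ p = y n" by blast
  have "frob (restrict x {0<..}) = y"
    by (rule witt_ext[of _ "{0<..}"]) (use y x in \<open>simp_all add: frob_def\<close>)
  thus ?thesis by (intro bexI[of _ "restrict x {0<..}"]) (simp_all add: witt_F_p_eq)
qed

lemma Theta_frob:
  assumes m: "m \<in> I_prime_to p" and x: "x \<in> carrier big_witt"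
  shows "Theta p (witt_F p x) m = Fr p (Theta p (x :: nat \<Rightarrow> 'k) m)"
proof -
  have "wfrob m (frob x) i = wfrob m x i ^ p" if "i \<in> p_powers p" for i
    using p_powers_pos[OF that] I_prime_to_pos[OF m] by
        (simp add: frob_def wfrob_restrict map_wfrob[OF comm_ring_hom_frobenius])
  thus ?thesis unfolding witt_F_p_eq[OF x] Theta_nth[OF m] Fr_def by (auto simp: restrict_def fun_eq_iff)
qed

lemma Fr_closed [simp]: "Fr p c \<in> carrier (p_witt p)"
  by (simp add: Fr_def)

lemma Fr_mult: "Fr p (c \<otimes>\<^bsub>p_witt p\<^esub> d) = Fr p c \<otimes>\<^bsub>p_witt p\<^esub> Fr p (d :: nat \<Rightarrow> 'k)"
  by (rule witt_ext[of _ "p_powers p"])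
     (simp_all add: Fr_def witt_ops wfun_restrict[OF divisor_closed_p] map_wmult[OF
         comm_ring_hom_frobenius])

lemma Fr_op_eq: "Fr_op p = restrict (witt_F p) (carrier (big_witt :: (nat \<Rightarrow> 'k) ring))"
proof (rule extensionalityI[of _ "carrier big_witt"])
  fix x :: "nat \<Rightarrow> 'k" assume x: "x \<in> carrier big_witt"
  have *: "Fr p (Theta p x m) \<in> carrier (p_witt p)" for m by simp
  show "Fr_op p x = restrict (witt_F p) (carrier big_witt) x"
    unfolding Fr_op_def restrict_apply'[OF x]
    by (rule Theta_eqI[OF Theta_inv_restrict(1)[OF *] witt_F_closed])
        (simp add: Theta_inv_restrict(2)[OF *] Theta_frob x)
qed (simp_all add: Fr_op_def)

lemma Fr_inv_op:
  assumes x: "x \<in> carrier big_witt"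
  shows "Fr_inv_op p x \<in> carrier big_witt" "witt_F p (Fr_inv_op p x) = (x :: nat \<Rightarrow> 'k)"
proof -
  have mem: "x \<in> Fr_op p ` carrier big_witt"
    using witt_F_p_surj[OF x] unfolding Fr_op_eq by (auto simp: image_iff)
  show c: "Fr_inv_op p x \<in> carrier big_witt" unfolding Fr_inv_op_def restrict_apply'[OF x]
      by (rule inv_into_into[OF mem])
  have "Fr_op p (Fr_inv_op p x) = x" unfolding Fr_inv_op_def restrict_apply'[OF x]
      by (rule f_inv_into_f[OF mem])
  thus "witt_F p (Fr_inv_op p x) = x" unfolding Fr_op_eq restrict_apply'[OF c] .
qed

lemma Fr_inv_op_End: "(Fr_inv_op p :: (nat \<Rightarrow> 'k) \<Rightarrow> _) \<in> carrier (End_ring big_witt)"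
proof -
  interpret W: cring "big_witt :: (nat \<Rightarrow> 'k) ring" by (rule cring_big_witt)
  have "Fr_inv_op p (x \<oplus>\<^bsub>big_witt\<^esub> y) = Fr_inv_op p x \<oplus>\<^bsub>big_witt\<^esub> Fr_inv_op p y"
    if xy: "x \<in> carrier big_witt" "y \<in> carrier big_witt" for x y :: "nat \<Rightarrow> 'k"
    by (rule witt_F_p_inj) (use xy in \<open>simp_all add: Fr_inv_op ring_hom_add[OF ring_hom_witt_F[OF
        p_pos]]\<close>)
  moreover have "(Fr_inv_op p :: (nat \<Rightarrow> 'k) \<Rightarrow> _) \<in> extensional (carrier big_witt)" by
      (simp add: Fr_inv_op_def)
  ultimately show ?thesis using Fr_inv_op(1) by (simp add: End_ring_simps)
qed

section \<open>The extended representation in \<open>p\<close>-adic coordinates\<close>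

lemma is_mu_op_iff:
  assumes n: "n > 0"
  shows "is_mu_op ext_rep n T \<longleftrightarrow>
    T \<in> carrier (End_ring big_witt) \<and> (\<forall>x\<in>carrier big_witt. [n] \<cdot>\<^bsub>big_witt\<^esub> T x = witt_V n x)"
  unfolding is_mu_op_def ext_rep_gen(3)[OF n] End_ring_add_pow by (auto simp: restrict_def fun_eq_iff)

lemma is_mu_op_prime_to_iff:
  assumes n: "n \<in> I_prime_to p" shows "is_mu_op ext_rep n T \<longleftrightarrow> T = V_div n"
proof
  assume T: "is_mu_op ext_rep n T"
  note T' = T[unfolded is_mu_op_iff[OF I_prime_to_pos[OF n]]]
  show "T = V_div n"
  proof (rule End_ring_ext[where M = big_witt])
    fix x :: "nat \<Rightarrow> 'k" assume x: "x \<in> carrier big_witt"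
    have "T x \<in> carrier big_witt" using T' x by (auto simp: End_ring_simps)
    moreover have "[n] \<cdot>\<^bsub>big_witt\<^esub> T x = [n] \<cdot>\<^bsub>big_witt\<^esub> V_div n x"
      using T' x V_div_multiple[OF n x] by simp
    ultimately show "T x = V_div n x" using big_witt_torsion_free V_div(1)[OF x] of_nat_prime_to[OF
        n] by blast
  qed (use T' V_div_End in blast)+
next
  assume "T = V_div n"
  thus "is_mu_op ext_rep n T" using V_div_End V_div_multiple[OF n] by
      (simp add: is_mu_op_iff I_prime_to_pos[OF n])
qed

text \<open>As \<open>V\<^sub>p F\<^sub>p = p\<close> and \<open>V\<^sub>p\<close> is injective, \<open>p T = V\<^sub>p\<close> means \<open>F\<^sub>p T = 1\<close>.\<close>

lemma is_mu_op_p_iff: "is_mu_op ext_rep p T \<longleftrightarrow> T = Fr_inv_op p"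
proof
  assume T: "is_mu_op ext_rep p T"
  note T' = T[unfolded is_mu_op_iff[OF p_pos]]
  show "T = Fr_inv_op p"
  proof (rule End_ring_ext[where M = big_witt])
    fix x :: "nat \<Rightarrow> 'k" assume x: "x \<in> carrier big_witt"
    have c: "T x \<in> carrier big_witt" using T' x by (auto simp: End_ring_simps)
    have "witt_V p (witt_F p (T x)) = witt_V p x" using T' x p_multiple[OF c] by simp
    hence "witt_F p (T x) = x" by (rule witt_V_inj[OF p_pos witt_F_closed x])
    hence "witt_F p (T x) = witt_F p (Fr_inv_op p x)" by (simp add: Fr_inv_op(2)[OF x])
    thus "T x = Fr_inv_op p x" by (rule witt_F_p_inj[OF c Fr_inv_op(1)[OF x]])
  qed (use T' Fr_inv_op_End in blast)+
next
  assume "T = Fr_inv_op p"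
  thus "is_mu_op ext_rep p T" using Fr_inv_op_End by (simp add: is_mu_op_iff p_multiple Fr_inv_op)
qed

lemma mu_op_prime_to: "n \<in> I_prime_to p \<Longrightarrow> mu_op ext_rep n = V_div n"
  unfolding mu_op_def by (rule the_equality) (simp_all only: is_mu_op_prime_to_iff)

lemma mu_op_p: "mu_op ext_rep p = Fr_inv_op p"
  unfolding mu_op_def by (rule the_equality) (simp_all only: is_mu_op_p_iff)

lemma Mu_star_apply:
  "n > 0 \<Longrightarrow> x \<in> carrier big_witt \<Longrightarrow> ext_rep (bc_class (Mu_star n)) x = witt_F n x"
  by (simp add: ext_rep_gen)

lemma Elt_apply:
  "w \<in> carrier big_witt \<Longrightarrow> ext_rep (bc_class (Elt x)) w = embed x \<otimes>\<^bsub>big_witt\<^esub> w"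
  by (simp add: ext_rep_gen)

lemma ext_rep_End: "bc_gen_ok g \<Longrightarrow> ext_rep (bc_class g) \<in> carrier (End_ring big_witt)"
  using ext_rep_closed[OF bc_class_closed] by blast

lemma O_linear_mu_op:
  assumes n: "n \<in> I_prime_to p" shows "O_linear p (mu_op ext_rep n)"
  unfolding mu_op_prime_to[OF n]
proof (rule O_linearI[OF V_div_End])
  interpret P: cring "p_witt p :: (nat \<Rightarrow> 'k) ring" by (rule cring_p_witt)
  fix c x :: "nat \<Rightarrow> 'k" and m assume c: "c \<in> carrier (p_witt p)" and x: "x \<in> carrier big_witt"
      and m: "m \<in> I_prime_to p"
  show "Theta p (V_div n (O_scale p c x)) m = c \<otimes>\<^bsub>p_witt p\<^esub> Theta p (V_div n x) m"
    unfolding V_div(2)[OF O_scale(1)[OF c] m] V_div(2)[OF x m]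
    using O_scale(2)[OF c I_prime_to_div[OF m]] P.r_null[OF c] by simp
qed

lemma O_linear_mu_star:
  assumes n: "n \<in> I_prime_to p" shows "O_linear p (ext_rep (bc_class (Mu_star n)))"
proof (rule O_linearI[OF ext_rep_End])
  have n0: "n > 0" using n by (rule I_prime_to_pos)
  show "bc_gen_ok (Mu_star n)" using n0 by simp
  fix c x :: "nat \<Rightarrow> 'k" and m assume c: "c \<in> carrier (p_witt p)" and x: "x \<in> carrier big_witt"
      and m: "m \<in> I_prime_to p"
  show "Theta p (ext_rep (bc_class (Mu_star n)) (O_scale p c x)) m
      = c \<otimes>\<^bsub>p_witt p\<^esub> Theta p (ext_rep (bc_class (Mu_star n)) x) m"
    unfolding Mu_star_apply[OF n0 x] Mu_star_apply[OF n0 O_scale(1)[OF c]] Theta_F[OF n0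
        I_prime_to_mult[OF m n] m]
    by (rule O_scale(2)[OF c I_prime_to_mult[OF m n]])
qed

lemma O_linear_Elt: "O_linear p (ext_rep (bc_class (Elt y)))"
proof (rule O_linearI[OF ext_rep_End])
  interpret P: cring "p_witt p :: (nat \<Rightarrow> 'k) ring" by (rule cring_p_witt)
  show "bc_gen_ok (Elt y)" by simp
  fix c x :: "nat \<Rightarrow> 'k" and m assume c: "c \<in> carrier (p_witt p)" and x: "x \<in> carrier big_witt"
      and m: "m \<in> I_prime_to p"
  show "Theta p (ext_rep (bc_class (Elt y)) (O_scale p c x)) m
      = c \<otimes>\<^bsub>p_witt p\<^esub> Theta p (ext_rep (bc_class (Elt y)) x) m"
    unfolding Elt_apply[OF x] Elt_apply[OF O_scale(1)[OF c]] Theta_mult[OF m embed(1) x]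
        Theta_mult[OF m embed(1) O_scale(1)[OF c]]
      O_scale(2)[OF c m]
    by (rule P.m_lcomm[OF Theta_closed[OF m] c Theta_closed[OF m]])
qed

lemma mu_op_eps:
  assumes n: "n \<in> I_prime_to p" and m: "m \<in> I_prime_to p"
  shows "mu_op ext_rep n (witt_eps p m) = witt_eps p (n * m)"
proof (rule Theta_eqI)
  fix k assume k: "k \<in> I_prime_to p"
  have n0: "n > 0" using n by (rule I_prime_to_pos)
  have "(n dvd k \<and> k div n = m) \<longleftrightarrow> k = n * m" using n0 by auto
  thus "Theta p (mu_op ext_rep n (witt_eps p m)) k = Theta p (witt_eps p (n * m) :: nat \<Rightarrow> 'k) k"
    unfolding mu_op_prime_to[OF n] V_div(2)[OF witt_eps(1) k] witt_eps(2)[OF k]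
    using witt_eps(2)[OF I_prime_to_div[OF k], of n m] by auto
qed (simp_all add: mu_op_prime_to[OF n] V_div witt_eps)

lemma mu_star_eps:
  assumes n: "n \<in> I_prime_to p" and k: "k \<in> I_prime_to p"
  shows "ext_rep (bc_class (Mu_star n)) (witt_eps p k) = (if n dvd k then witt_eps p (k div n) else
      \<zero>\<^bsub>big_witt\<^esub>)"
proof (rule Theta_eqI)
  interpret W: cring "big_witt :: (nat \<Rightarrow> 'k) ring" by (rule cring_big_witt)
  have n0: "n > 0" using n by (rule I_prime_to_pos)
  show "(if n dvd k then witt_eps p (k div n) else \<zero>\<^bsub>big_witt\<^esub>) \<in> carrier (big_witt :: (nat \<Rightarrow> 'k) ring)"
    by (simp add: witt_eps)
  show "ext_rep (bc_class (Mu_star n)) (witt_eps p k) \<in> carrier big_witt"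
    by (simp add: Mu_star_apply[OF n0 witt_eps(1)])
  fix m assume m: "m \<in> I_prime_to p"
  note F = Mu_star_apply[OF n0 witt_eps(1)] Theta_F[OF n0 I_prime_to_mult[OF m n] m] witt_eps(2)[OF
      I_prime_to_mult[OF m n]]
  show "Theta p (ext_rep (bc_class (Mu_star n)) (witt_eps p k)) m
      = Theta p (if n dvd k then witt_eps p (k div n) else \<zero>\<^bsub>big_witt\<^esub> :: nat \<Rightarrow> 'k) m"
  proof (cases "n dvd k")
    case True
    hence "(m * n = k) = (m = k div n)" using n0 by auto
    thus ?thesis unfolding F if_P[OF True] witt_eps(2)[OF m] by (simp only:)
  next
    case False
    hence "m * n \<noteq> k" by auto
    thus ?thesis unfolding F if_not_P[OF False] Theta_zero[OF m] by (simp only: if_False)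
  qed
qed

text \<open>Only the component of index \<open>m\<close> matters, and there the Teichmueller representative of \<open>\<alpha>\<close> has the
  value \<open>[\<alpha>\<^sup>m]\<close>.\<close>

lemma Elt_eps:
  assumes \<gamma>: "\<gamma> \<in> qz_prime_to p" and m: "m \<in> I_prime_to p"
  shows "ext_rep (bc_class (Elt (frag_of \<gamma>))) (witt_eps p m)
    = O_scale p (teichmueller (p_powers p) (sigma_inv \<sigma> \<gamma>) [^]\<^bsub>p_witt p\<^esub> m) (witt_eps p m)"
proof -
  interpret P: cring "p_witt p :: (nat \<Rightarrow> 'k) ring" by (rule cring_p_witt)
  interpret W: cring "big_witt :: (nat \<Rightarrow> 'k) ring" by (rule cring_big_witt)
  have c: "teichmueller (p_powers p) (sigma_inv \<sigma> \<gamma> ^ j) \<in> carrier (p_witt p)" for j by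
      (simp add: teichmueller_eq)
  have t: "teichmueller {0<..} (sigma_inv \<sigma> \<gamma>) \<in> carrier big_witt" by (simp add: teichmueller_eq)
  have e: "embed (frag_of \<gamma>) = teichmueller {0<..} (sigma_inv \<sigma> \<gamma>)"
    by (simp add: embed_of chi_def qz_proj_id[OF \<gamma>])
  show ?thesis
    unfolding teichmueller_pow Elt_apply[OF witt_eps(1)] e
  proof (rule Theta_eqI)
    fix n assume n: "n \<in> I_prime_to p"
    show "Theta p (teichmueller {0<..} (sigma_inv \<sigma> \<gamma>) \<otimes>\<^bsub>big_witt\<^esub> witt_eps p m) n
      = Theta p (O_scale p (teichmueller (p_powers p) (sigma_inv \<sigma> \<gamma> ^ m)) (witt_eps p m)) n"
      unfolding Theta_mult[OF n t witt_eps(1)] O_scale(2)[OF c n] witt_eps(2)[OF n]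
          Theta_teichmueller[OF n]
      using P.r_null[OF c[of n]] P.r_null[OF c[of m]] by simp
  qed (use O_scale(1)[OF c] t witt_eps(1) in simp_all)
qed

lemma Elt_r: "ext_rep (bc_class (Elt x)) = ext_rep (bc_class (Elt (bc_r p x)))"
  by (simp add: ext_rep_gen embed_r)

lemma mu_star_p: "ext_rep (bc_class (Mu_star p)) = Fr_op p"
  by (simp add: ext_rep_gen Fr_op_eq)

lemma mu_star_p_skew:
  assumes c: "c \<in> carrier (p_witt p)" and x: "x \<in> carrier big_witt"
  shows "ext_rep (bc_class (Mu_star p)) (O_scale p c x)
      = O_scale p (Fr p c) (ext_rep (bc_class (Mu_star p)) x)"
  unfolding Mu_star_apply[OF p_pos x] Mu_star_apply[OF p_pos O_scale(1)[OF c]]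
proof (rule Theta_eqI[OF witt_F_closed O_scale(1)[OF Fr_closed]])
  fix m assume m: "m \<in> I_prime_to p"
  show "Theta p (witt_F p (O_scale p c x)) m = Theta p (O_scale p (Fr p c) (witt_F p x)) m"
    unfolding O_scale(2)[OF Fr_closed m] Theta_frob[OF m x] Theta_frob[OF m O_scale(1)[OF c]]
        O_scale(2)[OF c m] Fr_mult ..
qed

text \<open>Both sides are multiplicative in the exponent; the powers of \<open>\<zeta>\<^sub>\<gamma>\<close> stay in the domain of \<open>\<rho>\<close>.\<close>

lemma cyc_embedding_power:
  assumes \<rho>: "cyc_embedding p \<sigma> C \<iota> \<rho>" and \<gamma>: "\<gamma> \<in> qz_prime_to p"
  shows "\<rho> (zeta \<gamma> ^ m) = \<iota> (teichmueller (p_powers p) (sigma_inv \<sigma> \<gamma>) [^]\<^bsub>p_witt p\<^esub> m)"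
proof -
  interpret P: cring "p_witt p :: (nat \<Rightarrow> 'k) ring" by (rule cring_p_witt)
  let ?t = "teichmueller (p_powers p) (sigma_inv \<sigma> \<gamma>)"
  have t: "?t \<in> carrier (p_witt p)" by (simp add: teichmueller_eq)
  have hom: "\<iota> \<in> ring_hom (p_witt p) C" "\<rho> \<in> ring_hom (Q_cyc p) C" and z: "\<rho> (zeta \<gamma>) = \<iota> ?t"
    using \<rho> \<gamma> by (simp_all add: cyc_embedding_def)
  have Q: "carrier (Q_cyc p) = generate_field ring_of_type_algebra (zeta ` qz_prime_to p)"
    "x \<otimes>\<^bsub>Q_cyc p\<^esub> y = x * y" "\<one>\<^bsub>Q_cyc p\<^esub> = 1" for x y
    by (simp_all add: Q_cyc_def ring_of_type_algebra_def)
  have g: "zeta \<gamma> \<in> carrier (Q_cyc p)" unfolding Q using \<gamma> by (blast intro: generate_field.incl)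
  have "zeta \<gamma> ^ m \<in> carrier (Q_cyc p) \<and> \<rho> (zeta \<gamma> ^ m) = \<iota> (?t [^]\<^bsub>p_witt p\<^esub> m)"
  proof (induction m)
    case 0
    have "(1::complex) \<in> carrier (Q_cyc p)"
      unfolding Q using generate_field.one[of "ring_of_type_algebra :: complex ring"] by
          (simp add: ring_of_type_algebra_def)
    thus ?case using ring_hom_one[OF hom(1)] ring_hom_one[OF hom(2)] by (simp add: Q(3))
  next
    case (Suc m)
    have "zeta \<gamma> ^ m * zeta \<gamma> \<in> carrier (Q_cyc p)"
      using generate_field.eng_mult[of "zeta \<gamma> ^ m" "ring_of_type_algebra :: complex ring" _
          "zeta \<gamma>"] Suc g
      unfolding Q by (simp add: ring_of_type_algebra_def)
    moreover have "\<rho> (zeta \<gamma> ^ m * zeta \<gamma>) = \<iota> (?t [^]\<^bsub>p_witt p\<^esub> m) \<otimes>\<^bsub>C\<^esub> \<iota> ?t"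
      using ring_hom_mult[OF hom(2) conjunct1[OF Suc] g] Suc z by (simp add: Q(2))
    moreover have "\<iota> (?t [^]\<^bsub>p_witt p\<^esub> Suc m) = \<iota> (?t [^]\<^bsub>p_witt p\<^esub> m) \<otimes>\<^bsub>C\<^esub> \<iota> ?t"
      unfolding P.nat_pow_Suc by (rule ring_hom_mult[OF hom(1) P.nat_pow_closed[OF t] t])
    ultimately show ?case by (simp only: power_Suc2)
  qed
  thus ?thesis ..
qed

end

theorem theorem6p4:
  fixes p :: nat
    and \<sigma> :: "'k::alg_closed_field \<Rightarrow> qz"
    and C :: "'c ring"
    and \<iota> :: "(nat \<Rightarrow> 'k) \<Rightarrow> 'c"
  assumes "Factorial_Ring.prime p"
    and "CHAR('k) = p"
    and "\<And>x::'k. \<exists>P. P \<noteq> 0 \<and> (\<forall>i. poly.coeff P i \<in> \<int>) \<and> poly P x = 0"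
    and "\<And>x y. x \<noteq> 0 \<Longrightarrow> y \<noteq> 0 \<Longrightarrow> \<sigma> (x * y) = \<sigma> x + \<sigma> y"
    and "inj_on \<sigma> (UNIV - {0})"
  shows "(\<exists>!\<pi>0. W0_representation p \<sigma> \<pi>0) \<and>
    (\<forall>\<pi>0. W0_representation p \<sigma> \<pi>0 \<longrightarrow>
      (\<exists>!\<pi>. continuous_extension \<pi>0 \<pi>) \<and>
      (\<forall>\<pi>. continuous_extension \<pi>0 \<pi> \<longrightarrow>
        (\<forall>n\<in>insert p (I_prime_to p). \<exists>!T. is_mu_op \<pi> n T) \<and>
        (\<forall>n\<in>I_prime_to p. O_linear p (mu_op \<pi> n) \<and> O_linear p (\<pi> (bc_class (Mu_star n)))) \<and>
        (\<forall>x. O_linear p (\<pi> (bc_class (Elt x)))) \<and>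
        (\<forall>n\<in>I_prime_to p. \<forall>m\<in>I_prime_to p. mu_op \<pi> n (witt_eps p m) = witt_eps p (n * m)) \<and>
        (\<forall>a. \<forall>b\<in>I_prime_to p. \<forall>m\<in>I_prime_to p.
           \<exists>c\<in>carrier (p_witt p).
             \<pi> (bc_class (Elt (frag_of (qz_frac a b)))) (witt_eps p m)
               = O_scale p c (witt_eps p m) \<and>
             c = teichmueller (p_powers p) (sigma_inv \<sigma> (qz_frac a b)) [^]\<^bsub>p_witt p\<^esub> m \<and>
             (\<forall>\<rho>. cyc_embedding p \<sigma> C \<iota> \<rho> \<longrightarrow> \<rho> (zeta (qz_frac a b) ^ m) = \<iota> c)) \<and>
        (\<forall>n\<in>I_prime_to p. \<forall>k\<in>I_prime_to p.
           \<pi> (bc_class (Mu_star n)) (witt_eps p k)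
             = (if n dvd k then witt_eps p (k div n) else \<zero>\<^bsub>big_witt\<^esub>)) \<and>
        (\<forall>x. \<pi> (bc_class (Elt x)) = \<pi> (bc_class (Elt (bc_r p x)))) \<and>
        mu_op \<pi> p = Fr_inv_op p \<and>
        \<pi> (bc_class (Mu_star p)) = Fr_op p \<and>
        (\<forall>c\<in>carrier (p_witt p). \<forall>x\<in>carrier big_witt.
           \<pi> (bc_class (Mu_star p)) (O_scale p c x)
             = O_scale p (Fr p c) (\<pi> (bc_class (Mu_star p)) x))))"
proof -
  interpret residue_character p \<sigma>
    by unfold_locales (use assms in blast)+
  have mu: "\<exists>!T. is_mu_op ext_rep n T" if "n \<in> insert p (I_prime_to p)" for n
    using that is_mu_op_p_iff is_mu_op_prime_to_iff by auto
  have eps: "\<exists>c\<in>carrier (p_witt p).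
       ext_rep (bc_class (Elt (frag_of (qz_frac a b)))) (witt_eps p m) = O_scale p c (witt_eps p m) \<and>
       c = teichmueller (p_powers p) (sigma_inv \<sigma> (qz_frac a b)) [^]\<^bsub>p_witt p\<^esub> m \<and>
       (\<forall>\<rho>. cyc_embedding p \<sigma> C \<iota> \<rho> \<longrightarrow> \<rho> (zeta (qz_frac a b) ^ m) = \<iota> c)"
    if b: "b \<in> I_prime_to p" and m: "m \<in> I_prime_to p" for a b m
  proof -
    have \<gamma>: "qz_frac a b \<in> qz_prime_to p" using b by (auto simp: qz_prime_to_def)
    have "teichmueller (p_powers p) (sigma_inv \<sigma> (qz_frac a b)) [^]\<^bsub>p_witt p\<^esub> m \<in> carrier (p_witt p)"
      unfolding teichmueller_pow unfolding teichmueller_eq by (rule restrict_witt)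
    thus ?thesis
      using Elt_eps[OF \<gamma> m] cyc_embedding_power[OF _ \<gamma>] by blast
  qed
  have ext: "\<pi> = ext_rep" if "W0_representation p \<sigma> \<pi>0" "continuous_extension \<pi>0 \<pi>" for \<pi>0 \<pi>
    using that(2) unfolding W0_representation_unique[OF that(1)] continuous_extension_iff .
  have ex1: "\<exists>!\<pi>0. W0_representation p \<sigma> \<pi>0"
    using W0_representation_W0_rep W0_representation_unique by blast
  have ex1': "\<exists>!\<pi>. continuous_extension \<pi>0 \<pi>" if "W0_representation p \<sigma> \<pi>0" for \<pi>0
    unfolding W0_representation_unique[OF that] continuous_extension_iff by (rule ex1_eq)
  show ?thesis
    by (intro conjI allI impI ballI; (rule ex1; fail | erule ex1'; fail | frule (1) ext; hypsubst;
          (rule mu eps O_linear_mu_op O_linear_mu_star O_linear_Elt mu_op_eps mu_star_eps Elt_r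
              mu_op_p mu_star_p mu_star_p_skew; assumption?; fail)))
qed

end
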